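(* The following algorithm is an EXPTIME decision procedure for checking satisfiability of the concept assertions in $\Gamma$ with regards to a TBox $\mathcal{T}$: given $\Gamma$ and the concept assertion $T\ge1$ associated to $\mathcal{T}$ and $\Gamma$, construct a tableau $G$ for $\Gamma$ and $T \geq 1$; initialise $\operatorname{Unsat}$ with the node(s) labelled $\bot$ (if any); repeatedly add to $\operatorname{Unsat}$ every AND-node having some child in $\operatorname{Unsat}$ and every OR-node all of whose children are in $\operatorname{Unsat}$, until nothing changes; return false if the root $r^G\in\operatorname{Unsat}$ and true otherwise.
   Context: Non-expansive fuzzy $\mathcal{ALC}$: concepts $C,D ::= p \mid c \mid \lnot C \mid C \ominus c \mid C \sqcap D \mid \exists R.C$ ($p$ atomic, $R$ a role name, $c$ a rational constant in $[0,1]$, encoded by binary numerator and denominator of the reduced fraction). Interpretations $\mathcal{I}$: nonempty $\Delta^\mathcal{I}$, $p^\mathcal{I}:\Delta^\mathcal{I}\to[0,1]$, $R^\mathcal{I}:\Delta^\mathcal{I}\times\Delta^\mathcal{I}\to[0,1]$; $c^\mathcal{I}(x)=c$, $(\lnot D)^\mathcal{I}(x)=1-D^\mathcal{I}(x)$, $(C\ominus c)^\mathcal{I}(x)=\max(C^\mathcal{I}(x)-c,0)$, $(C\sqcap D)^\mathcal{I}(x)=\min$, $(\exists R.C)^\mathcal{I}(x)=\sup_y\min(R^\mathcal{I}(x,y),C^\mathcal{I}(y))$; $C\sqcup D=\lnot(\lnot C\sqcap\lnot D)$, $C\oplus c=\lnot((\lnot C)\ominus c)$. Concept assertions $C\bowtie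 c$, ${\bowtie}\in\{<,\le,>,\ge\}$; sequents are finite sets of them. TBox: set of GCIs $C\sqsubseteq D$, satisfied by $\mathcal{I}$ if $C^\mathcal{I}(x)\le D^\mathcal{I}(x)$ for all $x$; $\Gamma$ is satisfiable w.r.t. $\mathcal{T}$ if some $\mathcal{I}$ satisfying $\mathcal{T}$ has an individual satisfying all of $\Gamma$. Associated concept assertion of $\mathcal{T}=\{C_i\sqsubseteq D_i\}_{i=1}^n$ and $\Gamma$: $Z=[0,1]\cap$ (additive subgroup of $\mathbb{Q}$ generated by $1$ and the constants in $\Gamma,\mathcal{T}$), $\epsilon=\frac12\min(Z\setminus\{0\})$, $Z'=Z\cup\{z+\epsilon\mid z\in Z\setminus\{1\}\}$, $T=T_1\sqcap\cdots\sqcap T_n$, $T_i=\bigsqcup_{z\in Z'}((\lnot C_i\oplus z)\sqcap(D_i\oplus(1-z)))$. Tableau rules (${\triangleleft}\in\{<,\le\}$, ${\triangleright}\in\{>,\ge\}$; ${\bowtie^\circ}$ reverses direction $>\leftrightarrow<$, $\ge\leftrightarrow\le$; $\blacktriangleleft_{(\triangleleft,\triangleright)}$ is $<$ if $(\triangleleft,\triangleright)=(\le,\ge)$, else $\le$): (Ax 1) $S,p\triangleright c/\bot$ if $c\ge1$ (for $>$) resp. $c>1$ (for $\ge$); (Ax 0) $S,p\triangleleft c/\bot$ if $c\le0$ (for $<$) resp. $c<0$ (for $\le$); (Ax c) $S,c\triangleleft d/\bot$ if the constant inequality $c\triangleleft d$ is false; (Ax p) $S,p\triangleleft c,p\triangleright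 d/\bot$ if $d\blacktriangleleft_{(\triangleleft,\triangleright)}c$; ($\sqcap\triangleright$) $S,C\sqcap D\triangleright c/S,C\triangleright c,D\triangleright c$; ($\sqcap\triangleleft$) $S,C\sqcap D\triangleleft c/S,C\triangleleft c\mid S,D\triangleleft c$; ($\lnot\bowtie$) $S,\lnot C\bowtie c/S,C\bowtie^\circ1-c$; ($\ominus\triangleleft$) $S,C\ominus c\triangleleft d/S,C\triangleleft d+c,d\triangleleft^\circ0$; ($\ominus\triangleright$) $S,C\ominus c\triangleright d/S,C\triangleright d+c$ if $d\ge0$ (for $>$) resp. $d>0$ (for $\ge$); ($\exists R$) $S,\{\exists R.D_j\triangleleft_jd_j\}_{j=1}^n,\exists R.C\triangleright c/\{D_j\triangleleft_jd_j\mid d_j\blacktriangleleft_{(\triangleleft_j,\triangleright)}c\},C\triangleright c,T\ge1$ if $c\ge0$ (for $>$) resp. $c>0$ (for $\ge$) and $S$ contains no $\exists R.D\triangleleft d$. Propositional rules are all but ($\exists R$); saturated = no propositional rule applicable. Tableau graph: directed graph $(V^G,E^G)$ (nodes with identical labels are shared, i.e. global caching, so cycles may occur), root $r^G$, labels $\mathcal{L}^G(v)$ (assertion set or $\bot$); AND-nodes have saturated labels, others are OR-nodes. A tableau for $\Gamma$ and $T\ge1$: root label $\Gamma\cup\{T\ge1\}$, each OR-node's children are labelled exactly by the conclusions of one propositional rule instance applied to its label, each AND-node's children exactly by the conclusions of all possible ($\exists R$) applications. Complexity is measured in the syntactic size of $\Gamma$ and $\mathcal{T}$ (constants counted by the binary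 length of numerator and denominator).
   Formalization: Three tableau rules are corrected, since the procedure is wrong with them as printed: (Ax c) applies to all four comparisons, (Ax p) has side condition c ◀ d instead of d ◀ c, and (Ax 0) also closes impossible upper bounds on ∃R.C. *)

theory Defs
  imports
    Complex_Main
    "HOL-Library.While_Combinator"
    "HOL-Computational_Algebra.Group_Closure"
    "HOL-Computational_Algebra.Polynomial"
begin

section \<open>Syntax and semantics of non-expansive fuzzy ALC\<close>

text \<open>
  Atomic concepts and role names are natural numbers. Constants are unrestricted in the datatype,
  because the rule for truncated subtraction turns the bound of an assertion, which may lie outside
  the unit interval, into a constant concept. The grammar's restriction of constants to the unit
  interval is the predicate \<open>wf_concept\<close>.
\<close>

datatype concept =
    Atom nat
  | Const rat
  | Neg concept
  | Ominus concept rat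
  | And concept concept
  | Ex nat concept

definition Or :: "concept \<Rightarrow> concept \<Rightarrow> concept" where
  "Or C D = Neg (And (Neg C) (Neg D))"

definition Oplus :: "concept \<Rightarrow> rat \<Rightarrow> concept" where
  "Oplus C c = Neg (Ominus (Neg C) c)"

primrec wf_concept :: "concept \<Rightarrow> bool" where
  "wf_concept (Atom p) = True"
| "wf_concept (Const c) = (0 \<le> c \<and> c \<le> 1)"
| "wf_concept (Neg C) = wf_concept C"
| "wf_concept (Ominus C c) = (wf_concept C \<and> 0 \<le> c \<and> c \<le> 1)"
| "wf_concept (And C D) = (wf_concept C \<and> wf_concept D)"
| "wf_concept (Ex R C) = wf_concept C"

datatype cmp = Lt | Le | Gt | Ge

primrec cmp_rel :: "cmp \<Rightarrow> 'x::linorder \<Rightarrow> 'x \<Rightarrow> bool" where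
  "cmp_rel Lt x y = (x < y)"
| "cmp_rel Le x y = (x \<le> y)"
| "cmp_rel Gt x y = (x > y)"
| "cmp_rel Ge x y = (x \<ge> y)"

primrec flip :: "cmp \<Rightarrow> cmp" where
  "flip Lt = Gt"
| "flip Le = Ge"
| "flip Gt = Lt"
| "flip Ge = Le"

datatype assertion = Assert concept cmp rat

type_synonym gci = "concept \<times> concept"

primrec wf_assertion :: "assertion \<Rightarrow> bool" where
  "wf_assertion (Assert C r c) = wf_concept C"

definition wf_gci :: "gci \<Rightarrow> bool" where
  "wf_gci g = (wf_concept (fst g) \<and> wf_concept (snd g))"

record 'a interp =
  dom :: "'a set"
  conc :: "nat \<Rightarrow> 'a \<Rightarrow> real"
  role :: "nat \<Rightarrow> 'a \<Rightarrow> 'a \<Rightarrow> real"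

definition interpretation_ok :: "'a interp \<Rightarrow> bool" where
  "interpretation_ok I \<longleftrightarrow>
     dom I \<noteq> {} \<and>
     (\<forall>p. \<forall>x \<in> dom I. conc I p x \<in> {0..1}) \<and>
     (\<forall>R. \<forall>x \<in> dom I. \<forall>y \<in> dom I. role I R x y \<in> {0..1})"

primrec sem :: "'a interp \<Rightarrow> concept \<Rightarrow> 'a \<Rightarrow> real" where
  "sem I (Atom p) x = conc I p x"
| "sem I (Const c) x = of_rat c"
| "sem I (Neg C) x = 1 - sem I C x"
| "sem I (Ominus C c) x = max (sem I C x - of_rat c) 0"
| "sem I (And C D) x = min (sem I C x) (sem I D x)"
| "sem I (Ex R C) x = (SUP y \<in> dom I. min (role I R x y) (sem I C y))"

primrec holds :: "'a interp \<Rightarrow> 'a \<Rightarrow> assertion \<Rightarrow> bool" where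
  "holds I x (Assert C r c) = cmp_rel r (sem I C x) (of_rat c)"

definition sat_tbox :: "'a interp \<Rightarrow> gci set \<Rightarrow> bool" where
  "sat_tbox I \<T> \<longleftrightarrow> (\<forall>(C, D) \<in> \<T>. \<forall>x \<in> dom I. sem I C x \<le> sem I D x)"

text \<open>
  HOL cannot quantify over types inside a formula, so satisfiability is relative to the type from
  which the individuals are drawn (the domain is any nonempty set of individuals of that type).
\<close>

definition satisfiable :: "'a itself \<Rightarrow> gci set \<Rightarrow> assertion set \<Rightarrow> bool" where
  "satisfiable _ \<T> \<Gamma> \<longleftrightarrow>
     (\<exists>I :: 'a interp. interpretation_ok I \<and> sat_tbox I \<T> \<and> (\<exists>x \<in> dom I. \<forall>A \<in> \<Gamma>. holds I x A))"


section \<open>The concept associated with a TBox and a sequent\<close>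

primrec concept_consts :: "concept \<Rightarrow> rat set" where
  "concept_consts (Atom p) = {}"
| "concept_consts (Const c) = {c}"
| "concept_consts (Neg C) = concept_consts C"
| "concept_consts (Ominus C c) = insert c (concept_consts C)"
| "concept_consts (And C D) = concept_consts C \<union> concept_consts D"
| "concept_consts (Ex R C) = concept_consts C"

primrec assertion_consts :: "assertion \<Rightarrow> rat set" where
  "assertion_consts (Assert C r c) = insert c (concept_consts C)"

definition all_consts :: "gci set \<Rightarrow> assertion set \<Rightarrow> rat set" where
  "all_consts \<T> \<Gamma> =
     (\<Union>A \<in> \<Gamma>. assertion_consts A) \<union> (\<Union>(C, D) \<in> \<T>. concept_consts C \<union> concept_consts D)"

definition Z_set :: "gci set \<Rightarrow> assertion set \<Rightarrow> rat set" where
  "Z_set \<T> \<Gamma> = {0..1} \<inter> group_closure (insert 1 (all_consts \<T> \<Gamma>))"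

definition eps :: "gci set \<Rightarrow> assertion set \<Rightarrow> rat" where
  "eps \<T> \<Gamma> = Min (Z_set \<T> \<Gamma> - {0}) / 2"

definition Z'_set :: "gci set \<Rightarrow> assertion set \<Rightarrow> rat set" where
  "Z'_set \<T> \<Gamma> = Z_set \<T> \<Gamma> \<union> (\<lambda>z. z + eps \<T> \<Gamma>) ` (Z_set \<T> \<Gamma> - {1})"

text \<open>Finite meets and joins are nested to the right; the empty ones are the constants 1 and 0.\<close>

fun big_and :: "concept list \<Rightarrow> concept" where
  "big_and [] = Const 1"
| "big_and [C] = C"
| "big_and (C # D # Cs) = And C (big_and (D # Cs))"

fun big_or :: "concept list \<Rightarrow> concept" where
  "big_or [] = Const 0"
| "big_or [C] = C"
| "big_or (C # D # Cs) = Or C (big_or (D # Cs))"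

definition assoc_gci :: "rat set \<Rightarrow> gci \<Rightarrow> concept" where
  "assoc_gci Z g =
     big_or (map (\<lambda>z. And (Oplus (Neg (fst g)) z) (Oplus (snd g) (1 - z))) (sorted_list_of_set Z))"

definition assoc_concept :: "gci list \<Rightarrow> assertion set \<Rightarrow> concept" where
  "assoc_concept ts \<Gamma> = big_and (map (assoc_gci (Z'_set (set ts) \<Gamma>)) ts)"


section \<open>Tableau rules\<close>

definition upper :: "cmp \<Rightarrow> bool" where "upper r \<longleftrightarrow> r = Lt \<or> r = Le"
definition lower :: "cmp \<Rightarrow> bool" where "lower r \<longleftrightarrow> r = Gt \<or> r = Ge"

text \<open>
  For an upper comparison \<open>u\<close> and a lower comparison \<open>l\<close>, \<open>black u l d c\<close> says that no value \<open>x\<close>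
  satisfies both \<open>cmp_rel u x d\<close> and \<open>cmp_rel l x c\<close>.
\<close>

definition black :: "cmp \<Rightarrow> cmp \<Rightarrow> rat \<Rightarrow> rat \<Rightarrow> bool" where
  "black u l d c = (if u = Le \<and> l = Ge then d < c else d \<le> c)"

datatype label = Bot | Seq "assertion set"

text \<open>
  \<open>prop_rule L K\<close>: some instance of a propositional rule has premise \<open>L\<close> and set of conclusions \<open>K\<close>.
  The context of a rule never contains the principal assertion, which therefore disappears from
  the conclusions; otherwise a node could become its own child.

  Three side conditions are not the printed ones, under which the procedure would be incorrect:
  \<^item> \<open>Ax_c\<close> covers all four comparisons. The rule \<open>Ominus_upper\<close> produces constant concepts with
    lower bounds, and \<open>Const 0 \<ge> 1\<close> would never be refuted otherwise.
  \<^item> \<open>Ax_p\<close> compares the upper bound with the lower bound in the same order as the rule for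
    existential restrictions. With the arguments swapped, \<open>p \<le> 1, p \<ge> 0\<close> would be closed.
  \<^item> \<open>Ax_0_Ex\<close> extends the axiom rule for impossible upper bounds on atoms to existential
    restrictions, to which no other propositional rule applies; otherwise the unsatisfiable
    \<open>Ex R C < 0\<close> would label a saturated node without children.
\<close>

inductive prop_rule :: "assertion set \<Rightarrow> label set \<Rightarrow> bool" where
  Ax_1: "Assert (Atom p) r c \<in> L \<Longrightarrow> r = Gt \<and> c \<ge> 1 \<or> r = Ge \<and> c > 1 \<Longrightarrow> prop_rule L {Bot}"
| Ax_0: "Assert (Atom p) r c \<in> L \<Longrightarrow> r = Lt \<and> c \<le> 0 \<or> r = Le \<and> c < 0 \<Longrightarrow> prop_rule L {Bot}"
| Ax_0_Ex: "Assert (Ex R C) r c \<in> L \<Longrightarrow> r = Lt \<and> c \<le> 0 \<or> r = Le \<and> c < 0 \<Longrightarrow> prop_rule L {Bot}"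
| Ax_c: "Assert (Const c) r d \<in> L \<Longrightarrow> \<not> cmp_rel r c d \<Longrightarrow> prop_rule L {Bot}"
| Ax_p: "Assert (Atom p) u c \<in> L \<Longrightarrow> Assert (Atom p) l d \<in> L \<Longrightarrow> upper u \<Longrightarrow> lower l \<Longrightarrow>
    black u l c d \<Longrightarrow> prop_rule L {Bot}"
| And_lower: "Assert (And C D) r c \<in> L \<Longrightarrow> lower r \<Longrightarrow>
    prop_rule L {Seq (L - {Assert (And C D) r c} \<union> {Assert C r c, Assert D r c})}"
| And_upper: "Assert (And C D) r c \<in> L \<Longrightarrow> upper r \<Longrightarrow>
    prop_rule L {Seq (L - {Assert (And C D) r c} \<union> {Assert C r c}),
                 Seq (L - {Assert (And C D) r c} \<union> {Assert D r c})}"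
| Neg: "Assert (Neg C) r c \<in> L \<Longrightarrow>
    prop_rule L {Seq (L - {Assert (Neg C) r c} \<union> {Assert C (flip r) (1 - c)})}"
| Ominus_upper: "Assert (Ominus C c) r d \<in> L \<Longrightarrow> upper r \<Longrightarrow>
    prop_rule L {Seq (L - {Assert (Ominus C c) r d} \<union>
                      {Assert C r (d + c), Assert (Const d) (flip r) 0})}"
| Ominus_lower: "Assert (Ominus C c) r d \<in> L \<Longrightarrow> r = Gt \<and> d \<ge> 0 \<or> r = Ge \<and> d > 0 \<Longrightarrow>
    prop_rule L {Seq (L - {Assert (Ominus C c) r d} \<union> {Assert C r (d + c)})}"

definition saturated :: "assertion set \<Rightarrow> bool" where
  "saturated L \<longleftrightarrow> (\<nexists>K. prop_rule L K)"

inductive ex_rule :: "concept \<Rightarrow> assertion set \<Rightarrow> label \<Rightarrow> bool" for T L where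
  "Assert (Ex R C) r c \<in> L \<Longrightarrow> r = Gt \<and> c \<ge> 0 \<or> r = Ge \<and> c > 0 \<Longrightarrow>
   ex_rule T L (Seq ({Assert D u d |D u d. Assert (Ex R D) u d \<in> L \<and> upper u \<and> black u r d c} \<union>
                     {Assert C r c, Assert T Ge 1}))"


section \<open>Tableau graphs and propagation of unsatisfiability\<close>

record 'v tgraph =
  verts :: "'v set"
  edges :: "('v \<times> 'v) set"
  root :: 'v
  lab :: "'v \<Rightarrow> label"

abbreviation children :: "'v tgraph \<Rightarrow> 'v \<Rightarrow> 'v set" where
  "children G v \<equiv> edges G `` {v}"

definition and_node :: "'v tgraph \<Rightarrow> 'v \<Rightarrow> bool" where
  "and_node G v \<longleftrightarrow> v \<in> verts G \<and> (\<exists>L. lab G v = Seq L \<and> saturated L)"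

definition or_node :: "'v tgraph \<Rightarrow> 'v \<Rightarrow> bool" where
  "or_node G v \<longleftrightarrow> v \<in> verts G \<and> (\<exists>L. lab G v = Seq L \<and> \<not> saturated L)"

text \<open>
  Injectivity of the labelling is global caching. A tableau is built from its root, so it has no
  unreachable nodes.
\<close>

definition tableau :: "concept \<Rightarrow> assertion set \<Rightarrow> 'v tgraph \<Rightarrow> bool" where
  "tableau T \<Gamma> G \<longleftrightarrow>
     root G \<in> verts G \<and> edges G \<subseteq> verts G \<times> verts G \<and> inj_on (lab G) (verts G) \<and>
     verts G \<subseteq> (edges G)\<^sup>* `` {root G} \<and>
     lab G (root G) = Seq (\<Gamma> \<union> {Assert T Ge 1}) \<and>
     (\<forall>v \<in> verts G. case lab G v of
        Bot \<Rightarrow> children G v = {}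
      | Seq L \<Rightarrow>
          if saturated L then lab G ` children G v = {l. ex_rule T L l}
          else prop_rule L (lab G ` children G v))"

definition unsat_step :: "'v tgraph \<Rightarrow> 'v set \<Rightarrow> 'v set" where
  "unsat_step G U =
     U \<union> {v. and_node G v \<and> (\<exists>w \<in> children G v. w \<in> U)}
       \<union> {v. or_node G v \<and> (\<forall>w \<in> children G v. w \<in> U)}"

definition Unsat :: "'v tgraph \<Rightarrow> 'v set" where
  "Unsat G = while (\<lambda>U. unsat_step G U \<noteq> U) (unsat_step G) {v \<in> verts G. lab G v = Bot}"

definition answer :: "'v tgraph \<Rightarrow> bool" where
  "answer G \<longleftrightarrow> root G \<notin> Unsat G"


section \<open>Syntactic size\<close>

fun bits :: "nat \<Rightarrow> bool list" where
  "bits n = (if n = 0 then [] else odd n # bits (n div 2))"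

declare bits.simps [simp del]

definition size_nat :: "nat \<Rightarrow> nat" where
  "size_nat n = length (bits n)"

definition size_rat :: "rat \<Rightarrow> nat" where
  "size_rat q = (case quotient_of q of (a, b) \<Rightarrow> size_nat (nat \<bar>a\<bar>) + size_nat (nat b))"

primrec size_concept :: "concept \<Rightarrow> nat" where
  "size_concept (Atom p) = 1 + size_nat p"
| "size_concept (Const c) = 1 + size_rat c"
| "size_concept (Neg C) = 1 + size_concept C"
| "size_concept (Ominus C c) = 1 + size_concept C + size_rat c"
| "size_concept (And C D) = 1 + size_concept C + size_concept D"
| "size_concept (Ex R C) = 1 + size_nat R + size_concept C"

primrec size_assertion :: "assertion \<Rightarrow> nat" where
  "size_assertion (Assert C r c) = 1 + size_concept C + size_rat c"

definition size_gci :: "gci \<Rightarrow> nat" where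
  "size_gci g = 1 + size_concept (fst g) + size_concept (snd g)"

definition input_size :: "gci list \<Rightarrow> assertion list \<Rightarrow> nat" where
  "input_size ts gs = sum_list (map size_gci ts) + sum_list (map size_assertion gs)"


section \<open>Model of computation\<close>

text \<open>
  Programs are finite lists of mutually recursive first-order functions on binary trees, with
  call-by-value evaluation, in the style of the languages F and WHILE of N. D. Jones,
  ``Computability and Complexity from a Programming Perspective''. A variable \<open>V i\<close> is an index into
  the environment. Each evaluation step costs one unit. Only constant-time operations on cons cells
  are primitive (trees can only be compared with the leaf), and a fixed program only ever uses
  environments of bounded length, so running time is polynomially related to that of Turing machines
  and the notion of exponential time is the usual one.
\<close>

datatype tree = Lf | Nd tree tree

datatype expr =
    V nat
  | ELf
  | ENd expr expr
  | Case expr expr expr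
  | Call nat "expr list"

type_synonym program = "expr list"

inductive eval :: "program \<Rightarrow> tree list \<Rightarrow> expr \<Rightarrow> tree \<Rightarrow> nat \<Rightarrow> bool"
  and evals :: "program \<Rightarrow> tree list \<Rightarrow> expr list \<Rightarrow> tree list \<Rightarrow> nat \<Rightarrow> bool"
  for P :: program where
  "i < length \<rho> \<Longrightarrow> eval P \<rho> (V i) (\<rho> ! i) 1"
| "eval P \<rho> ELf Lf 1"
| "eval P \<rho> a x s \<Longrightarrow> eval P \<rho> b y t \<Longrightarrow> eval P \<rho> (ENd a b) (Nd x y) (s + t + 1)"
| "eval P \<rho> e Lf s \<Longrightarrow> eval P \<rho> a x t \<Longrightarrow> eval P \<rho> (Case e a b) x (s + t + 1)"
| "eval P \<rho> e (Nd y z) s \<Longrightarrow> eval P (y # z # \<rho>) b x t \<Longrightarrow> eval P \<rho> (Case e a b) x (s + t + 1)"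
| "evals P \<rho> es xs s \<Longrightarrow> f < length P \<Longrightarrow> eval P xs (P ! f) x t \<Longrightarrow>
     eval P \<rho> (Call f es) x (s + t + 1)"
| "evals P \<rho> [] [] 0"
| "eval P \<rho> e x s \<Longrightarrow> evals P \<rho> es xs t \<Longrightarrow> evals P \<rho> (e # es) (x # xs) (s + t)"

definition computes_within :: "program \<Rightarrow> tree \<Rightarrow> tree \<Rightarrow> nat \<Rightarrow> bool" where
  "computes_within P x y t \<longleftrightarrow> (\<exists>s \<le> t. eval P [x] (Call 0 [V 0]) y s)"


section \<open>Encoding of inputs and outputs\<close>

definition enc_tag :: "nat \<Rightarrow> tree" where
  "enc_tag n = (Nd Lf ^^ n) Lf"

definition enc_bool :: "bool \<Rightarrow> tree" where
  "enc_bool b = (if b then Nd Lf Lf else Lf)"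

definition enc_list :: "('x \<Rightarrow> tree) \<Rightarrow> 'x list \<Rightarrow> tree" where
  "enc_list f xs = foldr (\<lambda>x. Nd (f x)) xs Lf"

definition enc_nat :: "nat \<Rightarrow> tree" where
  "enc_nat n = enc_list enc_bool (bits n)"

definition enc_rat :: "rat \<Rightarrow> tree" where
  "enc_rat q = (case quotient_of q of (a, b) \<Rightarrow>
     Nd (enc_bool (a < 0)) (Nd (enc_nat (nat \<bar>a\<bar>)) (enc_nat (nat b))))"

primrec enc_concept :: "concept \<Rightarrow> tree" where
  "enc_concept (Atom p) = Nd (enc_tag 0) (enc_nat p)"
| "enc_concept (Const c) = Nd (enc_tag 1) (enc_rat c)"
| "enc_concept (Neg C) = Nd (enc_tag 2) (enc_concept C)"
| "enc_concept (Ominus C c) = Nd (enc_tag 3) (Nd (enc_concept C) (enc_rat c))"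
| "enc_concept (And C D) = Nd (enc_tag 4) (Nd (enc_concept C) (enc_concept D))"
| "enc_concept (Ex R C) = Nd (enc_tag 5) (Nd (enc_nat R) (enc_concept C))"

primrec enc_cmp :: "cmp \<Rightarrow> tree" where
  "enc_cmp Lt = enc_tag 0"
| "enc_cmp Le = enc_tag 1"
| "enc_cmp Gt = enc_tag 2"
| "enc_cmp Ge = enc_tag 3"

primrec enc_assertion :: "assertion \<Rightarrow> tree" where
  "enc_assertion (Assert C r c) = Nd (enc_cmp r) (Nd (enc_concept C) (enc_rat c))"

definition enc_gci :: "gci \<Rightarrow> tree" where
  "enc_gci g = Nd (enc_concept (fst g)) (enc_concept (snd g))"

definition enc_input :: "gci list \<Rightarrow> assertion list \<Rightarrow> tree" where
  "enc_input ts gs = Nd (enc_list enc_gci ts) (enc_list enc_assertion gs)"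

text \<open>
  A finite graph is represented by the list of its nodes, each with its label (\<open>None\<close> for \<open>Bot\<close>, and
  a list of assertions standing for the set of its elements) and the list of its children; nodes are
  positions in that list, and position 0 is the root.
\<close>

type_synonym graph_rep = "(assertion list option \<times> nat list) list"

definition graph_of :: "graph_rep \<Rightarrow> nat tgraph" where
  "graph_of ns =
     \<lparr>verts = {..<length ns},
      edges = {(v, w). v < length ns \<and> w \<in> set (snd (ns ! v))},
      root = 0,
      lab = (\<lambda>v. case fst (ns ! v) of None \<Rightarrow> Bot | Some L \<Rightarrow> Seq (set L))\<rparr>"

definition enc_node :: "assertion list option \<times> nat list \<Rightarrow> tree" where
  "enc_node n =
     Nd (case fst n of None \<Rightarrow> Lf | Some L \<Rightarrow> Nd Lf (enc_list enc_assertion L))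
        (enc_list enc_nat (snd n))"

definition enc_output :: "graph_rep \<Rightarrow> nat list \<Rightarrow> bool \<Rightarrow> tree" where
  "enc_output ns us b = Nd (enc_list enc_node ns) (Nd (enc_list enc_nat us) (enc_bool b))"

end

theory Submission
  imports Defs
begin

text \<open>
  Soundness. All constants are multiples of \<open>1/N\<close>. Given a model, round every value that is not within
  \<open>\<delta>\<close> of a multiple of \<open>1/N\<close> to the midpoint of its grid interval, and the others to the grid. Rounding
  commutes with the propositional constructors, keeps the GCIs, and turns them into the assertion for
  the TBox; choosing \<open>\<delta>\<close> anew at each existential rule, a path of labels satisfied in the model never
  meets \<open>\<bottom>\<close>.

  Completeness. Outside \<open>Unsat\<close> every node has a descending branch to a saturated node; these nodes
  form a finite model, in which the assertion for the TBox holds everywhere and yields the GCIs.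

  Complexity. A label has linearly many elements, since a disjunction of exponentially many
  alternatives contributes only one of them, and they come from an exponential universe; so there are
  exponentially many labels. The construction is polynomial in the input together with a unary string
  \<open>pad\<close> whose length dominates all intermediate sizes. It suffices to prove this with combinators for
  polynomial time, and then to prepend a program computing an exponentially long \<open>pad\<close>.
\<close>

section \<open>The group generated by the constants\<close>

text \<open>Assertions over grid constants only see where a value lies relative to the multiples of
  1/N, so each open grid interval may be represented by its midpoint. This explains Z': between two
  rounded values in the right order there is always a z of the grid of step 1/(2N). The bound on
  label sizes has to be kept for every quantifier depth separately: a successor inherits the bodies
  of existential restrictions from all alternatives chosen so far, and receives a fresh copy of T on
  top. Global caching lets the graph be cyclic. Propositional steps shrink a label, so every cycle
  passes through an existential step; truth in the constructed model is therefore proved by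
  induction on quantifier depth, for all nodes at once. In the machine model a tree can be
  duplicated at unit cost, so running time does not control the size of results. Every complexity
  bound below covers time and output size together, and every loop comes with a bound on its
  intermediate states.\<close>

definition denoms :: "gci set \<Rightarrow> assertion set \<Rightarrow> nat set" where
  "denoms \<T> \<Gamma> = (\<lambda>q. nat (snd (quotient_of q))) ` all_consts \<T> \<Gamma>"

definition multiples :: "nat \<Rightarrow> rat set" where
  "multiples N = range (\<lambda>k. of_int k / of_nat N)"

lemma multiples_diff: "p \<in> multiples N \<Longrightarrow> q \<in> multiples N \<Longrightarrow> p - q \<in> multiples N"
  unfolding multiples_def by (auto simp: diff_divide_distrib[symmetric] simp flip: of_int_diff)

lemma multiples_of_int: "0 < N \<Longrightarrow> of_int k \<in> multiples N"
  unfolding multiples_def by (auto intro!: image_eqI[of _ _ "k * int N"])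

lemma multiples_0: "0 \<in> multiples N"
  unfolding multiples_def by (auto intro!: image_eqI[of _ _ 0])

lemma multiples_uminus: "p \<in> multiples N \<Longrightarrow> - p \<in> multiples N"
  using multiples_diff[OF multiples_0] by fastforce

lemma multiples_add: "p \<in> multiples N \<Longrightarrow> q \<in> multiples N \<Longrightarrow> p + q \<in> multiples N"
  using multiples_diff[OF _ multiples_uminus, of p N q] by simp

lemma group_closure_int_mult:
  fixes s :: rat
  assumes "s \<in> group_closure S" shows "of_int k * s \<in> group_closure S"
proof (cases "0 \<le> k")
  case True
  then show ?thesis using group_closure_scalar_mult_left[OF assms, of "nat k"] by simp
next
  case False
  then have "- (of_nat (nat (- k)) * s) \<in> group_closure S"
    using group_closure_scalar_mult_left[OF assms, of "nat (- k)"] by simp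
  then show ?thesis using False by simp
qed

lemma rat_eq_quotient: "q = of_int (fst (quotient_of q)) / of_nat (nat (snd (quotient_of q)))"
  using quotient_of_denom_pos'[of q] quotient_of_div[of q "fst (quotient_of q)" "snd (quotient_of q)"]
  by simp

text \<open>With \<open>q\<close> = a/b in lowest terms, Bezout gives u*a + v*b = 1; dividing by b
  writes 1/b as the integer combination u*q + v*1 of the generators.\<close>

lemma unit_fraction_in_group_closure:
  fixes q :: rat
  assumes "q \<in> S"
  shows "1 / of_nat (nat (snd (quotient_of q))) \<in> group_closure (insert 1 S)"
proof -
  let ?a = "fst (quotient_of q)" and ?b = "snd (quotient_of q)"
  have b: "0 < ?b" by (rule quotient_of_denom_pos')
  have "coprime ?a ?b" using quotient_of_coprime[of q ?a ?b] by simp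
  then obtain u v where uv: "u * ?a + v * ?b = 1"
    using bezout_int[of ?a ?b] by (auto simp: coprime_iff_gcd_eq_1)
  have "of_int u * q + of_int v * 1 \<in> group_closure (insert 1 S)"
    by (intro group_closure_add group_closure_int_mult group_closure.base) (use assms in auto)
  moreover have "of_int u * q + of_int v * 1 = of_int (u * ?a + v * ?b) / (of_int ?b :: rat)"
    by (subst rat_eq_quotient[of q]) (use b in \<open>simp add: field_simps\<close>)
  ultimately show ?thesis using uv b by simp
qed

text \<open>Bezout again: u*m + v*n = gcd m n is divided by m*n, and gcd m n / (m*n) is 1 / lcm m
  n.\<close>

lemma unit_fraction_lcm:
  assumes "1 / of_nat m \<in> group_closure (S :: rat set)" "1 / of_nat n \<in> group_closure S" "0 < m" "0 < n"
  shows "1 / of_nat (lcm m n) \<in> group_closure S"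
proof -
  obtain u v where uv: "u * int m + v * int n = int (gcd m n)"
    using bezout_int[of "int m" "int n"] by auto
  have "of_int u * (1 / of_nat n) + of_int v * (1 / of_nat m) \<in> group_closure S"
    by (intro group_closure_add group_closure_int_mult assms)
  moreover have "of_int u * (1 / of_nat n) + of_int v * (1 / of_nat m) = of_int (u * int m + v * int n) / (of_nat (m * n) :: rat)"
    using assms(3,4) by (simp add: field_simps)
  moreover have "\<dots> = of_nat (gcd m n) / (of_nat (gcd m n * lcm m n) :: rat)"
    unfolding uv by (simp only: prod_gcd_lcm_nat[of m n] of_int_of_nat_eq)
  moreover have "g \<noteq> 0 \<Longrightarrow> of_nat g / of_nat (g * l) = (1 / of_nat l :: rat)" for g l :: nat by simp
  then have "of_nat (gcd m n) / (of_nat (gcd m n * lcm m n) :: rat) = 1 / of_nat (lcm m n)"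
    using assms(3) by (metis gcd_eq_0_iff less_irrefl)
  ultimately show ?thesis by metis
qed

text \<open>A finitely generated group of rationals is cyclic. Since 1 is among the generators, the
  cyclic generator can be taken with numerator 1, and its denominator is the least common multiple
  of all denominators.\<close>

lemma group_closure_eq_multiples:
  assumes "finite S"
  shows "group_closure (insert 1 S) = multiples (Lcm ((\<lambda>q. nat (snd (quotient_of q))) ` S))" (is "?G = multiples ?N")
proof
  have pos: "0 < nat (snd (quotient_of q))" for q by (simp add: quotient_of_denom_pos')
  have "0 \<notin> (\<lambda>q. nat (snd (quotient_of q))) ` S"
  proof
    assume "0 \<in> (\<lambda>q. nat (snd (quotient_of q))) ` S"
    then obtain q where "0 = nat (snd (quotient_of q))" by (rule imageE)
    then show False using pos[of q] by simp
  qed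
  then have "?N \<noteq> 0" using assms by (simp add: Lcm_0_iff_nat)
  then have N0: "0 < ?N" by simp
  show "?G \<subseteq> multiples ?N"
  proof
    fix s assume "s \<in> ?G"
    then show "s \<in> multiples ?N"
    proof induction
      case (base s)
      consider "s = 0" | "s = 1" | "s \<in> S" using base by auto
      then show ?case
      proof cases
        case 3
        then have "nat (snd (quotient_of s)) dvd ?N" by (intro dvd_Lcm) auto
        then obtain c where c: "?N = nat (snd (quotient_of s)) * c" by (auto simp: dvd_def)
        then have "c \<noteq> 0" using N0 by auto
        then have "s = of_int (fst (quotient_of s) * int c) / of_nat ?N"
          unfolding c by (subst rat_eq_quotient[of s]) simp
        then show ?thesis unfolding multiples_def by blast
      qed (use multiples_0 multiples_of_int[OF N0, of 1] in auto)
    qed (rule multiples_diff)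
  qed
  have "1 / of_nat ?N \<in> ?G" if "finite F" "F \<subseteq> S" "?N = Lcm ((\<lambda>q. nat (snd (quotient_of q))) ` F)" for F
  proof -
    have "1 / of_nat (Lcm ((\<lambda>q. nat (snd (quotient_of q))) ` F)) \<in> ?G \<and> 0 < Lcm ((\<lambda>q. nat (snd (quotient_of q))) ` F)"
      using that(1,2)
    proof (induction F)
      case empty
      then show ?case by (auto intro: group_closure.base)
    next
      case (insert q F)
      then show ?case using unit_fraction_lcm[OF unit_fraction_in_group_closure, of q S] pos[of q]
        by (auto simp: lcm_pos_nat)
    qed
    then show ?thesis using that by simp
  qed
  from this[OF assms] have "1 / of_nat ?N \<in> ?G" by simp
  from group_closure_int_mult[OF this] show "multiples ?N \<subseteq> ?G"
    unfolding multiples_def by auto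
qed

section \<open>The sets Z and Z' as grids in the unit interval\<close>

lemma finite_concept_consts: "finite (concept_consts C)"
  by (induction C) auto

lemma finite_assertion_consts: "finite (assertion_consts A)"
  by (cases A) (auto simp: finite_concept_consts)

lemma finite_all_consts: "finite \<T> \<Longrightarrow> finite \<Gamma> \<Longrightarrow> finite (all_consts \<T> \<Gamma>)"
  by (auto simp: all_consts_def finite_concept_consts finite_assertion_consts)

definition common_denom :: "gci set \<Rightarrow> assertion set \<Rightarrow> nat" where
  "common_denom \<T> \<Gamma> = Lcm (denoms \<T> \<Gamma>)"

lemma common_denom_pos:
  assumes "finite \<T>" "finite \<Gamma>" shows "0 < common_denom \<T> \<Gamma>"
proof -
  have "0 \<notin> denoms \<T> \<Gamma>" unfolding denoms_def
  proof
    assume "0 \<in> (\<lambda>q. nat (snd (quotient_of q))) ` all_consts \<T> \<Gamma>"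
    then obtain q where "0 = nat (snd (quotient_of q))" by (rule imageE)
    then show False using quotient_of_denom_pos'[of q] by simp
  qed
  then have "common_denom \<T> \<Gamma> \<noteq> 0"
    using finite_all_consts[OF assms] by (simp add: common_denom_def denoms_def Lcm_0_iff_nat)
  then show ?thesis by simp
qed

lemma group_closure_all_consts:
  assumes "finite \<T>" "finite \<Gamma>"
  shows "group_closure (insert 1 (all_consts \<T> \<Gamma>)) = multiples (common_denom \<T> \<Gamma>)"
  unfolding common_denom_def denoms_def by (rule group_closure_eq_multiples[OF finite_all_consts[OF assms]])

lemma all_consts_multiples:
  assumes "finite \<T>" "finite \<Gamma>" shows "all_consts \<T> \<Gamma> \<subseteq> multiples (common_denom \<T> \<Gamma>)"
  unfolding group_closure_all_consts[OF assms, symmetric] by (auto intro: group_closure.base)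

lemma Z_set_eq:
  assumes "finite \<T>" "finite \<Gamma>"
  defines "N \<equiv> common_denom \<T> \<Gamma>"
  shows "Z_set \<T> \<Gamma> = (\<lambda>k. of_nat k / of_nat N) ` {0..N}"
proof -
  have N: "0 < N" unfolding N_def by (rule common_denom_pos[OF assms(1,2)])
  have "{0..1} \<inter> multiples N = (\<lambda>k. of_nat k / of_nat N) ` {0..N}"
  proof (intro equalityI subsetI)
    fix q :: rat assume "q \<in> {0..1} \<inter> multiples N"
    then obtain k where k: "q = of_int k / of_nat N" "0 \<le> q" "q \<le> 1" by (auto simp: multiples_def)
    have "of_int k = q * of_nat N" using N k(1) by simp
    then have "0 \<le> (of_int k :: rat)" "of_int k \<le> (of_int (int N) :: rat)"
      using k(2) mult_right_mono[OF k(3), of "of_nat N"] by simp_all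
    then have "0 \<le> k" "k \<le> int N" by (simp_all only: of_int_0_le_iff of_int_le_iff)
    then show "q \<in> (\<lambda>k. of_nat k / of_nat N) ` {0..N}"
      using k by (intro image_eqI[of _ _ "nat k"]) auto
  next
    fix q :: rat assume "q \<in> (\<lambda>k. of_nat k / of_nat N) ` {0..N}"
    then obtain k where "q = of_nat k / of_nat N" "k \<in> {0..N}" by blast
    moreover from this have "0 \<le> q" "q \<le> 1" using N by (auto simp: divide_le_eq)
    ultimately show "q \<in> {0..1} \<inter> multiples N" by (auto simp: multiples_def intro!: image_eqI[of _ _ "int k"])
  qed
  then show ?thesis unfolding Z_set_def group_closure_all_consts[OF assms(1,2)] N_def .
qed

lemma eps_eq:
  assumes "finite \<T>" "finite \<Gamma>"
  shows "eps \<T> \<Gamma> = 1 / of_nat (2 * common_denom \<T> \<Gamma>)"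
proof -
  let ?N = "common_denom \<T> \<Gamma>"
  have N: "0 < ?N" by (rule common_denom_pos[OF assms])
  have "Min (Z_set \<T> \<Gamma> - {0}) = 1 / of_nat ?N"
  proof (rule Min_eqI)
    show "finite (Z_set \<T> \<Gamma> - {0})" unfolding Z_set_eq[OF assms] by simp
    show "1 / of_nat ?N \<in> Z_set \<T> \<Gamma> - {0}" unfolding Z_set_eq[OF assms]
      using N by (auto intro!: image_eqI[of _ _ 1])
    fix y assume "y \<in> Z_set \<T> \<Gamma> - {0}"
    then obtain k where "y = of_nat k / of_nat ?N" "y \<noteq> 0" unfolding Z_set_eq[OF assms] by auto
    then show "1 / of_nat ?N \<le> y" using N by (cases k) (auto simp: field_simps)
  qed
  then show ?thesis by (simp add: eps_def)
qed

text \<open>On the scale 1/(2N) the elements of Z have the even numerators and the shifted elements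
  the odd ones; leaving out z = 1 before the shift keeps the odd numerators below 2N.\<close>

lemma Z'_set_eq:
  assumes "finite \<T>" "finite \<Gamma>"
  defines "N \<equiv> 2 * common_denom \<T> \<Gamma>"
  shows "Z'_set \<T> \<Gamma> = (\<lambda>k. of_nat k / of_nat N) ` {0..N}"
proof -
  let ?M = "common_denom \<T> \<Gamma>"
  have M: "0 < ?M" by (rule common_denom_pos[OF assms(1,2)])
  have e: "of_nat k / of_nat ?M = (of_nat (2 * k) / of_nat N :: rat)" for k
    using M by (simp add: N_def)
  have s: "of_nat k / of_nat ?M + 1 / of_nat N = (of_nat (2 * k + 1) / of_nat N :: rat)" for k
    unfolding e by (simp add: add_divide_distrib)
  show ?thesis
  proof (intro equalityI subsetI)
    fix q assume "q \<in> Z'_set \<T> \<Gamma>"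
    then consider k where "k \<in> {0..?M}" "q = of_nat k / of_nat ?M"
      | k where "k \<in> {0..?M}" "of_nat k / of_nat ?M \<noteq> (1::rat)" "q = of_nat k / of_nat ?M + 1 / of_nat N"
      unfolding Z'_set_def Z_set_eq[OF assms(1,2)] eps_eq[OF assms(1,2)] N_def by blast
    then show "q \<in> (\<lambda>k. of_nat k / of_nat N) ` {0..N}"
    proof cases
      case 1
      then show ?thesis unfolding e by (intro image_eqI[of _ _ "2 * k"]) (auto simp: N_def)
    next
      case 2
      then have "k \<noteq> ?M" using M by auto
      then show ?thesis using 2 unfolding s by (intro image_eqI[of _ _ "2 * k + 1"]) (auto simp: N_def)
    qed
  next
    fix q :: rat assume "q \<in> (\<lambda>k. of_nat k / of_nat N) ` {0..N}"
    then obtain k where k: "k \<le> N" "q = of_nat k / of_nat N" by auto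
    show "q \<in> Z'_set \<T> \<Gamma>"
    proof (cases "even k")
      case True
      then obtain j where j: "k = 2 * j" by auto
      have "q = of_nat j / of_nat ?M" unfolding e k(2) j ..
      moreover have "j \<le> ?M" using k(1) j by (simp add: N_def)
      ultimately have "q \<in> Z_set \<T> \<Gamma>" unfolding Z_set_eq[OF assms(1,2)]
        by (intro image_eqI[of _ _ j]) auto
      then show ?thesis by (simp add: Z'_set_def)
    next
      case False
      then obtain j where j: "k = 2 * j + 1" by (auto elim: oddE)
      then have "j < ?M" using k by (auto simp: N_def)
      then have "of_nat j / of_nat ?M \<in> Z_set \<T> \<Gamma> - {1}" unfolding Z_set_eq[OF assms(1,2)]
        using M by (auto intro!: image_eqI[of _ _ j])
      moreover have "q = of_nat j / of_nat ?M + eps \<T> \<Gamma>"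
        unfolding eps_eq[OF assms(1,2)] N_def[symmetric] s k(2) j ..
      ultimately show ?thesis unfolding Z'_set_def by blast
    qed
  qed
qed

lemma finite_Z'_set: "finite \<T> \<Longrightarrow> finite \<Gamma> \<Longrightarrow> finite (Z'_set \<T> \<Gamma>)"
  by (simp add: Z'_set_eq)

section \<open>Soundness\<close>

text \<open>
  A supremum need not be attained, so rounding interior values to the midpoints of the grid does not
  commute with it. Snapping all values within \<open>\<delta>\<close> of a grid point to that point gives some room:
  a witness that almost attains the supremum becomes good enough after a slight increase of \<open>\<delta>\<close>.
\<close>

lemma real_of_int_less_add1: "(of_int n :: real) < of_int n' + 1 \<Longrightarrow> (of_int n :: real) \<le> of_int n'"
  using of_int_less_iff[of n "n' + 1", where 'a = real] by simp

lemma real_of_int_less_imp: "(of_int n :: real) < of_int n' \<Longrightarrow> (of_int n :: real) + 1 \<le> of_int n'"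
  using of_int_le_iff[of "n + 1" n', where 'a = real] by simp

text \<open>The argument is already multiplied by N, so grid points are integers. For \<delta> < 1/2
  the zones around different integers are disjoint. Zones are closed: for \<delta> = 0 they consist
  of the integers alone, and a point in a zone stays there when \<delta> grows.\<close>

definition snap :: "real \<Rightarrow> real \<Rightarrow> real" where
  "snap \<delta> m = (if \<bar>m - of_int (round m)\<bar> \<le> \<delta> then of_int (round m) else of_int \<lfloor>m\<rfloor> + 1/2)"

context
  fixes \<delta> :: real
  assumes d: "0 \<le> \<delta>" "\<delta> < 1/2"
begin

lemma snap_eq1: "\<bar>m - of_int n\<bar> \<le> \<delta> \<Longrightarrow> snap \<delta> m = of_int n"
proof -
  assume a: "\<bar>m - of_int n\<bar> \<le> \<delta>"
  then have "round m = n" using d by (intro round_unique') auto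
  then show ?thesis using a by (simp add: snap_def)
qed

lemma snap_eq2:
  assumes "of_int n + \<delta> < m" "m < of_int n + 1 - \<delta>" shows "snap \<delta> m = of_int n + 1/2"
proof -
  have f: "\<lfloor>m\<rfloor> = n" using assms d by (intro floor_unique) auto
  have "round m = n \<or> round m = n + 1" unfolding round_def using assms d by linarith
  then have "\<not> \<bar>m - of_int (round m)\<bar> \<le> \<delta>" using assms by auto
  then show ?thesis by (simp add: snap_def f)
qed

lemma snap_cases:
  obtains n where "\<bar>m - of_int n\<bar> \<le> \<delta>" "snap \<delta> m = of_int n"
  | n where "of_int n + \<delta> < m" "m < of_int n + 1 - \<delta>" "snap \<delta> m = of_int n + 1/2"
proof -
  let ?n = "\<lfloor>m\<rfloor>"
  have fl: "of_int ?n \<le> m" "m < of_int ?n + 1" by linarith+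
  consider "\<bar>m - of_int ?n\<bar> \<le> \<delta>" | "\<bar>m - of_int (?n + 1)\<bar> \<le> \<delta>" | "of_int ?n + \<delta> < m" "m < of_int ?n + 1 - \<delta>"
    using fl by fastforce
  then show ?thesis using that snap_eq1 snap_eq2 by cases blast+
qed

text \<open>Zones around integers and the gaps between them alternate along the line. From m \<le>
  m' the integers that name the two places satisfy an inequality up to less than 1, which
  integrality sharpens to the required one.\<close>

lemma snap_mono: assumes "m \<le> m'" shows "snap \<delta> m \<le> snap \<delta> m'"
proof (cases m rule: snap_cases)
  case (1 n)
  note n = this
  show ?thesis
  proof (cases m' rule: snap_cases)
    case (1 n')
    then have "(of_int n :: real) \<le> of_int n'" using n assms d by (intro real_of_int_less_add1) linarith
    then show ?thesis using 1 n by linarith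
  next
    case (2 n')
    then have "(of_int n :: real) \<le> of_int n'" using n assms d by (intro real_of_int_less_add1) linarith
    then show ?thesis using 2 n by linarith
  qed
next
  case (2 n)
  note n = this
  show ?thesis
  proof (cases m' rule: snap_cases)
    case (1 n')
    then have "(of_int n :: real) + 1 \<le> of_int n'" using n assms d by (intro real_of_int_less_imp) linarith
    then show ?thesis using 1 n by linarith
  next
    case (2 n')
    then have "(of_int n :: real) \<le> of_int n'" using n assms d by (intro real_of_int_less_add1) linarith
    then show ?thesis using 2 n by linarith
  qed
qed

lemma snap_int [simp]: "snap \<delta> (of_int n) = of_int n"
  using d by (intro snap_eq1) auto

lemma snap_add_int: "snap \<delta> (m + of_int k) = snap \<delta> m + of_int k"
proof (cases m rule: snap_cases)
  case (1 n)
  then show ?thesis using snap_eq1[of "m + of_int k" "n + k"] by simp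
next
  case (2 n)
  then show ?thesis using snap_eq2[of "n + k" "m + of_int k"] by simp
qed

lemma snap_uminus: "snap \<delta> (- m) = - snap \<delta> m"
proof (cases m rule: snap_cases)
  case (1 n)
  then show ?thesis using snap_eq1[of "- m" "- n"] by (simp add: abs_minus_commute)
next
  case (2 n)
  then show ?thesis using snap_eq2[of "- n - 1" "- m"] by simp
qed

lemma snap_half_integer: "\<exists>k. snap \<delta> m = of_int k / 2"
proof (cases m rule: snap_cases)
  case (1 n) then show ?thesis by (intro exI[of _ "2 * n"]) simp
next
  case (2 n) then show ?thesis by (intro exI[of _ "2 * n + 1"]) simp
qed

text \<open>A point of a zone remains in it as \<delta> grows, and a point of a gap has positive
  distance from both neighbouring zones; finitely many such distances have a positive minimum. The
  last clause preserves in the same way a position to the left of the zone around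
  \<open>b\<close>.\<close>

lemma snap_stable:
  assumes "finite M"
  shows "\<exists>\<eta>>0. \<forall>\<delta>'. \<delta> \<le> \<delta>' \<and> \<delta>' < \<delta> + \<eta> \<longrightarrow> \<delta>' < 1/2 \<and>
           (\<forall>m\<in>M. snap \<delta>' m = snap \<delta> m \<and> (m < b - \<delta> \<longrightarrow> m < b - \<delta>'))"
  using assms
proof (induction M)
  case empty
  show ?case using d by (intro exI[of _ "1/2 - \<delta>"]) auto
next
  case (insert m M)
  then obtain \<eta> where \<eta>: "\<eta> > 0" "\<And>\<delta>'. \<delta> \<le> \<delta>' \<Longrightarrow> \<delta>' < \<delta> + \<eta> \<Longrightarrow> \<delta>' < 1/2 \<and>
           (\<forall>m\<in>M. snap \<delta>' m = snap \<delta> m \<and> (m < b - \<delta> \<longrightarrow> m < b - \<delta>'))" by blast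
  \<comment> \<open>The alternative 1 is arbitrary: there is nothing to preserve unless m < b -
    \<delta>.\<close>
  define e1 where "e1 = (if m < b - \<delta> then b - \<delta> - m else 1)"
  have e1: "e1 > 0" "\<And>\<delta>'. \<delta>' < \<delta> + e1 \<Longrightarrow> m < b - \<delta> \<Longrightarrow> m < b - \<delta>'" by (auto simp: e1_def)
  obtain e2 where e2: "e2 > 0" "\<And>\<delta>'. \<delta> \<le> \<delta>' \<Longrightarrow> \<delta>' < \<delta> + e2 \<Longrightarrow> \<delta>' < 1/2 \<Longrightarrow> snap \<delta>' m = snap \<delta> m"
  proof (cases m rule: snap_cases)
    case (1 n)
    show ?thesis
    proof (rule that[of 1])
      fix \<delta>' assume "\<delta> \<le> \<delta>'" "\<delta>' < 1/2"
      then show "snap \<delta>' m = snap \<delta> m" using Submission.snap_eq1[of \<delta>' m n] 1 d by simp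
    qed simp
  next
    case (2 n)
    show ?thesis
    proof (rule that[of "min (m - of_int n - \<delta>) (of_int n + 1 - \<delta> - m)"])
      fix \<delta>' assume "\<delta> \<le> \<delta>'" "\<delta>' < 1/2" "\<delta>' < \<delta> + min (m - of_int n - \<delta>) (of_int n + 1 - \<delta> - m)"
      then show "snap \<delta>' m = snap \<delta> m" using Submission.snap_eq2[of \<delta>' n m] 2 d by simp
    qed (use 2 in auto)
  qed
  show ?case
  proof (rule exI[of _ "min \<eta> (min e1 e2)"], intro conjI allI impI ballI)
    show "0 < min \<eta> (min e1 e2)" using \<eta>(1) e1(1) e2(1) by simp
    fix \<delta>' assume "\<delta> \<le> \<delta>' \<and> \<delta>' < \<delta> + min \<eta> (min e1 e2)"
    then have a: "\<delta> \<le> \<delta>'" "\<delta>' < \<delta> + \<eta>" "\<delta>' < \<delta> + e1" "\<delta>' < \<delta> + e2" by auto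
    note h = \<eta>(2)[OF a(1,2)]
    show l: "\<delta>' < 1/2" using h by blast
    fix m' assume m': "m' \<in> insert m M"
    then show "snap \<delta>' m' = snap \<delta> m'" using h e2(2)[OF a(1,4) l] by blast
    assume "m' < b - \<delta>"
    then show "m' < b - \<delta>'" using m' h e1(2)[OF a(3)] by blast
  qed
qed

end

section \<open>Rounding values to the half grid\<close>

definition rnd :: "nat \<Rightarrow> real \<Rightarrow> real \<Rightarrow> real" where
  "rnd N \<delta> v = snap \<delta> (v * of_nat N) / of_nat N"

lemma multiples_scaled: "0 < N \<Longrightarrow> c \<in> multiples N \<Longrightarrow> \<exists>k. of_rat c * of_nat N = (of_int k :: real)"
  unfolding multiples_def by (auto simp: of_rat_divide)

context
  fixes \<delta> :: real and N :: nat
  assumes d: "0 \<le> \<delta>" "\<delta> < 1/2" and N: "0 < N"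
begin

lemma rnd_mono: "v \<le> w \<Longrightarrow> rnd N \<delta> v \<le> rnd N \<delta> w"
  unfolding rnd_def using N by (intro divide_right_mono snap_mono[OF d] mult_right_mono) auto

lemma rnd_multiples: "c \<in> multiples N \<Longrightarrow> rnd N \<delta> (of_rat c) = of_rat c"
  using multiples_scaled[OF N, of c] N by (auto simp: rnd_def snap_int[OF d] field_simps)

lemma rnd_diff: "c \<in> multiples N \<Longrightarrow> rnd N \<delta> (v - of_rat c) = rnd N \<delta> v - of_rat c"
proof -
  assume "c \<in> multiples N"
  then obtain k where k: "of_rat c * of_nat N = (of_int k :: real)" using multiples_scaled[OF N] by blast
  have "snap \<delta> ((v - of_rat c) * of_nat N) = snap \<delta> (v * of_nat N) - of_int k"
    using snap_add_int[OF d, of "v * of_nat N" "- k"] k by (simp add: left_diff_distrib)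
  then show ?thesis unfolding rnd_def using k N by (simp add: field_simps)
qed

lemma rnd_uminus: "rnd N \<delta> (- v) = - rnd N \<delta> v"
  unfolding rnd_def using snap_uminus[OF d, of "v * of_nat N"] by simp

lemma rnd_0: "rnd N \<delta> 0 = 0" and rnd_1: "rnd N \<delta> 1 = 1"
  using rnd_multiples[OF multiples_of_int[OF N, of 0]] rnd_multiples[OF multiples_of_int[OF N, of 1]] by auto

lemma rnd_compl: "rnd N \<delta> (1 - v) = 1 - rnd N \<delta> v"
  using rnd_diff[OF multiples_of_int[OF N, of "-1"], of "- v"] rnd_uminus[of v] by (simp add: of_rat_minus)

lemma rnd_range: "0 \<le> v \<Longrightarrow> v \<le> 1 \<Longrightarrow> 0 \<le> rnd N \<delta> v \<and> rnd N \<delta> v \<le> 1"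
  using rnd_mono[of 0 v] rnd_mono[of v 1] by (simp add: rnd_0 rnd_1)

lemma rnd_min: "rnd N \<delta> (min v w) = min (rnd N \<delta> v) (rnd N \<delta> w)"
  using rnd_mono[of v w] rnd_mono[of w v] by (auto simp: min_def)

lemma rnd_ominus: "c \<in> multiples N \<Longrightarrow> rnd N \<delta> (max (v - of_rat c) 0) = max (rnd N \<delta> v - of_rat c) 0"
  using rnd_diff[of c v] rnd_mono[of "v - of_rat c" 0] rnd_mono[of 0 "v - of_rat c"]
  by (auto simp: max_def rnd_0)

text \<open>Snapped values are half-integers, so rounded values of the unit interval lie in Z'. The
  midpoints were added to Z for this purpose.\<close>

lemma rnd_half_grid:
  assumes "0 \<le> v" "v \<le> 1"
  shows "\<exists>k\<in>{0..2 * N}. rnd N \<delta> v = of_rat (of_nat k / of_nat (2 * N))"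
proof -
  obtain k where k: "snap \<delta> (v * of_nat N) = of_int k / 2" using snap_half_integer[OF d] by blast
  have r: "rnd N \<delta> v = of_int k / of_nat (2 * N)" unfolding rnd_def k by simp
  have "0 \<le> (of_int k :: real)" "(of_int k :: real) \<le> of_nat (2 * N)"
    using rnd_range[OF assms] N unfolding r by (auto simp: field_simps)
  then have "0 \<le> k" "k \<le> int (2 * N)" by linarith+
  then show ?thesis unfolding r by (intro bexI[of _ "nat k"]) (auto simp: of_rat_divide of_rat_mult)
qed

end

text \<open>Rounding happens at atoms and existential restrictions only, and the propositional
  structure is evaluated exactly. For concepts with grid constants this equals the rounded value,
  but labels also contain T, whose half-grid constants do not commute with rounding, and constants
  produced by \<open>Ominus_upper\<close>.\<close>

primrec rsem :: "(real \<Rightarrow> real) \<Rightarrow> 'a interp \<Rightarrow> concept \<Rightarrow> 'a \<Rightarrow> real" where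
  "rsem f I (Atom p) x = f (conc I p x)"
| "rsem f I (Const c) x = of_rat c"
| "rsem f I (Neg C) x = 1 - rsem f I C x"
| "rsem f I (Ominus C c) x = max (rsem f I C x - of_rat c) 0"
| "rsem f I (And C D) x = min (rsem f I C x) (rsem f I D x)"
| "rsem f I (Ex R C) x = f (sem I (Ex R C) x)"

lemma rsem_id: "rsem (\<lambda>v. v) I C x = sem I C x"
  by (induction C) auto

primrec rholds :: "(real \<Rightarrow> real) \<Rightarrow> 'a interp \<Rightarrow> 'a \<Rightarrow> assertion \<Rightarrow> bool" where
  "rholds f I x (Assert C r c) = cmp_rel r (rsem f I C x) (of_rat c)"

lemma rholds_id: "rholds (\<lambda>v. v) I x A = holds I x A"
  by (cases A) (simp add: rsem_id)

lemma rsem_rnd: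
  assumes "0 \<le> \<delta>" "\<delta> < 1/2" "0 < N" "concept_consts C \<subseteq> multiples N"
  shows "rsem (rnd N \<delta>) I C x = rnd N \<delta> (sem I C x)"
  using assms(4)
  by (induction C) (auto simp: rnd_multiples[OF assms(1-3)] rnd_compl[OF assms(1-3)] rnd_min[OF assms(1-3)]
      rnd_ominus[OF assms(1-3)])

lemma sem_range:
  assumes "interpretation_ok I" "wf_concept C" "x \<in> dom I"
  shows "0 \<le> sem I C x \<and> sem I C x \<le> 1"
  using assms(2,3)
proof (induction C arbitrary: x)
  case (Ominus C c)
  then have "0 \<le> (of_rat c :: real)" "0 \<le> sem I C x" "sem I C x \<le> 1" by auto
  then show ?case by (auto simp: max_def simp del: zero_le_of_rat_iff)
next
  case (Ex R C)
  let ?f = "\<lambda>y. min (role I R x y) (sem I C y)"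
  have r: "0 \<le> ?f y \<and> ?f y \<le> 1" if "y \<in> dom I" for y
    using Ex that assms(1) by (auto simp: interpretation_ok_def min_le_iff_disj)
  then have b: "bdd_above (?f ` dom I)" by (auto intro!: bdd_aboveI[of _ 1])
  have "(SUP y\<in>dom I. ?f y) \<le> 1" using r Ex.prems by (intro cSUP_least) auto
  moreover have "0 \<le> (SUP y\<in>dom I. ?f y)" using r Ex.prems b by (intro cSUP_upper2[of _ _ x]) auto
  ultimately show ?case by simp
qed (use assms in \<open>auto simp: interpretation_ok_def min_le_iff_disj\<close>)

lemma sem_Ex_upper:
  assumes "interpretation_ok I" "x \<in> dom I" "y \<in> dom I"
  shows "min (role I R x y) (sem I C y) \<le> sem I (Ex R C) x"
proof -
  have "role I R x y \<le> 1" if "y \<in> dom I" for y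
    using assms that by (auto simp: interpretation_ok_def)
  then have "bdd_above ((\<lambda>y. min (role I R x y) (sem I C y)) ` dom I)"
    by (auto intro!: bdd_aboveI[of _ 1] simp: min_le_iff_disj)
  then show ?thesis using assms by (auto intro!: cSUP_upper)
qed

lemma sem_Ex_witness:
  assumes "interpretation_ok I" "x \<in> dom I" "v < sem I (Ex R C) x"
  shows "\<exists>y\<in>dom I. v < min (role I R x y) (sem I C y)"
proof (rule ccontr)
  assume "\<not> ?thesis"
  then have "sem I (Ex R C) x \<le> v" using assms(1) unfolding sem.simps
    by (intro cSUP_least) (auto simp: interpretation_ok_def not_less)
  then show False using assms(3) by simp
qed

text \<open>Well-formedness and grid constants are demanded only below a quantifier, where the
  rounded value of a body is compared with the body at a successor. At propositional positions
  labels contain half-grid constants of T and constants outside the unit interval.\<close>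

primrec ex_ok :: "nat \<Rightarrow> concept \<Rightarrow> bool" where
  "ex_ok N (Atom p) = True"
| "ex_ok N (Const c) = True"
| "ex_ok N (Neg C) = ex_ok N C"
| "ex_ok N (Ominus C c) = ex_ok N C"
| "ex_ok N (And C D) = (ex_ok N C \<and> ex_ok N D)"
| "ex_ok N (Ex R C) = (wf_concept C \<and> concept_consts C \<subseteq> multiples N)"

lemma ex_okI: "wf_concept C \<Longrightarrow> concept_consts C \<subseteq> multiples N \<Longrightarrow> ex_ok N C"
  by (induction C) auto

definition concept_of :: "assertion \<Rightarrow> concept" where
  "concept_of A = (case A of Assert C r c \<Rightarrow> C)"

lemma concept_of_simps [simp]: "concept_of (Assert C r c) = C"
  by (simp add: concept_of_def)

definition label_ok :: "nat \<Rightarrow> assertion set \<Rightarrow> bool" where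
  "label_ok N L \<longleftrightarrow> finite L \<and> (\<forall>A\<in>L. ex_ok N (concept_of A))"

lemma label_ok_prop_rule:
  assumes "prop_rule L K" "Seq L' \<in> K" "label_ok N L" shows "label_ok N L'"
  using assms by (cases rule: prop_rule.cases) (force simp: label_ok_def)+

definition ex_label :: "concept \<Rightarrow> assertion set \<Rightarrow> nat \<Rightarrow> concept \<Rightarrow> cmp \<Rightarrow> rat \<Rightarrow> assertion set" where
  "ex_label T L R C r c =
     {Assert D u d |D u d. Assert (Ex R D) u d \<in> L \<and> upper u \<and> black u r d c} \<union>
     {Assert C r c, Assert T Ge 1}"

lemma ex_rule_iff:
  "ex_rule T L l \<longleftrightarrow> (\<exists>R C r c. l = Seq (ex_label T L R C r c) \<and> Assert (Ex R C) r c \<in> L \<and>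
     (r = Gt \<and> c \<ge> 0 \<or> r = Ge \<and> c > 0))"
  unfolding ex_rule.simps ex_label_def by blast

lemma finite_ex_label: assumes "finite L" shows "finite (ex_label T L R C r c)"
proof -
  have "{Assert D u d |D u d. Assert (Ex R D) u d \<in> L \<and> upper u \<and> black u r d c}
    \<subseteq> (\<lambda>A. case A of Assert E u d \<Rightarrow> Assert (case E of Ex S D \<Rightarrow> D | _ \<Rightarrow> E) u d) ` L"
    by (force intro!: image_eqI)
  then have "finite {Assert D u d |D u d. Assert (Ex R D) u d \<in> L \<and> upper u \<and> black u r d c}"
    using assms by (meson finite_imageI finite_subset)
  then show ?thesis by (simp add: ex_label_def)
qed

lemma label_ok_ex_label:
  assumes "label_ok N L" "ex_ok N T" "Assert (Ex R C) r c \<in> L"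
  shows "label_ok N (ex_label T L R C r c)"
proof -
  have "ex_ok N D" if "Assert (Ex S D) u d \<in> L" for S D u d
  proof -
    have "ex_ok N (concept_of (Assert (Ex S D) u d))" using assms(1) that unfolding label_ok_def by blast
    then show ?thesis by (auto intro: ex_okI)
  qed
  then show ?thesis using assms finite_ex_label[of L T R C r c]
    by (auto simp: label_ok_def ex_label_def)
qed

lemma cmp_rel_flip: "cmp_rel (flip r) v (1 - c) \<longleftrightarrow> cmp_rel r (1 - v) c" for v c :: real
  by (cases r) auto

text \<open>The rules treat atoms and existential restrictions as opaque values of the unit
  interval, so the argument is the same for every \<open>f\<close> that maps this interval to
  itself.\<close>

lemma prop_rule_sound:
  assumes "prop_rule L K" and L: "\<forall>A\<in>L. rholds f I x A" "\<forall>A\<in>L. ex_ok N (concept_of A)"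
    and I: "interpretation_ok I" "x \<in> dom I"
    and f: "\<And>v. 0 \<le> v \<Longrightarrow> v \<le> 1 \<Longrightarrow> 0 \<le> f v \<and> f v \<le> 1"
  shows "\<exists>L'. Seq L' \<in> K \<and> (\<forall>A\<in>L'. rholds f I x A)"
  using assms(1)
proof cases
  case (Ax_1 p r c)
  have "f (conc I p x) \<le> 1" using f[of "conc I p x"] I by (auto simp: interpretation_ok_def)
  moreover have "cmp_rel r (f (conc I p x)) (of_rat c)" using L(1) Ax_1 by force
  ultimately have "r = Gt \<Longrightarrow> (of_rat c :: real) < 1" "r = Ge \<Longrightarrow> (of_rat c :: real) \<le> 1"
    by (auto simp del: of_rat_less_1_iff of_rat_le_1_iff)
  then show ?thesis using Ax_1(3) by auto
next
  case (Ax_0 p r c)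
  have "0 \<le> f (conc I p x)" using f[of "conc I p x"] I by (auto simp: interpretation_ok_def)
  moreover have "cmp_rel r (f (conc I p x)) (of_rat c)" using L(1) Ax_0 by force
  ultimately have "r = Lt \<Longrightarrow> 0 < (of_rat c :: real)" "r = Le \<Longrightarrow> 0 \<le> (of_rat c :: real)"
    by (auto simp del: zero_less_of_rat_iff zero_le_of_rat_iff)
  then show ?thesis using Ax_0(3) by auto
next
  case (Ax_0_Ex R C r c)
  have "wf_concept C" using L(2) Ax_0_Ex by fastforce
  then have "0 \<le> f (sem I (Ex R C) x)"
    using f[of "sem I (Ex R C) x"] sem_range[OF I(1) _ I(2), of "Ex R C"] by (auto simp del: sem.simps)
  moreover have "cmp_rel r (f (sem I (Ex R C) x)) (of_rat c)"
    using L(1) Ax_0_Ex by (auto simp del: sem.simps)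
  ultimately have "r = Lt \<Longrightarrow> 0 < (of_rat c :: real)" "r = Le \<Longrightarrow> 0 \<le> (of_rat c :: real)"
    by (auto simp del: sem.simps zero_less_of_rat_iff zero_le_of_rat_iff)
  then show ?thesis using Ax_0_Ex(3) by auto
next
  case (Ax_c c r d)
  have "cmp_rel r (of_rat c :: real) (of_rat d)" using L(1) Ax_c by force
  then have "cmp_rel r c d" by (cases r) (auto simp: of_rat_less of_rat_less_eq)
  then show ?thesis using Ax_c by simp
next
  case (Ax_p p u c l d)
  have "cmp_rel u (f (conc I p x)) (of_rat c)" "cmp_rel l (f (conc I p x)) (of_rat d)"
    using L(1) Ax_p by force+
  moreover have "(of_rat c :: real) \<le> of_rat d" "\<not> (u = Le \<and> l = Ge) \<or> (of_rat c :: real) < of_rat d"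
    using Ax_p(6) by (auto simp: black_def of_rat_less of_rat_less_eq split: if_splits)
  ultimately show ?thesis using Ax_p(4,5) by (auto simp: upper_def lower_def)
next
  case (And_lower C D r c)
  then have "rholds f I x (Assert C r c)" "rholds f I x (Assert D r c)"
    using L(1) by (fastforce simp: lower_def)+
  then show ?thesis using And_lower L(1) by auto
next
  case (And_upper C D r c)
  then have "rholds f I x (Assert C r c) \<or> rholds f I x (Assert D r c)"
    using L(1) by (fastforce simp: upper_def min_less_iff_disj min_le_iff_disj)
  then have "(\<forall>A\<in>L - {Assert (And C D) r c} \<union> {Assert C r c}. rholds f I x A) \<or>
     (\<forall>A\<in>L - {Assert (And C D) r c} \<union> {Assert D r c}. rholds f I x A)"
    using L(1) by blast
  then show ?thesis using And_upper(1) by blast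
next
  case (Neg C r c)
  then have "rholds f I x (Assert C (flip r) (1 - c))"
    using L(1) by (fastforce simp: of_rat_diff cmp_rel_flip)
  then show ?thesis using Neg L(1) by auto
next
  case (Ominus_upper C c r d)
  then have "cmp_rel r (max (rsem f I C x - of_rat c) 0) (of_rat d :: real)"
    using L(1) by fastforce
  then have "rholds f I x (Assert C r (d + c))" "rholds f I x (Assert (Const d) (flip r) 0)"
    using Ominus_upper(3) by (auto simp: of_rat_add upper_def)
  then show ?thesis using Ominus_upper L(1) by auto
next
  case (Ominus_lower C c r d)
  then have "cmp_rel r (max (rsem f I C x - of_rat c) 0) (of_rat d :: real)"
    using L(1) by fastforce
  moreover have "d > 0 \<Longrightarrow> (of_rat d :: real) > 0" "d \<ge> 0 \<Longrightarrow> (of_rat d :: real) \<ge> 0" by simp_all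
  ultimately have "rholds f I x (Assert C r (d + c))"
    using Ominus_lower(3) by (auto simp: of_rat_add max_def split: if_splits)
  then show ?thesis using Ominus_lower L(1) by auto
qed

text \<open>Let v be the supremum. If v rounds to a grid point n, a witness above n - \<delta>' for
  a slightly larger \<delta>' rounds to at least n as well, while the finitely many relevant
  upper-bounded suprema keep their rounded values. If v rounds to a midpoint, a witness close to v
  already rounds high enough. In both cases the role value exceeds the upper-bounded suprema, which
  forces the bodies to be small at the witness.\<close>

lemma ex_rule_sound:
  assumes L: "\<forall>A\<in>L. rholds (rnd N \<delta>) I x A" "label_ok N L"
    and I: "interpretation_ok I" "x \<in> dom I" and d: "0 \<le> \<delta>" "\<delta> < 1/2" and N: "0 < N"
    and E: "Assert (Ex R C) r c \<in> L" "lower r"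
    and T: "\<And>\<delta> y. 0 \<le> \<delta> \<Longrightarrow> \<delta> < 1/2 \<Longrightarrow> y \<in> dom I \<Longrightarrow> rholds (rnd N \<delta>) I y (Assert T Ge 1)"
  shows "\<exists>y\<in>dom I. \<exists>\<delta>'. 0 \<le> \<delta>' \<and> \<delta>' < 1/2 \<and> (\<forall>A\<in>ex_label T L R C r c. rholds (rnd N \<delta>') I y A)"
proof -
  define v where "v = sem I (Ex R C) x"
  \<comment> \<open>\<open>J\<close> lists the upper bounds that the rule copies to the successor;
    \<open>M\<close> collects their unrounded values, scaled so that grid points are
    integers.\<close>
  define J where "J = {(D, u, d). Assert (Ex R D) u d \<in> L \<and> upper u \<and> black u r d c}"
  define M where "M = (\<lambda>(D, u, d). sem I (Ex R D) x * of_nat N) ` J"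
  have "J \<subseteq> (\<lambda>A. case A of Assert E u d \<Rightarrow> ((case E of Ex S D \<Rightarrow> D | _ \<Rightarrow> E), u, d)) ` L"
    by (force intro!: image_eqI simp: J_def)
  then have "finite J" using L(2) by (auto simp: label_ok_def intro: finite_subset)
  then have fin: "finite M" by (simp add: M_def)
  have cv: "cmp_rel r (rnd N \<delta> v) (of_rat c)" using L(1) E(1) by (auto simp: v_def simp del: sem.simps)
  have uv: "cmp_rel u (rnd N \<delta> (sem I (Ex R D) x)) (of_rat d)" if "(D, u, d) \<in> J" for D u d
    using L(1) that by (auto simp: J_def simp del: sem.simps)
  \<comment> \<open>\<open>black\<close> makes the two bounds contradictory for a single value, so
    the two rounded values are strictly separated.\<close>
  have less: "rnd N \<delta> (sem I (Ex R D) x) < rnd N \<delta> v" if j: "(D, u, d) \<in> J" for D u d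
  proof -
    have "(of_rat d :: real) \<le> of_rat c" "\<not> (u = Le \<and> r = Ge) \<or> (of_rat d :: real) < of_rat c" "upper u"
      using j by (auto simp: J_def black_def of_rat_less of_rat_less_eq split: if_splits)
    then show ?thesis using cv uv[OF j] E(2) by (auto simp: upper_def lower_def)
  qed
  have snapless: "snap \<delta> m < snap \<delta> (v * of_nat N)" if "m \<in> M" for m
    using that less N by (auto simp: M_def rnd_def divide_less_cancel)
  have "\<exists>y\<in>dom I. \<exists>\<delta>'. 0 \<le> \<delta>' \<and> \<delta>' < 1/2 \<and> snap \<delta> (v * of_nat N) \<le> snap \<delta>' (sem I C y * of_nat N) \<and>
     (\<forall>m\<in>M. snap \<delta>' m = snap \<delta> m \<and> m < role I R x y * of_nat N)"
  proof (cases "v * of_nat N" rule: snap_cases[OF d])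
    case (1 n)
    have lt: "m < of_int n - \<delta>" if "m \<in> M" for m
    proof (rule ccontr)
      assume "\<not> ?thesis"
      then have "snap \<delta> (of_int n - \<delta>) \<le> snap \<delta> m" by (intro snap_mono[OF d]) auto
      moreover have "snap \<delta> (of_int n - \<delta>) = of_int n" using d by (intro snap_eq1) auto
      ultimately show False using snapless[OF that] 1 by simp
    qed
    obtain \<eta> where \<eta>: "\<eta> > 0" "\<And>\<delta>'. \<delta> \<le> \<delta>' \<Longrightarrow> \<delta>' < \<delta> + \<eta> \<Longrightarrow> \<delta>' < 1/2 \<and>
           (\<forall>m\<in>M. snap \<delta>' m = snap \<delta> m \<and> (m < of_int n - \<delta> \<longrightarrow> m < of_int n - \<delta>'))"
      using snap_stable[OF d fin, of "of_int n"] by blast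
    \<comment> \<open>Half of the margin: strictly more than \<delta>, so that a witness exists
      although the supremum need not be attained, and small enough to keep the snapped values of
      \<open>M\<close>.\<close>
    define \<delta>' where "\<delta>' = \<delta> + \<eta> / 2"
    have d': "0 \<le> \<delta>'" "\<delta>' < 1/2" "\<delta> < \<delta>'" and
      M: "\<And>m. m \<in> M \<Longrightarrow> snap \<delta>' m = snap \<delta> m \<and> m < of_int n - \<delta>'"
      using \<eta>(2)[of \<delta>'] \<eta>(1) d lt by (auto simp: \<delta>'_def)
    have "(of_int n - \<delta>') / of_nat N < v" using 1 d' N by (simp add: field_simps)
    then obtain y where y: "y \<in> dom I" "(of_int n - \<delta>') / of_nat N < min (role I R x y) (sem I C y)"
      using sem_Ex_witness[OF I] unfolding v_def by blast
    then have y': "of_int n - \<delta>' < role I R x y * of_nat N" "of_int n - \<delta>' < sem I C y * of_nat N"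
      using N by (auto simp: field_simps)
    have "snap \<delta>' (of_int n - \<delta>') \<le> snap \<delta>' (sem I C y * of_nat N)"
      using y' by (intro snap_mono d') auto
    moreover have "snap \<delta>' (of_int n - \<delta>') = of_int n" using d' by (intro snap_eq1) auto
    ultimately show ?thesis
      using y(1) y'(1) d' M 1 by (intro bexI[of _ y] exI[of _ \<delta>']) force+
  next
    \<comment> \<open>Here \<delta> can be kept: everything strictly above n + \<delta> snaps to at
      least n + 1/2.\<close>
    case (2 n)
    have up: "of_int n + 1/2 \<le> snap \<delta> m" if "of_int n + \<delta> < m" for m
    proof -
      have "snap \<delta> (min m (v * of_nat N)) = of_int n + 1/2" using that 2 by (intro snap_eq2[OF d]) auto
      then show ?thesis using snap_mono[OF d, of "min m (v * of_nat N)" m] by simp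
    qed
    have "(of_int n + \<delta>) / of_nat N < v" using 2 N by (simp add: field_simps)
    then obtain y where y: "y \<in> dom I" "(of_int n + \<delta>) / of_nat N < min (role I R x y) (sem I C y)"
      using sem_Ex_witness[OF I] unfolding v_def by blast
    then have y': "of_int n + \<delta> < role I R x y * of_nat N" "of_int n + \<delta> < sem I C y * of_nat N"
      using N by (auto simp: field_simps)
    have "m < role I R x y * of_nat N" if "m \<in> M" for m
      using up[of m] snapless[OF that] 2 y'(1) by force
    then show ?thesis using up[OF y'(2)] 2 y(1) d by (intro bexI[of _ y] exI[of _ \<delta>]) auto
  qed
  then obtain y \<delta>' where y: "y \<in> dom I" "0 \<le> \<delta>'" "\<delta>' < 1/2"
    and C: "snap \<delta> (v * of_nat N) \<le> snap \<delta>' (sem I C y * of_nat N)"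
    and M: "\<And>m. m \<in> M \<Longrightarrow> snap \<delta>' m = snap \<delta> m \<and> m < role I R x y * of_nat N" by blast
  have body: "concept_consts D \<subseteq> multiples N" if "Assert (Ex R D) u d \<in> L" for D u d
  proof -
    have "ex_ok N (concept_of (Assert (Ex R D) u d))" using L(2) that unfolding label_ok_def by blast
    then show ?thesis by simp
  qed
  have "rholds (rnd N \<delta>') I y (Assert D u d)" if j: "(D, u, d) \<in> J" for D u d
  proof -
    have m: "sem I (Ex R D) x * of_nat N \<in> M" using j unfolding M_def by force
    \<comment> \<open>As the role value exceeds the supremum, only the concept value can keep the
      minimum below it.\<close>
    have "sem I (Ex R D) x < role I R x y" using M[OF m] N by auto
    moreover have "min (role I R x y) (sem I D y) \<le> sem I (Ex R D) x" by (rule sem_Ex_upper[OF I y(1)])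
    ultimately have "sem I D y \<le> sem I (Ex R D) x" by (simp add: min_le_iff_disj del: sem.simps)
    then have "rnd N \<delta>' (sem I D y) \<le> rnd N \<delta>' (sem I (Ex R D) x)" by (intro rnd_mono y N)
    also have "\<dots> = rnd N \<delta> (sem I (Ex R D) x)" using M[OF m] by (simp add: rnd_def del: sem.simps)
    finally have le: "rsem (rnd N \<delta>') I D y \<le> rnd N \<delta> (sem I (Ex R D) x)"
      using body[of D u d] j by (subst rsem_rnd[OF y(2,3) N]) (auto simp: J_def simp del: sem.simps)
    have "upper u" using j by (auto simp: J_def)
    then show ?thesis using uv[OF j] le by (auto simp: upper_def simp del: sem.simps)
  qed
  moreover have "rholds (rnd N \<delta>') I y (Assert C r c)"
  proof -
    have "rnd N \<delta> v \<le> rnd N \<delta>' (sem I C y)" unfolding rnd_def using C N by (simp add: divide_right_mono)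
    then have "rnd N \<delta> v \<le> rsem (rnd N \<delta>') I C y" using body[OF E(1)] by (subst rsem_rnd[OF y(2,3) N])
    then show ?thesis using cv E(2) by (auto simp: lower_def)
  qed
  ultimately have "\<forall>A\<in>ex_label T L R C r c. rholds (rnd N \<delta>') I y A"
    using T[OF y(2,3,1)] by (auto simp: ex_label_def J_def simp del: rholds.simps)
  then show ?thesis using y by blast
qed

lemma rsem_big_and: "1 \<le> rsem f I (big_and Cs) x \<longleftrightarrow> (\<forall>C\<in>set Cs. 1 \<le> rsem f I C x)"
  by (induction Cs rule: big_and.induct) auto

lemma rsem_big_or: "1 \<le> rsem f I (big_or Cs) x \<longleftrightarrow> (\<exists>C\<in>set Cs. 1 \<le> rsem f I C x)"
  by (induction Cs rule: big_or.induct) (auto simp: Or_def min_def)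

text \<open>Truncation makes the members of the disjunction two-sided tests: the join of \<not>C
  with the shift z reaches 1 iff C \<le> z, and D shifted by 1 - z reaches 1 iff z \<le> D.
  Soundness uses this with a rounding \<open>f\<close>, completeness with the identity.\<close>

lemma rsem_assoc_concept:
  assumes "finite (Z'_set (set ts) \<Gamma>)"
  shows "rholds f I x (Assert (assoc_concept ts \<Gamma>) Ge 1) \<longleftrightarrow>
     (\<forall>(C, D)\<in>set ts. \<exists>z\<in>Z'_set (set ts) \<Gamma>. rsem f I C x \<le> of_rat z \<and> of_rat z \<le> rsem f I D x)"
proof -
  have "1 \<le> rsem f I (And (Oplus (Neg C) z) (Oplus D (1 - z))) x \<longleftrightarrow>
     rsem f I C x \<le> of_rat z \<and> of_rat z \<le> rsem f I D x" for C D z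
    by (auto simp: Oplus_def of_rat_diff max_def)
  then show ?thesis
    using set_sorted_list_of_set[OF assms]
    by (auto simp: assoc_concept_def rsem_big_and assoc_gci_def rsem_big_or case_prod_beta)
qed

section \<open>Invariants of labels and the least fixed point \<open>Unsat\<close>\<close>

lemma tableau_label_inv:
  assumes G: "tableau T \<Gamma> G" and base: "P (\<Gamma> \<union> {Assert T Ge 1})"
    and pr: "\<And>L K L'. P L \<Longrightarrow> prop_rule L K \<Longrightarrow> Seq L' \<in> K \<Longrightarrow> P L'"
    and ex: "\<And>L R C r c. P L \<Longrightarrow> saturated L \<Longrightarrow> Assert (Ex R C) r c \<in> L \<Longrightarrow>
       r = Gt \<and> c \<ge> 0 \<or> r = Ge \<and> c > 0 \<Longrightarrow> P (ex_label T L R C r c)"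
    and v: "v \<in> verts G" "lab G v = Seq L"
  shows "P L"
proof -
  have "(root G, v) \<in> (edges G)\<^sup>*" using G v(1) by (auto simp: tableau_def)
  then show ?thesis using v(2)
  proof (induction arbitrary: L rule: rtrancl_induct)
    case base
    then show ?case using G assms(2) by (auto simp: tableau_def)
  next
    case (step u w)
    have u: "u \<in> verts G" "w \<in> children G u" using step G by (auto simp: tableau_def)
    have lu: "case lab G u of Bot \<Rightarrow> children G u = {}
      | Seq L \<Rightarrow> if saturated L then lab G ` children G u = {l. ex_rule T L l}
          else prop_rule L (lab G ` children G u)" using G u(1) unfolding tableau_def by blast
    then obtain M where M: "lab G u = Seq M" using u(2) by (cases "lab G u") auto
    then have PM: "P M" by (rule step.IH)
    have w: "Seq L \<in> lab G ` children G u" using u(2) step.prems by force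
    show ?case
    proof (cases "saturated M")
      case True
      then have "ex_rule T M (Seq L)" using lu M w by auto
      then show ?thesis using ex[OF PM True] by (auto simp: ex_rule_iff)
    next
      case False
      then show ?thesis using lu M w pr[OF PM] by auto
    qed
  qed
qed

text \<open>The loop ends because a step that changes the set leaves fewer vertices outside it. The
  last claim is the induction principle: \<open>Q\<close> may be any set that contains the
  \<open>Bot\<close> nodes and absorbs one step from each of its subsets.\<close>

lemma Unsat_lfp:
  assumes fin: "finite (verts G)"
  shows "unsat_step G (Unsat G) = Unsat G" "{v \<in> verts G. lab G v = Bot} \<subseteq> Unsat G" "Unsat G \<subseteq> verts G"
    and "\<And>Q. {v \<in> verts G. lab G v = Bot} \<subseteq> Q \<Longrightarrow> (\<And>U. U \<subseteq> Q \<Longrightarrow> unsat_step G U \<subseteq> Q) \<Longrightarrow> Unsat G \<subseteq> Q"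
proof -
  let ?B = "{v \<in> verts G. lab G v = Bot}"
  let ?P = "\<lambda>U. ?B \<subseteq> U \<and> U \<subseteq> verts G \<and>
     (\<forall>Q. ?B \<subseteq> Q \<longrightarrow> (\<forall>U. U \<subseteq> Q \<longrightarrow> unsat_step G U \<subseteq> Q) \<longrightarrow> U \<subseteq> Q)"
  have inc: "U \<subseteq> unsat_step G U" for U by (auto simp: unsat_step_def)
  have sub: "U \<subseteq> verts G \<Longrightarrow> unsat_step G U \<subseteq> verts G" for U
    by (auto simp: unsat_step_def and_node_def or_node_def)
  have "?P (Unsat G) \<and> unsat_step G (Unsat G) = Unsat G"
    unfolding Unsat_def
  proof (rule while_rule[where P = ?P and r = "measure (\<lambda>U. card (verts G - U))"])
    fix U assume U: "?P U" "unsat_step G U \<noteq> U"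
    show "?P (unsat_step G U)"
    proof (intro conjI allI impI)
      show "?B \<subseteq> unsat_step G U" "unsat_step G U \<subseteq> verts G" using U inc[of U] sub[of U] by blast+
      fix Q assume "?B \<subseteq> Q" and c: "\<forall>U\<subseteq>Q. unsat_step G U \<subseteq> Q"
      then have "U \<subseteq> Q" using U(1) by simp
      then show "unsat_step G U \<subseteq> Q" using c by simp
    qed
  next
    fix U assume U: "?P U" "unsat_step G U \<noteq> U"
    have "verts G - unsat_step G U \<subset> verts G - U" using U sub[of U] inc[of U] by blast
    then show "(unsat_step G U, U) \<in> measure (\<lambda>U. card (verts G - U))"
      using fin by (auto intro: psubset_card_mono)
  next
    fix U assume "?P U" "\<not> unsat_step G U \<noteq> U"
    then show "?P U \<and> unsat_step G U = U" by simp
  qed auto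
  then have r: "?P (Unsat G)" "unsat_step G (Unsat G) = Unsat G" by simp_all
  then show "unsat_step G (Unsat G) = Unsat G" "?B \<subseteq> Unsat G" "Unsat G \<subseteq> verts G"
    by simp_all
  show "Unsat G \<subseteq> Q" if "?B \<subseteq> Q" "\<And>U. U \<subseteq> Q \<Longrightarrow> unsat_step G U \<subseteq> Q" for Q
    using r(1) that by simp
qed

lemma label_ok_root:
  assumes wf: "\<forall>g\<in>set ts. wf_gci g" "\<forall>A\<in>\<Gamma>. wf_assertion A" and fin: "finite \<Gamma>"
  shows "label_ok (common_denom (set ts) \<Gamma>) (\<Gamma> \<union> {Assert (assoc_concept ts \<Gamma>) Ge 1})"
proof -
  let ?N = "common_denom (set ts) \<Gamma>"
  note multiples = all_consts_multiples[OF finite_set fin, of ts]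
  have "ex_ok ?N (concept_of A)" if "A \<in> \<Gamma>" for A
  proof (cases A)
    case (Assert C r c)
    then have "concept_consts C \<subseteq> all_consts (set ts) \<Gamma>" using that by (force simp: all_consts_def)
    then show ?thesis using Assert wf(2) that multiples by (auto intro!: ex_okI)
  qed
  moreover have g: "ex_ok ?N (fst g) \<and> ex_ok ?N (snd g)" if "g \<in> set ts" for g
  proof -
    have "concept_consts (fst g) \<subseteq> all_consts (set ts) \<Gamma>" "concept_consts (snd g) \<subseteq> all_consts (set ts) \<Gamma>"
      using that by (force simp: all_consts_def)+
    then show ?thesis using wf(1) that multiples by (auto intro!: ex_okI simp: wf_gci_def)
  qed
  have a: "ex_ok ?N (big_and Cs) \<longleftrightarrow> (\<forall>C\<in>set Cs. ex_ok ?N C)" for Cs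
    by (induction Cs rule: big_and.induct) auto
  have o: "ex_ok ?N (big_or Cs) \<longleftrightarrow> (\<forall>C\<in>set Cs. ex_ok ?N C)" for Cs
    by (induction Cs rule: big_or.induct) (auto simp: Or_def)
  have "ex_ok ?N (assoc_concept ts \<Gamma>)"
    unfolding assoc_concept_def assoc_gci_def a using g by (auto simp: o Oplus_def)
  ultimately show ?thesis using fin by (auto simp: label_ok_def)
qed

lemma tableau_label_ok:
  assumes wf: "\<forall>g\<in>set ts. wf_gci g" "\<forall>A\<in>\<Gamma>. wf_assertion A" and fin: "finite \<Gamma>"
    and G: "tableau (assoc_concept ts \<Gamma>) \<Gamma> G" and v: "v \<in> verts G" "lab G v = Seq L"
  shows "label_ok (common_denom (set ts) \<Gamma>) L"
proof (rule tableau_label_inv[OF G _ _ _ v])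
  note root = label_ok_root[OF wf fin]
  show "label_ok (common_denom (set ts) \<Gamma>) (\<Gamma> \<union> {Assert (assoc_concept ts \<Gamma>) Ge 1})" by (rule root)
  fix L R C r c
  assume "label_ok (common_denom (set ts) \<Gamma>) L" "Assert (Ex R C) r c \<in> L"
  then show "label_ok (common_denom (set ts) \<Gamma>) (ex_label (assoc_concept ts \<Gamma>) L R C r c)"
    using root by (intro label_ok_ex_label) (auto simp: label_ok_def)
qed (rule label_ok_prop_rule)

text \<open>Induction over the least fixed point: no label in \<open>Unsat\<close> is realised, that
  is, true after rounding at some individual for some \<delta> < 1/2. Both the individual and
  \<delta> are quantified because an existential step changes both.\<close>

theorem answer_if_satisfiable:
  fixes G :: "'v tgraph"
  assumes wf: "\<forall>g\<in>set ts. wf_gci g" "\<forall>A\<in>\<Gamma>. wf_assertion A" and fin: "finite \<Gamma>"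
    and G: "tableau (assoc_concept ts \<Gamma>) \<Gamma> G" "finite (verts G)"
    and sat: "satisfiable TYPE('a) (set ts) \<Gamma>"
  shows "answer G"
proof -
  let ?T = "assoc_concept ts \<Gamma>"
  let ?N = "common_denom (set ts) \<Gamma>"
  note N = common_denom_pos[OF finite_set fin, of ts]
  note multiples = all_consts_multiples[OF finite_set fin, of ts]
  obtain I :: "'a interp" and x where I: "interpretation_ok I" "sat_tbox I (set ts)" "x \<in> dom I"
    and x: "\<forall>A\<in>\<Gamma>. holds I x A" using sat unfolding satisfiable_def by blast
  have T: "rholds (rnd ?N \<delta>) I y (Assert ?T Ge 1)" if d: "0 \<le> \<delta>" "\<delta> < 1/2" and y: "y \<in> dom I" for \<delta> y
    unfolding rsem_assoc_concept[OF finite_Z'_set[OF finite_set fin]]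
  proof (clarify)
    fix C D assume g: "(C, D) \<in> set ts"
    have c: "concept_consts C \<subseteq> multiples ?N" "concept_consts D \<subseteq> multiples ?N"
      using g multiples by (force simp: all_consts_def)+
    have w: "wf_concept C" using wf(1) g by (force simp: wf_gci_def)
    have "sem I C y \<le> sem I D y" using I(2) g y by (auto simp: sat_tbox_def)
    then have "rnd ?N \<delta> (sem I C y) \<le> rnd ?N \<delta> (sem I D y)" by (rule rnd_mono[OF d N])
    \<comment> \<open>The rounded value of \<open>C\<close> itself serves as the separating
      z.\<close>
    moreover obtain k where "k \<in> {0..2 * ?N}" "rnd ?N \<delta> (sem I C y) = of_rat (of_nat k / of_nat (2 * ?N))"
      using rnd_half_grid[OF d N] sem_range[OF I(1) w y] by blast
    ultimately show "\<exists>z\<in>Z'_set (set ts) \<Gamma>. rsem (rnd ?N \<delta>) I C y \<le> of_rat z \<and> of_rat z \<le> rsem (rnd ?N \<delta>) I D y"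
      unfolding Z'_set_eq[OF finite_set fin] rsem_rnd[OF d N c(1)] rsem_rnd[OF d N c(2)] by auto
  qed
  \<comment> \<open>For \<delta> = 0 grid points are fixed and all other values stay strictly
    between the same two grid points, so comparisons with multiples of 1/N survive.\<close>
  have \<Gamma>: "rholds (rnd ?N 0) I x A" if A: "A \<in> \<Gamma>" for A
  proof (cases A)
    case (Assert C r c)
    have "assertion_consts A \<subseteq> multiples ?N" using A multiples by (force simp: all_consts_def)
    then have c: "concept_consts C \<subseteq> multiples ?N" "c \<in> multiples ?N" using Assert by auto
    have d: "0 \<le> (0::real)" "(0::real) < 1/2" by auto
    define m where "m = sem I C x * of_nat ?N"
    obtain k where k: "of_rat c * of_nat ?N = (of_int k :: real)" using multiples_scaled[OF N c(2)] by blast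
    have c': "(of_rat c :: real) = of_int k / of_nat ?N" using k N by (simp add: field_simps)
    have "cmp_rel r m (of_int k)"
      using x A Assert N unfolding m_def k[symmetric] by (cases r) (auto simp: mult_less_cancel_right mult_le_cancel_right)
    then have "cmp_rel r (snap 0 m) (of_int k)"
    proof (cases m rule: snap_cases[OF d])
      case (1 n)
      then show ?thesis using \<open>cmp_rel r m (of_int k)\<close> by simp
    next
      case (2 n)
      have "n < k \<or> k \<le> n" by linarith
      then consider "(of_int n :: real) + 1 \<le> of_int k" | "(of_int k :: real) \<le> of_int n"
        using real_of_int_less_imp[of n k] by auto
      then show ?thesis
        by cases (use 2 \<open>cmp_rel r m (of_int k)\<close> in \<open>cases r; simp only: cmp_rel.simps; linarith\<close>)+
    qed
    then have "cmp_rel r (rnd ?N 0 (sem I C x)) (of_rat c)"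
      unfolding rnd_def m_def[symmetric] c' using N by (cases r) (auto simp: divide_less_cancel divide_le_cancel)
    then show ?thesis unfolding Assert rholds.simps rsem_rnd[OF d N c(1)] .
  qed
  define S where "S L \<longleftrightarrow> (\<exists>y\<in>dom I. \<exists>\<delta>. 0 \<le> \<delta> \<and> \<delta> < 1/2 \<and> (\<forall>A\<in>L. rholds (rnd ?N \<delta>) I y A))" for L
  let ?Q = "{v. \<forall>L. lab G v = Seq L \<longrightarrow> \<not> S L}"
  have "Unsat G \<subseteq> ?Q"
  proof (rule Unsat_lfp(4)[OF G(2)])
    fix U :: "'v set" assume U: "U \<subseteq> ?Q"
    show "unsat_step G U \<subseteq> ?Q"
    proof
      fix v assume "v \<in> unsat_step G U"
      then consider "v \<in> U" | "and_node G v" "\<exists>w\<in>children G v. w \<in> U"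
        | "or_node G v" "\<forall>w\<in>children G v. w \<in> U" by (auto simp: unsat_step_def)
      then show "v \<in> ?Q"
      proof cases
        case 1 then show ?thesis using U by blast
      next
        case 2
        then obtain L w where v: "v \<in> verts G" "lab G v = Seq L" "saturated L" and w: "w \<in> children G v" "w \<in> U"
          by (auto simp: and_node_def)
        have "case lab G v of Bot \<Rightarrow> children G v = {}
          | Seq L \<Rightarrow> if saturated L then lab G ` children G v = {l. ex_rule ?T L l}
            else prop_rule L (lab G ` children G v)" using G v(1) unfolding tableau_def by blast
        then have "ex_rule ?T L (lab G w)" using v w by auto
        then obtain R C r c where e: "lab G w = Seq (ex_label ?T L R C r c)" "Assert (Ex R C) r c \<in> L"
          "r = Gt \<or> r = Ge" by (auto simp: ex_rule_iff)
        have ok: "label_ok ?N L" by (rule tableau_label_ok[OF wf fin G(1) v(1,2)])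
        have "\<not> S (ex_label ?T L R C r c)" using U w(2) e by blast
        then have "\<not> S L" using ex_rule_sound[OF _ ok I(1) _ _ _ N e(2) _ T] e(3)
          unfolding S_def lower_def by blast
        then show ?thesis using v by auto
      next
        case 3
        then obtain L where v: "v \<in> verts G" "lab G v = Seq L" "\<not> saturated L"
          by (auto simp: or_node_def)
        have "case lab G v of Bot \<Rightarrow> children G v = {}
          | Seq L \<Rightarrow> if saturated L then lab G ` children G v = {l. ex_rule ?T L l}
            else prop_rule L (lab G ` children G v)" using G v(1) unfolding tableau_def by blast
        then have p: "prop_rule L (lab G ` children G v)" using v by auto
        have ok: "\<forall>A\<in>L. ex_ok ?N (concept_of A)"
          using tableau_label_ok[OF wf fin G(1) v(1,2)] by (simp add: label_ok_def)
        have "\<not> S L"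
        proof
          assume "S L"
          then obtain y \<delta> where y: "y \<in> dom I" "0 \<le> \<delta>" "\<delta> < 1/2" "\<forall>A\<in>L. rholds (rnd ?N \<delta>) I y A"
            unfolding S_def by blast
          obtain L' where "Seq L' \<in> lab G ` children G v" "\<forall>A\<in>L'. rholds (rnd ?N \<delta>) I y A"
            using prop_rule_sound[OF p y(4) ok I(1) y(1) rnd_range[OF y(2,3) N]] by blast
          moreover have "\<not> S L'" using calculation(1) 3(2) U by fastforce
          ultimately show False using y unfolding S_def by blast
        qed
        then show ?thesis using v by auto
      qed
    qed
  qed auto
  moreover have "S (\<Gamma> \<union> {Assert ?T Ge 1})"
    unfolding S_def using I(3) \<Gamma> T[of 0 x]
    by (intro bexI[of _ x] exI[of _ 0]) auto
  ultimately show ?thesis using G(1) unfolding answer_def tableau_def by blast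
qed

section \<open>Completeness\<close>

text \<open>A weight under which every rule makes its principal assertion lighter.
  \<open>Ominus\<close> counts 2 because the rule for upper bounds also leaves behind a constant of
  weight 1.\<close>

primrec csize :: "concept \<Rightarrow> nat" where
  "csize (Atom p) = 1"
| "csize (Const c) = 1"
| "csize (Neg C) = csize C + 1"
| "csize (Ominus C c) = csize C + 2"
| "csize (And C D) = csize C + csize D + 1"
| "csize (Ex R C) = csize C + 1"

primrec mdepth :: "concept \<Rightarrow> nat" where
  "mdepth (Atom p) = 0"
| "mdepth (Const c) = 0"
| "mdepth (Neg C) = mdepth C"
| "mdepth (Ominus C c) = mdepth C"
| "mdepth (And C D) = max (mdepth C) (mdepth D)"
| "mdepth (Ex R C) = Suc (mdepth C)"

definition lsize :: "assertion set \<Rightarrow> nat" where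
  "lsize L = (\<Sum>A\<in>L. csize (concept_of A))"

lemma sum_replace_less:
  fixes f :: "'b \<Rightarrow> nat"
  assumes "finite L" "A \<in> L" "finite M" "sum f M < f A"
  shows "sum f (L - {A} \<union> M) < sum f L"
proof -
  have "sum f (L - {A} \<union> M) \<le> sum f (L - {A}) + sum f M"
    using assms by (metis finite_Diff sum.union_inter trans_le_add1 le_add1)
  also have "\<dots> < sum f (L - {A}) + f A" using assms(4) by simp
  also have "\<dots> = sum f L" using assms(1,2) by (simp add: sum.remove add.commute)
  finally show ?thesis .
qed

lemma sum_pair_le:
  fixes f :: "'b \<Rightarrow> nat" shows "sum f {x, y} \<le> f x + f y"
  by (cases "x = y") auto

lemma csize_pos: "0 < csize C" by (induction C) auto

text \<open>Replacing the principal assertion by its parts lowers the total weight, and merging with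
  assertions already present can only lower it further. Hence propositional steps never run in a
  cycle, in spite of caching.\<close>

lemma lsize_prop_rule:
  assumes "prop_rule L K" "Seq L' \<in> K" "finite L" shows "lsize L' < lsize L"
proof -
  let ?f = "\<lambda>A. csize (concept_of A)"
  have "\<exists>A M. A \<in> L \<and> L' = L - {A} \<union> M \<and> finite M \<and> sum ?f M < ?f A"
    using assms(1,2)
  proof cases
    case (And_lower C D r c)
    have "sum ?f {Assert C r c, Assert D r c} < ?f (Assert (And C D) r c)"
      using sum_pair_le[of ?f "Assert C r c" "Assert D r c"] by simp
    then show ?thesis using And_lower assms(2)
      by (intro exI[of _ "Assert (And C D) r c"] exI[of _ "{Assert C r c, Assert D r c}"]) simp
  next
    case (And_upper C D r c)
    then consider "L' = L - {Assert (And C D) r c} \<union> {Assert C r c}"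
      | "L' = L - {Assert (And C D) r c} \<union> {Assert D r c}" using assms(2) by auto
    then show ?thesis
    proof cases
      case 1 then show ?thesis using And_upper
        by (intro exI[of _ "Assert (And C D) r c"] exI[of _ "{Assert C r c}"]) simp
    next
      case 2 then show ?thesis using And_upper
        by (intro exI[of _ "Assert (And C D) r c"] exI[of _ "{Assert D r c}"]) simp
    qed
  next
    case (Neg C r c)
    then show ?thesis using assms(2)
      by (intro exI[of _ "Assert (Neg C) r c"] exI[of _ "{Assert C (flip r) (1 - c)}"]) simp
  next
    case (Ominus_upper C c r d)
    have "sum ?f {Assert C r (d + c), Assert (Const d) (flip r) 0} < ?f (Assert (Ominus C c) r d)"
      using sum_pair_le[of ?f "Assert C r (d + c)" "Assert (Const d) (flip r) 0"] by simp
    then show ?thesis using Ominus_upper assms(2)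
      by (intro exI[of _ "Assert (Ominus C c) r d"] exI[of _ "{Assert C r (d + c), Assert (Const d) (flip r) 0}"]) simp
  next
    case (Ominus_lower C c r d)
    then show ?thesis using assms(2)
      by (intro exI[of _ "Assert (Ominus C c) r d"] exI[of _ "{Assert C r (d + c)}"]) simp
  qed (use assms(2) in auto)
  then show ?thesis unfolding lsize_def using sum_replace_less[OF assms(3)] by blast
qed

text \<open>A conclusion contains all other assertions of the premise and enough about the parts of
  the principal one to make it true. These parts are no deeper than the whole, so the statement can
  be cut off at depth \<open>n\<close>, as an induction on depth requires.\<close>

lemma prop_rule_reflects:
  assumes "prop_rule L K" "Seq L' \<in> K"
    and L': "\<forall>A\<in>L'. mdepth (concept_of A) \<le> n \<longrightarrow> holds I x A"
  shows "\<forall>A\<in>L. mdepth (concept_of A) \<le> n \<longrightarrow> holds I x A"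
proof -
  have "\<exists>A\<in>L. L - {A} \<subseteq> L' \<and> (mdepth (concept_of A) \<le> n \<longrightarrow> holds I x A)"
    using assms(1,2)
  proof cases
    case (And_lower C D r c)
    then have "mdepth C \<le> n \<longrightarrow> cmp_rel r (sem I C x) (of_rat c)" "mdepth D \<le> n \<longrightarrow> cmp_rel r (sem I D x) (of_rat c)"
      using L' assms(2) by auto
    then have "mdepth (And C D) \<le> n \<longrightarrow> holds I x (Assert (And C D) r c)"
      using And_lower(3) by (auto simp: lower_def)
    then show ?thesis using And_lower assms(2) by (intro bexI[of _ "Assert (And C D) r c"]) auto
  next
    case (And_upper C D r c)
    then have "mdepth (And C D) \<le> n \<longrightarrow> cmp_rel r (sem I C x) (of_rat c) \<or> cmp_rel r (sem I D x) (of_rat c)"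
      using L' assms(2) by auto
    then have "mdepth (And C D) \<le> n \<longrightarrow> holds I x (Assert (And C D) r c)"
      using And_upper(3) by (auto simp: upper_def min_le_iff_disj min_less_iff_disj)
    then show ?thesis using And_upper assms(2) by (intro bexI[of _ "Assert (And C D) r c"]) auto
  next
    case (Neg C r c)
    then have "mdepth C \<le> n \<longrightarrow> cmp_rel (flip r) (sem I C x) (1 - of_rat c)"
      using L' assms(2) by (auto simp: of_rat_diff)
    then have "mdepth (Neg C) \<le> n \<longrightarrow> holds I x (Assert (Neg C) r c)"
      by (simp add: cmp_rel_flip)
    then show ?thesis using Neg assms(2) by (intro bexI[of _ "Assert (Neg C) r c"]) auto
  next
    case (Ominus_upper C c r d)
    then have "mdepth C \<le> n \<longrightarrow> cmp_rel r (sem I C x) (of_rat d + of_rat c)" "cmp_rel (flip r) (of_rat d :: real) 0"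
      using L' assms(2) by (auto simp: of_rat_add)
    then have "mdepth (Ominus C c) \<le> n \<longrightarrow> holds I x (Assert (Ominus C c) r d)"
      using Ominus_upper(3) by (auto simp: upper_def)
    then show ?thesis using Ominus_upper assms(2) by (intro bexI[of _ "Assert (Ominus C c) r d"]) auto
  next
    case (Ominus_lower C c r d)
    then have "mdepth C \<le> n \<longrightarrow> cmp_rel r (sem I C x) (of_rat d + of_rat c)"
      using L' assms(2) by (auto simp: of_rat_add)
    then have "mdepth (Ominus C c) \<le> n \<longrightarrow> holds I x (Assert (Ominus C c) r d)"
      using Ominus_lower(3) by auto
    then show ?thesis using Ominus_lower assms(2) by (intro bexI[of _ "Assert (Ominus C c) r d"]) auto
  qed (use assms(2) in auto)
  then show ?thesis using L' by blast
qed

text \<open>Take the largest lower bound c and the least upper bound d. If c < d, the midpoint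
  works; if c = d, compatibility forces all comparisons with this common value to be non-strict, and
  the value itself works.\<close>

lemma exists_value_between:
  fixes Lo Up :: "(cmp \<times> rat) set"
  assumes fin: "finite Lo" "finite Up"
    and lo: "\<And>l c. (l, c) \<in> Lo \<Longrightarrow> l = Gt \<or> l = Ge" and up: "\<And>u d. (u, d) \<in> Up \<Longrightarrow> u = Lt \<or> u = Le"
    and comp: "\<And>l c u d. (l, c) \<in> Lo \<Longrightarrow> (u, d) \<in> Up \<Longrightarrow> \<not> black u l d c"
    and ne: "Lo \<noteq> {}" "Up \<noteq> {}"
  shows "\<exists>a :: rat. (\<forall>(l, c)\<in>Lo. cmp_rel l a c) \<and> (\<forall>(u, d)\<in>Up. cmp_rel u a d)"
proof -
  define c where "c = Max (snd ` Lo)"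
  define d where "d = Min (snd ` Up)"
  have "c \<in> snd ` Lo" "d \<in> snd ` Up" using fin ne unfolding c_def d_def by (auto intro!: Max_in Min_in)
  then obtain l u where lu: "(l, c) \<in> Lo" "(u, d) \<in> Up" by force
  have c: "c' \<le> c" if "(l', c') \<in> Lo" for l' c' using that fin unfolding c_def by (intro Max_ge) force+
  have d: "d \<le> d'" if "(u', d') \<in> Up" for u' d' using that fin unfolding d_def by (intro Min_le) force+
  have cd: "c \<le> d" using comp[OF lu] by (auto simp: black_def split: if_splits)
  show ?thesis
  proof (cases "c = d")
    case True
    have "cmp_rel l' c c'" if "(l', c') \<in> Lo" for l' c'
      using lo[OF that] c[OF that] comp[OF that lu(2)] True by (auto simp: black_def split: if_splits)
    moreover have "cmp_rel u' c d'" if "(u', d') \<in> Up" for u' d'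
      using up[OF that] d[OF that] comp[OF lu(1) that] True by (auto simp: black_def split: if_splits)
    ultimately show ?thesis by blast
  next
    case False
    then have lt: "c < (c + d) / 2" "(c + d) / 2 < d" using cd by auto
    have "cmp_rel l' ((c + d) / 2) c'" if "(l', c') \<in> Lo" for l' c'
      using lo[OF that] c[OF that] lt by force
    moreover have "cmp_rel u' ((c + d) / 2) d'" if "(u', d') \<in> Up" for u' d'
      using up[OF that] d[OF that] lt by force
    ultimately show ?thesis by blast
  qed
qed

lemma cmp_rel_of_rat: "cmp_rel r (of_rat a :: real) (of_rat b) \<longleftrightarrow> cmp_rel r a b"
  by (cases r) (auto simp: of_rat_less of_rat_less_eq)

lemma cmp_cases: "lower r \<or> upper r" by (cases r) (auto simp: lower_def upper_def)

text \<open>The unit interval enters as two additional bounds, \<ge> 0 and \<le> 1. Failure of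
  \<open>Ax_1\<close>, \<open>Ax_0\<close> and \<open>Ax_p\<close> then is the pairwise
  compatibility of all lower with all upper bounds.\<close>

lemma saturated_atom:
  assumes "saturated L" "finite L"
  shows "\<exists>a::real. 0 \<le> a \<and> a \<le> 1 \<and> (\<forall>r c. Assert (Atom p) r c \<in> L \<longrightarrow> cmp_rel r a (of_rat c))"
proof -
  define Lo where "Lo = insert (Ge, 0) {(r, c). Assert (Atom p) r c \<in> L \<and> lower r}"
  define Up where "Up = insert (Le, 1) {(r, c). Assert (Atom p) r c \<in> L \<and> upper r}"
  have "Lo \<subseteq> insert (Ge, 0) ((\<lambda>A. case A of Assert C r c \<Rightarrow> (r, c)) ` L)"
     "Up \<subseteq> insert (Le, 1) ((\<lambda>A. case A of Assert C r c \<Rightarrow> (r, c)) ` L)"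
    by (force simp: Lo_def Up_def intro!: image_eqI)+
  then have fin: "finite Lo" "finite Up" using assms(2) by (auto intro: finite_subset)
  have ns: "\<not> prop_rule L {Bot}" using assms(1) by (auto simp: saturated_def)
  have "\<not> black u l d c" if "(l, c) \<in> Lo" "(u, d) \<in> Up" for l c u d
    using that ns Ax_p[of p u d L l c] Ax_1[of p l c L] Ax_0[of p u d L]
    unfolding Lo_def Up_def by (auto simp: black_def lower_def upper_def split: if_splits)
  then have "\<exists>a. (\<forall>(l, c)\<in>Lo. cmp_rel l a c) \<and> (\<forall>(u, d)\<in>Up. cmp_rel u a d)"
    by (intro exists_value_between[OF fin]) (auto simp: Lo_def Up_def lower_def upper_def)
  then obtain a where a: "\<forall>(l, c)\<in>Lo. cmp_rel l a c" "\<forall>(u, d)\<in>Up. cmp_rel u a d" by blast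
  have "cmp_rel r a c" if "Assert (Atom p) r c \<in> L" for r c
    using cmp_cases[of r] a that unfolding Lo_def Up_def by auto
  then have "0 \<le> (of_rat a::real) \<and> (of_rat a::real) \<le> 1 \<and> (\<forall>r c. Assert (Atom p) r c \<in> L \<longrightarrow> cmp_rel r (of_rat a :: real) (of_rat c))"
    using a by (auto simp: cmp_rel_of_rat Lo_def Up_def)
  then show ?thesis by blast
qed

text \<open>\<open>Ax_0_Ex\<close> excludes upper bounds that even 0 violates, so a role value of 0
  is always safe.\<close>

lemma saturated_Ex_upper:
  assumes "saturated L" "Assert (Ex R D) u d \<in> L" "upper u"
  shows "cmp_rel u 0 (of_rat d :: real)"
proof -
  have "\<not> prop_rule L {Bot}" using assms(1) by (auto simp: saturated_def)
  then show ?thesis using Ax_0_Ex[OF assms(2)] assms(3)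
    by (cases "d \<le> 0"; cases "d < 0") (auto simp: upper_def)
qed

text \<open>The role value towards the successor made for the bound \<open>r c\<close> must reach
  \<open>c\<close>, yet respect the upper bounds that are not copied to that successor; the copied
  ones are met by the concept value there. A bound beyond 1 cannot be reached by any role value, and
  0 is taken.\<close>

lemma saturated_role_value:
  assumes L: "saturated L" "finite L" and r: "r = Gt \<and> c \<ge> 0 \<or> r = Ge \<and> c > 0"
  shows "\<exists>\<rho>::real. 0 \<le> \<rho> \<and> \<rho> \<le> 1 \<and> (r = Gt \<and> c < 1 \<or> r = Ge \<and> c \<le> 1 \<longrightarrow> cmp_rel r \<rho> (of_rat c)) \<and>
     (\<forall>D u d. Assert (Ex R D) u d \<in> L \<and> upper u \<and> \<not> black u r d c \<longrightarrow> cmp_rel u \<rho> (of_rat d))"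
proof (cases "r = Gt \<and> c < 1 \<or> r = Ge \<and> c \<le> 1")
  case True
  define Up where "Up = insert (Le, 1) {(u, d). \<exists>D. Assert (Ex R D) u d \<in> L \<and> upper u \<and> \<not> black u r d c}"
  have "Up \<subseteq> insert (Le, 1) ((\<lambda>A. case A of Assert C r c \<Rightarrow> (r, c)) ` L)"
    by (auto simp: Up_def intro: rev_image_eqI)
  then have fin: "finite Up" using L(2) by (auto intro: finite_subset)
  have "\<exists>a. (\<forall>(l, c)\<in>{(r, c)}. cmp_rel l a c) \<and> (\<forall>(u, d)\<in>Up. cmp_rel u a d)"
    by (rule exists_value_between[OF _ fin]) (use r True in \<open>auto simp: Up_def upper_def black_def\<close>)
  then obtain a where a: "cmp_rel r a c" "\<forall>(u, d)\<in>Up. cmp_rel u a d" by auto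
  have "0 \<le> a" using a(1) r by auto
  then show ?thesis using a by (intro exI[of _ "of_rat a"]) (auto simp: cmp_rel_of_rat Up_def)
next
  case False
  then show ?thesis using saturated_Ex_upper[OF L(1)] by (intro exI[of _ 0]) auto
qed

text \<open>Saturation leaves bounds on atoms, constants and existential restrictions, and lower
  bounds on truncated differences so low that every value satisfies them.\<close>

lemma saturated_holds:
  assumes L: "saturated L" "A \<in> L" and I: "\<And>p r c. Assert (Atom p) r c \<in> L \<Longrightarrow> cmp_rel r (conc I p x) (of_rat c)"
    and E: "\<And>R C r c. A = Assert (Ex R C) r c \<Longrightarrow> holds I x A"
  shows "holds I x A"
proof (cases A)
  case (Assert C r c)
  have ns: "\<not> prop_rule L K" for K using L(1) by (auto simp: saturated_def)
  show ?thesis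
  proof (cases C)
    case (Const q)
    then show ?thesis using Ax_c[of q r c L] ns L(2) Assert by (auto simp: cmp_rel_of_rat)
  next
    case (Neg D)
    then show ?thesis using prop_rule.Neg[of D r c L] ns L(2) Assert by auto
  next
    case (Ominus D q)
    have "\<not> upper r" using Ominus_upper[of D q r c L] ns L(2) Assert Ominus by auto
    moreover have "\<not> (r = Gt \<and> c \<ge> 0 \<or> r = Ge \<and> c > 0)" using Ominus_lower[of D q r c L] ns L(2) Assert Ominus by auto
    ultimately have "r = Gt \<and> c < 0 \<or> r = Ge \<and> c \<le> 0" by (cases r) (auto simp: upper_def)
    then have "r = Gt \<and> (of_rat c :: real) < 0 \<or> r = Ge \<and> (of_rat c :: real) \<le> 0" by simp
    then show ?thesis using Assert Ominus by (auto simp del: of_rat_le_0_iff of_rat_less_0_iff)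
  next
    case (And D E)
    then show ?thesis using And_upper[of D E r c L] And_lower[of D E r c L] ns L(2) Assert cmp_cases[of r] by auto
  next
    case (Ex R D)
    then show ?thesis using E Assert by blast
  next
    case (Atom p)
    then show ?thesis using I L(2) Assert by auto
  qed
qed

lemma tableau_nodeD:
  assumes "tableau T \<Gamma> G" "v \<in> verts G" "lab G v = Seq L"
  shows "saturated L \<Longrightarrow> lab G ` children G v = {l. ex_rule T L l}"
    "\<not> saturated L \<Longrightarrow> prop_rule L (lab G ` children G v)"
proof -
  have "case lab G v of Bot \<Rightarrow> children G v = {}
          | Seq L \<Rightarrow> if saturated L then lab G ` children G v = {l. ex_rule T L l}
            else prop_rule L (lab G ` children G v)" using assms(1,2) unfolding tableau_def by blast
  then show "saturated L \<Longrightarrow> lab G ` children G v = {l. ex_rule T L l}"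
    "\<not> saturated L \<Longrightarrow> prop_rule L (lab G ` children G v)" using assms(3) by auto
qed

text \<open>
  \<open>branch G v w\<close>: the saturated node \<open>w\<close> is reached from \<open>v\<close> by choosing, at every OR-node, a child
  outside \<open>Unsat\<close>.
\<close>

inductive branch :: "'v tgraph \<Rightarrow> 'v \<Rightarrow> 'v \<Rightarrow> bool" for G where
  stop: "v \<in> verts G \<Longrightarrow> v \<notin> Unsat G \<Longrightarrow> lab G v = Seq L \<Longrightarrow> saturated L \<Longrightarrow> branch G v v"
| move: "v \<in> verts G \<Longrightarrow> lab G v = Seq L \<Longrightarrow> \<not> saturated L \<Longrightarrow> u \<in> children G v \<Longrightarrow> branch G u w \<Longrightarrow> branch G v w"

text \<open>\<open>Unsat\<close> is a fixed point, so an OR-node outside it has a child outside it,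
  and this child has a smaller label. \<open>Bot\<close> nodes belong to \<open>Unsat\<close>; their
  measure 0 is only a default.\<close>

lemma branch_exists:
  assumes G: "tableau T \<Gamma> G" "finite (verts G)" and fin: "\<And>v L. v \<in> verts G \<Longrightarrow> lab G v = Seq L \<Longrightarrow> finite L"
    and v: "v \<in> verts G" "v \<notin> Unsat G"
  shows "\<exists>w. branch G v w"
  using v
proof (induction "case lab G v of Bot \<Rightarrow> 0 | Seq L \<Rightarrow> lsize L" arbitrary: v rule: less_induct)
  case less
  note U = Unsat_lfp[OF G(2)]
  obtain L where L: "lab G v = Seq L" using less.prems U(2) by (cases "lab G v") auto
  show ?case
  proof (cases "saturated L")
    case True
    then show ?thesis using less.prems L by (blast intro: branch.stop)
  next
    case False
    then have "or_node G v" using less.prems L by (auto simp: or_node_def)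
    then have "\<not> (\<forall>w\<in>children G v. w \<in> Unsat G)" using less.prems U(1) by (auto simp: unsat_step_def)
    then obtain u where u: "u \<in> children G v" "u \<notin> Unsat G" by blast
    have uv: "u \<in> verts G" using u G(1) by (auto simp: tableau_def)
    then obtain L' where L': "lab G u = Seq L'" using u U(2) by (cases "lab G u") auto
    have "prop_rule L (lab G ` children G v)" by (rule tableau_nodeD(2)[OF G(1) less.prems(1) L False])
    moreover have "Seq L' \<in> lab G ` children G v" using u(1) L' by force
    ultimately have "lsize L' < lsize L" using fin less.prems(1) L by (intro lsize_prop_rule)
    then have "\<exists>w. branch G u w" using less.hyps[of u] uv u(2) L L' by simp
    then show ?thesis using less.prems(1) L False u(1) by (blast intro: branch.move)
  qed
qed

lemma branch_target:
  "branch G v w \<Longrightarrow> w \<in> verts G \<and> w \<notin> Unsat G \<and> (\<exists>L. lab G w = Seq L \<and> saturated L)"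
  by (induction rule: branch.induct) auto

lemma branch_nonbot: "branch G v w \<Longrightarrow> \<exists>L. lab G v = Seq L"
  by (induction rule: branch.induct) auto

text \<open>All labels on a branch describe one individual, so truth at the saturated end travels
  back through the rules to the start.\<close>

lemma branch_reflects:
  assumes "branch G v w" "tableau T \<Gamma> G" "lab G v = Seq L"
    and "\<And>M. lab G w = Seq M \<Longrightarrow> \<forall>A\<in>M. mdepth (concept_of A) \<le> n \<longrightarrow> holds I x A"
  shows "\<forall>A\<in>L. mdepth (concept_of A) \<le> n \<longrightarrow> holds I x A"
  using assms(1,3,4)
proof (induction arbitrary: L rule: branch.induct)
  case (stop v L')
  then show ?case by auto
next
  case (move v L' u w)
  have p: "prop_rule L' (lab G ` children G v)" by (rule tableau_nodeD(2)[OF assms(2) move.hyps(1-3)])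
  obtain Lu where Lu: "lab G u = Seq Lu" using branch_nonbot[OF move.hyps(5)] by blast
  have "\<forall>A\<in>Lu. mdepth (concept_of A) \<le> n \<longrightarrow> holds I x A" using move.IH[OF Lu move.prems(2)] by simp
  moreover have "Seq Lu \<in> lab G ` children G v" using Lu move.hyps(4) by force
  ultimately have "\<forall>A\<in>L'. mdepth (concept_of A) \<le> n \<longrightarrow> holds I x A" by (intro prop_rule_reflects[OF p])
  then show ?case using move.prems(1) move.hyps(2) by simp
qed

lemma sem_pullback:
  assumes "inj_on e (dom I)"
  defines "J \<equiv> \<lparr>dom = e ` dom I, conc = (\<lambda>p n. conc I p (inv_into (dom I) e n)),
     role = (\<lambda>R m n. role I R (inv_into (dom I) e m) (inv_into (dom I) e n))\<rparr>"
  shows "x \<in> dom I \<Longrightarrow> sem J C (e x) = sem I C x"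
proof (induction C arbitrary: x)
  case (Ex R C)
  have "(SUP y\<in>dom J. min (role J R (e x) y) (sem J C y)) = (SUP y\<in>dom I. min (role J R (e x) (e y)) (sem J C (e y)))"
    by (simp add: J_def image_image)
  also have "\<dots> = (SUP y\<in>dom I. min (role I R x y) (sem I C y))"
    using Ex assms(1) by (intro SUP_cong) (auto simp: J_def)
  finally show ?case by simp
qed (use assms in \<open>auto simp: J_def\<close>)

text \<open>The model is built from vertices, whose type is arbitrary. Being finite, it has an
  isomorphic copy among the natural numbers.\<close>

lemma satisfiable_nat:
  fixes I :: "'a interp"
  assumes "interpretation_ok I" "sat_tbox I \<T>" "x \<in> dom I" "\<forall>A\<in>\<Gamma>. holds I x A" "finite (dom I)"
  shows "satisfiable TYPE(nat) \<T> \<Gamma>"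
proof -
  obtain e :: "'a \<Rightarrow> nat" where e: "inj_on e (dom I)" using finite_imp_inj_to_nat_seg[OF assms(5)] by blast
  define J where "J = \<lparr>dom = e ` dom I, conc = (\<lambda>p n. conc I p (inv_into (dom I) e n)),
     role = (\<lambda>R m n. role I R (inv_into (dom I) e m) (inv_into (dom I) e n))\<rparr>"
  note s = sem_pullback[OF e, folded J_def]
  have "interpretation_ok J" using assms(1) e by (auto simp: interpretation_ok_def J_def)
  moreover have "sat_tbox J \<T>" using assms(2) by (auto simp: sat_tbox_def J_def s[unfolded J_def])
  moreover have "holds J (e x) A" if "A \<in> \<Gamma>" for A
    using assms(3,4) that s by (cases A) fastforce
  moreover have "e x \<in> dom J" using assms(3) by (simp add: J_def)
  ultimately show ?thesis unfolding satisfiable_def by blast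
qed

text \<open>
  The model lives on the saturated nodes outside \<open>Unsat\<close> to which branches lead from labels containing
  the assertion for the TBox. A role value is the largest one demanded by the existential
  restrictions whose branch leads to the target.
\<close>

theorem satisfiable_if_answer:
  fixes G :: "'v tgraph"
  assumes wf: "\<forall>g\<in>set ts. wf_gci g" "\<forall>A\<in>\<Gamma>. wf_assertion A" and fin: "finite \<Gamma>"
    and G: "tableau (assoc_concept ts \<Gamma>) \<Gamma> G" "finite (verts G)"
    and ans: "answer G"
  shows "satisfiable TYPE(nat) (set ts) \<Gamma>"
proof -
  let ?T = "assoc_concept ts \<Gamma>"
  let ?N = "common_denom (set ts) \<Gamma>"
  note U = Unsat_lfp[OF G(2)]
  have ok: "label_ok ?N L" if "v \<in> verts G" "lab G v = Seq L" for v L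
    by (rule tableau_label_ok[OF wf fin G(1) that])
  then have finL: "finite L" if "v \<in> verts G" "lab G v = Seq L" for v L
    using that by (auto simp: label_ok_def)
  define F where "F v = (SOME w. branch G v w)" for v
  have F: "branch G v (F v)" if "v \<in> verts G" "v \<notin> Unsat G" for v
    unfolding F_def using branch_exists[OF G finL that] by (rule someI_ex)
  define labs where "labs v = (case lab G v of Bot \<Rightarrow> {} | Seq L \<Rightarrow> L)" for v
  \<comment> \<open>These are the root and the targets of existential steps out of the model, since
    both kinds of label receive the assertion for the TBox; hence the domain \<open>D\<close> is
    closed under the required successors.\<close>
  define S where "S = {v \<in> verts G. v \<notin> Unsat G \<and> Assert ?T Ge 1 \<in> labs v}"
  define D where "D = F ` S"
  have Dsat: "w \<in> verts G" "w \<notin> Unsat G" "lab G w = Seq (labs w)" "saturated (labs w)" if w: "w \<in> D" for w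
  proof -
    obtain v where v: "v \<in> verts G" "v \<notin> Unsat G" "w = F v" using w by (auto simp: D_def S_def)
    obtain L where "lab G w = Seq L" "saturated L" "w \<in> verts G" "w \<notin> Unsat G"
      using branch_target[OF F[OF v(1,2)]] v(3) by blast
    then show "w \<in> verts G" "w \<notin> Unsat G" "lab G w = Seq (labs w)" "saturated (labs w)"
      by (simp_all add: labs_def)
  qed
  define app where "app r c \<longleftrightarrow> r = Gt \<and> c \<ge> 0 \<or> r = Ge \<and> c > 0" for r and c :: rat
  define wit where "wit v R C r c = F (SOME u. u \<in> children G v \<and> lab G u = Seq (ex_label ?T (labs v) R C r c))" for v R C r c
  have wit: "\<exists>u\<in>S. wit v R C r c = F u \<and> lab G u = Seq (ex_label ?T (labs v) R C r c)"
    if v: "v \<in> D" and E: "Assert (Ex R C) r c \<in> labs v" "app r c" for v R C r c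
  proof -
    let ?P = "\<lambda>u. u \<in> children G v \<and> lab G u = Seq (ex_label ?T (labs v) R C r c)"
    have "ex_rule ?T (labs v) (Seq (ex_label ?T (labs v) R C r c))"
      unfolding ex_rule_iff using E by (auto simp: app_def)
    then have "Seq (ex_label ?T (labs v) R C r c) \<in> lab G ` children G v"
      using tableau_nodeD(1)[OF G(1) Dsat(1,3,4)[OF v]] by simp
    then have "\<exists>u. ?P u" by force
    then have P: "?P (SOME u. ?P u)" by (rule someI_ex)
    let ?u = "SOME u. ?P u"
    have "and_node G v" using Dsat[OF v] by (auto simp: and_node_def)
    then have "?u \<notin> Unsat G" using P Dsat(2)[OF v] U(1) by (auto simp: unsat_step_def)
    moreover have "?u \<in> verts G" using P G(1) by (auto simp: tableau_def)
    ultimately have "?u \<in> S" using P by (auto simp: S_def labs_def ex_label_def)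
    then show ?thesis using P by (auto simp: wit_def)
  qed
  define pv where "pv v p = (SOME a::real. 0 \<le> a \<and> a \<le> 1 \<and> (\<forall>r c. Assert (Atom p) r c \<in> labs v \<longrightarrow> cmp_rel r a (of_rat c)))" for v p
  have pv: "0 \<le> pv v p \<and> pv v p \<le> 1 \<and> (\<forall>r c. Assert (Atom p) r c \<in> labs v \<longrightarrow> cmp_rel r (pv v p) (of_rat c))" if "v \<in> D" for v p
    unfolding pv_def by (rule someI_ex[OF saturated_atom[OF Dsat(4)[OF that] finL[OF Dsat(1,3)[OF that]]]])
  let ?rvP = "\<lambda>v R r c (\<rho>::real). 0 \<le> \<rho> \<and> \<rho> \<le> 1 \<and> (r = Gt \<and> c < 1 \<or> r = Ge \<and> c \<le> 1 \<longrightarrow> cmp_rel r \<rho> (of_rat c)) \<and>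
     (\<forall>D u d. Assert (Ex R D) u d \<in> labs v \<and> upper u \<and> \<not> black u r d c \<longrightarrow> cmp_rel u \<rho> (of_rat d))"
  define rv where "rv v R r c = (SOME \<rho>. ?rvP v R r c \<rho>)" for v R r c
  have rv: "?rvP v R r c (rv v R r c)" if v: "v \<in> D" and a: "app r c" for v R r c
    unfolding rv_def
    by (rule someI_ex[OF saturated_role_value[OF Dsat(4)[OF v] finL[OF Dsat(1,3)[OF v]] a[unfolded app_def]]])
  \<comment> \<open>The element 0 makes the maximum meaningful for pairs that no existential
    restriction links.\<close>
  define RV where "RV v R w = insert 0 {rv v R r c |C r c. Assert (Ex R C) r c \<in> labs v \<and> app r c \<and> wit v R C r c = w}" for v R w
  have finRV: "finite (RV v R w)" if "v \<in> D" for v R w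
  proof -
    have "RV v R w \<subseteq> insert 0 ((\<lambda>A. case A of Assert E r c \<Rightarrow> rv v R r c) ` labs v)"
      by (auto simp: RV_def intro: rev_image_eqI)
    then show ?thesis using finL[OF Dsat(1,3)] that by (meson finite.insertI finite_imageI finite_subset)
  qed
  define I where "I = \<lparr>dom = D, conc = (\<lambda>p v. pv v p), role = (\<lambda>R v w. Max (RV v R w))\<rparr>"
  have I_simps: "dom I = D" "conc I p v = pv v p" "role I R v w = Max (RV v R w)" for p v R w
    by (simp_all add: I_def)
  have finD: "finite D" using G(2) by (simp add: D_def S_def)
  have root: "root G \<in> S" using ans G(1) by (auto simp: answer_def S_def labs_def tableau_def)
  then have Dne: "D \<noteq> {}" by (auto simp: D_def)
  have RVrange: "0 \<le> \<rho> \<and> \<rho> \<le> 1" if "v \<in> D" "\<rho> \<in> RV v R w" for v R w \<rho>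
    using that rv by (auto simp: RV_def)
  have Max_in: "Max (RV v R w) \<in> RV v R w" if "v \<in> D" for v R w
    using finRV[OF that] by (intro Max_in) (auto simp: RV_def)
  have Iok: "interpretation_ok I"
    using pv RVrange[OF _ Max_in] Dne by (auto simp: interpretation_ok_def I_simps)
  have ex_body: "wf_concept C" if "v \<in> D" "Assert (Ex R C) r c \<in> labs v" for v R C r c
  proof -
    have "ex_ok ?N (concept_of (Assert (Ex R C) r c))"
      using ok[OF Dsat(1,3)[OF that(1)]] that(2) unfolding label_ok_def by blast
    then show ?thesis by simp
  qed
  \<comment> \<open>The claim is made for all nodes at once and proved by depth: a successor is
    consulted only about bodies of smaller depth, so cycles of the cached graph do no harm.\<close>
  have truth: "\<forall>v\<in>D. \<forall>A\<in>labs v. mdepth (concept_of A) \<le> n \<longrightarrow> holds I v A" for n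
  proof (induction n rule: less_induct)
    case (less n)
    have below: "holds I (F u) A" if "u \<in> S" "A \<in> labs u" "mdepth (concept_of A) < n" for u A
    proof -
      have u: "u \<in> verts G" "u \<notin> Unsat G" using that(1) by (auto simp: S_def)
      have Fu: "F u \<in> D" using that(1) by (simp add: D_def)
      have lu: "lab G u = Seq (labs u)" using branch_nonbot[OF F[OF u]] by (auto simp: labs_def)
      have "\<forall>A\<in>M. mdepth (concept_of A) \<le> mdepth (concept_of A') \<longrightarrow> holds I (F u) A"
        if "lab G (F u) = Seq M" "mdepth (concept_of A') < n" for M A'
        using less[of "mdepth (concept_of A')"] that Fu Dsat(3)[OF Fu] by auto
      then show ?thesis using branch_reflects[OF F[OF u] G(1) lu, of "mdepth (concept_of A)" I "F u"] that(2,3) by blast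
    qed
    show ?case
    proof (intro ballI impI)
      fix v A assume v: "v \<in> D" and A: "A \<in> labs v" "mdepth (concept_of A) \<le> n"
      show "holds I v A"
      proof (rule saturated_holds[OF Dsat(4)[OF v] A(1)])
        show "cmp_rel r (conc I p v) (of_rat c)" if "Assert (Atom p) r c \<in> labs v" for p r c
          using pv[OF v] that by (auto simp: I_simps)
        fix R C r c assume AE: "A = Assert (Ex R C) r c"
        let ?s = "sem I (Ex R C) v"
        have wfC: "wf_concept C" using ex_body[OF v] A(1) AE by blast
        have md: "mdepth C < n" using A(2) AE by simp
        have vI: "v \<in> dom I" using v by (simp add: I_simps)
        have s0: "0 \<le> ?s" using sem_range[OF Iok, of "Ex R C"] wfC vI by simp
        show "holds I v A"
        proof (cases "upper r")
          case True
          have *: "cmp_rel r (min (role I R v w) (sem I C w)) (of_rat c)" if w: "w \<in> D" for w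
          proof -
            have "0 \<le> sem I C w" using sem_range[OF Iok wfC] w by (simp add: I_simps)
            \<comment> \<open>Distinguished by the demand that produced the role value. Without a
              demand the value is 0. If the demand contradicts the upper bound at hand, this bound
              was copied to the successor and holds there for the body; otherwise the role value
              itself obeys it.\<close>
            consider "Max (RV v R w) = 0" | C' r' c' where "Max (RV v R w) = rv v R r' c'"
              "Assert (Ex R C') r' c' \<in> labs v" "app r' c'" "wit v R C' r' c' = w"
              using Max_in[OF v, of R w] by (auto simp: RV_def)
            then show ?thesis
            proof cases
              case 1
              then show ?thesis using \<open>0 \<le> sem I C w\<close> saturated_Ex_upper[OF Dsat(4)[OF v], of R C r c] A(1) AE True
                by (simp add: I_simps)
            next
              case 2
              show ?thesis
              proof (cases "black r r' c c'")
                case True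
                obtain u where u: "u \<in> S" "w = F u" "lab G u = Seq (ex_label ?T (labs v) R C' r' c')"
                  using wit[OF v 2(2,3)] 2(4) by auto
                have "Assert C r c \<in> labs u" using u(3) A(1) AE True \<open>upper r\<close> by (auto simp: labs_def ex_label_def)
                from below[OF u(1) this] md have "cmp_rel r (sem I C w) (of_rat c)" by (simp add: u(2))
                then show ?thesis using \<open>upper r\<close> by (auto simp: upper_def min_le_iff_disj min_less_iff_disj)
              next
                case False
                then have "cmp_rel r (rv v R r' c') (of_rat c)"
                  using rv[OF v 2(3), of R] A(1) AE \<open>upper r\<close> by blast
                then show ?thesis using \<open>upper r\<close> 2(1) by (auto simp: I_simps upper_def min_le_iff_disj min_less_iff_disj)
              qed
            qed
          qed
          \<comment> \<open>Finiteness of the domain turns the supremum into a maximum, as strict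
            upper bounds require.\<close>
          have "?s \<in> (\<lambda>w. min (role I R v w) (sem I C w)) ` D"
            using finD Dne cSup_eq_Max[of "(\<lambda>w. min (role I R v w) (sem I C w)) ` D"]
              Lattices_Big.Max_in[of "(\<lambda>w. min (role I R v w) (sem I C w)) ` D"] by (simp add: I_simps(1))
          then show ?thesis using * AE by auto
        next
          case False
          show ?thesis
          proof (cases "app r c")
            case True
            obtain u where u: "u \<in> S" "wit v R C r c = F u" "lab G u = Seq (ex_label ?T (labs v) R C r c)"
              using wit[OF v _ True] A(1) AE by blast
            have Fu: "F u \<in> D" using u(1) by (simp add: D_def)
            have "Assert C r c \<in> labs u" using u(3) by (auto simp: labs_def ex_label_def)
            from below[OF u(1) this] md have C: "cmp_rel r (sem I C (F u)) (of_rat c)" by simp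
            have "sem I C (F u) \<le> 1" using sem_range[OF Iok wfC] Fu by (simp add: I_simps)
            \<comment> \<open>The body attains the demanded bound at the successor, so this bound is
              within the unit interval; under this condition \<open>rv\<close> was chosen to meet
              it.\<close>
            then have "r = Gt \<Longrightarrow> (of_rat c :: real) < 1" "r = Ge \<Longrightarrow> (of_rat c :: real) \<le> 1"
              using C by (auto simp del: of_rat_less_1_iff of_rat_le_1_iff)
            then have "r = Gt \<and> c < 1 \<or> r = Ge \<and> c \<le> 1" using True by (auto simp: app_def)
            then have "cmp_rel r (rv v R r c) (of_rat c)" using rv[OF v True, of R] by blast
            moreover have "rv v R r c \<le> role I R v (F u)"
              unfolding I_simps using finRV[OF v] A(1) AE True u(2) by (intro Max_ge) (auto simp: RV_def)
            moreover have "min (role I R v (F u)) (sem I C (F u)) \<le> ?s"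
              by (rule sem_Ex_upper[OF Iok vI]) (use Fu in \<open>simp add: I_simps\<close>)
            ultimately have "cmp_rel r ?s (of_rat c)" using C True by (auto simp: app_def simp del: sem.simps)
            then show ?thesis using AE by simp
          next
            case na: False
            then have "r = Gt \<and> c < 0 \<or> r = Ge \<and> c \<le> 0" using False by (cases r) (auto simp: app_def upper_def)
            then have "r = Gt \<and> (of_rat c :: real) < 0 \<or> r = Ge \<and> (of_rat c :: real) \<le> 0" by simp
            then have "cmp_rel r ?s (of_rat c)"
              using s0 by (auto simp del: sem.simps of_rat_le_0_iff of_rat_less_0_iff)
            then show ?thesis using AE by simp
          qed
        qed
      qed
    qed
  qed
  have lift: "holds I (F u) A" if u: "u \<in> S" and A: "A \<in> labs u" for u A
  proof -
    have uv: "u \<in> verts G" "u \<notin> Unsat G" using u by (auto simp: S_def)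
    have Fu: "F u \<in> D" using u by (simp add: D_def)
    have lu: "lab G u = Seq (labs u)" using branch_nonbot[OF F[OF uv]] by (auto simp: labs_def)
    have "\<forall>A\<in>labs u. mdepth (concept_of A) \<le> mdepth (concept_of A') \<longrightarrow> holds I (F u) A" for A'
      by (rule branch_reflects[OF F[OF uv] G(1) lu]) (use truth Fu Dsat(3)[OF Fu] in auto)
    then show ?thesis using A by blast
  qed
  have "sat_tbox I (set ts)"
    unfolding sat_tbox_def
  proof (clarify)
    fix C C' w assume g: "(C, C') \<in> set ts" and "w \<in> dom I"
    then obtain u where u: "u \<in> S" "w = F u" by (auto simp: I_simps D_def)
    have "holds I w (Assert ?T Ge 1)" unfolding u(2) by (rule lift[OF u(1)]) (use u in \<open>simp add: S_def\<close>)
    then have "rholds (\<lambda>v. v) I w (Assert ?T Ge 1)" by (simp only: rholds_id)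
    then show "sem I C w \<le> sem I C' w"
      using g unfolding rsem_assoc_concept[OF finite_Z'_set[OF finite_set fin]] rsem_id by fastforce
  qed
  moreover have "\<Gamma> \<subseteq> labs (root G)" using G(1) by (auto simp: tableau_def labs_def)
  then have "\<forall>A\<in>\<Gamma>. holds I (F (root G)) A" using lift[OF root] by blast
  moreover have "F (root G) \<in> dom I" using root by (simp add: I_simps D_def)
  ultimately show ?thesis using satisfiable_nat[OF Iok] finD by (simp add: I_simps)
qed

section \<open>The number of labels\<close>

text \<open>Comparison and bound are carried along: an occurrence of a subconcept determines the one
  assertion it can produce. The closure is therefore linear in the concept, with no factor for the
  number of possible bounds.\<close>

primrec subassertions :: "concept \<Rightarrow> cmp \<Rightarrow> rat \<Rightarrow> assertion set" where
  "subassertions (Atom p) r c = {Assert (Atom p) r c}"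
| "subassertions (Const q) r c = {Assert (Const q) r c}"
| "subassertions (Neg C) r c = insert (Assert (Neg C) r c) (subassertions C (flip r) (1 - c))"
| "subassertions (Ominus C q) r c =
     {Assert (Ominus C q) r c, Assert (Const c) (flip r) 0} \<union> subassertions C r (c + q)"
| "subassertions (And C D) r c = insert (Assert (And C D) r c) (subassertions C r c \<union> subassertions D r c)"
| "subassertions (Ex R C) r c = insert (Assert (Ex R C) r c) (subassertions C r c)"

definition closure_of :: "assertion set \<Rightarrow> assertion set" where
  "closure_of L = (\<Union>A\<in>L. case A of Assert C r c \<Rightarrow> subassertions C r c)"

lemma subassertions_self: "Assert C r c \<in> subassertions C r c"
  by (cases C) auto

lemma subassertions_trans: "Assert D u d \<in> subassertions C r c \<Longrightarrow> subassertions D u d \<subseteq> subassertions C r c"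
proof (induction C arbitrary: r c)
  case (And C D')
  then consider "Assert D u d = Assert (And C D') r c" | "subassertions D u d \<subseteq> subassertions C r c" | "subassertions D u d \<subseteq> subassertions D' r c"
    by auto
  then show ?case by cases auto
qed auto

lemma finite_cl: "finite (subassertions C r c)"
  by (induction C arbitrary: r c) auto

lemma card_cl: "card (subassertions C r c) \<le> csize C"
proof (induction C arbitrary: r c)
  case (Neg C)
  then show ?case using card_insert_le_m1 by (simp add: card_insert_if finite_cl le_SucI)
next
  case (Ominus C q)
  have "card ({Assert (Ominus C q) r c, Assert (Const c) (flip r) 0} \<union> subassertions C r (c + q)) \<le>
     card {Assert (Ominus C q) r c, Assert (Const c) (flip r) 0} + card (subassertions C r (c + q))"
    by (rule card_Un_le)
  also have "\<dots> \<le> 2 + csize C" using Ominus[of r "c + q"] by simp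
  finally show ?case by simp
next
  case (And C D)
  have "card (subassertions C r c \<union> subassertions D r c) \<le> csize C + csize D"
    using card_Un_le[of "subassertions C r c" "subassertions D r c"] And[of r c] by linarith
  then show ?case by (simp add: card_insert_if finite_cl le_SucI)
next
  case (Ex R C)
  then show ?case by (simp add: card_insert_if finite_cl le_SucI)
qed auto

lemma subassertions_invariant:
  assumes "\<And>C r c. P (Assert (Neg C) r c) \<Longrightarrow> P (Assert C (flip r) (1 - c))"
    "\<And>C q r c. P (Assert (Ominus C q) r c) \<Longrightarrow> P (Assert C r (c + q)) \<and> P (Assert (Const c) (flip r) 0)"
    "\<And>C D r c. P (Assert (And C D) r c) \<Longrightarrow> P (Assert C r c) \<and> P (Assert D r c)"
    "\<And>R C r c. P (Assert (Ex R C) r c) \<Longrightarrow> P (Assert C r c)"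
  shows "P (Assert C r c) \<Longrightarrow> A \<in> subassertions C r c \<Longrightarrow> P A"
proof (induction C arbitrary: r c)
  case (Neg C)
  then show ?case using assms(1)[OF Neg.prems(1)] by auto
next
  case (Ominus C q)
  then show ?case using assms(2)[OF Ominus.prems(1)] by auto
next
  case (And C D)
  then show ?case using assms(3)[OF And.prems(1)] by auto
next
  case (Ex R C)
  then show ?case using assms(4)[OF Ex.prems(1)] by auto
qed auto

lemma closure_of_self: "L \<subseteq> closure_of L"
proof
  fix A assume "A \<in> L"
  then show "A \<in> closure_of L" unfolding closure_of_def
    by (intro UN_I[of A]) (auto intro: subassertions_self split: assertion.splits)
qed

lemma closure_of_cl:
  assumes "Assert C r c \<in> closure_of L" shows "subassertions C r c \<subseteq> closure_of L"
proof -
  obtain A where A: "A \<in> L" "Assert C r c \<in> (case A of Assert C r c \<Rightarrow> subassertions C r c)"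
    using assms unfolding closure_of_def by blast
  then have "subassertions C r c \<subseteq> (case A of Assert C r c \<Rightarrow> subassertions C r c)"
    by (cases A) (auto dest: subassertions_trans)
  then show ?thesis using A(1) unfolding closure_of_def by blast
qed

lemma finite_closure_of: "finite L \<Longrightarrow> finite (closure_of L)"
  unfolding closure_of_def by (auto split: assertion.splits intro: finite_cl)

lemma card_closure_of: "finite L \<Longrightarrow> card (closure_of L) \<le> (\<Sum>A\<in>L. csize (concept_of A))"
proof -
  assume fin: "finite L"
  have "card (closure_of L) \<le> (\<Sum>A\<in>L. card (case A of Assert C r c \<Rightarrow> subassertions C r c))"
    unfolding closure_of_def by (rule card_UN_le[OF fin])
  also have "\<dots> \<le> (\<Sum>A\<in>L. csize (concept_of A))"
    by (intro sum_mono) (auto simp: card_cl split: assertion.splits)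
  finally show ?thesis .
qed

text \<open>
  \<open>width C b k\<close> bounds the number of assertions at quantifier depth \<open>k\<close> that the decomposition of a
  lower (\<open>b\<close>) or upper (\<open>\<not> b\<close>) bound on \<open>C\<close> leaves in a label. The join of exponentially many
  alternatives in the TBox concept only contributes the maximum of its members.
\<close>

primrec width :: "concept \<Rightarrow> bool \<Rightarrow> nat \<Rightarrow> nat" where
  "width (Atom p) b k = of_bool (k = 0)"
| "width (Const c) b k = of_bool (k = 0)"
| "width (Neg C) b k = width C (\<not> b) k"
| "width (Ominus C c) b k = width C b k + of_bool (k = 0)"
| "width (And C D) b k = (if b then width C b k + width D b k else max (width C b k) (width D b k))"
| "width (Ex R C) b k = (case k of 0 \<Rightarrow> 1 | Suc k \<Rightarrow> width C b k)"

text \<open>Because every assertion counts at depth 0, \<open>lwidth 0\<close> bounds the number of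
  elements of a label.\<close>

lemma width_0: "1 \<le> width C b 0"
  by (induction C arbitrary: b) (auto simp: le_max_iff_disj intro: trans_le_add1)

lemma width_deep: "mdepth C < k \<Longrightarrow> width C b k = 0"
  by (induction C arbitrary: b k) (auto split: nat.splits)

lemma sum_of_bool_0: "finite K \<Longrightarrow> (\<Sum>k\<in>K. of_bool (k = (0::nat))) \<le> (1::nat)"
  by (simp add: of_bool_def)

text \<open>Each constructor contributes to one depth only, so summing over all depths costs no more
  than the weight of the concept.\<close>

lemma sum_width: "(\<Sum>k<m. width C b k) \<le> csize C"
proof (induction C arbitrary: b m)
  case (Ominus C c)
  have "(\<Sum>k<m. width (Ominus C c) b k) = (\<Sum>k<m. width C b k) + (\<Sum>k<m. of_bool (k = 0))"
    by (simp add: sum.distrib)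
  also have "\<dots> \<le> csize C + 1" by (intro add_mono Ominus sum_of_bool_0) auto
  finally show ?case by simp
next
  case (And C D)
  have "(\<Sum>k<m. width (And C D) b k) \<le> (\<Sum>k<m. width C b k + width D b k)"
    by (intro sum_mono) auto
  also have "\<dots> \<le> csize C + csize D" unfolding sum.distrib by (intro add_mono And)
  finally show ?case by simp
next
  case (Ex R C)
  show ?case
  proof (cases m)
    case (Suc m')
    have "(\<Sum>k<m. width (Ex R C) b k) = 1 + (\<Sum>k<m'. width C b k)"
      unfolding Suc sum.lessThan_Suc_shift by simp
    then show ?thesis using Ex[of b m'] by simp
  qed simp
qed (use sum_of_bool_0 in \<open>auto simp: le_SucI\<close>)

definition awidth :: "nat \<Rightarrow> assertion \<Rightarrow> nat" where
  "awidth k A = (case A of Assert C r c \<Rightarrow> width C (lower r) k)"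

lemma awidth_simps [simp]: "awidth k (Assert C r c) = width C (lower r) k"
  by (simp add: awidth_def)

definition lwidth :: "nat \<Rightarrow> assertion set \<Rightarrow> nat" where
  "lwidth k L = (\<Sum>A\<in>L. awidth k A)"

lemma lower_flip [simp]: "lower (flip r) \<longleftrightarrow> \<not> lower r"
  by (cases r) (auto simp: lower_def)

lemma upper_iff: "upper r \<longleftrightarrow> \<not> lower r"
  by (cases r) (auto simp: lower_def upper_def)

lemma sum_replace_le:
  fixes f :: "'b \<Rightarrow> nat"
  assumes "finite L" "A \<in> L" "finite M" "sum f M \<le> f A"
  shows "sum f (L - {A} \<union> M) \<le> sum f L"
proof -
  have "sum f (L - {A} \<union> M) \<le> sum f (L - {A}) + sum f M"
    using assms by (metis finite_Diff sum.union_inter trans_le_add1 le_add1)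
  also have "\<dots> \<le> sum f (L - {A}) + f A" using assms(4) by simp
  also have "\<dots> = sum f L" using assms(1,2) by (simp add: sum.remove add.commute)
  finally show ?thesis .
qed

text \<open>The common shape of the rules as far as counting is concerned: one assertion is
  exchanged for some of its descendants, and at no depth does the width increase.\<close>

lemma prop_rule_replaces:
  assumes "prop_rule L K" "Seq L' \<in> K"
  obtains C r c M where "Assert C r c \<in> L" "L' = L - {Assert C r c} \<union> M" "finite M"
    "M \<subseteq> subassertions C r c" "\<And>k. (\<Sum>A\<in>M. awidth k A) \<le> awidth k (Assert C r c)"
  using assms
proof cases
  case (And_lower C D r c)
  then show ?thesis using assms(2) sum_pair_le[of "awidth _" "Assert C r c" "Assert D r c"]
    by (intro that[of "And C D" r c "{Assert C r c, Assert D r c}"]) (auto simp: subassertions_self)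
next
  case (And_upper C D r c)
  then consider "L' = L - {Assert (And C D) r c} \<union> {Assert C r c}"
    | "L' = L - {Assert (And C D) r c} \<union> {Assert D r c}" using assms(2) by auto
  then show ?thesis
  proof cases
    case 1 then show ?thesis using And_upper
      by (intro that[of "And C D" r c "{Assert C r c}"]) (auto simp: subassertions_self upper_iff)
  next
    case 2 then show ?thesis using And_upper
      by (intro that[of "And C D" r c "{Assert D r c}"]) (auto simp: subassertions_self upper_iff)
  qed
next
  case (Neg C r c)
  then show ?thesis using assms(2)
    by (intro that[of "Neg C" r c "{Assert C (flip r) (1 - c)}"]) (auto simp: subassertions_self)
next
  case (Ominus_upper C c r d)
  have "(\<Sum>A\<in>{Assert C r (d + c), Assert (Const d) (flip r) 0}. awidth k A) \<le> width (Ominus C c) (lower r) k" for k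
    using sum_pair_le[of "awidth k" "Assert C r (d + c)" "Assert (Const d) (flip r) 0"] by simp
  then show ?thesis using Ominus_upper assms(2)
    by (intro that[of "Ominus C c" r d "{Assert C r (d + c), Assert (Const d) (flip r) 0}"]) (auto simp: subassertions_self)
next
  case (Ominus_lower C c r d)
  then show ?thesis using assms(2)
    by (intro that[of "Ominus C c" r d "{Assert C r (d + c)}"]) (auto simp: subassertions_self)
qed (use assms(2) in auto)

text \<open>Material at depth k in a label stems from some depth j \<ge> k of the root, because each
  existential step strips one quantifier and adds a fresh T. The tail sum is stable under such
  steps: the tail from k + 1 moves down to k, and the root's own width at depth k pays for the new
  T.\<close>

definition label_inv :: "concept \<Rightarrow> assertion set \<Rightarrow> nat \<Rightarrow> assertion set \<Rightarrow> bool" where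
  "label_inv T \<Gamma> m L \<longleftrightarrow> finite L \<and> L \<subseteq> closure_of (\<Gamma> \<union> {Assert T Ge 1}) \<and>
     (\<forall>k. lwidth k L \<le> (\<Sum>j\<in>{k..<m}. lwidth j (\<Gamma> \<union> {Assert T Ge 1})))"

context
  fixes T :: concept and \<Gamma> :: "assertion set" and m :: nat
  assumes fin: "finite \<Gamma>" and m: "\<And>A. A \<in> \<Gamma> \<union> {Assert T Ge 1} \<Longrightarrow> mdepth (concept_of A) < m"
begin

abbreviation (input) "rt \<equiv> \<Gamma> \<union> {Assert T Ge 1}"

lemma lwidth_deep: "m \<le> k \<Longrightarrow> lwidth k rt = 0"
proof -
  assume k: "m \<le> k"
  have "awidth k A = 0" if "A \<in> rt" for A
    using m[OF that] k by (cases A) (auto intro: width_deep)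
  then show ?thesis unfolding lwidth_def by (intro sum.neutral) auto
qed

lemma label_inv_root: "label_inv T \<Gamma> m rt"
  unfolding label_inv_def
proof (intro conjI allI)
  fix k
  show "lwidth k rt \<le> (\<Sum>j\<in>{k..<m}. lwidth j rt)"
  proof (cases "k < m")
    case True
    then show ?thesis by (intro member_le_sum) auto
  next
    case False
    then show ?thesis using lwidth_deep[of k] by simp
  qed
qed (use fin closure_of_self[of rt] in auto)

lemma label_inv_prop_rule:
  assumes "label_inv T \<Gamma> m L" "prop_rule L K" "Seq L' \<in> K" shows "label_inv T \<Gamma> m L'"
  using assms(2,3)
proof (cases rule: prop_rule_replaces)
  case (1 C r c M)
  have "lwidth k L' \<le> lwidth k L" for k
    unfolding lwidth_def 1(2) using assms(1) 1 by (intro sum_replace_le) (auto simp: label_inv_def)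
  moreover have "M \<subseteq> closure_of rt"
    using 1(1,4) assms(1) closure_of_cl[of C r c rt] by (auto simp: label_inv_def)
  moreover have "lwidth k L \<le> (\<Sum>j\<in>{k..<m}. lwidth j rt)" for k
    using assms(1) by (simp add: label_inv_def)
  ultimately have "lwidth k L' \<le> (\<Sum>j\<in>{k..<m}. lwidth j rt)" for k by (meson le_trans)
  moreover have "finite L'" "L' \<subseteq> closure_of rt"
    using assms(1) 1(2,3) \<open>M \<subseteq> closure_of rt\<close> by (auto simp: label_inv_def)
  ultimately show ?thesis unfolding label_inv_def by blast
qed

lemma label_inv_ex_label:
  assumes inv: "label_inv T \<Gamma> m L" and E: "Assert (Ex R C) r c \<in> L" "lower r"
  shows "label_inv T \<Gamma> m (ex_label T L R C r c)"
proof -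
  let ?X = "{A \<in> L. \<exists>S D u d. A = Assert (Ex S D) u d}"
  let ?b = "\<lambda>A. case A of Assert E u d \<Rightarrow> Assert (case E of Ex S D \<Rightarrow> D | _ \<Rightarrow> E) u d"
  let ?L' = "ex_label T L R C r c"
  have finL: "finite L" using inv by (simp add: label_inv_def)
  have b: "?b (Assert (Ex S D) u d) = Assert D u d" for S D u d by simp
  have sub: "?L' \<subseteq> ?b ` ?X \<union> {Assert T Ge 1}"
  proof
    fix A assume "A \<in> ?L'"
    then consider D u d where "A = Assert D u d" "Assert (Ex R D) u d \<in> L" | "A = Assert T Ge 1"
      using E(1) by (auto simp: ex_label_def)
    then show "A \<in> ?b ` ?X \<union> {Assert T Ge 1}"
    proof cases
      case (1 D u d)
      then have "A = ?b (Assert (Ex R D) u d)" "Assert (Ex R D) u d \<in> ?X" by auto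
      then show ?thesis by blast
    qed simp
  qed
  have wb: "awidth k (?b A) = awidth (Suc k) A" if "A \<in> ?X" for k A
    using that by auto
  have w: "lwidth k ?L' \<le> lwidth (Suc k) L + awidth k (Assert T Ge 1)" for k
  proof -
    have "lwidth k ?L' \<le> (\<Sum>A\<in>?b ` ?X \<union> {Assert T Ge 1}. awidth k A)"
      unfolding lwidth_def using finL sub by (intro sum_mono2) auto
    also have "\<dots> \<le> (\<Sum>A\<in>?b ` ?X. awidth k A) + (\<Sum>A\<in>{Assert T Ge 1}. awidth k A)"
      using finL by (subst sum.union_inter[symmetric]) auto
    also have "(\<Sum>A\<in>?b ` ?X. awidth k A) \<le> (\<Sum>A\<in>?X. awidth k (?b A))"
      using finL by (intro sum_image_le[unfolded comp_def]) auto
    also have "\<dots> = (\<Sum>A\<in>?X. awidth (Suc k) A)" by (intro sum.cong refl wb)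
    also have "\<dots> \<le> lwidth (Suc k) L" unfolding lwidth_def using finL by (intro sum_mono2) auto
    finally show ?thesis by simp
  qed
  have wT: "awidth k (Assert T Ge 1) \<le> lwidth k rt" for k
    unfolding lwidth_def using fin by (intro member_le_sum) auto
  have "lwidth k ?L' \<le> (\<Sum>j\<in>{k..<m}. lwidth j rt)" for k
  proof (cases "k < m")
    case True
    have "lwidth k ?L' \<le> (\<Sum>j\<in>{Suc k..<m}. lwidth j rt) + lwidth k rt"
    proof -
      have "lwidth (Suc k) L \<le> (\<Sum>j\<in>{Suc k..<m}. lwidth j rt)" using inv by (simp add: label_inv_def)
      then show ?thesis using w[of k] wT[of k] by linarith
    qed
    also have "\<dots> = (\<Sum>j\<in>{k..<m}. lwidth j rt)" using True by (simp add: sum.atLeast_Suc_lessThan)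
    finally show ?thesis .
  next
    case False
    then have "lwidth (Suc k) L \<le> 0" using inv unfolding label_inv_def by (metis atLeastLessThan_empty le_Suc_eq not_less sum.empty)
    then show ?thesis using w[of k] wT[of k] lwidth_deep[of k] False by simp
  qed
  moreover have "?L' \<subseteq> closure_of rt"
  proof -
    have "?b A \<in> closure_of rt" if A: "A \<in> ?X" for A
    proof -
      obtain S D u d where "A = Assert (Ex S D) u d" "A \<in> closure_of rt"
        using A inv by (auto simp: label_inv_def)
      then show ?thesis using closure_of_cl[of "Ex S D" u d rt] subassertions_self[of D u d] by auto
    qed
    then show ?thesis using sub closure_of_self[of rt] by blast
  qed
  moreover have "finite ?L'" by (rule finite_ex_label[OF finL])
  ultimately show ?thesis by (simp add: label_inv_def)
qed

lemma label_inv_card: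
  assumes "label_inv T \<Gamma> m L" shows "card L \<le> (\<Sum>j<m. lwidth j rt)"
proof -
  have "card L = (\<Sum>A\<in>L. 1)" by simp
  also have "\<dots> \<le> lwidth 0 L" unfolding lwidth_def
    by (intro sum_mono) (auto simp: awidth_def width_0 simp del: One_nat_def split: assertion.splits)
  also have "\<dots> \<le> (\<Sum>j\<in>{0..<m}. lwidth j rt)" using assms unfolding label_inv_def by blast
  finally show ?thesis by (simp add: atLeast0LessThan)
qed

end

lemma card_bounded_subsets:
  assumes "finite U"
  shows "finite {L. L \<subseteq> U \<and> card L \<le> q}" "card {L. L \<subseteq> U \<and> card L \<le> q} \<le> (card U + 1) ^ q"
proof -
  let ?O = "insert None (Some ` U)"
  have fO: "finite ?O" using assms by simp
  have "card ?O \<le> card U + 1" by (metis card_image card_insert_le_m1 inj_Some Suc_eq_plus1 add_diff_cancel_right' card_insert_if fO finite_insert le_refl le_SucI)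
  let ?Q = "{xs. set xs \<subseteq> ?O \<and> length xs = q}"
  let ?f = "\<lambda>xs. {a. Some a \<in> set xs}"
  have "{L. L \<subseteq> U \<and> card L \<le> q} \<subseteq> ?f ` ?Q"
  proof
    fix L assume "L \<in> {L. L \<subseteq> U \<and> card L \<le> q}"
    then have L: "L \<subseteq> U" "card L \<le> q" by auto
    then obtain xs where xs: "set xs = L" "length xs = card L"
      using assms by (metis distinct_card finite_distinct_list finite_subset)
    let ?ys = "map Some xs @ replicate (q - card L) None"
    have "L = ?f ?ys" using xs by auto
    moreover have "?ys \<in> ?Q" using xs L by auto
    ultimately show "L \<in> ?f ` ?Q" by (rule image_eqI)
  qed
  moreover have fQ: "finite ?Q" by (rule finite_lists_length_eq[OF fO])
  ultimately show "finite {L. L \<subseteq> U \<and> card L \<le> q}" by (meson finite_imageI finite_subset)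
  have "card {L. L \<subseteq> U \<and> card L \<le> q} \<le> card (?f ` ?Q)"
    using \<open>_ \<subseteq> ?f ` ?Q\<close> fQ by (intro card_mono) auto
  also have "\<dots> \<le> card ?Q" by (rule card_image_le[OF fQ])
  also have "\<dots> = card ?O ^ q" by (rule card_lists_length_eq[OF fO])
  also have "\<dots> \<le> (card U + 1) ^ q" using \<open>card ?O \<le> card U + 1\<close> by (rule power_mono) simp
  finally show "card {L. L \<subseteq> U \<and> card L \<le> q} \<le> (card U + 1) ^ q" .
qed

section \<open>Constants, size and width of the TBox concept\<close>

definition denom :: "rat \<Rightarrow> nat" where "denom q = nat (snd (quotient_of q))"

lemma denom_pos: "0 < denom q"
  using quotient_of_denom_pos'[of q] by (simp add: denom_def)

text \<open>A product in place of the least common multiple: binary lengths add up under products,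
  which gives a bound by 2 to the size of the concept.\<close>

primrec denom_prod :: "concept \<Rightarrow> nat" where
  "denom_prod (Atom p) = 1"
| "denom_prod (Const c) = denom c"
| "denom_prod (Neg C) = denom_prod C"
| "denom_prod (Ominus C c) = denom_prod C * denom c"
| "denom_prod (And C D) = denom_prod C * denom_prod D"
| "denom_prod (Ex R C) = denom_prod C"

lemma denom_dvd_prod: "c \<in> concept_consts C \<Longrightarrow> denom c dvd denom_prod C"
  by (induction C) auto

lemma bits_0 [simp]: "bits 0 = []"
  by (subst bits.simps) simp

lemma less_two_power_bits: "n < 2 ^ length (bits n)"
proof (induction n rule: less_induct)
  case (less n)
  show ?case
  proof (cases "n = 0")
    case False
    then have "n div 2 < 2 ^ length (bits (n div 2))" by (intro less) auto
    moreover have "length (bits n) = Suc (length (bits (n div 2)))"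
      using False by (subst bits.simps) simp
    ultimately show ?thesis by simp
  qed simp
qed

lemma denom_less: "denom q \<le> 2 ^ size_rat q"
proof -
  have "denom q \<le> 2 ^ size_nat (denom q)"
    using less_two_power_bits[of "denom q"] by (simp add: size_nat_def)
  also have "\<dots> \<le> 2 ^ size_rat q"
    by (intro power_increasing) (auto simp: size_rat_def denom_def split: prod.splits)
  finally show ?thesis .
qed

lemma size_rat_pos: "1 \<le> size_rat q"
proof -
  have "0 < snd (quotient_of q)" by (rule quotient_of_denom_pos')
  then have "size_nat (nat (snd (quotient_of q))) \<noteq> 0"
    unfolding size_nat_def by (subst bits.simps) simp
  then show ?thesis by (auto simp: size_rat_def split: prod.splits)
qed

lemma denom_prod_le: "denom_prod C \<le> 2 ^ size_concept C"
proof (induction C)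
  case (Const c)
  then show ?case using denom_less[of c] by simp
next
  case (Ominus C c)
  have "denom_prod C * denom c \<le> 2 ^ size_concept C * 2 ^ size_rat c"
    by (intro mult_le_mono Ominus denom_less)
  then show ?case by (simp add: power_add)
next
  case (And C D)
  then have "denom_prod C * denom_prod D \<le> 2 ^ size_concept C * 2 ^ size_concept D"
    by (intro mult_le_mono)
  then show ?case by (simp add: power_add)
next
  case (Ex R C)
  have "(2::nat) ^ size_concept C \<le> 2 ^ size_concept (Ex R C)" by (intro power_increasing) auto
  then show ?case using Ex by simp
qed auto

lemma csize_le_size: "csize C \<le> size_concept C"
proof (induction C)
  case (Ominus C c)
  then show ?case using size_rat_pos[of c] by simp
qed auto

text \<open>The least common multiple divides the product of all denominators in the input, and each
  denominator is at most 2 to its binary length. Hence N, and with it the number of disjuncts per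
  GCI, is only exponential.\<close>

lemma common_denom_le: "common_denom (set ts) (set gs) \<le> 2 ^ input_size ts gs"
proof -
  let ?pa = "\<lambda>A. case A of Assert C r c \<Rightarrow> denom_prod C * denom c"
  let ?pg = "\<lambda>g. denom_prod (fst g) * denom_prod (snd g)"
  let ?P = "prod_list (map ?pg ts) * prod_list (map ?pa gs)"
  have d: "x \<in> set xs \<Longrightarrow> f x dvd prod_list (map f xs)" for x and xs :: "'b list" and f :: "'b \<Rightarrow> nat"
    by (induction xs) auto
  have "denom q dvd ?P" if "q \<in> all_consts (set ts) (set gs)" for q
  proof -
    consider A where "A \<in> set gs" "q \<in> assertion_consts A" | C D where "(C, D) \<in> set ts" "q \<in> concept_consts C \<union> concept_consts D"
      using \<open>q \<in> _\<close> by (auto simp: all_consts_def)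
    then show ?thesis
    proof cases
      case 1
      obtain C r c where A: "A = Assert C r c" by (cases A)
      have "denom q dvd ?pa A" using 1(2) unfolding A by (auto dest: denom_dvd_prod)
      then show ?thesis using d[OF 1(1), of ?pa] by (meson dvd_mult dvd_trans)
    next
      case 2
      then have "denom q dvd ?pg (C, D)" by (auto dest: denom_dvd_prod)
      then show ?thesis using d[OF 2(1), of ?pg] by (meson dvd_mult2 dvd_trans)
    qed
  qed
  then have "common_denom (set ts) (set gs) dvd ?P"
    unfolding common_denom_def denoms_def by (intro Lcm_least) (auto simp: denom_def)
  moreover have dp: "0 < denom_prod C" for C by (induction C) (auto simp: denom_pos)
  have pl: "(\<And>x. 0 < f x) \<Longrightarrow> 0 < prod_list (map f xs)" for f :: "'b \<Rightarrow> nat" and xs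
    by (induction xs) auto
  have "0 < ?P" unfolding nat_0_less_mult_iff
    by (intro conjI pl) (auto simp: dp denom_pos split: assertion.splits)
  ultimately have "common_denom (set ts) (set gs) \<le> ?P" by (intro dvd_imp_le)
  also have "prod_list (map ?pg ts) \<le> 2 ^ sum_list (map size_gci ts)"
  proof (induction ts)
    case (Cons g ts)
    have "?pg g \<le> 2 ^ size_concept (fst g) * 2 ^ size_concept (snd g)" by (intro mult_le_mono denom_prod_le)
    also have "\<dots> \<le> 2 ^ size_gci g" by (simp add: size_gci_def power_add)
    finally show ?case using Cons by (simp add: power_add mult_le_mono)
  qed simp
  also have "prod_list (map ?pa gs) \<le> 2 ^ sum_list (map size_assertion gs)"
  proof (induction gs)
    case (Cons A gs)
    obtain C r c where A: "A = Assert C r c" by (cases A)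
    have "?pa A \<le> 2 ^ size_concept C * 2 ^ size_rat c" unfolding A by (simp, intro mult_le_mono denom_prod_le denom_less)
    also have "\<dots> \<le> 2 ^ size_assertion A" by (simp add: A power_add)
    finally show ?case using Cons by (simp add: power_add mult_le_mono)
  qed simp
  finally show ?thesis by (simp add: input_size_def power_add)
qed

lemma sum_set_le_sum_list:
  fixes f :: "'b \<Rightarrow> nat" shows "sum f (set xs) \<le> sum_list (map f xs)"
proof (induction xs)
  case (Cons x xs)
  then show ?case by (cases "x \<in> set xs") (auto simp: insert_absorb)
qed simp

lemma sum_width_big_and:
  "(\<Sum>k<m. width (big_and Cs) True k) \<le> 1 + (\<Sum>C\<leftarrow>Cs. \<Sum>k<m. width C True k)"
proof (induction Cs rule: big_and.induct)
  case 1
  then show ?case using sum_of_bool_0[of "{..<m}"] by simp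
qed (auto simp: sum.distrib)

text \<open>A join is a negated meet of negations. Under a lower bound the outer negation makes the
  meet upper-bounded, so the width is a maximum. The second premise covers the constant that
  represents the empty join.\<close>

lemma width_big_or:
  "(\<And>C. C \<in> set Cs \<Longrightarrow> width C True k \<le> b) \<Longrightarrow> of_bool (k = 0) \<le> b \<Longrightarrow> width (big_or Cs) True k \<le> b"
  by (induction Cs rule: big_or.induct) (auto simp: Or_def)

text \<open>The left side of the GCI ends up under an odd number of negations, hence its upper
  width; the additional 2 comes from the two truncated additions.\<close>

lemma sum_width_assoc_gci: "(\<Sum>k<m. width (assoc_gci Z g) True k) \<le> csize (fst g) + csize (snd g) + 2"
proof -
  let ?b = "\<lambda>k. width (fst g) False k + width (snd g) True k + 2 * of_bool (k = 0)"
  have "width (assoc_gci Z g) True k \<le> ?b k" for k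
    unfolding assoc_gci_def by (intro width_big_or) (auto simp: Oplus_def)
  then have "(\<Sum>k<m. width (assoc_gci Z g) True k) \<le> (\<Sum>k<m. ?b k)" by (rule sum_mono)
  also have "\<dots> = (\<Sum>k<m. width (fst g) False k) + (\<Sum>k<m. width (snd g) True k) + 2 * (\<Sum>k<m. of_bool (k = 0))"
    by (simp add: sum.distrib sum_distrib_left)
  also have "\<dots> \<le> csize (fst g) + csize (snd g) + 2 * 1"
    by (intro add_mono mult_le_mono sum_width sum_of_bool_0) auto
  finally show ?thesis by simp
qed

lemma csize_big_and: "csize (big_and Cs) \<le> 1 + (\<Sum>C\<leftarrow>Cs. csize C + 1)"
  by (induction Cs rule: big_and.induct) auto

lemma csize_big_or: "csize (big_or Cs) \<le> 1 + (\<Sum>C\<leftarrow>Cs. csize C + 4)"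
  by (induction Cs rule: big_or.induct) (auto simp: Or_def)

text \<open>Per disjunct, 10 is the weight of the constructors placed around the two sides of the
  GCI, and 4 that of one binary join.\<close>

lemma csize_assoc_gci:
  assumes "finite Z" shows "csize (assoc_gci Z g) + 1 \<le> 2 + card Z * (csize (fst g) + csize (snd g) + 14)"
proof -
  have "length (sorted_list_of_set Z) = card Z" using assms by simp
  moreover have "csize (assoc_gci Z g) \<le> 1 + (\<Sum>z\<leftarrow>sorted_list_of_set Z. csize (fst g) + csize (snd g) + 14)"
    unfolding assoc_gci_def by (rule order_trans[OF csize_big_or]) (simp add: Oplus_def comp_def algebra_simps)
  ultimately show ?thesis by (simp add: sum_list_triv)
qed

context
  fixes ts :: "gci list" and gs :: "assertion list"
begin

abbreviation (input) "TC \<equiv> assoc_concept ts (set gs)"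
abbreviation (input) "NN \<equiv> common_denom (set ts) (set gs)"
abbreviation (input) "nn \<equiv> input_size ts gs"

lemma card_Z'_le: "card (Z'_set (set ts) (set gs)) \<le> 2 * NN + 1"
  unfolding Z'_set_eq[OF finite_set finite_set] by (rule order_trans[OF card_image_le]) auto

lemma csize_assoc_concept: "csize TC \<le> 1 + (2 * 2 ^ nn + 1) * 16 * nn"
proof -
  let ?Z = "Z'_set (set ts) (set gs)"
  have Z: "card ?Z \<le> 2 * 2 ^ nn + 1" using card_Z'_le common_denom_le[of ts gs] by linarith
  have "csize TC \<le> 1 + (\<Sum>g\<leftarrow>ts. csize (assoc_gci ?Z g) + 1)"
    unfolding assoc_concept_def by (rule order_trans[OF csize_big_and]) (simp add: comp_def)
  also have "(\<Sum>g\<leftarrow>ts. csize (assoc_gci ?Z g) + 1) \<le> (\<Sum>g\<leftarrow>ts. (2 * 2 ^ nn + 1) * 16 * size_gci g)"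
  proof (rule sum_list_mono)
    fix g
    have "csize (assoc_gci ?Z g) + 1 \<le> 2 + card ?Z * (csize (fst g) + csize (snd g) + 14)"
      by (intro csize_assoc_gci finite_Z'_set) auto
    also have "\<dots> \<le> (2 * 2 ^ nn + 1) * 2 + (2 * 2 ^ nn + 1) * (csize (fst g) + csize (snd g) + 14)"
      by (intro add_mono mult_right_mono Z) auto
    also have "\<dots> = (2 * 2 ^ nn + 1) * (csize (fst g) + csize (snd g) + 16)"
      by (simp only: distrib_left[symmetric]) simp
    also have "\<dots> \<le> (2 * 2 ^ nn + 1) * (16 * size_gci g)"
      using csize_le_size[of "fst g"] csize_le_size[of "snd g"] by (intro mult_left_mono) (auto simp: size_gci_def)
    finally show "csize (assoc_gci ?Z g) + 1 \<le> (2 * 2 ^ nn + 1) * 16 * size_gci g" by (simp only: mult.assoc)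
  qed
  also have "\<dots> = (2 * 2 ^ nn + 1) * 16 * sum_list (map size_gci ts)"
    by (simp only: sum_list_const_mult)
  also have "\<dots> \<le> (2 * 2 ^ nn + 1) * 16 * nn" by (intro mult_left_mono) (auto simp: input_size_def)
  finally show ?thesis by simp
qed

lemma sum_csize_le: "(\<Sum>A\<in>set gs. csize (concept_of A)) \<le> nn"
proof -
  have "(\<Sum>A\<in>set gs. csize (concept_of A)) \<le> (\<Sum>A\<leftarrow>gs. csize (concept_of A))"
    by (rule sum_set_le_sum_list)
  also have "\<dots> \<le> sum_list (map size_assertion gs)"
    by (rule sum_list_mono) (metis (no_types) assertion.exhaust concept_of_simps csize_le_size le_trans size_assertion.simps trans_le_add1 trans_le_add2 le_add2 le_refl)
  finally show ?thesis by (simp add: input_size_def)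
qed

definition md_bound :: nat where
  "md_bound = Suc (Max ((\<lambda>A. mdepth (concept_of A)) ` (set gs \<union> {Assert TC Ge 1})))"

lemma md_bound: "A \<in> set gs \<union> {Assert TC Ge 1} \<Longrightarrow> mdepth (concept_of A) < md_bound"
  unfolding md_bound_def by (intro le_imp_less_Suc Max_ge) auto

definition root_label_inv :: "assertion set \<Rightarrow> bool" where
  "root_label_inv = label_inv TC (set gs) md_bound"

lemma root_label_inv_root: "root_label_inv (set gs \<union> {Assert TC Ge 1})"
  unfolding root_label_inv_def by (rule label_inv_root) (auto intro: md_bound)

lemma root_label_inv_prop_rule: "root_label_inv L \<Longrightarrow> prop_rule L K \<Longrightarrow> Seq L' \<in> K \<Longrightarrow> root_label_inv L'"
  unfolding root_label_inv_def by (rule label_inv_prop_rule) (auto intro: md_bound)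

lemma root_label_inv_ex_label: "root_label_inv L \<Longrightarrow> Assert (Ex R C) r c \<in> L \<Longrightarrow> lower r \<Longrightarrow> root_label_inv (ex_label TC L R C r c)"
  unfolding root_label_inv_def by (rule label_inv_ex_label) (auto intro: md_bound)

definition label_universe :: "assertion set" where
  "label_universe = closure_of (set gs \<union> {Assert TC Ge 1})"

lemma root_label_inv_subset: "root_label_inv L \<Longrightarrow> L \<subseteq> label_universe"
  unfolding root_label_inv_def label_inv_def label_universe_def by blast

text \<open>The widths of the members of the root add up. Summed over all depths, a GCI contributes
  at most twice its size, however many alternatives its disjunction has.\<close>

lemma root_label_inv_card: assumes "root_label_inv L" shows "card L \<le> 2 * nn + 1"
proof -
  have "card L \<le> (\<Sum>j<md_bound. lwidth j (set gs \<union> {Assert TC Ge 1}))"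
    using assms unfolding root_label_inv_def by (intro label_inv_card) (auto intro: md_bound)
  also have "\<dots> \<le> (\<Sum>j<md_bound. (\<Sum>A\<in>set gs. awidth j A) + width TC True j)"
    unfolding lwidth_def by (intro sum_mono) (auto simp: lower_def sum.insert_if)
  also have "\<dots> = (\<Sum>A\<in>set gs. \<Sum>j<md_bound. awidth j A) + (\<Sum>j<md_bound. width TC True j)"
    unfolding sum.distrib by (subst sum.swap) simp
  also have "\<dots> \<le> sum_list (map size_assertion gs) + (1 + 2 * sum_list (map size_gci ts))"
  proof (intro add_mono)
    have "(\<Sum>A\<in>set gs. \<Sum>j<md_bound. awidth j A) \<le> (\<Sum>A\<in>set gs. size_assertion A)"
    proof (rule sum_mono)
      fix A
      obtain C r c where A: "A = Assert C r c" by (cases A)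
      show "(\<Sum>j<md_bound. awidth j A) \<le> size_assertion A"
        using sum_width[of C "lower r" md_bound] csize_le_size[of C] by (simp add: A)
    qed
    also have "\<dots> \<le> sum_list (map size_assertion gs)" by (rule sum_set_le_sum_list)
    finally show "(\<Sum>A\<in>set gs. \<Sum>j<md_bound. awidth j A) \<le> sum_list (map size_assertion gs)" .
    let ?Z = "Z'_set (set ts) (set gs)"
    have "(\<Sum>j<md_bound. width TC True j) \<le> 1 + (\<Sum>g\<leftarrow>ts. \<Sum>k<md_bound. width (assoc_gci ?Z g) True k)"
      unfolding assoc_concept_def by (rule order_trans[OF sum_width_big_and]) (simp add: comp_def)
    also have "(\<Sum>g\<leftarrow>ts. \<Sum>k<md_bound. width (assoc_gci ?Z g) True k) \<le> (\<Sum>g\<leftarrow>ts. 2 * size_gci g)"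
    proof (rule sum_list_mono)
      fix g
      show "(\<Sum>k<md_bound. width (assoc_gci ?Z g) True k) \<le> 2 * size_gci g"
        using sum_width_assoc_gci[of ?Z g md_bound] csize_le_size[of "fst g"] csize_le_size[of "snd g"]
        by (simp add: size_gci_def)
    qed
    also have "\<dots> = 2 * sum_list (map size_gci ts)" by (simp only: sum_list_const_mult)
    finally show "(\<Sum>j<md_bound. width TC True j) \<le> 1 + 2 * sum_list (map size_gci ts)" by simp
  qed
  finally show ?thesis by (simp add: input_size_def)
qed

lemma finite_univ: "finite label_universe"
  unfolding label_universe_def by (intro finite_closure_of) simp

definition label_universe_bound :: "nat \<Rightarrow> nat" where
  "label_universe_bound n = n + 1 + (2 * 2 ^ n + 1) * 16 * n"

lemma card_univ: "card label_universe \<le> label_universe_bound nn"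
proof -
  have "card label_universe \<le> (\<Sum>A\<in>set gs \<union> {Assert TC Ge 1}. csize (concept_of A))"
    unfolding label_universe_def by (intro card_closure_of) simp
  also have "\<dots> \<le> (\<Sum>A\<in>set gs. csize (concept_of A)) + csize TC"
    by (auto simp: sum.insert_if)
  also have "\<dots> \<le> label_universe_bound nn"
    using sum_csize_le csize_assoc_concept by (simp add: label_universe_bound_def)
  finally show ?thesis .
qed

text \<open>One possible label per subset of the universe with at most 2n + 1 elements, and one more
  for \<open>Bot\<close>.\<close>

definition node_bound :: "nat \<Rightarrow> nat" where
  "node_bound n = (label_universe_bound n + 1) ^ (2 * n + 1) + 1"

lemma label_count:
  assumes "\<And>l. l \<in> X \<Longrightarrow> l = Bot \<or> (\<exists>L. l = Seq L \<and> root_label_inv L)"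
  shows "finite X" "card X \<le> node_bound nn"
proof -
  let ?S = "{L. L \<subseteq> label_universe \<and> card L \<le> 2 * nn + 1}"
  note c = card_bounded_subsets[OF finite_univ, of "2 * nn + 1"]
  have "X \<subseteq> insert Bot (Seq ` ?S)" using assms root_label_inv_subset root_label_inv_card by fast
  moreover have f: "finite (insert Bot (Seq ` ?S))" using c(1) by simp
  ultimately show "finite X" and "card X \<le> node_bound nn"
  proof -
    assume s: "X \<subseteq> insert Bot (Seq ` ?S)"
    then show "finite X" using f by (rule finite_subset)
    have "card X \<le> card (insert Bot (Seq ` ?S))" using s f by (intro card_mono)
    also have "\<dots> \<le> card (Seq ` ?S) + 1" using c(1) by (simp add: card_insert_if)
    also have "\<dots> \<le> card ?S + 1" using card_image_le[OF c(1)] by simp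
    also have "\<dots> \<le> (card label_universe + 1) ^ (2 * nn + 1) + 1" using c(2) by simp
    also have "\<dots> \<le> node_bound nn" unfolding node_bound_def using card_univ by (intro add_mono power_mono) auto
    finally show "card X \<le> node_bound nn" .
  qed
qed

theorem tableau_finite:
  fixes G :: "'v tgraph"
  assumes G: "tableau TC (set gs) G"
  shows "finite (verts G) \<and> card (verts G) \<le> node_bound nn"
proof -
  have inv: "root_label_inv L" if "v \<in> verts G" "lab G v = Seq L" for v L
    by (rule tableau_label_inv[where P = root_label_inv, OF G root_label_inv_root _ _ that])
      (auto intro: root_label_inv_prop_rule root_label_inv_ex_label simp: lower_def)
  have "l = Bot \<or> (\<exists>L. l = Seq L \<and> root_label_inv L)" if "l \<in> lab G ` verts G" for l
    using that inv by (cases l) auto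
  note c = label_count[OF this]
  have "inj_on (lab G) (verts G)" using G by (auto simp: tableau_def)
  then show ?thesis using c finite_imageD card_image by metis
qed

end

section \<open>Linking time-bounded programs\<close>

text \<open>Types carry their tree representation, so that complexity statements can speak about
  typed functions while programs only handle trees. Injectivity makes equality decidable by
  comparing codes.\<close>

class coded =
  fixes cd :: "'a \<Rightarrow> tree"
  assumes cd_inj: "cd x = cd y \<Longrightarrow> x = y"

instantiation tree :: coded begin
definition cd_tree :: "tree \<Rightarrow> tree" where "cd_tree t = t"
instance by standard (simp add: cd_tree_def)
end

instantiation unit :: coded begin
definition cd_unit :: "unit \<Rightarrow> tree" where "cd_unit u = Lf"
instance by standard simp
end

instantiation bool :: coded begin
definition cd_bool :: "bool \<Rightarrow> tree" where "cd_bool = enc_bool"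
instance by standard (auto simp: cd_bool_def enc_bool_def split: if_splits)
end

instantiation prod :: (coded, coded) coded begin
definition cd_prod :: "'a \<times> 'b \<Rightarrow> tree" where "cd_prod p = Nd (cd (fst p)) (cd (snd p))"
instance by standard (auto simp: cd_prod_def dest: cd_inj)
end

instantiation list :: (coded) coded begin
definition cd_list :: "'a list \<Rightarrow> tree" where "cd_list = enc_list cd"
instance
proof
  fix xs ys :: "'a list"
  show "cd xs = cd ys \<Longrightarrow> xs = ys"
  proof (induction xs arbitrary: ys)
    case Nil then show ?case by (cases ys) (auto simp: cd_list_def enc_list_def)
  next
    case (Cons x xs) then show ?case by (cases ys) (auto simp: cd_list_def enc_list_def dest: cd_inj)
  qed
qed
end

instantiation option :: (coded) coded begin
text \<open>A leaf against a node, so that one case expression separates the two; the layout is the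
  one \<open>enc_node\<close> uses for labels.\<close>

definition cd_option :: "'a option \<Rightarrow> tree" where
  "cd_option x = (case x of None \<Rightarrow> Lf | Some y \<Rightarrow> Nd Lf (cd y))"
instance by standard (auto simp: cd_option_def dest: cd_inj split: option.splits)
end

lemma cd_simps [simp]:
  "cd (t :: tree) = t" "cd () = Lf" "cd True = Nd Lf Lf" "cd False = Lf"
  "cd (a, b) = Nd (cd a) (cd b)"
  "cd [] = Lf" "cd (x # xs) = Nd (cd x) (cd xs)" "cd None = Lf" "cd (Some y) = Nd Lf (cd y)"
  by (simp_all add: cd_tree_def cd_unit_def cd_bool_def enc_bool_def cd_prod_def cd_list_def
      enc_list_def cd_option_def)

lemma cd_inj_iff: "cd x = cd y \<longleftrightarrow> x = y"
  using cd_inj by blast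

lemma bits_pos: "0 < n \<Longrightarrow> bits n = odd n # bits (n div 2)"
  by (subst bits.simps) simp

lemma bits_inj: "bits m = bits n \<Longrightarrow> m = n"
proof (induction m arbitrary: n rule: less_induct)
  case (less m)
  show ?case
  proof (cases "m = 0 \<or> n = 0")
    case True
    then show ?thesis using less.prems by (cases "m = 0"; cases "n = 0") (auto simp: bits_pos)
  next
    case False
    then have e: "odd m = odd n" "bits (m div 2) = bits (n div 2)"
      using less.prems by (auto simp: bits_pos)
    then have "m div 2 = n div 2" using less.IH[of "m div 2"] False by auto
    then show ?thesis using e(1) by (metis dvd_mult_div_cancel odd_two_times_div_two_succ)
  qed
qed

instantiation nat :: coded begin
definition cd_nat :: "nat \<Rightarrow> tree" where "cd_nat = enc_nat"
instance
proof
  fix m n :: nat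
  have "enc_nat k = cd (bits k)" for k by (simp add: enc_nat_def cd_list_def cd_bool_def)
  moreover have "enc_bool = cd" by (simp add: cd_bool_def)
  ultimately show "cd m = cd n \<Longrightarrow> m = n"
    using bits_inj cd_inj by (metis cd_nat_def)
qed
end

lemma cd_nat: "cd (n :: nat) = cd (bits n)"
  by (simp add: cd_nat_def enc_nat_def cd_list_def cd_bool_def)

instantiation int :: coded begin
definition cd_int :: "int \<Rightarrow> tree" where "cd_int i = cd (i < 0, nat \<bar>i\<bar>)"
instance by standard (auto simp: cd_int_def cd_inj_iff)
end

instantiation rat :: coded begin
definition cd_rat :: "rat \<Rightarrow> tree" where "cd_rat = enc_rat"
instance
proof
  fix p q :: rat
  assume "cd p = cd q"
  then have "quotient_of p = quotient_of q"
    using quotient_of_denom_pos[of p] quotient_of_denom_pos[of q]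
    by (auto simp: cd_rat_def enc_rat_def cd_inj_iff simp flip: cd_nat_def cd_bool_def
        split: prod.splits)
  then show "p = q" by (simp add: quotient_of_inject)
qed
end

lemma cd_rat: "cd q = cd (fst (quotient_of q) < 0, nat \<bar>fst (quotient_of q)\<bar>, nat (snd (quotient_of q)))"
  by (simp add: cd_rat_def enc_rat_def cd_nat_def cd_bool_def split: prod.splits)

instantiation concept :: coded begin
definition cd_concept :: "concept \<Rightarrow> tree" where "cd_concept = enc_concept"
instance
proof
  fix C D :: concept
  have r: "enc_rat p = enc_rat q \<longleftrightarrow> p = q" for p q by (metis cd_inj cd_rat_def)
  have n: "enc_nat p = enc_nat q \<longleftrightarrow> p = q" for p q by (metis cd_inj cd_nat_def)
  have "enc_concept C = enc_concept D \<Longrightarrow> C = D"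
  proof (induction C arbitrary: D)
    case (Atom x) then show ?case by (cases D) (auto simp: enc_tag_def r n eval_nat_numeral)
  next
    case (Const x) then show ?case by (cases D) (auto simp: enc_tag_def r n eval_nat_numeral)
  next
    case (Neg C) then show ?case by (cases D) (auto simp: enc_tag_def r n eval_nat_numeral)
  next
    case (Ominus C x) then show ?case by (cases D) (auto simp: enc_tag_def r n eval_nat_numeral)
  next
    case (And C1 C2) then show ?case by (cases D) (auto simp: enc_tag_def r n eval_nat_numeral)
  next
    case (Ex x C) then show ?case by (cases D) (auto simp: enc_tag_def r n eval_nat_numeral)
  qed
  then show "cd C = cd D \<Longrightarrow> C = D" by (simp add: cd_concept_def)
qed
end

instantiation cmp :: coded begin
definition cd_cmp :: "cmp \<Rightarrow> tree" where "cd_cmp = enc_cmp"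
instance
proof
  fix r s :: cmp
  show "cd r = cd s \<Longrightarrow> r = s"
    by (cases r; cases s) (auto simp: cd_cmp_def enc_tag_def eval_nat_numeral)
qed
end

instantiation assertion :: coded begin
definition cd_assertion :: "assertion \<Rightarrow> tree" where "cd_assertion = enc_assertion"
instance
proof
  fix A B :: assertion
  show "cd A = cd B \<Longrightarrow> A = B"
    by (cases A; cases B) (auto simp: cd_assertion_def cd_inj_iff simp flip: cd_concept_def cd_cmp_def cd_rat_def)
qed
end

section \<open>Sizes of codes, relocation of programs and time bounds\<close>

primrec tsize :: "tree \<Rightarrow> nat" where
  "tsize Lf = 1"
| "tsize (Nd a b) = tsize a + tsize b + 1"

definition sz :: "'a::coded \<Rightarrow> nat" where "sz x = tsize (cd x)"

lemma tsize_pos [simp]: "0 < tsize t" by (induction t) auto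

lemma sz_pos [simp]: "0 < sz x" by (simp add: sz_def)

lemma sz_ge_1: "1 \<le> sz x" using sz_pos[of x] by linarith

lemma sz_simps [simp]:
  "sz (a, b) = sz a + sz b + 1" "sz [] = 1" "sz (x # xs) = sz x + sz xs + 1"
  "sz () = 1" "sz True = 3" "sz False = 1" "sz None = 1" "sz (Some y) = sz y + 2"
  by (simp_all add: sz_def)

text \<open>Relocation: a program appended behind \<open>m\<close> functions must have its call
  targets moved by \<open>m\<close>, whereas variables refer to the local environment and stay as
  they are.\<close>

primrec shift_calls :: "nat \<Rightarrow> expr \<Rightarrow> expr" where
  "shift_calls m (V i) = V i"
| "shift_calls m ELf = ELf"
| "shift_calls m (ENd a b) = ENd (shift_calls m a) (shift_calls m b)"
| "shift_calls m (Case e a b) = Case (shift_calls m e) (shift_calls m a) (shift_calls m b)"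
| "shift_calls m (Call f es) = Call (m + f) (map (shift_calls m) es)"

lemmas eval_Suc = eval_evals.intros(1-5)[unfolded One_nat_def add_Suc_right add_0_right]

lemma eval_shift:
  "eval Q \<rho> e v t \<Longrightarrow> eval (P @ map (shift_calls (length P)) Q) \<rho> (shift_calls (length P) e) v t"
  "evals Q \<rho> es vs t \<Longrightarrow> evals (P @ map (shift_calls (length P)) Q) \<rho> (map (shift_calls (length P)) es) vs t"
proof (induction rule: eval_evals.inducts)
  case (6 \<rho> es xs s f x t)
  then have "eval (P @ map (shift_calls (length P)) Q) \<rho> (Call (length P + f) (map (shift_calls (length P)) es)) x (s + t + 1)"
    by (intro eval_evals.intros) auto
  then show ?case by simp
qed (auto intro: eval_evals.intros eval_Suc)

lemma eval_append:
  "eval P \<rho> e v t \<Longrightarrow> eval (P @ Q) \<rho> e v t"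
  "evals P \<rho> es vs t \<Longrightarrow> evals (P @ Q) \<rho> es vs t"
proof (induction rule: eval_evals.inducts)
  case (6 \<rho> es xs s f x t)
  then have "eval (P @ Q) \<rho> (Call f es) x (s + t + 1)"
    by (intro eval_evals.intros) (auto simp: nth_append)
  then show ?case by simp
qed (auto intro: eval_evals.intros eval_Suc)

text \<open>Upper bounds instead of exact costs, so that branches of different cost fit one
  estimate.\<close>

definition eval_le :: "program \<Rightarrow> tree list \<Rightarrow> expr \<Rightarrow> tree \<Rightarrow> nat \<Rightarrow> bool" where
  "eval_le P \<rho> e v t \<longleftrightarrow> (\<exists>s\<le>t. eval P \<rho> e v s)"

definition evals_le :: "program \<Rightarrow> tree list \<Rightarrow> expr list \<Rightarrow> tree list \<Rightarrow> nat \<Rightarrow> bool" where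
  "evals_le P \<rho> es vs t \<longleftrightarrow> (\<exists>s\<le>t. evals P \<rho> es vs s)"

lemma eval_le_V: "i < length \<rho> \<Longrightarrow> \<rho> ! i = v \<Longrightarrow> eval_le P \<rho> (V i) v 1"
  unfolding eval_le_def by (blast intro: eval_evals.intros)

lemma eval_le_Lf: "eval_le P \<rho> ELf Lf 1"
  unfolding eval_le_def by (blast intro: eval_evals.intros)

lemma eval_le_Nd: "eval_le P \<rho> a x s \<Longrightarrow> eval_le P \<rho> b y t \<Longrightarrow> eval_le P \<rho> (ENd a b) (Nd x y) (s + t + 1)"
  unfolding eval_le_def by (meson add_mono eval_evals.intros le_refl)

lemma eval_le_Case_Lf: "eval_le P \<rho> e Lf s \<Longrightarrow> eval_le P \<rho> a x t \<Longrightarrow> eval_le P \<rho> (Case e a b) x (s + t + 1)"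
  unfolding eval_le_def by (meson add_mono eval_evals.intros le_refl)

lemma eval_le_Case_Nd:
  "eval_le P \<rho> e (Nd y z) s \<Longrightarrow> eval_le P (y # z # \<rho>) b x t \<Longrightarrow> eval_le P \<rho> (Case e a b) x (s + t + 1)"
  unfolding eval_le_def by (meson add_mono eval_evals.intros le_refl)

lemma eval_le_Call:
  "evals_le P \<rho> es xs s \<Longrightarrow> f < length P \<Longrightarrow> eval_le P xs (P ! f) x t \<Longrightarrow>
   eval_le P \<rho> (Call f es) x (s + t + 1)"
  unfolding eval_le_def evals_le_def by (meson add_mono eval_evals.intros le_refl)

lemma evals_le_Nil: "evals_le P \<rho> [] [] 0"
  unfolding evals_le_def by (blast intro: eval_evals.intros)

lemma evals_le_Cons: "eval_le P \<rho> e x s \<Longrightarrow> evals_le P \<rho> es xs t \<Longrightarrow> evals_le P \<rho> (e # es) (x # xs) (s + t)"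
  unfolding eval_le_def evals_le_def by (meson add_mono eval_evals.intros le_refl)

lemma eval_le_mono: "eval_le P \<rho> e v s \<Longrightarrow> s \<le> t \<Longrightarrow> eval_le P \<rho> e v t"
  unfolding eval_le_def by (meson le_trans)

lemma eval_le_append: "eval_le P \<rho> e v t \<Longrightarrow> eval_le (P @ Q) \<rho> e v t"
  unfolding eval_le_def using eval_append by blast

lemma eval_le_shift: "eval_le Q \<rho> e v t \<Longrightarrow> eval_le (P @ map (shift_calls (length P)) Q) \<rho> (shift_calls (length P) e) v t"
  unfolding eval_le_def using eval_shift by blast

text \<open>The bound on the size of the result does not follow from the bound on time: a variable
  may be used twice at unit cost, so the result can double with every few steps.\<close>

definition implements :: "program \<Rightarrow> nat \<Rightarrow> (nat \<Rightarrow> nat) \<Rightarrow> ('a::coded \<Rightarrow> 'b::coded) \<Rightarrow> bool" where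
  "implements R i B f \<longleftrightarrow> i < length R \<and>
     (\<forall>x. eval_le R [cd x] (R ! i) (cd (f x)) (B (sz x)) \<and> sz (f x) \<le> B (sz x))"

lemma implements_append: "implements R i B f \<Longrightarrow> implements (R @ Q) i B f"
  unfolding implements_def by (auto simp: nth_append intro: eval_le_append)

lemma implements_shift: "implements R i B f \<Longrightarrow> implements (P @ map (shift_calls (length P)) R) (length P + i) B f"
  unfolding implements_def by (auto intro: eval_le_shift)

lemma implements_call:
  "implements R i B f \<Longrightarrow> eval_le R \<rho> e (cd x) s \<Longrightarrow> eval_le R \<rho> (Call i [e]) (cd (f x)) (s + B (sz x) + 1)"
  using eval_le_Call[OF evals_le_Cons[OF _ evals_le_Nil], of R \<rho> e "cd x" s i "cd (f x)" "B (sz x)"]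
  unfolding implements_def by simp

definition time_bounded :: "(nat \<Rightarrow> nat) \<Rightarrow> ('a::coded \<Rightarrow> 'b::coded) \<Rightarrow> bool" where
  "time_bounded B f \<longleftrightarrow> (\<exists>R i. implements R i B f)"

lemma time_boundedI:
  assumes "\<And>x. eval_le R [cd x] e (cd (f x)) (B (sz x))" "\<And>x. sz (f x) \<le> B (sz x)"
  shows "time_bounded B f"
proof -
  have "implements (R @ [e]) (length R) B f"
    using assms by (auto simp: implements_def intro: eval_le_append)
  then show ?thesis unfolding time_bounded_def by blast
qed

lemma time_bounded_link2:
  assumes "time_bounded B f" "time_bounded C g"
  obtains R i j where "implements R i B f" "implements R j C g"
  using assms unfolding time_bounded_def by (meson implements_append implements_shift)

lemma time_bounded_link3:
  assumes "time_bounded B f" "time_bounded C g" "time_bounded D h"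
  obtains R i j k where "implements R i B f" "implements R j C g" "implements R k D h"
  using assms unfolding time_bounded_def by (meson implements_append implements_shift)

lemma time_bounded_mono: "time_bounded B f \<Longrightarrow> (\<And>n. B n \<le> C n) \<Longrightarrow> time_bounded C f"
  unfolding time_bounded_def implements_def by (meson eval_le_mono le_trans)

lemma hasD_sz: "implements R i B f \<Longrightarrow> sz (f x) \<le> B (sz x)"
  unfolding implements_def by blast

lemma time_bounded_comp:
  assumes f: "time_bounded B f" and g: "time_bounded C g" and B: "mono B"
  shows "time_bounded (\<lambda>n. C n + B (C n) + 3) (\<lambda>x. f (g x))"
proof -
  obtain R i j where R: "implements R i B f" "implements R j C g" using time_bounded_link2[OF f g] .
  have s: "B (sz (g x)) \<le> B (C (sz x))" for x
    using hasD_sz[OF R(2)] B by (auto dest: monoD)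
  show ?thesis
  proof (rule time_boundedI)
    fix x
    have "eval_le R [cd x] (Call i [Call j [V 0]]) (cd (f (g x))) (1 + C (sz x) + 1 + B (sz (g x)) + 1)"
      by (intro implements_call R eval_le_V) auto
    then show "eval_le R [cd x] (Call i [Call j [V 0]]) (cd (f (g x))) (C (sz x) + B (C (sz x)) + 3)"
      by (rule eval_le_mono) (use s[of x] in linarith)
    show "sz (f (g x)) \<le> C (sz x) + B (C (sz x)) + 3"
      using hasD_sz[OF R(1), of "g x"] s[of x] by linarith
  qed
qed

lemma time_bounded_pair:
  assumes f: "time_bounded B f" and g: "time_bounded C g"
  shows "time_bounded (\<lambda>n. B n + C n + 5) (\<lambda>x. (f x, g x))"
proof -
  obtain R i j where R: "implements R i B f" "implements R j C g" using time_bounded_link2[OF f g] .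
  show ?thesis
  proof (rule time_boundedI)
    fix x
    have "eval_le R [cd x] (ENd (Call i [V 0]) (Call j [V 0])) (Nd (cd (f x)) (cd (g x)))
      (1 + B (sz x) + 1 + (1 + C (sz x) + 1) + 1)"
      by (intro implements_call R eval_le_V eval_le_Nd) auto
    then show "eval_le R [cd x] (ENd (Call i [V 0]) (Call j [V 0])) (cd (f x, g x)) (B (sz x) + C (sz x) + 5)"
      by (auto elim: eval_le_mono)
    show "sz (f x, g x) \<le> B (sz x) + C (sz x) + 5"
      using R[THEN hasD_sz, of x] by simp
  qed
qed

text \<open>The recogniser \<open>s\<close> ranges over any type whose codes distinguish the two cases, so that one
  lemma covers booleans, options, lists, numbers and trees.\<close>

lemma time_bounded_case:
  fixes g :: "'x::coded \<times> 'h::coded \<times> 't::coded \<Rightarrow> 'r::coded"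
  assumes s: "time_bounded B s" and f: "time_bounded C f" and g: "time_bounded D g" and D: "mono D"
    and F: "\<And>x. (cd (s x) = Lf \<and> F x = f x) \<or>
             (\<exists>h t. cd (s x) = Nd (cd h) (cd t) \<and> F x = g (x, h, t))"
  shows "time_bounded (\<lambda>n. B n + C n + D (n + B n + 1) + 10) F"
proof -
  obtain R i j k where R: "implements R i B s" "implements R j C f" "implements R k D g" using time_bounded_link3[OF s f g] .
  let ?e = "Case (Call i [V 0]) (Call j [V 0]) (Call k [ENd (V 2) (ENd (V 0) (V 1))])"
  show ?thesis
  proof (rule time_boundedI)
    fix x :: 'x
    let ?T = "B (sz x) + C (sz x) + D (sz x + B (sz x) + 1) + 10"
    have s: "eval_le R [cd x] (Call i [V 0]) (cd (s x)) (1 + B (sz x) + 1)"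
      by (intro implements_call R eval_le_V) auto
    have "eval_le R [cd x] ?e (cd (F x)) ?T \<and> sz (F x) \<le> ?T"
      using F[of x]
    proof (elim disjE conjE exE)
      assume a: "cd (s x) = Lf" "F x = f x"
      have "eval_le R [cd x] ?e (cd (F x)) ((1 + B (sz x) + 1) + (1 + C (sz x) + 1) + 1)"
        unfolding a(2) by (intro eval_le_Case_Lf s[unfolded a] implements_call R eval_le_V) auto
      then show ?thesis using hasD_sz[OF R(2), of x] a by (auto elim: eval_le_mono)
    next
      fix h t assume a: "cd (s x) = Nd (cd h) (cd t)" "F x = g (x, h, t)"
      have "sz h + sz t + 1 \<le> B (sz x)"
        using hasD_sz[OF R(1), of x] a by (simp add: sz_def)
      then have "sz (x, h, t) \<le> sz x + B (sz x) + 1" by simp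
      then have d: "D (sz (x, h, t)) \<le> D (sz x + B (sz x) + 1)" using D by (blast dest: monoD)
      have "eval_le R [cd h, cd t, cd x] (ENd (V 2) (ENd (V 0) (V 1))) (cd (x, h, t)) (1 + (1 + 1 + 1) + 1)"
        unfolding cd_simps by (intro eval_le_Nd eval_le_V) auto
      then have "eval_le R [cd x] ?e (cd (F x))
        ((1 + B (sz x) + 1) + ((1 + (1 + 1 + 1) + 1) + D (sz (x, h, t)) + 1) + 1)"
        unfolding a(2) using s a(1) by (intro eval_le_Case_Nd implements_call R) auto
      then show ?thesis using hasD_sz[OF R(3), of "(x, h, t)"] a d by (auto elim: eval_le_mono)
    qed
    then show "eval_le R [cd x] ?e (cd (F x)) ?T" "sz (F x) \<le> ?T" by auto
  qed
qed

lemma length_le_sz: "length xs \<le> sz xs"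
  by (induction xs) auto

lemma sz_take_le: "sz (take i xs) \<le> sz xs"
proof (induction xs arbitrary: i)
  case (Cons a xs)
  show ?case by (cases i) (use Cons in auto)
qed simp

lemma sz_mem_le: "x \<in> set xs \<Longrightarrow> sz x \<le> sz xs"
  by (induction xs) auto

text \<open>The loop is a tail-recursive function of the fixed argument, the state and the remaining
  list. A bound for one step does not control its iterates, hence the separate bound
  \<open>S\<close> on all intermediate states.\<close>

lemma time_bounded_foldl:
  fixes s0 :: "'x::coded \<Rightarrow> 's::coded" and xs :: "'x \<Rightarrow> 'a::coded list"
  assumes g: "time_bounded Bg (\<lambda>p. g (fst p) (fst (snd p)) (snd (snd p)))" and mono: "mono Bg"
    and s0: "time_bounded B0 s0" and xs: "time_bounded B1 xs"
    and S: "\<And>x i. sz (foldl (g x) (s0 x) (take i (xs x))) \<le> S (sz x)"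
  shows "time_bounded (\<lambda>n. B0 n + B1 n + S n + (B1 n + 1) * (Bg (n + S n + B1 n + 2) + 20) + 20)
     (\<lambda>x. foldl (g x) (s0 x) (xs x))"
proof -
  let ?gp = "\<lambda>p. g (fst p) (fst (snd p)) (snd (snd p))"
  obtain R0 i j k where R0: "implements R0 i Bg ?gp" "implements R0 j B0 s0" "implements R0 k B1 xs"
    using time_bounded_link3[OF g s0 xs] .
  let ?m = "length R0"
  \<comment> \<open>In the node branch the environment consists of head, tail, fixed argument, state
    and the list itself, in this order.\<close>
  define loop where
    "loop = Case (V 2) (V 1) (Call ?m [V 2, Call i [ENd (V 2) (ENd (V 3) (V 0))], V 1])"
  define R where "R = R0 @ [loop]"
  have R: "implements R i Bg ?gp" "implements R j B0 s0" "implements R k B1 xs"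
    unfolding R_def using R0 by (auto intro: implements_append)
  have Rm: "?m < length R" "R ! ?m = loop" by (auto simp: R_def)
  have loop: "eval_le R [cd x, cd s, cd ys] loop (cd (foldl (g x) s ys)) ((length ys + 1) * (K + 20))"
    if "\<And>l. sz (foldl (g x) s (take l ys)) \<le> S'" "\<And>y. y \<in> set ys \<Longrightarrow> Bg (sz x + S' + sz y + 2) \<le> K"
    for x :: 'x and s ys S' K
    using that
  proof (induction ys arbitrary: s)
    case Nil
    have "eval_le R [cd x, cd s, cd ([]::'a list)] loop (cd s) (1 + 1 + 1)"
      unfolding loop_def by (intro eval_le_Case_Lf eval_le_V) auto
    then show ?case by (auto elim: eval_le_mono)
  next
    case (Cons y ys)
    have st: "sz (foldl (g x) (g x s y) (take l ys)) \<le> S'" for l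
      using Cons.prems(1)[of "Suc l"] by simp
    have "sz s \<le> S'" using Cons.prems(1)[of 0] by simp
    then have "Bg (sz (x, s, y)) \<le> Bg (sz x + S' + sz y + 2)"
      using mono by (auto intro!: monoD[OF mono])
    also have "\<dots> \<le> K" using Cons.prems(2) by simp
    finally have K: "Bg (sz (x, s, y)) \<le> K" .
    let ?rho = "[cd y, cd ys, cd x, cd s, cd (y # ys)]"
    have "eval_le R ?rho (ENd (V 2) (ENd (V 3) (V 0))) (cd (x, s, y)) (1 + (1 + 1 + 1) + 1)"
      unfolding cd_simps by (intro eval_le_Nd eval_le_V) auto
    from implements_call[OF R(1) this]
    have c: "eval_le R ?rho (Call i [ENd (V 2) (ENd (V 3) (V 0))]) (cd (g x s y)) (6 + K)"
      using K by (auto elim!: eval_le_mono)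
    have "evals_le R ?rho [V 2, Call i [ENd (V 2) (ENd (V 3) (V 0))], V 1]
       [cd x, cd (g x s y), cd ys] (1 + ((6 + K) + (1 + 0)))"
      by (intro evals_le_Cons evals_le_Nil c eval_le_V) auto
    then have "eval_le R ?rho (Call ?m [V 2, Call i [ENd (V 2) (ENd (V 3) (V 0))], V 1])
       (cd (foldl (g x) (g x s y) ys)) (1 + ((6 + K) + (1 + 0)) + ((length ys + 1) * (K + 20)) + 1)"
      using Rm Cons.IH[OF st] Cons.prems(2) by (intro eval_le_Call) auto
    then have "eval_le R [cd x, cd s, cd (y # ys)] loop (cd (foldl (g x) s (y # ys)))
       (1 + (1 + ((6 + K) + (1 + 0)) + ((length ys + 1) * (K + 20)) + 1) + 1)"
      unfolding loop_def by (intro eval_le_Case_Nd[where y = "cd y" and z = "cd ys"] eval_le_V) auto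
    then show ?case by (rule eval_le_mono) auto
  qed
  show ?thesis
  proof (rule time_boundedI)
    fix x :: 'x
    let ?n = "sz x"
    let ?K = "Bg (?n + S ?n + B1 ?n + 2)"
    have xb: "sz (xs x) \<le> B1 ?n" using hasD_sz[OF R(3)] .
    have "Bg (?n + S ?n + sz y + 2) \<le> ?K" if "y \<in> set (xs x)" for y
      using sz_mem_le[OF that] xb by (intro monoD[OF mono]) auto
    then have l: "eval_le R [cd x, cd (s0 x), cd (xs x)] loop (cd (foldl (g x) (s0 x) (xs x)))
       ((length (xs x) + 1) * (?K + 20))"
      by (intro loop[OF S]) auto
    have "evals_le R [cd x] [V 0, Call j [V 0], Call k [V 0]] [cd x, cd (s0 x), cd (xs x)]
      (1 + ((1 + B0 ?n + 1) + ((1 + B1 ?n + 1) + 0)))"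
      by (intro evals_le_Cons evals_le_Nil implements_call R eval_le_V) auto
    then have "eval_le R [cd x] (Call ?m [V 0, Call j [V 0], Call k [V 0]]) (cd (foldl (g x) (s0 x) (xs x)))
      (1 + ((1 + B0 ?n + 1) + ((1 + B1 ?n + 1) + 0)) + ((length (xs x) + 1) * (?K + 20)) + 1)"
      using Rm l by (intro eval_le_Call) auto
    moreover have "(length (xs x) + 1) * (?K + 20) \<le> (B1 ?n + 1) * (?K + 20)"
      using xb length_le_sz[of "xs x"] by (intro mult_right_mono) auto
    ultimately show "eval_le R [cd x] (Call ?m [V 0, Call j [V 0], Call k [V 0]])
       (cd (foldl (g x) (s0 x) (xs x)))
       (B0 ?n + B1 ?n + S ?n + (B1 ?n + 1) * (?K + 20) + 20)"
      by (elim eval_le_mono) linarith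
    show "sz (foldl (g x) (s0 x) (xs x)) \<le> B0 ?n + B1 ?n + S ?n + (B1 ?n + 1) * (?K + 20) + 20"
      using S[of x "length (xs x)"] by simp
  qed
qed

section \<open>Polynomial-time combinators\<close>

named_theorems poly_bounded_intros
named_theorems polytime_intros

text \<open>The base n + 2 is at least 2 even for n = 0, so constants and sums are absorbed by a
  larger exponent.\<close>

definition poly_bounded :: "(nat \<Rightarrow> nat) \<Rightarrow> bool" where "poly_bounded B \<longleftrightarrow> (\<exists>k. \<forall>n. B n \<le> (n + 2) ^ k)"

lemma poly_boundedI: "(\<And>n. B n \<le> (n + 2) ^ k) \<Longrightarrow> poly_bounded B"
  unfolding poly_bounded_def by (rule exI[of _ k]) simp

lemma poly_bounded_pow [poly_bounded_intros]: "poly_bounded (\<lambda>n. (n + 2) ^ k)"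
  by (rule poly_boundedI) (rule order_refl)

lemma poly_bounded_const [poly_bounded_intros]: "poly_bounded (\<lambda>n. c)"
proof (rule poly_boundedI)
  fix n :: nat
  have "c \<le> 2 ^ c" by (simp add: less_imp_le_nat)
  also have "\<dots> \<le> (n + 2) ^ c" by (intro power_mono) auto
  finally show "c \<le> (n + 2) ^ c" .
qed

lemma poly_bounded_id [poly_bounded_intros]: "poly_bounded (\<lambda>n. n)"
  by (rule poly_boundedI[of _ 1]) simp

lemma poly_bounded_add [poly_bounded_intros]:
  assumes "poly_bounded B" "poly_bounded C" shows "poly_bounded (\<lambda>n. B n + C n)"
proof -
  obtain k l where k: "\<And>n. B n \<le> (n + 2) ^ k" and l: "\<And>n. C n \<le> (n + 2) ^ l"
    using assms unfolding poly_bounded_def by blast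
  show ?thesis
  proof (rule poly_boundedI)
    fix n :: nat
    have "B n + C n \<le> (n + 2) ^ (k + l) + (n + 2) ^ (k + l)"
      by (intro add_mono order_trans[OF k] order_trans[OF l] power_increasing) auto
    also have "\<dots> \<le> (n + 2) * (n + 2) ^ (k + l)" by simp
    finally show "B n + C n \<le> (n + 2) ^ (Suc (k + l))" by simp
  qed
qed

lemma poly_bounded_mult [poly_bounded_intros]:
  assumes "poly_bounded B" "poly_bounded C" shows "poly_bounded (\<lambda>n. B n * C n)"
proof -
  obtain k l where k: "\<And>n. B n \<le> (n + 2) ^ k" and l: "\<And>n. C n \<le> (n + 2) ^ l"
    using assms unfolding poly_bounded_def by blast
  show ?thesis
    by (rule poly_boundedI[of _ "k + l"]) (unfold power_add, intro mult_le_mono k l)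
qed

lemma poly_bounded_power [poly_bounded_intros]: "poly_bounded B \<Longrightarrow> poly_bounded (\<lambda>n. B n ^ k)"
  by (induction k) (simp_all add: poly_bounded_const poly_bounded_mult)

definition polytime :: "('a::coded \<Rightarrow> 'b::coded) \<Rightarrow> bool" where
  "polytime f \<longleftrightarrow> (\<exists>k. time_bounded (\<lambda>n. (n + 2) ^ k) f)"

lemma polytimeI: "time_bounded B f \<Longrightarrow> poly_bounded B \<Longrightarrow> polytime f"
  unfolding polytime_def poly_bounded_def by (blast intro: time_bounded_mono)

lemma mono_pow: "mono (\<lambda>n::nat. (n + 2) ^ k)"
  by (auto intro!: monoI power_mono)

lemma polytime_szE:
  assumes "polytime f"
  obtains k where "\<And>x. sz (f x) \<le> (sz x + 2) ^ k"
  using assms unfolding polytime_def time_bounded_def by (blast dest: hasD_sz)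

lemma polytime_comp:
  assumes "polytime f" "polytime g" shows "polytime (\<lambda>x. f (g x))"
proof -
  obtain k l where "time_bounded (\<lambda>n. (n + 2) ^ k) f" "time_bounded (\<lambda>n. (n + 2) ^ l) g"
    using assms unfolding polytime_def by blast
  from time_bounded_comp[OF this mono_pow] show ?thesis by (rule polytimeI) (intro poly_bounded_intros)
qed

lemma polytime_pair [polytime_intros]:
  assumes "polytime f" "polytime g" shows "polytime (\<lambda>x. (f x, g x))"
proof -
  obtain k l where "time_bounded (\<lambda>n. (n + 2) ^ k) f" "time_bounded (\<lambda>n. (n + 2) ^ l) g"
    using assms unfolding polytime_def by blast
  from time_bounded_pair[OF this] show ?thesis by (rule polytimeI) (intro poly_bounded_intros)
qed

text \<open>Replacing a function by one with the same codes changes types without changing the program.\<close>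

lemma polytime_recode:
  fixes f :: "'a::coded \<Rightarrow> 'b::coded" and g :: "'c::coded \<Rightarrow> 'd::coded"
  assumes "polytime f" "\<And>y. \<exists>x. cd y = cd x \<and> cd (g y) = cd (f x)"
  shows "polytime g"
proof -
  obtain k R i where R: "implements R i (\<lambda>n. (n + 2) ^ k) f"
    using assms(1) unfolding polytime_def time_bounded_def by blast
  have "implements R i (\<lambda>n. (n + 2) ^ k) g"
    unfolding implements_def
  proof (intro conjI allI)
    show "i < length R" using R by (simp add: implements_def)
    fix y
    obtain x where "cd y = cd x" "cd (g y) = cd (f x)" using assms(2) by blast
    then show "eval_le R [cd y] (R ! i) (cd (g y)) ((sz y + 2) ^ k)" "sz (g y) \<le> (sz y + 2) ^ k"
      using R unfolding implements_def sz_def by auto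
  qed
  then show ?thesis unfolding polytime_def time_bounded_def by blast
qed

lemma polytime_out: "polytime f \<Longrightarrow> (\<And>x. cd (g x) = cd (f x)) \<Longrightarrow> polytime g"
  by (rule polytime_recode) auto

lemma polytime_id [polytime_intros]: "polytime (\<lambda>x. x)"
proof (rule polytimeI)
  show "time_bounded (\<lambda>n. n + 1) (\<lambda>x. x)"
    by (rule time_boundedI[where e = "V 0" and R = "[]"]) (auto intro: eval_le_mono[OF eval_le_V])
qed (intro poly_bounded_intros)

lemma polytime_fst [polytime_intros]: assumes "polytime f" shows "polytime (\<lambda>x. fst (f x))"
proof (rule polytime_comp[OF _ assms], rule polytimeI)
  show "time_bounded (\<lambda>n. n + 3) (fst :: 'b \<times> 'c \<Rightarrow> 'b)"
  proof (rule time_boundedI[where e = "Case (V 0) (V 0) (V 0)" and R = "[]"])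
    fix x :: "'b \<times> 'c"
    have "eval_le [] [cd x] (Case (V 0) (V 0) (V 0)) (cd (fst x)) (1 + 1 + 1)"
      by (rule eval_le_Case_Nd[of _ _ _ "cd (fst x)" "cd (snd x)"])
        (auto intro!: eval_le_V[unfolded One_nat_def] simp: cd_prod_def)
    then show "eval_le [] [cd x] (Case (V 0) (V 0) (V 0)) (cd (fst x)) (sz x + 3)"
      by (rule eval_le_mono) simp
  qed (auto simp: sz_def cd_prod_def)
qed (intro poly_bounded_intros)

lemma polytime_snd [polytime_intros]: assumes "polytime f" shows "polytime (\<lambda>x. snd (f x))"
proof (rule polytime_comp[OF _ assms], rule polytimeI)
  show "time_bounded (\<lambda>n. n + 3) (snd :: 'b \<times> 'c \<Rightarrow> 'c)"
  proof (rule time_boundedI[where e = "Case (V 0) (V 0) (V 1)" and R = "[]"])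
    fix x :: "'b \<times> 'c"
    have "eval_le [] [cd x] (Case (V 0) (V 0) (V 1)) (cd (snd x)) (1 + 1 + 1)"
      by (rule eval_le_Case_Nd[of _ _ _ "cd (fst x)" "cd (snd x)"])
        (auto intro!: eval_le_V[unfolded One_nat_def] simp: cd_prod_def)
    then show "eval_le [] [cd x] (Case (V 0) (V 0) (V 1)) (cd (snd x)) (sz x + 3)"
      by (rule eval_le_mono) simp
  qed (auto simp: sz_def cd_prod_def)
qed (intro poly_bounded_intros)

primrec quote :: "tree \<Rightarrow> expr" where
  "quote Lf = ELf"
| "quote (Nd a b) = ENd (quote a) (quote b)"

lemma eval_le_quote: "eval_le P \<rho> (quote t) t (tsize t)"
  by (induction t) (auto intro: eval_le_Lf[unfolded One_nat_def] eval_le_Nd[unfolded Suc_eq_plus1[symmetric]])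

lemma polytime_const [polytime_intros]: "polytime (\<lambda>x. c)"
proof (rule polytimeI)
  show "time_bounded (\<lambda>n. sz c) (\<lambda>x. c)"
    by (rule time_boundedI[where e = "quote (cd c)" and R = "[]"]) (auto simp: sz_def intro: eval_le_quote)
qed (intro poly_bounded_intros)

text \<open>A variable of type \<open>'h \<times> 't\<close> in the recogniser's second component stands for the two
  components of a node.\<close>

lemma polytime_case:
  fixes g :: "'x::coded \<Rightarrow> 'h::coded \<Rightarrow> 't::coded \<Rightarrow> 'r::coded"
  assumes "polytime s" "polytime f" "polytime (\<lambda>p. g (fst p) (fst (snd p)) (snd (snd p)))"
    and "\<And>x. (cd (s x) = Lf \<and> F x = f x) \<or>
             (\<exists>h t. cd (s x) = Nd (cd h) (cd t) \<and> F x = g x h t)"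
  shows "polytime F"
proof -
  obtain a b c where "time_bounded (\<lambda>n. (n + 2) ^ a) s" "time_bounded (\<lambda>n. (n + 2) ^ b) f"
     "time_bounded (\<lambda>n. (n + 2) ^ c) (\<lambda>p. g (fst p) (fst (snd p)) (snd (snd p)))"
    using assms(1-3) unfolding polytime_def by blast
  from time_bounded_case[OF this mono_pow, of F] assms(4) have 
    "time_bounded (\<lambda>n. (n + 2) ^ a + (n + 2) ^ b + (n + (n + 2) ^ a + 1 + 2) ^ c + 10) F" by simp
  then show ?thesis by (rule polytimeI) (intro poly_bounded_intros)
qed

text \<open>The code of \<open>True\<close> is a node with two leaves; the type \<open>unit\<close>
  supplies these leaves as typed components.\<close>

lemma polytime_if [polytime_intros]:
  assumes "polytime b" "polytime f" "polytime g" shows "polytime (\<lambda>x. if b x then f x else g x)"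
proof (rule polytime_case[of b g "\<lambda>x (h::unit) (t::unit). f x"])
  show "polytime (\<lambda>p :: 'a \<times> unit \<times> unit. f (fst p))" by (intro polytime_comp[OF assms(2)] polytime_intros)
  fix x
  show "cd (b x) = Lf \<and> (if b x then f x else g x) = g x \<or>
    (\<exists>(h::unit) (t::unit). cd (b x) = Nd (cd h) (cd t) \<and> (if b x then f x else g x) = f x)"
    by (cases "b x") auto
qed (use assms in auto)

lemma polytime_case_list [polytime_intros]:
  assumes "polytime s" "polytime f" "polytime (\<lambda>p. g (fst p) (fst (snd p)) (snd (snd p)))"
  shows "polytime (\<lambda>x. case s x of [] \<Rightarrow> f x | h # t \<Rightarrow> g x h t)"
  by (rule polytime_case[OF assms]) (auto split: list.splits)

lemma polytime_case_option [polytime_intros]: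
  fixes g :: "'a::coded \<Rightarrow> 'd::coded \<Rightarrow> 'b::coded"
  assumes "polytime s" "polytime f" "polytime (\<lambda>p. g (fst p) (snd p))"
  shows "polytime (\<lambda>x. case s x of None \<Rightarrow> f x | Some t \<Rightarrow> g x t)"
proof (rule polytime_case[OF assms(1,2), of "\<lambda>x (h::unit) t. g x t"])
  have "polytime (\<lambda>p :: 'a \<times> unit \<times> 'd. (fst p, snd (snd p)))" by (intro polytime_intros)
  from polytime_comp[OF assms(3) this] show "polytime (\<lambda>p :: 'a \<times> unit \<times> 'd. g (fst p) (snd (snd p)))" by simp
qed (auto split: option.splits)

lemma polytime_Cons [polytime_intros]: "polytime f \<Longrightarrow> polytime g \<Longrightarrow> polytime (\<lambda>x. f x # g x)"
  by (rule polytime_out[OF polytime_pair]) auto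

lemma polytime_Some [polytime_intros]: "polytime f \<Longrightarrow> polytime (\<lambda>x. Some (f x))"
  by (rule polytime_out[OF polytime_pair[OF polytime_const[of "()"]]]) auto

lemma polytime_cong: "polytime f \<Longrightarrow> (\<And>x. g x = f x) \<Longrightarrow> polytime g"
  by (rule polytime_out) auto

lemma polytime_not [polytime_intros]: "polytime b \<Longrightarrow> polytime (\<lambda>x. \<not> b x)"
  by (rule polytime_cong[of "\<lambda>x. if b x then False else True"], intro polytime_intros) auto

lemma polytime_and [polytime_intros]: "polytime b \<Longrightarrow> polytime c \<Longrightarrow> polytime (\<lambda>x. b x \<and> c x)"
  by (rule polytime_cong[of "\<lambda>x. if b x then c x else False"], intro polytime_intros) auto

lemma polytime_or [polytime_intros]: "polytime b \<Longrightarrow> polytime c \<Longrightarrow> polytime (\<lambda>x. b x \<or> c x)"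
  by (rule polytime_cong[of "\<lambda>x. if b x then True else c x"], intro polytime_intros) auto

lemma polytime_Let [polytime_intros]: "polytime (\<lambda>x. f x (g x)) \<Longrightarrow> polytime (\<lambda>x. let y = g x in f x y)"
  by simp

lemma polytime_foldl:
  fixes g :: "'x::coded \<Rightarrow> 's::coded \<Rightarrow> 'a::coded \<Rightarrow> 's"
  assumes g: "polytime (\<lambda>p. g (fst p) (fst (snd p)) (snd (snd p)))" and s0: "polytime s0" and xs: "polytime xs"
    and S: "poly_bounded S" "\<And>x i. sz (foldl (g x) (s0 x) (take i (xs x))) \<le> S (sz x)"
  shows "polytime (\<lambda>x. foldl (g x) (s0 x) (xs x))"
proof -
  obtain a b c where "time_bounded (\<lambda>n. (n + 2) ^ a) (\<lambda>p. g (fst p) (fst (snd p)) (snd (snd p)))"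
     "time_bounded (\<lambda>n. (n + 2) ^ b) s0" "time_bounded (\<lambda>n. (n + 2) ^ c) xs"
    using g s0 xs unfolding polytime_def by blast
  from time_bounded_foldl[OF this(1) mono_pow this(2,3) S(2)] show ?thesis
    by (rule polytimeI) (intro poly_bounded_intros S(1))
qed

section \<open>Lists, equality and unary clocks\<close>

lemma sz_append: "sz (xs @ ys) + 1 = sz xs + sz ys"
  by (induction xs) auto

lemma sz_append_le: "sz (xs @ ys) \<le> sz xs + sz ys"
  using sz_append[of xs ys] by linarith

lemma sz_rev [simp]: "sz (rev xs) = sz xs"
proof (induction xs)
  case (Cons x xs)
  then show ?case using sz_append[of "rev xs" "[x]"] by simp
qed simp

lemma sz_list_le: "(\<And>y. y \<in> set ys \<Longrightarrow> sz y \<le> K) \<Longrightarrow> sz ys \<le> length ys * (K + 1) + 1"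
proof (induction ys)
  case (Cons y ys)
  then have "sz y \<le> K" "sz ys \<le> length ys * (K + 1) + 1" by auto
  then show ?case by simp
qed simp

lemma sz_filter_le: "sz (filter P xs) \<le> sz xs"
  by (induction xs) auto

lemma foldl_Cons_rev: "foldl (\<lambda>s a. a # s) ys xs = rev xs @ ys"
  by (induction xs arbitrary: ys) auto

lemma polytime_rev_append: 
  assumes "polytime xs" "polytime ys" shows "polytime (\<lambda>x. rev (xs x) @ ys x)"
proof -
  obtain k l where k: "\<And>x. sz (xs x) \<le> (sz x + 2) ^ k" and l: "\<And>x. sz (ys x) \<le> (sz x + 2) ^ l"
    using assms polytime_szE by metis
  have "polytime (\<lambda>x. foldl (\<lambda>s a. a # s) (ys x) (xs x))"
  proof (rule polytime_foldl[where g = "\<lambda>_ s a. a # s" and S = "\<lambda>n. (n + 2) ^ k + (n + 2) ^ l"])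
    fix x i
    show "sz (foldl (\<lambda>s a. a # s) (ys x) (take i (xs x))) \<le> (sz x + 2) ^ k + (sz x + 2) ^ l"
      unfolding foldl_Cons_rev
      using k[of x] l[of x] sz_append_le[of "rev (take i (xs x))" "ys x"] sz_take_le[of i "xs x"]
      by simp
  qed (intro polytime_intros poly_bounded_intros assms)+
  then show ?thesis by (simp add: foldl_Cons_rev)
qed

lemma polytime_rev [polytime_intros]: "polytime xs \<Longrightarrow> polytime (\<lambda>x. rev (xs x))"
  using polytime_rev_append[of xs "\<lambda>x. []"] by (simp add: polytime_const)

lemma polytime_append [polytime_intros]: "polytime xs \<Longrightarrow> polytime ys \<Longrightarrow> polytime (\<lambda>x. xs x @ ys x)"
  using polytime_rev_append[of "\<lambda>x. rev (xs x)" ys] by (simp add: polytime_rev)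

lemma polytime_map [polytime_intros]:
  fixes f :: "'x::coded \<Rightarrow> 'a::coded \<Rightarrow> 'b::coded"
  assumes f: "polytime (\<lambda>p. f (fst p) (snd p))" and xs: "polytime xs"
  shows "polytime (\<lambda>x. map (f x) (xs x))"
proof -
  obtain k where k: "\<And>x. sz (xs x) \<le> (sz x + 2) ^ k"
    using polytime_szE[OF xs] by blast
  obtain l where l: "\<And>p. sz (f (fst p) (snd p)) \<le> (sz p + 2) ^ l"
    using polytime_szE[OF f] by blast
  have e: "foldl (\<lambda>s a. f x a # s) [] ys = rev (map (f x) ys)" for x ys
    using foldl_Cons_rev[of "[]" "map (f x) ys"] by (simp add: foldl_map)
  let ?S = "\<lambda>n. (n + 2) ^ k * ((n + (n + 2) ^ k + 3) ^ l + 1) + 1"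
  have "polytime (\<lambda>x. foldl (\<lambda>s a. f x a # s) [] (xs x))"
  proof (rule polytime_foldl[where g = "\<lambda>x s a. f x a # s" and S = ?S])
    have "polytime (\<lambda>p :: 'x \<times> 'b list \<times> 'a. (fst p, snd (snd p)))" by (intro polytime_intros)
    from polytime_comp[OF f this]
    have "polytime (\<lambda>p :: 'x \<times> 'b list \<times> 'a. f (fst p) (snd (snd p)))" by simp
    then show "polytime (\<lambda>p :: 'x \<times> 'b list \<times> 'a. f (fst p) (snd (snd p)) # fst (snd p))"
      by (intro polytime_intros)
    fix x i
    let ?ys = "map (f x) (take i (xs x))"
    have "sz y \<le> (sz x + (sz x + 2) ^ k + 3) ^ l" if y: "y \<in> set ?ys" for y
    proof -
      obtain a where a: "a \<in> set (xs x)" "y = f x a" using y by (auto dest: in_set_takeD)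
      have "sz y \<le> (sz (x, a) + 2) ^ l" using l[of "(x, a)"] a by simp
      also have "\<dots> \<le> (sz x + (sz x + 2) ^ k + 3) ^ l"
        using sz_mem_le[OF a(1)] k[of x] by (intro power_mono) auto
      finally show ?thesis .
    qed
    then have "sz ?ys \<le> length ?ys * ((sz x + (sz x + 2) ^ k + 3) ^ l + 1) + 1"
      by (rule sz_list_le)
    also have "\<dots> \<le> (sz x + 2) ^ k * ((sz x + (sz x + 2) ^ k + 3) ^ l + 1) + 1"
      using length_le_sz[of "xs x"] k[of x] by (intro add_mono mult_right_mono) auto
    finally show "sz (foldl (\<lambda>s a. f x a # s) [] (take i (xs x))) \<le> ?S (sz x)"
      unfolding e sz_rev .
  next
    show "poly_bounded ?S" by (intro poly_bounded_intros)
  qed (intro polytime_intros poly_bounded_intros xs)+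
  from polytime_rev[OF this] show ?thesis by (simp add: e)
qed

lemma polytime_filter [polytime_intros]:
  fixes P :: "'x::coded \<Rightarrow> 'a::coded \<Rightarrow> bool"
  assumes f: "polytime (\<lambda>p. P (fst p) (snd p))" and xs: "polytime xs"
  shows "polytime (\<lambda>x. filter (P x) (xs x))"
proof -
  obtain k where k: "\<And>x. sz (xs x) \<le> (sz x + 2) ^ k"
    using polytime_szE[OF xs] by blast
  have e: "foldl (\<lambda>s a. if P x a then a # s else s) zs ys = rev (filter (P x) ys) @ zs" for x ys zs
    by (induction ys arbitrary: zs) auto
  have "polytime (\<lambda>x. foldl (\<lambda>s a. if P x a then a # s else s) [] (xs x))"
  proof (rule polytime_foldl[where g = "\<lambda>x s a. if P x a then a # s else s" and S = "\<lambda>n. (n + 2) ^ k"])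
    have "polytime (\<lambda>p :: 'x \<times> 'a list \<times> 'a. (fst p, snd (snd p)))" by (intro polytime_intros)
    from polytime_comp[OF f this]
    have "polytime (\<lambda>p :: 'x \<times> 'a list \<times> 'a. P (fst p) (snd (snd p)))" by simp
    then show "polytime (\<lambda>p :: 'x \<times> 'a list \<times> 'a. if P (fst p) (snd (snd p)) then snd (snd p) # fst (snd p) else fst (snd p))"
      by (intro polytime_intros)
    fix x i
    have "sz (filter (P x) (take i (xs x))) \<le> (sz x + 2) ^ k"
      using sz_filter_le[of "P x" "take i (xs x)"] sz_take_le[of i "xs x"] k[of x] by linarith
    then show "sz (foldl (\<lambda>s a. if P x a then a # s else s) [] (take i (xs x))) \<le> (sz x + 2) ^ k"
      unfolding e by simp
  qed (intro polytime_intros poly_bounded_intros xs)+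
  from polytime_rev[OF this] show ?thesis by (simp add: e)
qed

lemma polytime_Bex [polytime_intros]:
  fixes P :: "'x::coded \<Rightarrow> 'a::coded \<Rightarrow> bool"
  assumes f: "polytime (\<lambda>p. P (fst p) (snd p))" and xs: "polytime xs"
  shows "polytime (\<lambda>x. \<exists>a \<in> set (xs x). P x a)"
proof -
  have "polytime (\<lambda>x. case filter (P x) (xs x) of [] \<Rightarrow> False | _ # _ \<Rightarrow> True)"
    by (intro polytime_intros assms)
  moreover have "(case filter (P x) (xs x) of [] \<Rightarrow> False | _ # _ \<Rightarrow> True) \<longleftrightarrow> (\<exists>a \<in> set (xs x). P x a)" for x
    by (cases "filter (P x) (xs x)") (auto simp: filter_empty_conv dest: filter_eq_ConsD)
  ultimately show ?thesis by simp
qed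

lemma polytime_Ball [polytime_intros]:
  fixes P :: "'x::coded \<Rightarrow> 'a::coded \<Rightarrow> bool"
  assumes f: "polytime (\<lambda>p. P (fst p) (snd p))" and xs: "polytime xs"
  shows "polytime (\<lambda>x. \<forall>a \<in> set (xs x). P x a)"
  using polytime_not[OF polytime_Bex[where P = "\<lambda>x a. \<not> P x a", OF polytime_not[OF f] xs]] by simp

lemma polytime_concat [polytime_intros]:
  fixes xs :: "'x::coded \<Rightarrow> 'c::coded list list"
  assumes xs: "polytime xs" shows "polytime (\<lambda>x. concat (xs x))"
proof -
  obtain k where k: "\<And>x. sz (xs x) \<le> (sz x + 2) ^ k"
    using polytime_szE[OF xs] by blast
  have e: "foldl (@) zs ys = zs @ concat ys" for zs :: "'c list" and ys
    by (induction ys arbitrary: zs) auto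
  have s: "sz (concat ys) \<le> sz ys" for ys :: "'c list list"
  proof (induction ys)
    case (Cons y ys) then show ?case using sz_append_le[of y "concat ys"] by simp
  qed simp
  have "polytime (\<lambda>x. foldl (\<lambda>s a. s @ a) [] (xs x))"
  proof (rule polytime_foldl[where g = "\<lambda>x s a. s @ a" and S = "\<lambda>n. (n + 2) ^ k"])
    fix x i
    show "sz (foldl (\<lambda>s a. s @ a) [] (take i (xs x))) \<le> (sz x + 2) ^ k"
      unfolding e using s[of "take i (xs x)"] sz_take_le[of i "xs x"] k[of x] by simp
  qed (intro polytime_intros poly_bounded_intros xs)+
  then show ?thesis by (simp add: e)
qed

text \<open>Simultaneous descent through two codes, linear in the first because the recursive calls
  visit disjoint subtrees. Injectivity of \<open>cd\<close> turns equality of codes into equality of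
  values.\<close>

lemma polytime_eq [polytime_intros]:
  fixes f g :: "'x::coded \<Rightarrow> 'a::coded"
  assumes "polytime f" "polytime g" shows "polytime (\<lambda>x. f x = g x)"
proof -
  \<comment> \<open>After both case distinctions the environment starts with the parts c, d of the
    second tree, followed by the parts a, b of the first. A successful comparison of a and c puts
    two leaves in front, which moves b and d to positions 5 and 3.\<close>
  define eqe where "eqe = Case (V 0) (Case (V 1) (ENd ELf ELf) ELf)
     (Case (V 3) ELf (Case (Call 0 [V 2, V 0]) ELf (Call 0 [V 5, V 3])))"
  have eqe: "eval_le [eqe] [s, t] eqe (cd (s = t)) (20 * tsize s)" for s t
  proof (induction s arbitrary: t)
    case Lf
    show ?case
    proof (cases t)
      case Lf
      have "eval_le [eqe] [tree.Lf, tree.Lf] eqe (cd True) (1 + (1 + (1 + 1 + 1) + 1) + 1)"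
        unfolding eqe_def cd_simps by (intro eval_le_Case_Lf eval_le_V eval_le_Nd eval_le_Lf) auto
      then show ?thesis using Lf by (auto elim: eval_le_mono)
    next
      case (Nd c d)
      have "eval_le [eqe] [tree.Lf, tree.Nd c d] eqe (cd False) (1 + (1 + 1 + 1) + 1)"
        unfolding eqe_def cd_simps
        by (intro eval_le_Case_Lf eval_le_V eval_le_Case_Nd[of _ _ _ c d] eval_le_Lf) auto
      then show ?thesis using Nd by (auto elim: eval_le_mono)
    qed
  next
    case (Nd a b)
    show ?case
    proof (cases t)
      case Lf
      have "eval_le [eqe] [tree.Nd a b, tree.Lf] eqe (cd False) (1 + (1 + 1 + 1) + 1)"
        unfolding eqe_def cd_simps
        by (intro eval_le_Case_Nd[of _ _ _ a b] eval_le_V eval_le_Case_Lf eval_le_Lf) auto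
      then show ?thesis using Lf by (auto elim: eval_le_mono)
    next
      case (Nd c d)
      let ?rho = "[c, d, a, b, tree.Nd a b, tree.Nd c d]"
      let ?in = "Case (Call 0 [V 2, V 0]) ELf (Call 0 [V 5, V 3])"
      have c1: "eval_le [eqe] ?rho (Call 0 [V 2, V 0]) (cd (a = c)) (1 + (1 + 0) + 20 * tsize a + 1)"
        by (intro eval_le_Call[where xs = "[a, c]"] evals_le_Cons evals_le_Nil eval_le_V) (auto simp: Nd.IH)
      have i: "eval_le [eqe] ?rho ?in (cd (a = c \<and> b = d)) (20 * tsize a + 20 * tsize b + 8)"
      proof (cases "a = c")
        case True
        have "eval_le [eqe] (tree.Lf # tree.Lf # ?rho) (Call 0 [V 5, V 3]) (cd (b = d)) (1 + (1 + 0) + 20 * tsize b + 1)"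
          by (intro eval_le_Call[where xs = "[b, d]"] evals_le_Cons evals_le_Nil eval_le_V) (auto simp: Nd.IH)
        then have "eval_le [eqe] ?rho ?in (cd (b = d)) ((1 + (1 + 0) + 20 * tsize a + 1) + (1 + (1 + 0) + 20 * tsize b + 1) + 1)"
          using c1 True by (intro eval_le_Case_Nd[of _ _ _ tree.Lf tree.Lf]) auto
        then show ?thesis using True by (auto elim: eval_le_mono)
      next
        case False
        with c1 have "eval_le [eqe] ?rho (Call 0 [V 2, V 0]) tree.Lf (1 + (1 + 0) + 20 * tsize a + 1)" by simp
        then have "eval_le [eqe] ?rho ?in tree.Lf ((1 + (1 + 0) + 20 * tsize a + 1) + 1 + 1)"
          by (intro eval_le_Case_Lf eval_le_Lf)
        then show ?thesis using False by (auto elim: eval_le_mono)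
      qed
      have "eval_le [eqe] [tree.Nd a b, tree.Nd c d] eqe (cd (a = c \<and> b = d))
         (1 + (1 + (20 * tsize a + 20 * tsize b + 8) + 1) + 1)"
        unfolding eqe_def
        by (rule eval_le_Case_Nd[of _ _ _ a b], (rule eval_le_V; simp), rule eval_le_Case_Nd[of _ _ _ c d], (rule eval_le_V; simp))
          (use i in \<open>simp add: eqe_def\<close>)
      then show ?thesis using Nd by (auto elim: eval_le_mono)
    qed
  qed
  have "time_bounded (\<lambda>n. 20 * n + 20) (\<lambda>p :: 'a \<times> 'a. fst p = snd p)"
  proof (rule time_boundedI[where R = "[eqe]" and e = "Case (V 0) (V 0) (Call 0 [V 0, V 1])"])
    fix p :: "'a \<times> 'a"
    have "eval_le [eqe] [cd (fst p), cd (snd p), cd p] (Call 0 [V 0, V 1]) (cd (fst p = snd p))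
        (1 + (1 + 0) + 20 * tsize (cd (fst p)) + 1)"
    proof (rule eval_le_Call)
      show "evals_le [eqe] [cd (fst p), cd (snd p), cd p] [V 0, V 1] [cd (fst p), cd (snd p)] (1 + (1 + 0))"
        by (intro evals_le_Cons evals_le_Nil eval_le_V) auto
    qed (use eqe[of "cd (fst p)" "cd (snd p)"] in \<open>auto simp: cd_inj_iff\<close>)
    then have "eval_le [eqe] [cd p] (Case (V 0) (V 0) (Call 0 [V 0, V 1])) (cd (fst p = snd p))
      (1 + (1 + (1 + 0) + 20 * tsize (cd (fst p)) + 1) + 1)"
      by (intro eval_le_Case_Nd[of _ _ _ "cd (fst p)" "cd (snd p)"] eval_le_V) (auto simp: cd_prod_def)
    then show "eval_le [eqe] [cd p] (Case (V 0) (V 0) (Call 0 [V 0, V 1])) (cd (fst p = snd p)) (20 * sz p + 20)"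
      by (rule eval_le_mono) (simp add: sz_def cd_prod_def)
    show "sz (fst p = snd p) \<le> 20 * sz p + 20" by (cases "fst p = snd p") auto
  qed
  then have "polytime (\<lambda>p :: 'a \<times> 'a. fst p = snd p)" by (rule polytimeI) (intro poly_bounded_intros)
  from polytime_comp[OF this polytime_pair[OF assms]] show ?thesis by simp
qed

lemma unit_list_eq: "length xs = length ys \<Longrightarrow> xs = (ys :: unit list)"
  by (simp add: list_eq_iff_nth_eq)

text \<open>A traversal with accumulator emits one tick per node, leaves included. The result is
  unary fuel for loops and makes the size of an argument itself computable.\<close>

lemma polytime_ticks: "polytime (\<lambda>x. replicate (sz x) ())"
proof -
  define te where "te = Case (V 0) (ENd ELf (V 1)) (Call 0 [V 0, Call 0 [V 1, ENd ELf (V 3)]])"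
  have te: "eval_le [te] [t, cd us] te (cd (replicate (tsize t) () @ us)) (20 * tsize t)" for t us
  proof (induction t arbitrary: us)
    case Lf
    have "eval_le [te] [tree.Lf, cd us] te (Nd tree.Lf (cd us)) (1 + (1 + 1 + 1) + 1)"
      unfolding te_def by (intro eval_le_Case_Lf eval_le_Nd eval_le_Lf eval_le_V) auto
    then show ?case by (auto elim: eval_le_mono)
  next
    case (Nd a b)
    let ?rho = "[a, b, tree.Nd a b, cd us]"
    have "eval_le [te] [b, tree.Nd tree.Lf (cd us)] te (cd (replicate (tsize b) () @ () # us)) (20 * tsize b)"
      using Nd.IH(2)[of "() # us"] by simp
    then have b: "eval_le [te] ?rho (Call 0 [V 1, ENd ELf (V 3)]) (cd (replicate (tsize b) () @ () # us))
      (1 + ((1 + 1 + 1) + 0) + 20 * tsize b + 1)"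
      by (intro eval_le_Call[where xs = "[b, tree.Nd tree.Lf (cd us)]"] evals_le_Cons evals_le_Nil eval_le_V eval_le_Nd eval_le_Lf) auto
    have "evals_le [te] ?rho [V 0, Call 0 [V 1, ENd ELf (V 3)]] [a, cd (replicate (tsize b) () @ () # us)]
       (1 + ((1 + ((1 + 1 + 1) + 0) + 20 * tsize b + 1) + 0))"
      by (intro evals_le_Cons evals_le_Nil b eval_le_V) auto
    then have "eval_le [te] ?rho (Call 0 [V 0, Call 0 [V 1, ENd ELf (V 3)]])
       (cd (replicate (tsize a) () @ replicate (tsize b) () @ () # us))
      (1 + ((1 + ((1 + 1 + 1) + 0) + 20 * tsize b + 1) + 0) + 20 * tsize a + 1)"
      using Nd.IH(1) by (intro eval_le_Call) auto
    then have "eval_le [te] [tree.Nd a b, cd us] te (cd (replicate (tsize a) () @ replicate (tsize b) () @ () # us))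
      (1 + (1 + ((1 + ((1 + 1 + 1) + 0) + 20 * tsize b + 1) + 0) + 20 * tsize a + 1) + 1)"
      unfolding te_def by (intro eval_le_Case_Nd[of _ _ _ a b] eval_le_V) auto
    moreover have "replicate (tsize a) () @ replicate (tsize b) () @ () # us = replicate (tsize (tree.Nd a b)) () @ us"
      by (rule unit_list_eq) simp
    ultimately show ?case by (auto elim!: eval_le_mono)
  qed
  have r: "sz (replicate n ()) = 2 * n + 1" for n by (induction n) auto
  have "time_bounded (\<lambda>n. 20 * n + 20) (\<lambda>x :: 'a. replicate (sz x) ())"
  proof (rule time_boundedI[where R = "[te]" and e = "Call 0 [V 0, ELf]"])
    fix x :: 'a
    have "eval_le [te] [cd x] (Call 0 [V 0, ELf]) (cd (replicate (sz x) ())) (1 + (1 + 0) + 20 * sz x + 1)"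
    proof (rule eval_le_Call)
      show "evals_le [te] [cd x] [V 0, ELf] [cd x, Lf] (1 + (1 + 0))"
        by (intro evals_le_Cons evals_le_Nil eval_le_V eval_le_Lf) auto
    qed (use te[of "cd x" "[]"] in \<open>auto simp: sz_def\<close>)
    then show "eval_le [te] [cd x] (Call 0 [V 0, ELf]) (cd (replicate (sz x) ())) (20 * sz x + 20)"
      by (rule eval_le_mono) simp
    show "sz (replicate (sz x) ()) \<le> 20 * sz x + 20" by (simp add: r)
  qed
  then show ?thesis by (rule polytimeI) (intro poly_bounded_intros)
qed

section \<open>Polynomial-time arithmetic\<close>

lemma cd_nat_unfold: "cd (n :: nat) = (if n = 0 then Lf else Nd (cd (odd n)) (cd (n div 2)))"
  by (simp add: cd_nat bits_pos)

lemma size_nat_0 [simp]: "size_nat 0 = 0"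
  by (simp add: size_nat_def)

lemma size_nat_pos: "0 < n \<Longrightarrow> size_nat n = Suc (size_nat (n div 2))"
  by (simp add: size_nat_def bits_pos)

lemma size_nat_le_iff: "size_nat n \<le> k \<longleftrightarrow> n < 2 ^ k"
proof (induction k arbitrary: n)
  case 0
  show ?case by (cases "n = 0") (auto simp: size_nat_pos)
next
  case (Suc k)
  show ?case
  proof (cases "n = 0")
    case False
    then have "size_nat n \<le> Suc k \<longleftrightarrow> n div 2 < 2 ^ k"
      using Suc by (simp add: size_nat_pos)
    then show ?thesis by (simp add: div_less_iff_less_mult mult.commute)
  qed auto
qed

lemma less_size_nat: "n < 2 ^ size_nat n"
  using size_nat_le_iff[of n "size_nat n"] by simp

lemma size_nat_mono: "m \<le> n \<Longrightarrow> size_nat m \<le> size_nat n"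
  using size_nat_le_iff[of m "size_nat n"] less_size_nat[of n] by linarith

lemma size_nat_mult: "size_nat (m * n) \<le> size_nat m + size_nat n"
  unfolding size_nat_le_iff power_add by (intro mult_strict_mono less_size_nat) auto

lemma size_nat_le_self: "size_nat n \<le> n"
  unfolding size_nat_le_iff by simp

lemma sz_nat_unfold: "sz n = (if n = 0 then 1 else sz (odd n) + sz (n div 2) + 1)" for n :: nat
  unfolding sz_def using cd_nat_unfold[of n] by simp

lemma sz_nat_le: "sz n \<le> 4 * size_nat n + 1" for n :: nat
proof (induction n rule: less_induct)
  case (less n)
  have "sz (odd n) \<le> 3" by (cases "odd n") auto
  then show ?case using less[of "n div 2"] sz_nat_unfold[of n] by (cases "n = 0") (auto simp: size_nat_pos)
qed

lemma size_nat_le_sz: "size_nat n \<le> sz n"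
proof (induction n rule: less_induct)
  case (less n)
  show ?case
  proof (cases "n = 0")
    case False
    then have "size_nat (n div 2) \<le> sz (n div 2)" by (intro less) auto
    then show ?thesis using False sz_nat_unfold[of n] sz_ge_1[of "odd n"] by (simp add: size_nat_pos)
  qed simp
qed

lemma sz_nat_mono: "m \<le> n \<Longrightarrow> sz m \<le> 4 * sz n + 1" for m n :: nat
  using sz_nat_le[of m] size_nat_mono[of m n] size_nat_le_sz[of n] by linarith

lemma polytime_bits [polytime_intros]: "polytime n \<Longrightarrow> polytime (\<lambda>x. bits (n x))"
  by (rule polytime_out[of n]) (auto simp: cd_nat)

lemma polytime_half [polytime_intros]:
  assumes "polytime n" shows "polytime (\<lambda>x. n x div (2::nat))"
  by (rule polytime_case[OF assms, of "\<lambda>x. 0" "\<lambda>x (h::bool) t. t"], (intro polytime_intros)+)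
     (use cd_nat_unfold[of "n _"] in auto)

lemma polytime_odd [polytime_intros]:
  fixes n :: "'a::coded \<Rightarrow> nat"
  assumes "polytime n" shows "polytime (\<lambda>x. odd (n x))"
  by (rule polytime_case[OF assms, of "\<lambda>x. False" "\<lambda>x h (t::nat). h"], (intro polytime_intros)+)
     (use cd_nat_unfold[of "n _"] in auto)

text \<open>Digits are stored from the least significant one, without a zero in the top position;
  the case distinction keeps the code of 0 empty.\<close>

lemma polytime_bit_Cons [polytime_intros]:
  assumes "polytime b" "polytime n" shows "polytime (\<lambda>x. of_bool (b x) + 2 * n x :: nat)"
proof (rule polytime_out)
  show "polytime (\<lambda>x. if \<not> b x \<and> n x = 0 then [] else b x # bits (n x))"
    by (intro polytime_intros assms)
  show "cd (of_bool (b x) + 2 * n x) = cd (if \<not> b x \<and> n x = 0 then [] else b x # bits (n x))" for x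
    unfolding cd_nat by (auto simp: bits_pos)
qed

text \<open>Full adder and full subtractor in one: \<open>c\<close> is the carry or borrow, and
  result bits are pushed onto the accumulator, which ends up with the most significant bit in front,
  as \<open>horner\<close> reads it.\<close>

definition addsub_step :: "bool \<Rightarrow> nat \<times> nat \<times> bool \<times> bool list \<Rightarrow> nat \<times> nat \<times> bool \<times> bool list" where
  "addsub_step sub s = (case s of (m, n, c, acc) \<Rightarrow>
     (m div 2, n div 2,
      ((odd m \<noteq> sub) \<and> (odd n \<or> c) \<or> odd n \<and> c),
      (odd m \<noteq> (odd n \<noteq> c)) # acc))"

text \<open>The two digit lists only act as a clock; their total length suffices to exhaust both
  operands.\<close>

definition addsub :: "bool \<Rightarrow> nat \<Rightarrow> nat \<Rightarrow> nat \<times> nat \<times> bool \<times> bool list" where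
  "addsub sub m n = foldl (\<lambda>s (_::bool). addsub_step sub s) (m, n, False, []) (bits m @ bits n)"

definition sgb :: "bool \<Rightarrow> int" where "sgb b = (if b then -1 else 1)"

definition horner :: "'a::comm_semiring_1 \<Rightarrow> bool list \<Rightarrow> 'a" where
  "horner = foldl (\<lambda>s b. of_bool b + 2 * s)"

text \<open>The unprocessed parts of the operands, combined with sign and carry, form the leading
  part in front of the bits produced so far. Integers are used since this leading part may be
  negative.\<close>

lemma addsub_inv:
  assumes "foldl (\<lambda>s (_::bool). addsub_step sub s) (m, n, c, acc) ks = (m', n', c', acc')"
  shows "m' = m div 2 ^ length ks \<and> n' = n div 2 ^ length ks \<and>
    horner (int m' + sgb sub * (int n' + of_bool c')) acc' =
     horner (int m + sgb sub * (int n + of_bool c)) acc \<and>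
    length acc' = length acc + length ks"
  using assms
proof (induction ks arbitrary: m n c acc)
  case (Cons k ks)
  let ?c = "(odd m \<noteq> sub) \<and> (odd n \<or> c) \<or> odd n \<and> c"
  let ?b = "odd m \<noteq> (odd n \<noteq> c)"
  have s: "addsub_step sub (m, n, c, acc) = (m div 2, n div 2, ?c, ?b # acc)"
    by (simp add: addsub_step_def)
  have p: "foldl (\<lambda>s (_::bool). addsub_step sub s) (m div 2, n div 2, ?c, ?b # acc) ks = (m', n', c', acc')"
    using Cons.prems s by simp
  note IH = Cons.IH[OF p]

  have m: "int m = 2 * int (m div 2) + of_bool (odd m)" and n: "int n = 2 * int (n div 2) + of_bool (odd n)"
    by (auto simp: of_bool_def zdiv_int elim!: oddE)
  have "int m + sgb sub * (int n + of_bool c) =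
    of_bool ?b + 2 * (int (m div 2) + sgb sub * (int (n div 2) + of_bool ?c))"
    apply (subst m, subst n)
    by (cases "odd m"; cases "odd n"; cases c; cases sub) (auto simp: sgb_def)
  then have "horner (int (m div 2) + sgb sub * (int (n div 2) + of_bool ?c)) (?b # acc) =
     horner (int m + sgb sub * (int n + of_bool c)) acc"
    by (simp add: horner_def)
  note h = trans[OF IH[THEN conjunct2, THEN conjunct2, THEN conjunct1] this]
  show ?case using IH by (intro conjI h) (simp_all add: div_mult2_eq)
qed auto

lemma horner_int: "horner (int s) bs = int (horner s bs)"
  unfolding horner_def
proof (induction bs arbitrary: s)
  case (Cons b bs)
  show ?case using Cons[of "of_bool b + 2 * s"] by simp
qed simp

lemma horner_neg: "s < 0 \<Longrightarrow> horner s bs < (0::int)"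
  unfolding horner_def by (induction bs arbitrary: s) (auto simp: of_bool_def)

lemma length_bits: "length (bits n) = size_nat n"
  by (simp add: size_nat_def)

text \<open>Once both operands are exhausted, the carry alone is the leading part. A leftover borrow
  makes it -1 and the whole value negative, so the same computation yields sum, difference and
  comparison.\<close>

lemma addsub_result:
  obtains c acc where "addsub sub m n = (0, 0, c, acc)"
    "\<not> sub \<Longrightarrow> m + n = horner (of_bool c) acc"
    "sub \<Longrightarrow> c \<longleftrightarrow> m < n" "sub \<Longrightarrow> \<not> c \<Longrightarrow> m - n = horner 0 acc"
proof -
  obtain m' n' c acc where r: "addsub sub m n = (m', n', c, acc)" by (cases "addsub sub m n") auto
  note inv = addsub_inv[OF r[unfolded addsub_def], THEN conjunct1]
    addsub_inv[OF r[unfolded addsub_def], THEN conjunct2, THEN conjunct1]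
    addsub_inv[OF r[unfolded addsub_def], THEN conjunct2, THEN conjunct2, THEN conjunct1]
  have "m < 2 ^ (size_nat m + size_nat n)" "n < 2 ^ (size_nat m + size_nat n)"
    using less_size_nat[of m] less_size_nat[of n]
    by (auto elim!: less_le_trans intro!: power_increasing)
  then have z: "m' = 0" "n' = 0" using inv(1,2) by (auto simp: length_bits)
  have h: "horner (sgb sub * (of_bool c)) acc = int m + sgb sub * int n"
    using inv(3) z by (simp add: horner_def)
  note h = h[unfolded sgb_def]
  show ?thesis
  proof
    show "addsub sub m n = (0, 0, c, acc)" using r z by simp
    show "\<not> sub \<Longrightarrow> m + n = horner (of_bool c) acc"
      using h horner_int[of "of_bool c" acc] by simp
    show "sub \<Longrightarrow> c \<longleftrightarrow> m < n"
      using h horner_int[of "0" acc] horner_neg[of "-1" acc] by (cases c) auto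
    show "sub \<Longrightarrow> \<not> c \<Longrightarrow> m - n = horner 0 acc"
      using h horner_int[of "0" acc] by auto
  qed
qed

lemma sz_bools_le: "sz (bs :: bool list) \<le> 4 * length bs + 1"
proof -
  have "sz b \<le> 3" for b :: bool by (cases b) auto
  then show ?thesis using sz_list_le[of bs 3] by simp
qed

lemma sz_bool_le: "sz (b :: bool) \<le> 3"
  by (cases b) auto

lemma polytime_addsub [polytime_intros]:
  fixes m n :: "'a::coded \<Rightarrow> nat"
  assumes m: "polytime m" and n: "polytime n" shows "polytime (\<lambda>x. addsub sub (m x) (n x))"
proof -
  obtain k where k: "\<And>x. sz (m x) \<le> (sz x + 2) ^ k" using polytime_szE[OF m] by blast
  obtain l where l: "\<And>x. sz (n x) \<le> (sz x + 2) ^ l" using polytime_szE[OF n] by blast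
  show ?thesis unfolding addsub_def
  proof (rule polytime_foldl[where g = "\<lambda>x s _. addsub_step sub s" 
        and S = "\<lambda>n. 20 * ((n + 2) ^ k + (n + 2) ^ l) + 20"])
    show "polytime (\<lambda>p :: 'a \<times> (nat \<times> nat \<times> bool \<times> bool list) \<times> bool. addsub_step sub (fst (snd p)))"
      unfolding addsub_step_def case_prod_beta by (intro polytime_intros)
    fix x i
    let ?ks = "take i (bits (m x) @ bits (n x))"
    obtain m' n' c acc where r: "foldl (\<lambda>s _. addsub_step sub s) (m x, n x, False, []) ?ks = (m', n', c, acc)"
      by (cases "foldl (\<lambda>s _. addsub_step sub s) (m x, n x, False, []) ?ks") auto
    have inv: "m' = m x div 2 ^ length ?ks" "n' = n x div 2 ^ length ?ks" "length acc = length ?ks"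
      using addsub_inv[OF r] by auto
    have "length acc \<le> size_nat (m x) + size_nat (n x)" using inv(3) by (simp add: length_bits)
    moreover have "sz m' \<le> 4 * sz (m x) + 1" "sz n' \<le> 4 * sz (n x) + 1"
      unfolding inv by (rule sz_nat_mono, rule div_le_dividend)+
    ultimately have "sz (m', n', c, acc) \<le> 20 * (sz (m x) + sz (n x)) + 20"
      using sz_bools_le[of acc] sz_bool_le[of c] size_nat_le_sz[of "m x"] size_nat_le_sz[of "n x"] by simp
    then show "sz (foldl (\<lambda>s _. addsub_step sub s) (m x, n x, False, []) ?ks) \<le> 20 * ((sz x + 2) ^ k + (sz x + 2) ^ l) + 20"
      unfolding r using k[of x] l[of x] by simp
  qed (intro polytime_intros poly_bounded_intros assms)+
qed

lemma size_nat_horner: "size_nat (horner s bs) \<le> size_nat s + length bs"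
  unfolding horner_def
proof (induction bs arbitrary: s)
  case (Cons b bs)
  have "size_nat (of_bool b + 2 * s) \<le> size_nat s + 1"
    unfolding size_nat_le_iff using less_size_nat[of s] by (cases b) auto
  then show ?case using Cons[of "of_bool b + 2 * s"] by simp
qed simp

lemma polytime_horner [polytime_intros]:
  assumes s: "polytime s" and bs: "polytime bs" shows "polytime (\<lambda>x. horner (s x) (bs x) :: nat)"
proof -
  obtain k where k: "\<And>x. sz (s x) \<le> (sz x + 2) ^ k" using polytime_szE[OF s] by blast
  obtain l where l: "\<And>x. sz (bs x) \<le> (sz x + 2) ^ l" using polytime_szE[OF bs] by blast
  show ?thesis unfolding horner_def
  proof (rule polytime_foldl[where g = "\<lambda>x s b. of_bool b + 2 * s"
        and S = "\<lambda>n. 4 * ((n + 2) ^ k + (n + 2) ^ l) + 1"])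
    fix x i
    have "sz (horner (s x) (take i (bs x))) \<le> 4 * (size_nat (s x) + length (take i (bs x))) + 1"
      using sz_nat_le[of "horner (s x) (take i (bs x))"] size_nat_horner[of "s x" "take i (bs x)"]
      by (meson add_le_mono1 le_trans mult_le_mono2)
    also have "\<dots> \<le> 4 * ((sz x + 2) ^ k + (sz x + 2) ^ l) + 1"
      using k[of x] l[of x] size_nat_le_sz[of "s x"] length_le_sz[of "bs x"] by simp
    finally show "sz (foldl (\<lambda>s b. of_bool b + 2 * s) (s x) (take i (bs x))) \<le> \<dots>"
      by (simp add: horner_def)
  qed (intro polytime_intros poly_bounded_intros assms)+
qed

lemma polytime_of_bool [polytime_intros]: "polytime b \<Longrightarrow> polytime (\<lambda>x. of_bool (b x) :: nat)"
  by (rule polytime_cong[of "\<lambda>x. if b x then 1 else 0"], intro polytime_intros) auto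

lemma polytime_nat_add [polytime_intros]:
  fixes m n :: "'a::coded \<Rightarrow> nat"
  assumes "polytime m" "polytime n" shows "polytime (\<lambda>x. m x + n x)"
proof (rule polytime_cong)
  show "polytime (\<lambda>x. let r = snd (snd (addsub False (m x) (n x))) in horner (of_bool (fst r)) (snd r) :: nat)"
    by (intro polytime_intros assms)
  fix x
  show "m x + n x = (let r = snd (snd (addsub False (m x) (n x))) in horner (of_bool (fst r)) (snd r))"
    by (rule addsub_result[of False "m x" "n x"]) (simp add: Let_def)
qed

lemma polytime_nat_less [polytime_intros]:
  fixes m n :: "'a::coded \<Rightarrow> nat"
  assumes "polytime m" "polytime n" shows "polytime (\<lambda>x. m x < n x)"
proof (rule polytime_cong)
  show "polytime (\<lambda>x. fst (snd (snd (addsub True (m x) (n x)))))"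
    by (intro polytime_intros assms)
  fix x
  show "(m x < n x) = fst (snd (snd (addsub True (m x) (n x))))"
    by (rule addsub_result[of True "m x" "n x"]) simp
qed

lemma polytime_nat_le [polytime_intros]:
  fixes m n :: "'a::coded \<Rightarrow> nat"
  assumes "polytime m" "polytime n" shows "polytime (\<lambda>x. m x \<le> n x)"
  by (rule polytime_cong[OF polytime_not[OF polytime_nat_less[OF assms(2,1)]]]) auto

lemma polytime_nat_diff [polytime_intros]:
  fixes m n :: "'a::coded \<Rightarrow> nat"
  assumes "polytime m" "polytime n" shows "polytime (\<lambda>x. m x - n x)"
proof (rule polytime_cong)
  show "polytime (\<lambda>x. let r = snd (snd (addsub True (m x) (n x))) in if fst r then 0 else horner 0 (snd r) :: nat)"
    by (intro polytime_intros assms)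
  fix x
  show "m x - n x = (let r = snd (snd (addsub True (m x) (n x))) in if fst r then 0 else horner 0 (snd r))"
    by (rule addsub_result[of True "m x" "n x"]) (auto simp add: Let_def)
qed

section \<open>Multiplication, division and greatest common divisors\<close>

definition bitfold :: "('s \<Rightarrow> bool \<Rightarrow> 's) \<Rightarrow> 's \<Rightarrow> nat \<Rightarrow> 's" where
  "bitfold f z n = foldl f z (rev (bits n))"

lemma bitfold_simps:
  "bitfold f z 0 = z"
  "0 < n \<Longrightarrow> bitfold f z n = f (bitfold f z (n div 2)) (odd n)"
  by (simp_all add: bitfold_def bits_pos)

lemma drop_bits: "drop j (bits n) = bits (n div 2 ^ j)"
proof (induction j arbitrary: n)
  case (Suc j)
  then show ?case by (cases "n = 0") (auto simp: bits_pos div_mult2_eq)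
qed simp

text \<open>Prefixes of the digits, most significant first, are the digits of
  \<open>n div 2 ^ j\<close>. Every intermediate state is therefore the final state for some smaller
  number, and a size bound for the values of the fold covers all of them.\<close>

lemma polytime_bitfold:
  fixes g :: "'x::coded \<Rightarrow> 's::coded \<Rightarrow> bool \<Rightarrow> 's"
  assumes g: "polytime (\<lambda>p. g (fst p) (fst (snd p)) (snd (snd p)))" and z: "polytime z" and n: "polytime n"
    and S: "poly_bounded S" "\<And>x k. k \<le> n x \<Longrightarrow> sz (bitfold (g x) (z x) k) \<le> S (sz x)"
  shows "polytime (\<lambda>x. bitfold (g x) (z x) (n x))"
  unfolding bitfold_def
proof (rule polytime_foldl[OF g _ _ S(1)])
  fix x i
  show "sz (foldl (g x) (z x) (take i (rev (bits (n x))))) \<le> S (sz x)"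
    using S(2)[of "n x div 2 ^ (length (bits (n x)) - i)" x]
    by (simp add: take_rev drop_bits bitfold_def)
qed (intro polytime_intros z n)+

text \<open>Double and add over the digits of the first factor.\<close>

lemma polytime_nat_mult [polytime_intros]:
  fixes m n :: "'a::coded \<Rightarrow> nat"
  assumes m: "polytime m" and n: "polytime n" shows "polytime (\<lambda>x. m x * n x)"
proof -
  obtain a where a: "\<And>x. sz (m x) \<le> (sz x + 2) ^ a" using polytime_szE[OF m] by blast
  obtain b where b: "\<And>x. sz (n x) \<le> (sz x + 2) ^ b" using polytime_szE[OF n] by blast
  have e: "bitfold (\<lambda>s b. if b then s + s + n else s + s) 0 m = m * n" for m n :: nat
  proof (induction m rule: less_induct)
    case (less m)
    show ?case
    proof (cases "m = 0")
      case False
      define q where "q = m div 2"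
      have "m = 2 * q + of_bool (odd m)" by (simp add: q_def of_bool_def)
      then have "m * n = (2 * q + of_bool (odd m)) * n" by simp
      moreover have "bitfold (\<lambda>s b. if b then s + s + n else s + s) 0 q = q * n"
        using False by (intro less) (auto simp: q_def)
      ultimately show ?thesis using False
        by (auto simp: bitfold_simps q_def[symmetric] add_mult_distrib)
    qed (simp add: bitfold_simps)
  qed
  have "polytime (\<lambda>x. bitfold (\<lambda>s b. if b then s + s + n x else s + s) 0 (m x))"
  proof (rule polytime_bitfold[where g = "\<lambda>x s b. if b then s + s + n x else s + s" and S = "\<lambda>n. 4 * ((n + 2) ^ a + (n + 2) ^ b) + 1"])
    fix x k assume "k \<le> m x"
    then have "size_nat (k * n x) \<le> size_nat (m x) + size_nat (n x)"
      using size_nat_mult[of k "n x"] size_nat_mono[of k "m x"] by linarith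
    then show "sz (bitfold (\<lambda>s b. if b then s + s + n x else s + s) 0 k) \<le> 4 * ((sz x + 2) ^ a + (sz x + 2) ^ b) + 1"
      unfolding e using sz_nat_le[of "k * n x"] size_nat_le_sz[of "m x"] size_nat_le_sz[of "n x"] a[of x] b[of x]
      by simp
  next
    show "polytime (\<lambda>p :: 'a \<times> nat \<times> bool. if snd (snd p) then fst (snd p) + fst (snd p) + n (fst p) else fst (snd p) + fst (snd p))"
      by (intro polytime_intros polytime_comp[OF n])
  qed (intro polytime_intros poly_bounded_intros assms)+
  then show ?thesis unfolding e .
qed

text \<open>Long division: shift in one digit, then subtract the divisor if it fits. The guard for
  divisor 0 reproduces the conventions m div 0 = 0 and m mod 0 = m.\<close>

lemma polytime_divmod:
  fixes m n :: "'a::coded \<Rightarrow> nat"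
  assumes m: "polytime m" and n: "polytime n" shows "polytime (\<lambda>x. (m x div n x, m x mod n x))"
proof -
  obtain a where a: "\<And>x. sz (m x) \<le> (sz x + 2) ^ a" using polytime_szE[OF m] by blast
  define g :: "nat \<Rightarrow> nat \<times> nat \<Rightarrow> bool \<Rightarrow> nat \<times> nat" where "g = (\<lambda>n s b. let r = of_bool b + 2 * snd s in
     if n \<noteq> 0 \<and> n \<le> r then (of_bool True + 2 * fst s, r - n) else (2 * fst s, r :: nat))"
  have e: "bitfold (g n) (0, 0) m = (m div n, m mod n)" for m n
  proof (induction m rule: less_induct)
    case (less m)
    show ?case
    proof (cases "m = 0 \<or> n = 0")
      case True
      have "bitfold (g 0) (0, 0) m = (0, m)"
      proof (cases "m = 0")
        case False
        then show ?thesis using less[of "m div 2"] True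
          by (auto simp: bitfold_simps g_def Let_def of_bool_def)
      qed (simp add: bitfold_simps)
      then show ?thesis using True by (auto simp: bitfold_simps)
    next
      case False
      define q r where "q = m div 2 div n" and "r = m div 2 mod n"
      have h: "m div 2 = q * n + r" "r < n" using False by (auto simp: q_def r_def)
      have m: "m = q * 2 * n + (of_bool (odd m) + 2 * r)"
      proof -
        have "m = 2 * (m div 2) + of_bool (odd m)" by (simp add: of_bool_def)
        then show ?thesis using h(1) by (simp add: algebra_simps)
      qed
      have eq: "bitfold (g n) (0, 0) m = g n (q, r) (odd m)"
        using False less[of "m div 2"] by (simp add: bitfold_simps q_def r_def)
      define r' where "r' = of_bool (odd m) + 2 * r"
      show ?thesis
      proof (cases "n \<le> r'")
        case True
        have "m = (r' - n) + (2 * q + 1) * n" using m True by (simp add: r'_def algebra_simps)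
        moreover have "r' - n < n" using h(2) by (auto simp: r'_def of_bool_def)
        ultimately have "m div n = 2 * q + 1" "m mod n = r' - n"
          by (metis add.commute add_cancel_left_left div_mult_self1 div_less False, metis mod_mult_self1 mod_less)
        moreover have "g n (q, r) (odd m) = (2 * q + 1, r' - n)"
          using True False unfolding g_def by (simp add: r'_def Let_def)
        ultimately show ?thesis unfolding eq by simp
      next
        case n: False
        have "m = r' + (2 * q) * n" using m by (simp add: r'_def algebra_simps)
        then have "m div n = 2 * q" "m mod n = r'" using n
          by (metis add.commute add_cancel_left_left div_mult_self1 div_less False not_le, metis mod_mult_self1 mod_less n not_le)
        moreover have "g n (q, r) (odd m) = (2 * q, r')"
          using n False unfolding g_def by (simp add: r'_def Let_def)
        ultimately show ?thesis unfolding eq by simp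
      qed
    qed
  qed
  have "polytime (\<lambda>x. bitfold (g (n x)) (0, 0) (m x))"
  proof (rule polytime_bitfold[where g = "\<lambda>x. g (n x)" and S = "\<lambda>n. 10 * ((n + 2) ^ a) + 10"])
    fix x k assume k: "k \<le> m x"
    have "k div n x \<le> m x" "k mod n x \<le> m x" using k
      by (meson div_le_dividend le_trans, meson mod_less_eq_dividend le_trans)
    from this[THEN sz_nat_mono]
    show "sz (bitfold (g (n x)) (0, 0) k) \<le> 10 * (sz x + 2) ^ a + 10"
      unfolding e using a[of x] by simp
  next
    have *: "polytime (\<lambda>x. 2 * f x)" if "polytime f" for f :: "'b::coded \<Rightarrow> nat"
      using polytime_nat_add[OF that that] by (simp add: mult_2)
    show "polytime (\<lambda>p :: 'a \<times> (nat \<times> nat) \<times> bool. g (n (fst p)) (fst (snd p)) (snd (snd p)))"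
      unfolding g_def by (intro polytime_intros * polytime_comp[OF n])
  qed (intro polytime_intros poly_bounded_intros assms)+
  then show ?thesis unfolding e .
qed

lemma polytime_nat_div [polytime_intros]: "polytime m \<Longrightarrow> polytime n \<Longrightarrow> polytime (\<lambda>x. m x div n x :: nat)"
  using polytime_fst[OF polytime_divmod] by fastforce

lemma polytime_nat_mod [polytime_intros]: "polytime m \<Longrightarrow> polytime n \<Longrightarrow> polytime (\<lambda>x. m x mod n x :: nat)"
  using polytime_snd[OF polytime_divmod] by fastforce

text \<open>Stationary once the second component is 0, so that a fixed number of rounds can be run
  without a test for termination.\<close>

definition euclid_step :: "nat \<times> nat \<Rightarrow> nat \<times> nat" where
  "euclid_step s = (if snd s = 0 then s else (snd s, fst s mod snd s))"

lemma euclid_inv: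
  "gcd (fst (foldl (\<lambda>s _. euclid_step s) s ks)) (snd (foldl (\<lambda>s _. euclid_step s) s ks)) = gcd (fst s) (snd s)"
proof (induction ks arbitrary: s)
  case (Cons k ks)
  then show ?case by (auto simp: euclid_step_def gcd_red_nat[symmetric])
qed simp

lemma euclid_bound:
  "fst s \<le> M \<Longrightarrow> snd s \<le> M \<Longrightarrow>
   fst (foldl (\<lambda>s _. euclid_step s) s ks) \<le> M \<and> snd (foldl (\<lambda>s _. euclid_step s) s ks) \<le> M"
proof (induction ks arbitrary: s)
  case (Cons k ks)
  have "fst (euclid_step s) \<le> M" "snd (euclid_step s) \<le> M"
    using Cons.prems by (auto simp: euclid_step_def intro: le_trans[OF mod_less_eq_dividend])
  then show ?case using Cons.IH[of "euclid_step s"] by simp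
qed simp

text \<open>Two division steps at least halve the second component, so 2k rounds remove k binary
  digits.\<close>

lemma euclid_terminates:
  "snd s < 2 ^ k \<Longrightarrow> length ks = 2 * k \<Longrightarrow> snd (foldl (\<lambda>s _. euclid_step s) s ks) = 0"
proof (induction k arbitrary: s ks)
  case (Suc k)
  then obtain a b ks' where ks: "ks = a # b # ks'" "length ks' = 2 * k"
    by (cases ks; cases "tl ks") auto
  have "snd (euclid_step (euclid_step s)) < 2 ^ k"
  proof (cases "snd s = 0 \<or> fst s mod snd s = 0")
    case False
    define r where "r = fst s mod snd s"
    have r: "0 < r" "r < snd s" using False by (auto simp: r_def)
    \<comment> \<open>The remainder is below r and also at most \<open>snd s - r\<close>; adding the
      two estimates gives the halving.\<close>
    have "snd s mod r < r" using r by simp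
    moreover have "snd s mod r \<le> snd s - r" using r by (metis le_mod_geq less_imp_le mod_less_eq_dividend)
    ultimately have "2 * (snd s mod r) < snd s" using r by linarith
    moreover have "snd (euclid_step (euclid_step s)) = snd s mod r"
      using False by (simp add: euclid_step_def r_def)
    ultimately show ?thesis using Suc.prems by simp
  qed (auto simp: euclid_step_def)
  from Suc.IH[OF this ks(2)] show ?case by (simp add: ks)
qed simp

lemma polytime_nat_gcd [polytime_intros]:
  fixes m n :: "'a::coded \<Rightarrow> nat"
  assumes m: "polytime m" and n: "polytime n" shows "polytime (\<lambda>x. gcd (m x) (n x))"
proof -
  obtain a where a: "\<And>x. sz (m x) \<le> (sz x + 2) ^ a" using polytime_szE[OF m] by blast
  obtain b where b: "\<And>x. sz (n x) \<le> (sz x + 2) ^ b" using polytime_szE[OF n] by blast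
  have "polytime (\<lambda>x. foldl (\<lambda>s (_::bool). euclid_step s) (m x, n x) (bits (n x) @ bits (n x)))"
  proof (rule polytime_foldl[where g = "\<lambda>x s _. euclid_step s" and S = "\<lambda>n. 8 * ((n + 2) ^ a + (n + 2) ^ b) + 10"])
    fix x i
    define r where "r = foldl (\<lambda>s (_::bool). euclid_step s) (m x, n x) (take i (bits (n x) @ bits (n x)))"
    have *: "sz y \<le> 4 * (sz p + sz q) + 1" if "y \<le> max p q" for y p q :: nat
      using sz_nat_mono[of y p] sz_nat_mono[of y q] that by (auto simp: le_max_iff_disj)
    have "sz (fst r) \<le> 4 * (sz (m x) + sz (n x)) + 1" "sz (snd r) \<le> 4 * (sz (m x) + sz (n x)) + 1"
      using euclid_bound[of "(m x, n x)" "max (m x) (n x)" "take i (bits (n x) @ bits (n x))"]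
      unfolding r_def by (simp_all only: fst_conv snd_conv max.cobounded1 max.cobounded2 *)
    moreover have "sz r = sz (fst r) + sz (snd r) + 1" by (metis prod.collapse sz_simps(1))
    ultimately show "sz (foldl (\<lambda>s (_::bool). euclid_step s) (m x, n x) (take i (bits (n x) @ bits (n x))))
      \<le> 8 * ((sz x + 2) ^ a + (sz x + 2) ^ b) + 10"
      unfolding r_def[symmetric] using a[of x] b[of x] by simp
    show "polytime (\<lambda>p :: 'a \<times> (nat \<times> nat) \<times> bool. euclid_step (fst (snd p)))"
      unfolding euclid_step_def by (intro polytime_intros)
  qed (intro polytime_intros poly_bounded_intros assms)+
  moreover have "gcd (m x) (n x) = fst (foldl (\<lambda>s (_::bool). euclid_step s) (m x, n x) (bits (n x) @ bits (n x)))" for x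
    using euclid_inv[of "(m x, n x)" "bits (n x) @ bits (n x)"]
      euclid_terminates[of "(m x, n x)" "size_nat (n x)" "bits (n x) @ bits (n x)"] less_size_nat[of "n x"]
    by (simp add: length_bits)
  ultimately show ?thesis using polytime_fst by fastforce
qed

lemma polytime_length [polytime_intros]:
  fixes xs :: "'a::coded \<Rightarrow> 'b::coded list"
  assumes xs: "polytime xs" shows "polytime (\<lambda>x. length (xs x))"
proof -
  obtain a where a: "\<And>x. sz (xs x) \<le> (sz x + 2) ^ a" using polytime_szE[OF xs] by blast
  have e: "foldl (\<lambda>s _. s + 1) n ys = n + length ys" for n and ys :: "'b list"
    by (induction ys arbitrary: n) auto
  have "polytime (\<lambda>x. foldl (\<lambda>s (_::'b). s + 1) (0::nat) (xs x))"
  proof (rule polytime_foldl[where g = "\<lambda>x s _. s + 1" and S = "\<lambda>n. 4 * (n + 2) ^ a + 1"])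
    fix x i
    show "sz (foldl (\<lambda>s (_::'b). s + 1) (0::nat) (take i (xs x))) \<le> 4 * (sz x + 2) ^ a + 1"
      unfolding e using sz_nat_le[of "length (take i (xs x))"] size_nat_le_self[of "length (take i (xs x))"]
         length_le_sz[of "xs x"] a[of x] by simp
  qed (intro polytime_intros poly_bounded_intros assms)+
  then show ?thesis unfolding e by simp
qed

section \<open>Integers and rationals\<close>

lemma polytime_int_neg [polytime_intros]: assumes "polytime i" shows "polytime (\<lambda>x. i x < (0::int))"
proof (rule polytime_comp[OF _ assms], rule polytime_recode)
  show "polytime (\<lambda>p :: bool \<times> nat. fst p)" by (intro polytime_intros)
  show "\<exists>p :: bool \<times> nat. cd i = cd p \<and> cd (i < 0) = cd (fst p)" for i :: int
    by (rule exI[of _ "(i < 0, nat \<bar>i\<bar>)"]) (simp add: cd_int_def)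
qed

lemma polytime_nat_abs [polytime_intros]: assumes "polytime i" shows "polytime (\<lambda>x. nat \<bar>i x :: int\<bar>)"
proof (rule polytime_comp[OF _ assms], rule polytime_recode)
  show "polytime (\<lambda>p :: bool \<times> nat. snd p)" by (intro polytime_intros)
  show "\<exists>p :: bool \<times> nat. cd i = cd p \<and> cd (nat \<bar>i\<bar>) = cd (snd p)" for i :: int
    by (rule exI[of _ "(i < 0, nat \<bar>i\<bar>)"]) (simp add: cd_int_def)
qed

lemma polytime_signed:
  assumes "polytime b" "polytime n" shows "polytime (\<lambda>x. if b x then - int (n x) else int (n x))"
  by (rule polytime_out[of "\<lambda>x. (b x \<and> n x \<noteq> 0, n x)"], intro polytime_intros assms)
    (auto simp: cd_int_def)

lemma polytime_int_of_nat [polytime_intros]: "polytime n \<Longrightarrow> polytime (\<lambda>x. int (n x))"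
  using polytime_signed[of "\<lambda>x. False" n] by (simp add: polytime_const)

lemma polytime_int_uminus [polytime_intros]:
  assumes "polytime i" shows "polytime (\<lambda>x. - (i x :: int))"
proof (rule polytime_cong)
  show "polytime (\<lambda>x. if \<not> i x < 0 then - int (nat \<bar>i x\<bar>) else int (nat \<bar>i x\<bar>))"
    by (intro polytime_signed polytime_intros assms)
qed auto

lemma polytime_nat [polytime_intros]:
  assumes "polytime i" shows "polytime (\<lambda>x. nat (i x))"
proof (rule polytime_cong)
  show "polytime (\<lambda>x. if i x < 0 then 0 else nat \<bar>i x\<bar>)" by (intro polytime_intros assms)
qed auto

lemma polytime_int_add [polytime_intros]:
  assumes "polytime i" "polytime j" shows "polytime (\<lambda>x. i x + j x :: int)"
proof (rule polytime_cong)
  let ?p = "\<lambda>x. nat (i x) + nat (j x)" and ?m = "\<lambda>x. nat (- i x) + nat (- j x)"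
  show "polytime (\<lambda>x. if ?p x < ?m x then - int (?m x - ?p x) else int (?p x - ?m x))"
    by (intro polytime_intros assms)
  show "i x + j x = (if ?p x < ?m x then - int (?m x - ?p x) else int (?p x - ?m x))" for x
    by (cases "0 \<le> i x"; cases "0 \<le> j x") auto
qed

lemma polytime_int_diff [polytime_intros]: "polytime i \<Longrightarrow> polytime j \<Longrightarrow> polytime (\<lambda>x. i x - j x :: int)"
  using polytime_int_add[of i "\<lambda>x. - j x"] by (simp add: polytime_int_uminus)

lemma polytime_int_mult [polytime_intros]:
  assumes "polytime i" "polytime j" shows "polytime (\<lambda>x. i x * j x :: int)"
proof (rule polytime_cong)
  show "polytime (\<lambda>x. if (i x < 0) = (\<not> j x < 0) then - int (nat \<bar>i x\<bar> * nat \<bar>j x\<bar>) else int (nat \<bar>i x\<bar> * nat \<bar>j x\<bar>))"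
    by (intro polytime_intros assms)
  show "i x * j x = (if (i x < 0) = (\<not> j x < 0) then - int (nat \<bar>i x\<bar> * nat \<bar>j x\<bar>) else int (nat \<bar>i x\<bar> * nat \<bar>j x\<bar>))" for x
    by (auto simp: abs_if)
qed

lemma polytime_int_less [polytime_intros]: "polytime i \<Longrightarrow> polytime j \<Longrightarrow> polytime (\<lambda>x. i x < (j x :: int))"
  by (rule polytime_cong[OF polytime_int_neg[OF polytime_int_diff]]) auto

lemma polytime_quotient_of [polytime_intros]: assumes "polytime q" shows "polytime (\<lambda>x. quotient_of (q x))"
proof (rule polytime_comp[OF _ assms], rule polytime_recode)
  show "polytime (\<lambda>t :: bool \<times> nat \<times> nat. ((fst t, fst (snd t)), False, snd (snd t)))"
    by (intro polytime_intros)
  fix q :: rat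
  have "0 < snd (quotient_of q)" by (rule quotient_of_denom_pos')
  then show "\<exists>t :: bool \<times> nat \<times> nat. cd q = cd t \<and> cd (quotient_of q) = cd ((fst t, fst (snd t)), False, snd (snd t))"
    by (intro exI[of _ "(fst (quotient_of q) < 0, nat \<bar>fst (quotient_of q)\<bar>, nat (snd (quotient_of q)))"])
      (auto simp: cd_rat cd_int_def cd_prod_def[of "quotient_of q"])
qed

text \<open>Cancelling by the gcd gives the pair in lowest terms that the code of a rational stores.
  A zero denominator denotes 0 by convention, with code (False, 0, 1).\<close>

lemma polytime_Fract [polytime_intros]:
  assumes i: "polytime i" and d: "polytime d" shows "polytime (\<lambda>x. Fract (i x) (int (d x)))"
proof (rule polytime_out)
  let ?f = "\<lambda>x. let n = nat \<bar>i x\<bar>; g = gcd n (d x) in 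
     if d x = 0 then (False, 0, 1) else (i x < 0, n div g, d x div g)"
  show "polytime ?f" by (intro polytime_intros assms)
  fix x
  show "cd (Fract (i x) (int (d x))) = cd (?f x)"
  proof (cases "d x = 0")
    case True
    then show ?thesis by (simp add: rat_number_collapse cd_rat)
  next
    case False
    define g where "g = gcd (nat \<bar>i x\<bar>) (d x)"
    have g: "int g = gcd (i x) (int (d x))" by (simp add: g_def flip: gcd_int_int_eq)
    have g0: "g \<noteq> 0" unfolding g_def using False by (metis gcd_eq_0_iff)
    have q: "quotient_of (Fract (i x) (int (d x))) = (i x div int g, int (d x) div int g)"
      unfolding g quotient_of_Fract normalize_def using False by (simp add: Let_def)
    have dv: "int g dvd i x" unfolding g by simp
    have "(i x div int g < 0) = (i x < 0)"
    proof -
      obtain c where "i x = int g * c" using dv by (auto simp: dvd_def)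
      then show ?thesis using g0 by (simp add: mult_less_0_iff)
    qed
    moreover have "nat \<bar>i x div int g\<bar> = nat \<bar>i x\<bar> div g"
    proof -
      obtain c where "i x = int g * c" using dv by (auto simp: dvd_def)
      then show ?thesis using g0 by (simp add: abs_mult nat_mult_distrib)
    qed
    moreover have "nat (int (d x) div int g) = d x div g" by (simp flip: zdiv_int)
    moreover have "?f x = (i x < 0, nat \<bar>i x\<bar> div g, d x div g)"
      using False by (simp only: Let_def g_def if_False)
    ultimately show ?thesis unfolding cd_rat q fst_conv snd_conv by (simp only:)
  qed
qed

lemma rat_eq_Fract: "q = Fract (fst (quotient_of q)) (int (nat (snd (quotient_of q))))"
  using quotient_of_denom_pos'[of q] quotient_of_div[of q] by (simp add: Fract_of_int_quotient prod_eq_iff)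

lemma polytime_rat_add [polytime_intros]:
  assumes "polytime p" "polytime q" shows "polytime (\<lambda>x. p x + q x :: rat)"
proof (rule polytime_cong)
  let ?a = "\<lambda>x. fst (quotient_of (p x))" and ?b = "\<lambda>x. snd (quotient_of (p x))"
  let ?c = "\<lambda>x. fst (quotient_of (q x))" and ?d = "\<lambda>x. snd (quotient_of (q x))"
  show "polytime (\<lambda>x. Fract (?a x * ?d x + ?c x * ?b x) (int (nat (?b x) * nat (?d x))))"
    by (intro polytime_intros assms)
  fix x
  have "0 < ?b x" "0 < ?d x" by (rule quotient_of_denom_pos')+
  then show "p x + q x = Fract (?a x * ?d x + ?c x * ?b x) (int (nat (?b x) * nat (?d x)))"
    by (intro quotient_of_inject) (simp add: rat_plus_code quotient_of_Fract Let_def case_prod_beta mult.commute)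
qed

lemma polytime_rat_uminus [polytime_intros]:
  assumes "polytime q" shows "polytime (\<lambda>x. - q x :: rat)"
proof (rule polytime_cong)
  show "polytime (\<lambda>x. Fract (- fst (quotient_of (q x))) (int (nat (snd (quotient_of (q x))))))"
    by (intro polytime_intros assms)
  show "- q x = Fract (- fst (quotient_of (q x))) (int (nat (snd (quotient_of (q x)))))" for x
    by (subst rat_eq_Fract[of "q x"]) simp
qed

lemma polytime_rat_diff [polytime_intros]: "polytime p \<Longrightarrow> polytime q \<Longrightarrow> polytime (\<lambda>x. p x - q x :: rat)"
  using polytime_rat_add[of p "\<lambda>x. - q x"] by (simp add: polytime_rat_uminus)

lemma polytime_rat_less [polytime_intros]:
  assumes "polytime p" "polytime q" shows "polytime (\<lambda>x. p x < (q x :: rat))"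
proof (rule polytime_cong)
  let ?a = "\<lambda>x. fst (quotient_of (p x))" and ?b = "\<lambda>x. snd (quotient_of (p x))"
  let ?c = "\<lambda>x. fst (quotient_of (q x))" and ?d = "\<lambda>x. snd (quotient_of (q x))"
  show "polytime (\<lambda>x. ?a x * ?d x < ?c x * ?b x)"
    by (intro polytime_intros assms)
  fix x
  show "(p x < q x) = (?a x * ?d x < ?c x * ?b x)"
    by (simp add: rat_less_code case_prod_beta mult.commute)
qed

lemma polytime_rat_le [polytime_intros]: "polytime p \<Longrightarrow> polytime q \<Longrightarrow> polytime (\<lambda>x. p x \<le> (q x :: rat))"
  by (rule polytime_cong[OF polytime_not[OF polytime_rat_less[of q p]]]) auto

section \<open>Polynomial-time operations on concepts\<close>

text \<open>The unary constructor tag of the encoding, read as a list of units, so that testing for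
  a constructor is comparing with a constant.\<close>

primrec ctag :: "concept \<Rightarrow> unit list" where
  "ctag (Atom p) = []"
| "ctag (Const c) = [()]"
| "ctag (Neg C) = [(), ()]"
| "ctag (Ominus C c) = [(), (), ()]"
| "ctag (And C D) = [(), (), (), ()]"
| "ctag (Ex R C) = [(), (), (), (), ()]"

text \<open>Selectors are made total by returning the argument, or a small constant, where the
  component does not exist; \<open>polytime_case_concept\<close> uses each selector only under the
  matching tag.\<close>

primrec csub :: "concept \<Rightarrow> concept" where
  "csub (Atom p) = Atom p"
| "csub (Const c) = Const c"
| "csub (Neg C) = C"
| "csub (Ominus C c) = C"
| "csub (And C D) = C"
| "csub (Ex R C) = C"

primrec csub2 :: "concept \<Rightarrow> concept" where
  "csub2 (Atom p) = Atom p"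
| "csub2 (Const c) = Const c"
| "csub2 (Neg C) = C"
| "csub2 (Ominus C c) = C"
| "csub2 (And C D) = D"
| "csub2 (Ex R C) = C"

primrec cname :: "concept \<Rightarrow> nat" where
  "cname (Atom p) = p"
| "cname (Const c) = 0"
| "cname (Neg C) = 0"
| "cname (Ominus C c) = 0"
| "cname (And C D) = 0"
| "cname (Ex R C) = R"

primrec crat :: "concept \<Rightarrow> rat" where
  "crat (Atom p) = 0"
| "crat (Const c) = c"
| "crat (Neg C) = 0"
| "crat (Ominus C c) = c"
| "crat (And C D) = 0"
| "crat (Ex R C) = 0"

lemma enc_tag_unfold: "enc_tag (Suc n) = Nd Lf (enc_tag n)" "enc_tag 0 = Lf"
  by (simp_all add: enc_tag_def)

lemma cd_concept_simps:
  "cd (Atom p) = Nd Lf (cd p)"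
  "cd (Const c) = Nd (Nd Lf Lf) (cd c)"
  "cd (Neg C) = Nd (Nd Lf (Nd Lf Lf)) (cd C)"
  "cd (Ominus C c) = Nd (Nd Lf (Nd Lf (Nd Lf Lf))) (Nd (cd C) (cd c))"
  "cd (And C D) = Nd (Nd Lf (Nd Lf (Nd Lf (Nd Lf Lf)))) (Nd (cd C) (cd D))"
  "cd (Ex R C) = Nd (Nd Lf (Nd Lf (Nd Lf (Nd Lf (Nd Lf Lf))))) (Nd (cd R) (cd C))"
  by (simp_all add: cd_concept_def cd_nat_def cd_rat_def eval_nat_numeral enc_tag_unfold)

lemma cd_assertion_simps: "cd (Assert C r c) = Nd (cd r) (Nd (cd C) (cd c))"
  by (simp add: cd_assertion_def cd_concept_def cd_cmp_def cd_rat_def)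

lemma cd_cmp_simps: "cd Lt = Lf" "cd Le = Nd Lf Lf" "cd Gt = Nd Lf (Nd Lf Lf)" "cd Ge = Nd Lf (Nd Lf (Nd Lf Lf))"
  by (simp_all add: cd_cmp_def eval_nat_numeral enc_tag_unfold)

text \<open>
  In the branch for the \<open>i\<close>-th constructor, variable \<open>2 * i + 1\<close> is the payload and variable
  \<open>2 * i + 2\<close> the whole concept.
\<close>

definition ccase :: "expr \<Rightarrow> expr \<Rightarrow> expr \<Rightarrow> expr \<Rightarrow> expr \<Rightarrow> expr \<Rightarrow> expr" where
  "ccase e0 e1 e2 e3 e4 e5 = Case (V 0) ELf (Case (V 0) e0 (Case (V 1) e1 (Case (V 1) e2
     (Case (V 1) e3 (Case (V 1) e4 e5)))))"

lemma ccase: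
  assumes
    "\<And>p. C = Atom p \<Longrightarrow> eval_le P [Lf, cd p, cd C] e0 v t"
    "\<And>c. C = Const c \<Longrightarrow> eval_le P [Lf, Lf, Nd Lf Lf, cd c, cd C] e1 v t"
    "\<And>D. C = Neg D \<Longrightarrow> eval_le P [Lf, Lf, Lf, Nd Lf Lf, Nd Lf (Nd Lf Lf), cd D, cd C] e2 v t"
    "\<And>D c. C = Ominus D c \<Longrightarrow> eval_le P [Lf, Lf, Lf, Nd Lf Lf, Lf, Nd Lf (Nd Lf Lf), Nd Lf (Nd Lf (Nd Lf Lf)),
        Nd (cd D) (cd c), cd C] e3 v t"
    "\<And>D E. C = And D E \<Longrightarrow> eval_le P [Lf, Lf, Lf, Nd Lf Lf, Lf, Nd Lf (Nd Lf Lf), Lf, Nd Lf (Nd Lf (Nd Lf Lf)),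
        Nd Lf (Nd Lf (Nd Lf (Nd Lf Lf))), Nd (cd D) (cd E), cd C] e4 v t"
    "\<And>R D. C = Ex R D \<Longrightarrow> eval_le P [Lf, Lf, Lf, Nd Lf Lf, Lf, Nd Lf (Nd Lf Lf), Lf, Nd Lf (Nd Lf (Nd Lf Lf)),
        Lf, Nd Lf (Nd Lf (Nd Lf (Nd Lf Lf))), Nd Lf (Nd Lf (Nd Lf (Nd Lf (Nd Lf Lf)))),
        Nd (cd R) (cd D), cd C] e5 v t"
  shows "eval_le P [cd C] (ccase e0 e1 e2 e3 e4 e5) v (t + 12)"
proof -
  have n: "eval_le P \<rho> (Case (V i) a b) v (s + 2)" if "i < length \<rho>" "\<rho> ! i = Nd y z" "eval_le P (y # z # \<rho>) b v s" for \<rho> i a b y z s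
    using eval_le_Case_Nd[OF eval_le_V[OF that(1,2)] that(3), of a] by (simp add: eval_le_mono)
  have l: "eval_le P \<rho> (Case (V i) a b) v (s + 2)" if "i < length \<rho>" "\<rho> ! i = Lf" "eval_le P \<rho> a v s" for \<rho> i a b s
    using eval_le_Case_Lf[OF eval_le_V[OF that(1,2)] that(3), of b] by (simp add: eval_le_mono)
  show ?thesis
  proof (cases C)
    case (Atom p)
    have "eval_le P [cd C] (ccase e0 e1 e2 e3 e4 e5) v (t + 2 + 2)" unfolding ccase_def
      by (rule n[where y = Lf and z = "cd p"], simp, simp add: Atom cd_concept_simps, rule l) (use assms(1)[OF Atom] in auto)
    then show ?thesis by (rule eval_le_mono) simp
  next
    case (Const c)
    have "eval_le P [cd C] (ccase e0 e1 e2 e3 e4 e5) v (t + 2 + 2 + 2)" unfolding ccase_def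
      by (rule n[where y = "Nd Lf Lf" and z = "cd c"], simp, simp add: Const cd_concept_simps,
          rule n, simp, simp, rule l) (use assms(2)[OF Const] in auto)
    then show ?thesis by (rule eval_le_mono) simp
  next
    case (Neg D)
    have "eval_le P [cd C] (ccase e0 e1 e2 e3 e4 e5) v (t + 2 + 2 + 2 + 2)" unfolding ccase_def
      by (rule n[where y = "Nd Lf (Nd Lf Lf)" and z = "cd D"], simp, simp add: Neg cd_concept_simps,
          rule n, simp, simp, rule n, simp, simp, rule l) (use assms(3)[OF Neg] in auto)
    then show ?thesis by (rule eval_le_mono) simp
  next
    case (Ominus D c)
    have "eval_le P [cd C] (ccase e0 e1 e2 e3 e4 e5) v (t + 2 + 2 + 2 + 2 + 2)" unfolding ccase_def
      by (rule n[where y = "Nd Lf (Nd Lf (Nd Lf Lf))" and z = "Nd (cd D) (cd c)"], simp, simp add: Ominus cd_concept_simps,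
          rule n, simp, simp, rule n, simp, simp, rule n, simp, simp, rule l) (use assms(4)[OF Ominus] in auto)
    then show ?thesis by (rule eval_le_mono) simp
  next
    case (And D E)
    have "eval_le P [cd C] (ccase e0 e1 e2 e3 e4 e5) v (t + 2 + 2 + 2 + 2 + 2 + 2)" unfolding ccase_def
      by (rule n[where y = "Nd Lf (Nd Lf (Nd Lf (Nd Lf Lf)))" and z = "Nd (cd D) (cd E)"], simp, simp add: And cd_concept_simps,
          rule n, simp, simp, rule n, simp, simp, rule n, simp, simp, rule n, simp, simp, rule l)
        (use assms(5)[OF And] in auto)
    then show ?thesis by (rule eval_le_mono) simp
  next
    case (Ex R D)
    have "eval_le P [cd C] (ccase e0 e1 e2 e3 e4 e5) v (t + 2 + 2 + 2 + 2 + 2 + 2)" unfolding ccase_def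
      by (rule n[where y = "Nd Lf (Nd Lf (Nd Lf (Nd Lf (Nd Lf Lf))))" and z = "Nd (cd R) (cd D)"], simp, simp add: Ex cd_concept_simps,
          rule n, simp, simp, rule n, simp, simp, rule n, simp, simp, rule n, simp, simp, rule n, simp, simp)
        (use assms(6)[OF Ex] in auto)
    then show ?thesis by (rule eval_le_mono) simp
  qed
qed

lemma polytime_ccase:
  fixes f :: "concept \<Rightarrow> 'b::coded"
  assumes "\<And>C. eval_le [] [cd C] (ccase e0 e1 e2 e3 e4 e5) (cd (f C)) (t + 12)" "\<And>C. sz (f C) \<le> sz C + t" "polytime s"
  shows "polytime (\<lambda>x. f (s x))"
proof (rule polytime_comp[OF _ assms(3)], rule polytimeI)
  show "time_bounded (\<lambda>n. n + t + 12) f"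
    by (rule time_boundedI[where R = "[]"], rule eval_le_mono, rule assms(1), simp) (rule order_trans[OF assms(2)], simp)
qed (intro poly_bounded_intros)

lemma sz_concept_simps:
  "sz (Atom p) = sz p + 2" "sz (Const c) = sz c + 4" "sz (Neg C) = sz C + 6"
  "sz (Ominus C c) = sz C + sz c + 9" "sz (And C D) = sz C + sz D + 11" "sz (Ex R C) = sz R + sz C + 13"
  by (simp_all add: sz_def cd_concept_simps)

lemma eval_le_fst: "i < length \<rho> \<Longrightarrow> \<rho> ! i = Nd y z \<Longrightarrow> eval_le P \<rho> (Case (V i) ELf (V 0)) y 3"
  using eval_le_Case_Nd[OF eval_le_V[of i \<rho> "Nd y z"] eval_le_V[of 0 "y # z # \<rho>" y], of P ELf] by (simp add: eval_nat_numeral)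

lemma eval_le_snd: "i < length \<rho> \<Longrightarrow> \<rho> ! i = Nd y z \<Longrightarrow> eval_le P \<rho> (Case (V i) ELf (V 1)) z 3"
  using eval_le_Case_Nd[OF eval_le_V[of i \<rho> "Nd y z"] eval_le_V[of 1 "y # z # \<rho>" z], of P ELf] by (simp add: eval_nat_numeral)

lemma eval_le_V': "i < length \<rho> \<Longrightarrow> \<rho> ! i = v \<Longrightarrow> 1 \<le> t \<Longrightarrow> eval_le P \<rho> (V i) v t"
  using eval_le_V eval_le_mono by blast

lemma eval_le_fst': "i < length \<rho> \<Longrightarrow> \<rho> ! i = Nd y z \<Longrightarrow> 3 \<le> t \<Longrightarrow> eval_le P \<rho> (Case (V i) ELf (V 0)) y t"
  using eval_le_fst eval_le_mono by blast

lemma eval_le_snd': "i < length \<rho> \<Longrightarrow> \<rho> ! i = Nd y z \<Longrightarrow> 3 \<le> t \<Longrightarrow> eval_le P \<rho> (Case (V i) ELf (V (Suc 0))) z t"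
  using eval_le_snd[of i \<rho> y z P] eval_le_mono by simp

lemma eval_le_quote': "tsize v \<le> t \<Longrightarrow> eval_le P \<rho> (quote v) v t"
  using eval_le_quote eval_le_mono by blast

lemma polytime_csub [polytime_intros]: "polytime s \<Longrightarrow> polytime (\<lambda>x. csub (s x))"
proof (erule polytime_ccase[rotated 2])
  fix C
  show "eval_le [] [cd C] (ccase (V 2) (V 4) (V 5) (Case (V 7) ELf (V 0)) (Case (V 9) ELf (V 0)) (Case (V 11) ELf (V 1)))
     (cd (csub C)) (3 + 12)"
    by (rule ccase) (auto intro!: eval_le_V' eval_le_fst' eval_le_snd')
  show "sz (csub C) \<le> sz C + 3" by (cases C) (auto simp: sz_concept_simps)
qed

lemma polytime_csub2 [polytime_intros]: "polytime s \<Longrightarrow> polytime (\<lambda>x. csub2 (s x))"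
proof (erule polytime_ccase[rotated 2])
  fix C
  show "eval_le [] [cd C] (ccase (V 2) (V 4) (V 5) (Case (V 7) ELf (V 0)) (Case (V 9) ELf (V 1)) (Case (V 11) ELf (V 1)))
     (cd (csub2 C)) (3 + 12)"
    by (rule ccase) (auto intro!: eval_le_V' eval_le_fst' eval_le_snd')
  show "sz (csub2 C) \<le> sz C + 3" by (cases C) (auto simp: sz_concept_simps)
qed

lemma polytime_cname [polytime_intros]: "polytime s \<Longrightarrow> polytime (\<lambda>x. cname (s x))"
proof (erule polytime_ccase[rotated 2])
  fix C
  let ?q = "quote (cd (0::nat))"
  have "tsize (cd (0::nat)) \<le> 3" by (simp add: cd_nat)
  then show "eval_le [] [cd C] (ccase (V 1) ?q ?q ?q ?q (Case (V 11) ELf (V 0))) (cd (cname C)) (3 + 12)"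
    by (intro ccase) (auto intro!: eval_le_V' eval_le_fst' eval_le_quote')
  show "sz (cname C) \<le> sz C + 3" by (cases C) (auto simp: sz_concept_simps sz_nat_unfold[of 0])
qed

lemma polytime_crat [polytime_intros]: "polytime s \<Longrightarrow> polytime (\<lambda>x. crat (s x))"
proof (erule polytime_ccase[rotated 2])
  fix C
  let ?q = "quote (cd (0::rat))"
  show "eval_le [] [cd C] (ccase ?q (V 3) ?q (Case (V 7) ELf (V 1)) ?q ?q) (cd (crat C)) ((3 + sz (0::rat)) + 12)"
    by (rule ccase) (auto intro!: eval_le_V' eval_le_snd' eval_le_quote' simp: sz_def)
  show "sz (crat C) \<le> sz C + (3 + sz (0::rat))" by (cases C) (auto simp: sz_concept_simps)
qed

lemma polytime_ctag [polytime_intros]: assumes "polytime s" shows "polytime (\<lambda>x. ctag (s x))"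
proof (rule polytime_comp[OF _ assms], rule polytime_recode)
  show "polytime (\<lambda>p :: unit list \<times> tree. fst p)" by (intro polytime_intros)
  show "\<exists>p :: unit list \<times> tree. cd C = cd p \<and> cd (ctag C) = cd (fst p)" for C
    by (rule exI[of _ "(ctag C, case cd C of Nd a b \<Rightarrow> b)"], cases C) (auto simp: cd_concept_simps)
qed

text \<open>Pattern matching is reassembled from tag tests and total selectors, so that definitions
  by cases on a concept are handled by the introduction rules.\<close>

lemma polytime_case_concept [polytime_intros]:
  assumes "polytime s" "polytime (\<lambda>p. f0 (fst p) (snd p))" "polytime (\<lambda>p. f1 (fst p) (snd p))" "polytime (\<lambda>p. f2 (fst p) (snd p))"
    "polytime (\<lambda>p. f3 (fst p) (fst (snd p)) (snd (snd p)))" "polytime (\<lambda>p. f4 (fst p) (fst (snd p)) (snd (snd p)))"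
    "polytime (\<lambda>p. f5 (fst p) (fst (snd p)) (snd (snd p)))"
  shows "polytime (\<lambda>x. case s x of Atom p \<Rightarrow> f0 x p | Const c \<Rightarrow> f1 x c | Neg C \<Rightarrow> f2 x C | Ominus C c \<Rightarrow> f3 x C c
     | And C D \<Rightarrow> f4 x C D | Ex R C \<Rightarrow> f5 x R C)"
proof (rule polytime_cong)
  have *: "polytime (\<lambda>x. f x (a x))" if "polytime (\<lambda>p. f (fst p) (snd p))" "polytime a" for f :: "'a \<Rightarrow> 'q::coded \<Rightarrow> 'b" and a
    using polytime_comp[OF that(1) polytime_pair[OF polytime_id that(2)]] by simp
  have **: "polytime (\<lambda>x. f x (a x) (b x))" if "polytime (\<lambda>p. f (fst p) (fst (snd p)) (snd (snd p)))" "polytime a" "polytime b"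
    for f :: "'a \<Rightarrow> 'q::coded \<Rightarrow> 'r::coded \<Rightarrow> 'b" and a b
    using polytime_comp[OF that(1) polytime_pair[OF polytime_id polytime_pair[OF that(2,3)]]] by simp
  let ?t = "\<lambda>x. ctag (s x)"
  show "polytime (\<lambda>x. if ?t x = [] then f0 x (cname (s x)) else if ?t x = [()] then f1 x (crat (s x))
    else if ?t x = [(), ()] then f2 x (csub (s x)) else if ?t x = [(), (), ()] then f3 x (csub (s x)) (crat (s x))
    else if ?t x = [(), (), (), ()] then f4 x (csub (s x)) (csub2 (s x)) else f5 x (cname (s x)) (csub (s x)))"
    by (intro polytime_if polytime_eq polytime_ctag polytime_const assms(1) *[OF assms(2) polytime_cname[OF assms(1)]]
        *[OF assms(3) polytime_crat[OF assms(1)]] *[OF assms(4) polytime_csub[OF assms(1)]]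
        **[OF assms(5) polytime_csub[OF assms(1)] polytime_crat[OF assms(1)]]
        **[OF assms(6) polytime_csub[OF assms(1)] polytime_csub2[OF assms(1)]]
        **[OF assms(7) polytime_cname[OF assms(1)] polytime_csub[OF assms(1)]])
qed (auto split: concept.splits)

lemma polytime_Atom [polytime_intros]: "polytime f \<Longrightarrow> polytime (\<lambda>x. Atom (f x))"
  by (rule polytime_out[OF polytime_pair[OF polytime_const[of "Lf"]]]) (auto simp: cd_concept_simps)

lemma polytime_Const [polytime_intros]: "polytime f \<Longrightarrow> polytime (\<lambda>x. Const (f x))"
  by (rule polytime_out[OF polytime_pair[OF polytime_const[of "[()]"]]]) (auto simp: cd_concept_simps)

lemma polytime_Neg [polytime_intros]: "polytime f \<Longrightarrow> polytime (\<lambda>x. Neg (f x))"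
  by (rule polytime_out[OF polytime_pair[OF polytime_const[of "[(), ()]"]]]) (auto simp: cd_concept_simps)

lemma polytime_Ominus [polytime_intros]: "polytime f \<Longrightarrow> polytime g \<Longrightarrow> polytime (\<lambda>x. Ominus (f x) (g x))"
  by (rule polytime_out[OF polytime_pair[OF polytime_const[of "[(), (), ()]"] polytime_pair]]) (auto simp: cd_concept_simps)

lemma polytime_And [polytime_intros]: "polytime f \<Longrightarrow> polytime g \<Longrightarrow> polytime (\<lambda>x. And (f x) (g x))"
  by (rule polytime_out[OF polytime_pair[OF polytime_const[of "[(), (), (), ()]"] polytime_pair]]) (auto simp: cd_concept_simps)

lemma polytime_Or [polytime_intros]: "polytime f \<Longrightarrow> polytime g \<Longrightarrow> polytime (\<lambda>x. Or (f x) (g x))"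
  unfolding Or_def by (intro polytime_intros)

lemma polytime_Oplus [polytime_intros]: "polytime f \<Longrightarrow> polytime g \<Longrightarrow> polytime (\<lambda>x. Oplus (f x) (g x))"
  unfolding Oplus_def by (intro polytime_intros)

section \<open>Assertions and comparisons\<close>

primrec cmp_of :: "assertion \<Rightarrow> cmp" where "cmp_of (Assert C r c) = r"
primrec bound_of :: "assertion \<Rightarrow> rat" where "bound_of (Assert C r c) = c"

lemma polytime_Assert [polytime_intros]: "polytime f \<Longrightarrow> polytime r \<Longrightarrow> polytime g \<Longrightarrow> polytime (\<lambda>x. Assert (f x) (r x) (g x))"
  by (rule polytime_out[OF polytime_pair[OF _ polytime_pair]]) (auto simp: cd_assertion_simps)

lemma polytime_concept_of [polytime_intros]: assumes "polytime s" shows "polytime (\<lambda>x. concept_of (s x))"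
proof (rule polytime_comp[OF _ assms], rule polytime_recode)
  show "polytime (\<lambda>p :: cmp \<times> concept \<times> rat. fst (snd p))" by (intro polytime_intros)
  show "\<exists>p :: cmp \<times> concept \<times> rat. cd A = cd p \<and> cd (concept_of A) = cd (fst (snd p))" for A
    by (rule exI[of _ "(cmp_of A, concept_of A, bound_of A)"], cases A) (auto simp: cd_assertion_simps)
qed

lemma polytime_cmp_of [polytime_intros]: assumes "polytime s" shows "polytime (\<lambda>x. cmp_of (s x))"
proof (rule polytime_comp[OF _ assms], rule polytime_recode)
  show "polytime (\<lambda>p :: cmp \<times> concept \<times> rat. fst p)" by (intro polytime_intros)
  show "\<exists>p :: cmp \<times> concept \<times> rat. cd A = cd p \<and> cd (cmp_of A) = cd (fst p)" for A
    by (rule exI[of _ "(cmp_of A, concept_of A, bound_of A)"], cases A) (auto simp: cd_assertion_simps)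
qed

lemma polytime_bound_of [polytime_intros]: assumes "polytime s" shows "polytime (\<lambda>x. bound_of (s x))"
proof (rule polytime_comp[OF _ assms], rule polytime_recode)
  show "polytime (\<lambda>p :: cmp \<times> concept \<times> rat. snd (snd p))" by (intro polytime_intros)
  show "\<exists>p :: cmp \<times> concept \<times> rat. cd A = cd p \<and> cd (bound_of A) = cd (snd (snd p))" for A
    by (rule exI[of _ "(cmp_of A, concept_of A, bound_of A)"], cases A) (auto simp: cd_assertion_simps)
qed

lemma polytime_flip [polytime_intros]: assumes "polytime r" shows "polytime (\<lambda>x. flip (r x))"
proof (rule polytime_cong)
  show "polytime (\<lambda>x. if r x = Lt then Gt else if r x = Le then Ge else if r x = Gt then Lt else Le)"
    by (intro polytime_intros assms)
  show "flip (r x) = (if r x = Lt then Gt else if r x = Le then Ge else if r x = Gt then Lt else Le)" for x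
    by (cases "r x") auto
qed

lemma polytime_upper [polytime_intros]: "polytime r \<Longrightarrow> polytime (\<lambda>x. upper (r x))"
  unfolding upper_def by (intro polytime_intros)

lemma polytime_lower [polytime_intros]: "polytime r \<Longrightarrow> polytime (\<lambda>x. lower (r x))"
  unfolding lower_def by (intro polytime_intros)

lemma polytime_black [polytime_intros]: "polytime u \<Longrightarrow> polytime l \<Longrightarrow> polytime c \<Longrightarrow> polytime d \<Longrightarrow> polytime (\<lambda>x. black (u x) (l x) (c x) (d x))"
  unfolding black_def by (intro polytime_intros)

lemma polytime_cmp_rel [polytime_intros]:
  assumes "polytime r" "polytime c" "polytime d" shows "polytime (\<lambda>x. cmp_rel (r x) (c x) (d x :: rat))"
proof (rule polytime_cong)
  show "polytime (\<lambda>x. if r x = Lt then c x < d x else if r x = Le then c x \<le> d x else if r x = Gt then d x < c x else d x \<le> c x)"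
    by (intro polytime_intros assms)
  show "cmp_rel (r x) (c x) (d x) = (if r x = Lt then c x < d x else if r x = Le then c x \<le> d x else if r x = Gt then d x < c x else d x \<le> c x)" for x
    by (cases "r x") auto
qed

lemma polytime_mem [polytime_intros]:
  assumes "polytime a" "polytime xs" shows "polytime (\<lambda>x. a x \<in> set (xs x))"
proof (rule polytime_cong)
  show "polytime (\<lambda>x. \<exists>b\<in>set (xs x). b = a x)" by (intro polytime_intros assms polytime_comp[OF assms(1)])
qed auto

lemma polytime_sz [polytime_intros]: "polytime f \<Longrightarrow> polytime (\<lambda>x. sz (f x))"
  using polytime_length[OF polytime_comp[OF polytime_ticks]] by simp

section \<open>Computing the TBox concept\<close>

definition enum :: "'a list \<Rightarrow> (nat \<times> 'a) list" where
  "enum xs = zip [0..<length xs] xs"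

lemma polytime_enum [polytime_intros]:
  fixes xs :: "'x::coded \<Rightarrow> 'a::coded list"
  assumes xs: "polytime xs" shows "polytime (\<lambda>x. enum (xs x))"
proof -
  obtain k where k: "\<And>x. sz (xs x) \<le> (sz x + 2) ^ k" using polytime_szE[OF xs] by blast
  let ?g = "\<lambda>s a. (Suc (fst s), (fst s, a) # snd s)"
  have e: "foldl ?g (0, []) ys = (length ys, rev (enum ys))" for ys :: "'a list"
    by (induction ys rule: rev_induct) (auto simp: enum_def)
  have z: "sz (enum ys) \<le> sz ys + length ys * (4 * length ys + 2)" for ys :: "'a list"
  proof -
    have "sz (zip [m..<m + length ys] ys) \<le> sz ys + length ys * (4 * (m + length ys) + 2)" for m
    proof (induction ys arbitrary: m)
      case (Cons y ys)
      have "sz m \<le> 4 * m + 1" using sz_nat_le[of m] size_nat_le_self[of m] by linarith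
      moreover have "[m..<m + length (y # ys)] = m # [Suc m..<Suc m + length ys]"
        by (subst upt_conv_Cons) (simp_all del: upt_Suc)
      then have "zip [m..<m + length (y # ys)] (y # ys) = (m, y) # zip [Suc m..<Suc m + length ys] ys"
        by (simp only: zip_Cons_Cons)
      ultimately show ?case using Cons[of "Suc m"] by (simp add: algebra_simps)
    qed simp
    from this[of 0] show ?thesis by (simp add: enum_def)
  qed
  have "polytime (\<lambda>x. foldl ?g (0, []) (xs x))"
  proof (rule polytime_foldl[where g = "\<lambda>x. ?g" and S = "\<lambda>n. 5 * (n + 2) ^ k + (n + 2) ^ k * (4 * (n + 2) ^ k + 2) + 5"])
    have *: "polytime (\<lambda>x. Suc (f x))" if "polytime f" for f :: "'b::coded \<Rightarrow> nat"
      using polytime_nat_add[OF that polytime_const[of 1]] by simp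
    show "polytime (\<lambda>p :: 'x \<times> (nat \<times> (nat \<times> 'a) list) \<times> 'a. ?g (fst (snd p)) (snd (snd p)))"
      by (intro polytime_intros *)
    fix x i
    let ?ys = "take i (xs x)"
    have l: "length ?ys \<le> (sz x + 2) ^ k" using length_le_sz[of "xs x"] k[of x] by simp
    have "sz (length ?ys) \<le> 4 * (sz x + 2) ^ k + 1"
      using sz_nat_le[of "length ?ys"] size_nat_le_self[of "length ?ys"] l by linarith
    moreover have "sz (enum ?ys) \<le> (sz x + 2) ^ k + (sz x + 2) ^ k * (4 * (sz x + 2) ^ k + 2)"
      using z[of ?ys] sz_take_le[of i "xs x"] k[of x] l by (meson add_mono le_trans mult_le_mono order_refl)
    ultimately show "sz (foldl ?g (0, []) ?ys) \<le> 5 * (sz x + 2) ^ k + (sz x + 2) ^ k * (4 * (sz x + 2) ^ k + 2) + 5"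
      unfolding e sz_simps sz_rev by linarith
  qed (intro polytime_intros poly_bounded_intros assms)+
  then have "polytime (\<lambda>x. rev (snd (foldl ?g (0, []) (xs x))))" by (intro polytime_intros)
  then show ?thesis by (simp add: e)
qed

text \<open>If a step adds no more than the size of the consumed element and a constant, all states
  remain linear in the input. This discharges the state bound for most loops below.\<close>

lemma foldl_sz_le:
  assumes "\<And>s a. a \<in> set xs \<Longrightarrow> sz (f s a) \<le> sz s + sz a + K"
  shows "sz (foldl f s xs) \<le> sz s + sz xs * (K + 1)"
  using assms
proof (induction xs arbitrary: s)
  case (Cons a xs)
  have "sz (foldl f s (a # xs)) \<le> sz (f s a) + sz xs * (K + 1)" using Cons by simp
  also have "sz (f s a) \<le> sz s + sz a + K" using Cons.prems by simp
  finally show ?case by (simp add: algebra_simps)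
qed simp

lemma polytime_foldl_add:
  fixes g :: "'s::coded \<Rightarrow> 'a::coded \<Rightarrow> 's"
  assumes g: "polytime (\<lambda>p. g (fst p) (snd p))" and s0: "polytime s0" and xs: "polytime xs"
    and K: "\<And>s a. sz (g s a) \<le> sz s + sz a + K"
  shows "polytime (\<lambda>x :: 'x::coded. foldl g (s0 x) (xs x))"
proof -
  obtain k where k: "\<And>x. sz (xs x) \<le> (sz x + 2) ^ k" using polytime_szE[OF xs] by blast
  obtain l where l: "\<And>x. sz (s0 x) \<le> (sz x + 2) ^ l" using polytime_szE[OF s0] by blast
  show ?thesis
  proof (rule polytime_foldl[where g = "\<lambda>x. g" and S = "\<lambda>n. (n + 2) ^ l + (n + 2) ^ k * (K + 1)"])
    show "polytime (\<lambda>p :: 'x \<times> 's \<times> 'a. g (fst (snd p)) (snd (snd p)))"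
      using polytime_comp[OF g polytime_snd[OF polytime_id]] by simp
    fix x i
    have "sz (foldl g (s0 x) (take i (xs x))) \<le> sz (s0 x) + sz (take i (xs x)) * (K + 1)"
      by (rule foldl_sz_le[OF K])
    also have "\<dots> \<le> (sz x + 2) ^ l + (sz x + 2) ^ k * (K + 1)"
      using sz_take_le[of i "xs x"] k[of x] l[of x] by (intro add_mono mult_right_mono) auto
    finally show "sz (foldl g (s0 x) (take i (xs x))) \<le> (sz x + 2) ^ l + (sz x + 2) ^ k * (K + 1)" .
  qed (intro polytime_intros poly_bounded_intros s0 xs)+
qed

text \<open>Loops are left folds; a right-nested join is such a fold over the reversed list, started
  at its first element, the last member of the join.\<close>

lemma big_or_foldl: "big_or Cs = (case rev Cs of [] \<Rightarrow> Const 0 | D # Ds \<Rightarrow> foldl (\<lambda>s C. Or C s) D Ds)"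
proof (induction Cs rule: big_or.induct)
  case (3 C D Cs)
  obtain E Es where E: "rev (D # Cs) = E # Es" by (cases "rev (D # Cs)") auto
  then have "rev (C # D # Cs) = E # (Es @ [C])" by simp
  then show ?case using 3 E by simp
qed auto

lemma big_and_foldl: "big_and Cs = (case rev Cs of [] \<Rightarrow> Const 1 | D # Ds \<Rightarrow> foldl (\<lambda>s C. And C s) D Ds)"
proof (induction Cs rule: big_and.induct)
  case (3 C D Cs)
  obtain E Es where E: "rev (D # Cs) = E # Es" by (cases "rev (D # Cs)") auto
  then have "rev (C # D # Cs) = E # (Es @ [C])" by simp
  then show ?case using 3 E by simp
qed auto

lemma polytime_big_or [polytime_intros]: assumes "polytime Cs" shows "polytime (\<lambda>x. big_or (Cs x))"
proof -
  have "polytime (\<lambda>p :: 'a \<times> concept \<times> concept list. foldl (\<lambda>s C. Or C s) (fst (snd p)) (snd (snd p)))"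
    by (rule polytime_foldl_add[where K = 29]) (intro polytime_intros | simp add: Or_def sz_concept_simps)+
  then show ?thesis unfolding big_or_foldl by (intro polytime_case_list polytime_rev assms polytime_const)
qed

lemma polytime_big_and [polytime_intros]: assumes "polytime Cs" shows "polytime (\<lambda>x. big_and (Cs x))"
proof -
  have "polytime (\<lambda>p :: 'a \<times> concept \<times> concept list. foldl (\<lambda>s C. And C s) (fst (snd p)) (snd (snd p)))"
    by (rule polytime_foldl_add[where K = 11]) (intro polytime_intros | simp add: sz_concept_simps)+
  then show ?thesis unfolding big_and_foldl by (intro polytime_case_list polytime_rev assms polytime_const)
qed

text \<open>Recursion through a concept as iteration with a worklist: every step removes one
  constructor from the front concept, so the size of the initial list is enough fuel.\<close>

definition denom_step :: "concept list \<times> nat list \<Rightarrow> concept list \<times> nat list" where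
  "denom_step s = (case fst s of [] \<Rightarrow> s | C # Cs \<Rightarrow>
     (case C of Atom p \<Rightarrow> (Cs, snd s) | Const c \<Rightarrow> (Cs, denom c # snd s) | Neg D \<Rightarrow> (D # Cs, snd s)
      | Ominus D c \<Rightarrow> (D # Cs, denom c # snd s) | And D E \<Rightarrow> (D # E # Cs, snd s) | Ex R D \<Rightarrow> (D # Cs, snd s)))"

lemma sz_denom: "sz (denom c) + 3 \<le> sz c"
proof -
  have "sz c = sz (fst (quotient_of c) < 0) + (sz (nat \<bar>fst (quotient_of c)\<bar>) + sz (denom c) + 1) + 1"
    unfolding sz_def[of c] cd_rat denom_def by (simp add: sz_def)
  then show ?thesis using sz_ge_1[of "fst (quotient_of c) < 0"] sz_ge_1[of "nat \<bar>fst (quotient_of c)\<bar>"] by linarith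
qed

text \<open>The code of a denominator is part of the code of the constant it is taken from, so
  collecting it never enlarges the state.\<close>

lemma denom_step_sz: "sz (denom_step s) \<le> sz s"
proof -
  obtain Cs ds where s: "s = (Cs, ds)" by (cases s)
  show ?thesis
  proof (cases Cs)
    case (Cons C Ds)
    show ?thesis
    proof (cases C)
      case (Const c)
      then show ?thesis using sz_denom[of c] by (simp add: s Cons denom_step_def sz_concept_simps)
    next
      case (Ominus D c)
      then show ?thesis using sz_denom[of c] by (simp add: s Cons denom_step_def sz_concept_simps)
    qed (simp_all add: s Cons denom_step_def sz_concept_simps)
  qed (simp add: s denom_step_def)
qed

definition denom_list :: "concept list \<Rightarrow> nat list" where
  "denom_list Cs = snd (foldl (\<lambda>s (_::unit). denom_step s) (Cs, []) (replicate (sz Cs) ()))"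

lemma polytime_denom [polytime_intros]: "polytime q \<Longrightarrow> polytime (\<lambda>x. denom (q x))"
  unfolding denom_def by (intro polytime_intros)

lemma foldl_const_funpow: "foldl (\<lambda>s (_::unit). f s) s xs = (f ^^ length xs) s"
  by (induction xs arbitrary: s) (auto simp: funpow_swap1)

lemma denom_step_iter_sz: "sz ((denom_step ^^ n) s) \<le> sz s"
  by (induction n) (auto intro: le_trans[OF denom_step_sz])

lemma polytime_denom_list [polytime_intros]:
  assumes "polytime Cs" shows "polytime (\<lambda>x. denom_list (Cs x))"
proof -
  obtain k where k: "\<And>x. sz (Cs x) \<le> (sz x + 2) ^ k" using polytime_szE[OF assms] by blast
  have "polytime (\<lambda>x. foldl (\<lambda>s (_::unit). denom_step s) (Cs x, []) (replicate (sz (Cs x)) ()))"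
  proof (rule polytime_foldl[where g = "\<lambda>x s _. denom_step s" and S = "\<lambda>n. (n + 2) ^ k + 2"])
    show "polytime (\<lambda>p :: 'a \<times> (concept list \<times> nat list) \<times> unit. denom_step (fst (snd p)))"
      unfolding denom_step_def by (intro polytime_intros)
    show "polytime (\<lambda>x. replicate (sz (Cs x)) ())" using polytime_comp[OF polytime_ticks assms] .
    fix x i
    show "sz (foldl (\<lambda>s (_::unit). denom_step s) (Cs x, []) (take i (replicate (sz (Cs x)) ()))) \<le> (sz x + 2) ^ k + 2"
      unfolding foldl_const_funpow using denom_step_iter_sz[of _ "(Cs x, [])"] k[of x] by (auto intro: le_trans)
  qed (intro polytime_intros poly_bounded_intros assms)+
  then show ?thesis unfolding denom_list_def by (intro polytime_intros)
qed

lemma csize_le_sz: "csize C \<le> sz C"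
  by (induction C) (auto simp: sz_concept_simps)

text \<open>The collected denominators together with those still occurring in the worklist are
  invariant, and the total weight of the worklist drops until it is empty.\<close>

lemma denom_list_correct: "set (denom_list Cs) = denom ` (\<Union>C\<in>set Cs. concept_consts C)"
proof -
  define all where "all s = set (snd s) \<union> denom ` (\<Union>C\<in>set (fst s). concept_consts C)" for s
  have step: "all (denom_step s) = all s" for s
    by (cases s) (auto simp: all_def denom_step_def split: list.splits concept.splits)
  have all: "all ((denom_step ^^ n) s) = all s" for n s
    by (induction n) (auto simp: step)
  define ms where "ms s = (\<Sum>C\<leftarrow>fst s. csize C)" for s :: "concept list \<times> nat list"
  have dec: "ms (denom_step s) \<le> ms s - 1" for s
    using csize_pos by (cases s) (auto simp: ms_def denom_step_def split: list.splits concept.splits)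
  have "ms ((denom_step ^^ n) s) \<le> ms s - n" for n s
    by (induction n) (auto intro: le_trans[OF dec])
  moreover have "ms (Cs, []) \<le> sz Cs"
    using csize_le_sz by (auto simp: ms_def, induction Cs) (auto intro: le_SucI add_mono)
  ultimately have "ms ((denom_step ^^ sz Cs) (Cs, [])) = 0" by (metis diff_is_0_eq le_zero_eq)
  moreover have "ms s = 0 \<Longrightarrow> fst s = []" for s
  proof (cases "fst s")
    case (Cons C Cs)
    assume "ms s = 0"
    then show ?thesis using Cons csize_pos[of C] by (simp add: ms_def)
  qed simp
  ultimately have "fst ((denom_step ^^ sz Cs) (Cs, [])) = []" by blast
  then show ?thesis using all[of "sz Cs" "(Cs, [])"]
    by (simp add: all_def denom_list_def foldl_const_funpow)
qed

text \<open>Bounds of assertions are wrapped as constant concepts, so that one traversal reaches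
  every constant.\<close>

definition all_concepts :: "gci list \<Rightarrow> assertion list \<Rightarrow> concept list" where
  "all_concepts ts gs = concat (map (\<lambda>g. [fst g, snd g]) ts) @ concat (map (\<lambda>A. [concept_of A, Const (bound_of A)]) gs)"

definition lcm_list :: "nat list \<Rightarrow> nat" where
  "lcm_list ns = foldl (\<lambda>a b. a * b div gcd a b) 1 ns"

lemma lcm_list_eq: "lcm_list ns = Lcm (set ns)"
proof -
  have "foldl (\<lambda>a b. a * b div gcd a b) m ns = lcm m (Lcm (set ns))" for m
    by (induction ns arbitrary: m) (auto simp: lcm_nat_def[symmetric] lcm.assoc)
  then show ?thesis by (simp add: lcm_list_def)
qed

lemma polytime_lcm_list [polytime_intros]:
  assumes "polytime ns" shows "polytime (\<lambda>x. lcm_list (ns x))"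
proof -
  obtain k where k: "\<And>x. sz (ns x) \<le> (sz x + 2) ^ k" using polytime_szE[OF assms] by blast
  have e: "size_nat (foldl (\<lambda>a b. a * b div gcd a b) m ys) \<le> size_nat m + sz ys" for m ys
  proof (induction ys arbitrary: m)
    case (Cons y ys)
    have "size_nat (m * y div gcd m y) \<le> size_nat m + size_nat y"
      using size_nat_mono[of "m * y div gcd m y" "m * y"] size_nat_mult[of m y] by (simp add: div_le_dividend)
    then show ?case using Cons[of "m * y div gcd m y"] size_nat_le_sz[of y] by simp
  qed simp
  show ?thesis unfolding lcm_list_def
  proof (rule polytime_foldl[where g = "\<lambda>x a b. a * b div gcd a b" and S = "\<lambda>n. 4 * (n + 2) ^ k + 9"])
    fix x i
    let ?m = "foldl (\<lambda>a b. a * b div gcd a b) 1 (take i (ns x))"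
    have "size_nat (1::nat) \<le> 1" by (simp add: size_nat_le_iff)
    then have "size_nat ?m \<le> 1 + (sz x + 2) ^ k"
      using e[of 1 "take i (ns x)"] sz_take_le[of i "ns x"] k[of x] by linarith
    then show "sz ?m \<le> 4 * (sz x + 2) ^ k + 9" using sz_nat_le[of ?m] by linarith
  qed (intro polytime_intros poly_bounded_intros assms)+
qed

lemma common_denom_code: "common_denom (set ts) (set gs) = lcm_list (denom_list (all_concepts ts gs))"
proof -
  have "(\<Union>C\<in>set (all_concepts ts gs). concept_consts C) = all_consts (set ts) (set gs)"
    by (auto simp: all_concepts_def all_consts_def concept_of_def split: assertion.splits) (metis assertion.exhaust bound_of.simps assertion_consts.simps insert_iff concept_of_simps)+
  then show ?thesis
    unfolding lcm_list_eq denom_list_correct common_denom_def denoms_def by (simp add: denom_def)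
qed

text \<open>The numerators are taken from the positions of \<open>pad\<close>: a list of N + 1
  points is too long for polynomial time in the binary N, but not in the unary string. A short
  \<open>pad\<close> merely truncates the list.\<close>

definition grid :: "unit list \<Rightarrow> nat \<Rightarrow> rat list" where
  "grid pad N = map (\<lambda>k. Fract (int k) (int N)) (filter (\<lambda>k. k \<le> N) (map fst (enum pad)))"

lemma grid_eq:
  assumes "N < length pad" "0 < N"
  shows "sorted_list_of_set ((\<lambda>k. of_nat k / of_nat N) ` {0..N}) = grid pad N"
proof -
  have "map fst (enum pad) = [0..<length pad]" by (simp add: enum_def)
  moreover have "filter (\<lambda>k. k \<le> N) [0..<length pad] = [0..<Suc N]"
  proof -
    have "[0..<length pad] = [0..<Suc N] @ [Suc N..<length pad]"
    proof -
      have "Suc N + (length pad - Suc N) = length pad" using assms(1) by simp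
      then show ?thesis using upt_add_eq_append[of 0 "Suc N" "length pad - Suc N"] by (simp only: le0)
    qed
    then show ?thesis by (simp only: filter_append) (simp del: upt_Suc)
  qed
  ultimately have g: "grid pad N = map (\<lambda>k. of_nat k / of_nat N) [0..<Suc N]"
    by (simp add: grid_def Fract_of_int_quotient del: upt_Suc)
  have "sorted_wrt (<) (map (\<lambda>k. of_nat k / of_nat N :: rat) [0..<Suc N])"
    unfolding sorted_wrt_map using assms(2)
    by (intro sorted_wrt_mono_rel[OF _ sorted_wrt_upt]) (auto simp: divide_strict_right_mono)
  then have "sorted_list_of_set (set (grid pad N)) = grid pad N"
    unfolding g by (intro sorted_list_of_set.idem_if_sorted_distinct) (auto simp: strict_sorted_iff simp del: upt_Suc)
  moreover have "set (grid pad N) = (\<lambda>k. of_nat k / of_nat N) ` {0..N}"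
    unfolding g set_map set_upt atLeastLessThanSuc_atLeastAtMost ..
  ultimately show ?thesis by simp
qed

definition tbox_concept :: "unit list \<Rightarrow> gci list \<Rightarrow> assertion list \<Rightarrow> concept" where
  "tbox_concept pad ts gs = (let zs = grid pad (2 * lcm_list (denom_list (all_concepts ts gs))) in
     big_and (map (\<lambda>g. big_or (map (\<lambda>z. And (Oplus (Neg (fst g)) z) (Oplus (snd g) (1 - z))) zs)) ts))"

lemma tbox_concept_eq:
  assumes "2 * common_denom (set ts) (set gs) < length pad"
  shows "tbox_concept pad ts gs = assoc_concept ts (set gs)"
  using grid_eq[OF assms] common_denom_pos[OF finite_set finite_set, of ts gs]
  unfolding tbox_concept_def assoc_concept_def assoc_gci_def Z'_set_eq[OF finite_set finite_set]
    common_denom_code[symmetric] by (simp add: Let_def)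

lemma polytime_tbox_concept [polytime_intros]:
  assumes "polytime pad" "polytime ts" "polytime gs" shows "polytime (\<lambda>x. tbox_concept (pad x) (ts x) (gs x))"
proof -
  have "polytime (\<lambda>p. tbox_concept (fst p) (fst (snd p)) (snd (snd p)))"
    unfolding tbox_concept_def grid_def all_concepts_def Let_def by (intro polytime_intros)
  from polytime_comp[OF this polytime_pair[OF assms(1) polytime_pair[OF assms(2,3)]]] show ?thesis by simp
qed

section \<open>Computing the tableau\<close>

definition label_of :: "assertion list option \<Rightarrow> label" where
  "label_of l = (case l of None \<Rightarrow> Bot | Some L \<Rightarrow> Seq (set L))"

lemma label_of_simps [simp]: "label_of None = Bot" "label_of (Some L) = Seq (set L)"
  by (simp_all add: label_of_def)

text \<open>Lists stand for sets of assertions, so mutual inclusion is the comparison that makes the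
  labelling injective.\<close>

definition same_label :: "assertion list option \<Rightarrow> assertion list option \<Rightarrow> bool" where
  "same_label l m = (case l of None \<Rightarrow> (case m of None \<Rightarrow> True | Some M \<Rightarrow> False)
     | Some L \<Rightarrow> (case m of None \<Rightarrow> False | Some M \<Rightarrow> (\<forall>A\<in>set L. A \<in> set M) \<and> (\<forall>A\<in>set M. A \<in> set L)))"

lemma same_label_iff: "same_label l m \<longleftrightarrow> label_of l = label_of m"
  by (auto simp: same_label_def split: option.splits)

definition uniq :: "'a list \<Rightarrow> 'a list" where
  "uniq xs = foldl (\<lambda>s a. if a \<in> set s then s else a # s) [] xs"

lemma uniq_correct: "set (uniq xs) = set xs \<and> distinct (uniq xs)"
proof -
  have "set (foldl (\<lambda>s a. if a \<in> set s then s else a # s) ys xs) = set ys \<union> set xs \<and>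
    (distinct ys \<longrightarrow> distinct (foldl (\<lambda>s a. if a \<in> set s then s else a # s) ys xs))" for ys
    by (induction xs arbitrary: ys) auto
  then show ?thesis by (simp add: uniq_def)
qed

lemmas set_uniq [simp] = uniq_correct[THEN conjunct1]
  and distinct_uniq [simp] = uniq_correct[THEN conjunct2]

definition nontriv :: "cmp \<Rightarrow> rat \<Rightarrow> bool" where
  "nontriv r c \<longleftrightarrow> r = Gt \<and> c \<ge> 0 \<or> r = Ge \<and> c > 0"

text \<open>The conclusions of a rule instance with principal assertion \<open>A\<close>, or the
  empty list if there is none. A clash between two bounds on an atom is reported at its upper bound
  only.\<close>

definition expand1 :: "assertion list \<Rightarrow> assertion \<Rightarrow> assertion list option list" where
  "expand1 L A = (let r = cmp_of A; c = bound_of A; S = filter (\<lambda>B. B \<noteq> A) L in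
     case concept_of A of
       Atom p \<Rightarrow> if (r = Gt \<and> c \<ge> 1 \<or> r = Ge \<and> c > 1) \<or> (r = Lt \<and> c \<le> 0 \<or> r = Le \<and> c < 0) \<or>
           upper r \<and> (\<exists>B\<in>set L. concept_of B = Atom p \<and> lower (cmp_of B) \<and> black r (cmp_of B) c (bound_of B))
         then [None] else []
     | Const q \<Rightarrow> if cmp_rel r q c then [] else [None]
     | Neg C \<Rightarrow> [Some (uniq (Assert C (flip r) (1 - c) # S))]
     | Ominus C q \<Rightarrow>
         if upper r then [Some (uniq (Assert C r (c + q) # Assert (Const c) (flip r) 0 # S))]
         else if nontriv r c then [Some (uniq (Assert C r (c + q) # S))] else []
     | And C D \<Rightarrow>
         if lower r then [Some (uniq (Assert C r c # Assert D r c # S))]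
         else [Some (uniq (Assert C r c # S)), Some (uniq (Assert D r c # S))]
     | Ex R C \<Rightarrow> if r = Lt \<and> c \<le> 0 \<or> r = Le \<and> c < 0 then [None] else [])"

lemma expand1_rule:
  assumes "A \<in> set L" "expand1 L A \<noteq> []"
  shows "prop_rule (set L) (label_of ` set (expand1 L A))"
proof (cases A)
  case (Assert C r c)
  have S: "set (filter (\<lambda>B. B \<noteq> A) L) = set L - {A}" by auto
  note e = assms(2)[unfolded expand1_def Assert Let_def cmp_of.simps bound_of.simps concept_of_simps]
  show ?thesis
  proof (cases C)
    case (Atom p)
    then consider "r = Gt \<and> c \<ge> 1 \<or> r = Ge \<and> c > 1" | "r = Lt \<and> c \<le> 0 \<or> r = Le \<and> c < 0"
      | B where "upper r" "B \<in> set L" "concept_of B = Atom p" "lower (cmp_of B)" "black r (cmp_of B) c (bound_of B)"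
      using e by (auto split: if_splits)
    moreover have "label_of ` set (expand1 L A) = {Bot}" using e Atom unfolding expand1_def Assert by (auto split: if_splits)
    moreover have "Assert (Atom p) r c \<in> set L" using assms(1) Assert Atom by simp
    ultimately show ?thesis
    proof cases
      case 3
      then obtain l d where "B = Assert (Atom p) l d" by (cases B) auto
      then show ?thesis using 3 Ax_p[of p r c "set L" l d] \<open>Assert (Atom p) r c \<in> set L\<close> \<open>_ = {Bot}\<close> by simp
    qed (auto intro: Ax_1 Ax_0)
  next
    case (Const q)
    then show ?thesis using e assms(1) Assert Ax_c[of q r c "set L"] by (auto simp: expand1_def split: if_splits)
  next
    case (Neg D)
    have "label_of ` set (expand1 L A) = {Seq (set L - {A} \<union> {Assert D (flip r) (1 - c)})}"
      using Neg S by (auto simp: expand1_def Assert)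
    then show ?thesis using prop_rule.Neg[of D r c "set L"] assms(1) Assert Neg by simp
  next
    case (Ominus D q)
    show ?thesis
    proof (cases "upper r")
      case True
      have "label_of ` set (expand1 L A) = {Seq (set L - {A} \<union> {Assert D r (c + q), Assert (Const c) (flip r) 0})}"
        using Ominus S True by (auto simp: expand1_def Assert)
      then show ?thesis using Ominus_upper[of D q r c "set L"] assms(1) Assert Ominus True by simp
    next
      case False
      then have nt: "nontriv r c" using e Ominus by (auto split: if_splits)
      have "label_of ` set (expand1 L A) = {Seq (set L - {A} \<union> {Assert D r (c + q)})}"
        using Ominus S False nt by (auto simp: expand1_def Assert)
      then show ?thesis using Ominus_lower[of D q r c "set L"] assms(1) Assert Ominus nt by (simp add: nontriv_def)
    qed
  next
    case (And D E)
    show ?thesis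
    proof (cases "lower r")
      case True
      have "label_of ` set (expand1 L A) = {Seq (set L - {A} \<union> {Assert D r c, Assert E r c})}"
        using And S True by (auto simp: expand1_def Assert)
      then show ?thesis using And_lower[of D E r c "set L"] assms(1) Assert And True by simp
    next
      case False
      have ex: "expand1 L A = [Some (uniq (Assert D r c # filter (\<lambda>B. B \<noteq> A) L)), Some (uniq (Assert E r c # filter (\<lambda>B. B \<noteq> A) L))]"
        using And False by (simp add: expand1_def Assert Let_def)
      have "label_of ` set (expand1 L A) = {Seq (insert (Assert D r c) (set L - {A})), Seq (insert (Assert E r c) (set L - {A}))}"
        unfolding ex by (simp only: list.set image_insert image_empty label_of_simps set_uniq S)
      moreover have "upper r" "A = Assert (And D E) r c" using False Assert And by (simp_all add: upper_iff)
      ultimately show ?thesis using And_upper[of D E r c "set L"] assms(1) by (simp only: Un_insert_right Un_empty_right)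
    qed
  next
    case (Ex R D)
    then show ?thesis using e assms(1) Assert Ax_0_Ex[of R D r c "set L"] by (auto simp: expand1_def split: if_splits)
  qed
qed

lemma expand1_complete:
  assumes "prop_rule (set L) K" shows "\<exists>A\<in>set L. expand1 L A \<noteq> []"
  using assms
proof cases
  case (Ax_1 p r c) then show ?thesis by (intro bexI[of _ "Assert (Atom p) r c"]) (auto simp: expand1_def Let_def)
next
  case (Ax_0 p r c) then show ?thesis by (intro bexI[of _ "Assert (Atom p) r c"]) (auto simp: expand1_def Let_def)
next
  case (Ax_0_Ex R C r c) then show ?thesis by (intro bexI[of _ "Assert (Ex R C) r c"]) (auto simp: expand1_def Let_def)
next
  case (Ax_c c r d) then show ?thesis by (intro bexI[of _ "Assert (Const c) r d"]) (auto simp: expand1_def Let_def)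
next
  case (Ax_p p u c l d)
  then have "\<exists>B\<in>set L. concept_of B = Atom p \<and> lower (cmp_of B) \<and> black u (cmp_of B) c (bound_of B)"
    by (intro bexI[of _ "Assert (Atom p) l d"]) auto
  then show ?thesis using Ax_p by (intro bexI[of _ "Assert (Atom p) u c"]) (auto simp: expand1_def Let_def)
next
  case (And_lower C D r c) then show ?thesis by (intro bexI[of _ "Assert (And C D) r c"]) (auto simp: expand1_def Let_def)
next
  case (And_upper C D r c) then show ?thesis by (intro bexI[of _ "Assert (And C D) r c"]) (auto simp: expand1_def Let_def)
next
  case (Neg C r c) then show ?thesis by (intro bexI[of _ "Assert (Neg C) r c"]) (auto simp: expand1_def Let_def)
next
  case (Ominus_upper C c r d) then show ?thesis by (intro bexI[of _ "Assert (Ominus C c) r d"]) (auto simp: expand1_def Let_def)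
next
  case (Ominus_lower C c r d) then show ?thesis
    by (intro bexI[of _ "Assert (Ominus C c) r d"]) (auto simp: expand1_def nontriv_def Let_def)
qed

text \<open>Any applicable rule instance may be used at an OR-node; the first one in list order is
  taken.\<close>

definition expand :: "assertion list \<Rightarrow> assertion list option list" where
  "expand L = (case filter (\<lambda>es. es \<noteq> []) (map (expand1 L) L) of [] \<Rightarrow> [] | es # _ \<Rightarrow> es)"

lemma expand_nonempty: "expand L \<noteq> [] \<Longrightarrow> \<exists>A\<in>set L. expand L = expand1 L A"
proof -
  assume a: "expand L \<noteq> []"
  then obtain es ess where e: "filter (\<lambda>es. es \<noteq> []) (map (expand1 L) L) = es # ess"
    by (auto simp: expand_def split: list.splits)
  from filter_eq_ConsD[OF e] obtain us vs where uv: "map (expand1 L) L = us @ es # vs" "es \<noteq> []" by blast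
  have "es \<in> set (map (expand1 L) L)" unfolding uv(1) by simp
  with uv(2) have "es \<in> set (map (expand1 L) L)" "es \<noteq> []" by blast+
  then obtain A where "A \<in> set L" "es = expand1 L A" "es \<noteq> []" by auto
  then show ?thesis using e by (auto simp add: expand_def)
qed

lemma expand_rule: "expand L \<noteq> [] \<Longrightarrow> prop_rule (set L) (label_of ` set (expand L))"
  using expand_nonempty[of L] expand1_rule by fastforce

lemma saturated_iff_expand: "saturated (set L) \<longleftrightarrow> expand L = []"
proof
  assume "saturated (set L)"
  then show "expand L = []" using expand_rule by (auto simp: saturated_def)
next
  assume a: "expand L = []"
  have "filter (\<lambda>es. es \<noteq> []) (map (expand1 L) L) = []"
  proof (rule ccontr)
    assume "\<not> ?thesis"
    then obtain es ess where e: "filter (\<lambda>es. es \<noteq> []) (map (expand1 L) L) = es # ess" by (meson list.exhaust)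
    from filter_eq_ConsD[OF e] have "es \<noteq> []" by auto
    then show False using a e by (simp add: expand_def)
  qed
  then show "saturated (set L)" using expand1_complete by (fastforce simp: saturated_def filter_empty_conv)
qed

definition ex_premises :: "assertion list \<Rightarrow> nat \<Rightarrow> cmp \<Rightarrow> rat \<Rightarrow> assertion list" where
  "ex_premises L R r c = concat (map (\<lambda>B. case concept_of B of Atom p \<Rightarrow> [] | Const q \<Rightarrow> [] | Neg C \<Rightarrow> [] | Ominus C q \<Rightarrow> []
     | And C D \<Rightarrow> [] | Ex S D \<Rightarrow> if S = R \<and> upper (cmp_of B) \<and> black (cmp_of B) r (bound_of B) c
         then [Assert D (cmp_of B) (bound_of B)] else []) L)"

definition ex_succ :: "concept \<Rightarrow> assertion list \<Rightarrow> assertion list option list" where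
  "ex_succ T L = concat (map (\<lambda>A. case concept_of A of Atom p \<Rightarrow> [] | Const q \<Rightarrow> [] | Neg C \<Rightarrow> [] | Ominus C q \<Rightarrow> []
     | And C D \<Rightarrow> [] | Ex R C \<Rightarrow> if nontriv (cmp_of A) (bound_of A)
         then [Some (uniq (Assert C (cmp_of A) (bound_of A) # Assert T Ge 1 # ex_premises L R (cmp_of A) (bound_of A)))] else []) L)"

lemma set_ex_premises:
  "set (ex_premises L R r c) = {Assert D u d |D u d. Assert (Ex R D) u d \<in> set L \<and> upper u \<and> black u r d c}"
proof (intro equalityI subsetI)
  fix A assume "A \<in> set (ex_premises L R r c)"
  then obtain B where B: "B \<in> set L" "A \<in> set (case concept_of B of Atom p \<Rightarrow> [] | Const q \<Rightarrow> [] | Neg C \<Rightarrow> [] | Ominus C q \<Rightarrow> []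
     | And C D \<Rightarrow> [] | Ex S D \<Rightarrow> if S = R \<and> upper (cmp_of B) \<and> black (cmp_of B) r (bound_of B) c
         then [Assert D (cmp_of B) (bound_of B)] else [])" unfolding ex_premises_def by auto
  show "A \<in> {Assert D u d |D u d. Assert (Ex R D) u d \<in> set L \<and> upper u \<and> black u r d c}"
  proof (cases B)
    case (Assert E u d)
    then show ?thesis using B by (cases E) (auto split: if_splits)
  qed
next
  fix A assume "A \<in> {Assert D u d |D u d. Assert (Ex R D) u d \<in> set L \<and> upper u \<and> black u r d c}"
  then obtain D u d where "A = Assert D u d" "Assert (Ex R D) u d \<in> set L" "upper u" "black u r d c" by auto
  then show "A \<in> set (ex_premises L R r c)" unfolding ex_premises_def by force
qed

lemma label_of_ex_succ: "label_of ` set (ex_succ T L) = {l. ex_rule T (set L) l}"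
proof (intro equalityI subsetI)
  fix l assume "l \<in> label_of ` set (ex_succ T L)"
  then obtain A where A: "A \<in> set L" "l \<in> label_of ` set (case concept_of A of Atom p \<Rightarrow> [] | Const q \<Rightarrow> [] | Neg C \<Rightarrow> [] | Ominus C q \<Rightarrow> []
     | And C D \<Rightarrow> [] | Ex R C \<Rightarrow> if nontriv (cmp_of A) (bound_of A)
         then [Some (uniq (Assert C (cmp_of A) (bound_of A) # Assert T Ge 1 # ex_premises L R (cmp_of A) (bound_of A)))] else [])"
    unfolding ex_succ_def by auto
  obtain R C r c where "A = Assert (Ex R C) r c" "nontriv r c"
     "l = Seq (set (uniq (Assert C r c # Assert T Ge 1 # ex_premises L R r c)))"
  proof (cases A)
    case (Assert E u d)
    then show ?thesis using A(2) that by (cases E) (auto split: if_splits)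
  qed
  moreover from this have "l = Seq (ex_label T (set L) R C r c)"
    by (auto simp: ex_label_def set_ex_premises)
  ultimately show "l \<in> {l. ex_rule T (set L) l}" using A(1) unfolding ex_rule_iff nontriv_def mem_Collect_eq by blast
next
  fix l assume "l \<in> {l. ex_rule T (set L) l}"
  then obtain R C r c where l: "l = Seq (ex_label T (set L) R C r c)" "Assert (Ex R C) r c \<in> set L" "nontriv r c"
    by (auto simp: ex_rule_iff nontriv_def)
  have "l = label_of (Some (uniq (Assert C r c # Assert T Ge 1 # ex_premises L R r c)))"
    unfolding l(1) by (auto simp: ex_label_def set_ex_premises)
  moreover have "Some (uniq (Assert C r c # Assert T Ge 1 # ex_premises L R r c)) \<in> set (ex_succ T L)"
    using l(2,3) unfolding ex_succ_def by force
  ultimately show "l \<in> label_of ` set (ex_succ T L)" by blast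
qed

definition succs :: "concept \<Rightarrow> assertion list option \<Rightarrow> assertion list option list" where
  "succs T l = (case l of None \<Rightarrow> [] | Some L \<Rightarrow> if expand L = [] then ex_succ T L else expand L)"

definition add_new :: "assertion list option list \<Rightarrow> assertion list option \<Rightarrow> assertion list option list" where
  "add_new ns l = (if \<exists>m\<in>set ns. same_label m l then ns else ns @ [l])"

text \<open>Every round recomputes the successors of all nodes. New labels are appended at the end,
  so the root keeps position 0.\<close>

definition grow :: "concept \<Rightarrow> assertion list option list \<Rightarrow> assertion list option list" where
  "grow T ns = foldl add_new ns (concat (map (succs T) ns))"

text \<open>Cutting off at the size of \<open>pad\<close> makes the iteration polynomial on arbitrary arguments; for a
  sufficiently long \<open>pad\<close> it never happens.\<close>

definition explore :: "concept \<Rightarrow> unit list \<Rightarrow> assertion list option \<Rightarrow> assertion list option list" where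
  "explore T pad l = foldl (\<lambda>s _. let s' = grow T s in if sz s' \<le> length pad then s' else s) [l] pad"

section \<open>Running time of the construction\<close>

lemma polytime_app2: "polytime (\<lambda>p. f (fst p) (snd p)) \<Longrightarrow> polytime a \<Longrightarrow> polytime b \<Longrightarrow> polytime (\<lambda>x. f (a x) (b x))"
  using polytime_comp[OF _ polytime_pair, of "\<lambda>p. f (fst p) (snd p)" a b] by simp

lemma polytime_same_label [polytime_intros]: "polytime a \<Longrightarrow> polytime b \<Longrightarrow> polytime (\<lambda>x. same_label (a x) (b x))"
  by (rule polytime_app2[of same_label], unfold same_label_def) (intro polytime_intros)+

lemma polytime_uniq [polytime_intros]:
  assumes "polytime xs" shows "polytime (\<lambda>x. uniq (xs x))"
  unfolding uniq_def
  by (rule polytime_foldl_add[where K = 1]) (intro polytime_intros assms | simp)+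

lemma polytime_nontriv [polytime_intros]: "polytime r \<Longrightarrow> polytime c \<Longrightarrow> polytime (\<lambda>x. nontriv (r x) (c x))"
  unfolding nontriv_def by (intro polytime_intros)

lemma polytime_expand1 [polytime_intros]: "polytime a \<Longrightarrow> polytime b \<Longrightarrow> polytime (\<lambda>x. expand1 (a x) (b x))"
  by (rule polytime_app2[of expand1], unfold expand1_def Let_def) (intro polytime_intros)+

lemma polytime_expand [polytime_intros]: assumes "polytime L" shows "polytime (\<lambda>x. expand (L x))"
proof -
  have "polytime expand" unfolding expand_def by (intro polytime_intros)
  from polytime_comp[OF this assms] show ?thesis .
qed

lemma polytime_ex_premises: "polytime (\<lambda>p. ex_premises (fst p) (fst (snd p)) (fst (snd (snd p))) (snd (snd (snd p))))"
  unfolding ex_premises_def by (intro polytime_intros)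

lemma polytime_ex_premises' [polytime_intros]:
  assumes "polytime a" "polytime b" "polytime c" "polytime d" shows "polytime (\<lambda>x. ex_premises (a x) (b x) (c x) (d x))"
  using polytime_comp[OF polytime_ex_premises polytime_pair[OF assms(1) polytime_pair[OF assms(2) polytime_pair[OF assms(3,4)]]]] by simp

lemma polytime_ex_succ [polytime_intros]: "polytime a \<Longrightarrow> polytime b \<Longrightarrow> polytime (\<lambda>x. ex_succ (a x) (b x))"
  by (rule polytime_app2[of ex_succ], unfold ex_succ_def) (intro polytime_intros)+

lemma polytime_succs [polytime_intros]: "polytime a \<Longrightarrow> polytime b \<Longrightarrow> polytime (\<lambda>x. succs (a x) (b x))"
  by (rule polytime_app2[of succs], unfold succs_def) (intro polytime_intros)+

lemma polytime_add_new [polytime_intros]: "polytime a \<Longrightarrow> polytime b \<Longrightarrow> polytime (\<lambda>x. add_new (a x) (b x))"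
  by (rule polytime_app2[of add_new], unfold add_new_def) (intro polytime_intros)+

lemma sz_add_new: "sz (add_new ns l) \<le> sz ns + sz l + 1"
  using sz_append[of ns "[l]"] by (simp add: add_new_def)

lemma polytime_grow [polytime_intros]: "polytime a \<Longrightarrow> polytime b \<Longrightarrow> polytime (\<lambda>x. grow (a x) (b x))"
proof (rule polytime_app2[of grow], unfold grow_def)
  show "polytime (\<lambda>p. foldl add_new (snd p) (concat (map (succs (fst p)) (snd p))))"
    by (rule polytime_foldl_add[OF _ _ _ sz_add_new]) (intro polytime_intros)+
qed

lemma polytime_explore [polytime_intros]:
  assumes "polytime T" "polytime pad" "polytime l" shows "polytime (\<lambda>x :: 'x::coded. explore (T x) (pad x) (l x))"
proof -
  obtain k where k: "\<And>x. sz (pad x) \<le> (sz x + 2) ^ k" using polytime_szE[OF assms(2)] by blast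
  obtain j where j: "\<And>x. sz (l x) \<le> (sz x + 2) ^ j" using polytime_szE[OF assms(3)] by blast
  let ?g = "\<lambda>x s (_::unit). let s' = grow (T x) s in if sz s' \<le> length (pad x) then s' else s"
  have b: "sz s \<le> M \<Longrightarrow> length (pad x) \<le> M \<Longrightarrow> sz (foldl (?g x) s us) \<le> M" for x s us M
    by (induction us arbitrary: s) (auto simp: Let_def)
  show ?thesis unfolding explore_def
  proof (rule polytime_foldl[where g = ?g and S = "\<lambda>n. (n + 2) ^ k + (n + 2) ^ j + 2"])
    show "polytime (\<lambda>p :: 'x \<times> assertion list option list \<times> unit. ?g (fst p) (fst (snd p)) (snd (snd p)))"
      unfolding Let_def by (intro polytime_intros polytime_comp[OF assms(1)] polytime_comp[OF assms(2)])
    fix x i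
    show "sz (foldl (?g x) [l x] (take i (pad x))) \<le> (sz x + 2) ^ k + (sz x + 2) ^ j + 2"
      using k[of x] j[of x] length_le_sz[of "pad x"] by (intro b) auto
  qed (intro polytime_intros poly_bounded_intros assms)+
qed

definition graph :: "concept \<Rightarrow> assertion list option list \<Rightarrow> graph_rep" where
  "graph T ns = map (\<lambda>l. (l, concat (map (\<lambda>m. map fst (filter (\<lambda>q. same_label m (snd q)) (enum ns))) (succs T l)))) ns"

definition unsat_pass :: "graph_rep \<Rightarrow> nat list \<Rightarrow> nat list" where
  "unsat_pass g us = map fst (filter (\<lambda>q. fst q \<in> set us \<or>
     (case fst (snd q) of None \<Rightarrow> False | Some L \<Rightarrow>
       if expand L = [] then \<exists>w\<in>set (snd (snd q)). w \<in> set us else \<forall>w\<in>set (snd (snd q)). w \<in> set us)) (enum g))"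

text \<open>A round that changes the set adds a node, so one round per node suffices and the node
  list itself can act as the clock.\<close>

definition unsat_list :: "graph_rep \<Rightarrow> nat list" where
  "unsat_list g = foldl (\<lambda>us _. unsat_pass g us) (map fst (filter (\<lambda>q. fst (snd q) = None) (enum g))) g"

definition construct :: "unit list \<times> gci list \<times> assertion list \<Rightarrow> graph_rep \<times> nat list \<times> bool" where
  "construct x = (let T = tbox_concept (fst x) (fst (snd x)) (snd (snd x));
     ns = explore T (fst x) (Some (uniq (Assert T Ge 1 # snd (snd x))));
     g = graph T ns; us = unsat_list g in (g, us, 0 \<notin> set us))"

lemma polytime_graph [polytime_intros]: "polytime a \<Longrightarrow> polytime b \<Longrightarrow> polytime (\<lambda>x. graph (a x) (b x))"
  by (rule polytime_app2[of graph], unfold graph_def) (intro polytime_intros)+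

lemma polytime_unsat_pass [polytime_intros]: "polytime a \<Longrightarrow> polytime b \<Longrightarrow> polytime (\<lambda>x. unsat_pass (a x) (b x))"
  by (rule polytime_app2[of unsat_pass], unfold unsat_pass_def) (intro polytime_intros)+

lemma sz_map_fst_filter: "sz (map fst (filter P xs)) \<le> sz (map fst xs)"
  by (induction xs) auto

lemma polytime_unsat_list: "polytime unsat_list"
proof -
  have "polytime (\<lambda>g :: graph_rep. map fst (enum g))" by (intro polytime_intros)
  then obtain k where k: "\<And>g :: graph_rep. sz (map fst (enum g)) \<le> (sz g + 2) ^ k" using polytime_szE by blast
  show ?thesis unfolding unsat_list_def
  proof (rule polytime_foldl[where g = "\<lambda>g us _. unsat_pass g us" and S = "\<lambda>n. (n + 2) ^ k"])
    fix g :: graph_rep and i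
    let ?U = "\<lambda>i. foldl (\<lambda>us _. unsat_pass g us) (map fst (filter (\<lambda>q. fst (snd q) = None) (enum g))) (take i g)"
    have "sz (unsat_pass g us) \<le> sz (map fst (enum g))" for us
      unfolding unsat_pass_def by (rule sz_map_fst_filter)
    then have "sz (foldl (\<lambda>us _. unsat_pass g us) vs ys) \<le> sz (map fst (enum g))" 
      if "sz vs \<le> sz (map fst (enum g))" for vs and ys :: graph_rep
      using that by (induction ys arbitrary: vs) auto
    from this[OF sz_map_fst_filter] show "sz (?U i) \<le> (sz g + 2) ^ k" using k[of g] le_trans by blast
  qed (intro polytime_intros poly_bounded_intros)+
qed

lemma polytime_construct: "polytime construct"
  unfolding construct_def Let_def by (intro polytime_intros polytime_comp[OF polytime_unsat_list])

section \<open>Correctness of the construction\<close>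

lemma foldl_add_new:
  "\<exists>ys. foldl add_new ns xs = ns @ ys \<and> set ys \<subseteq> set xs \<and>
     (\<forall>x\<in>set xs. \<exists>m\<in>set (ns @ ys). label_of m = label_of x) \<and> (distinct (map label_of ns) \<longrightarrow> distinct (map label_of (ns @ ys)))"
proof (induction xs arbitrary: ns)
  case (Cons x xs)
  define ns' where "ns' = add_new ns x"
  obtain zs where zs: "ns' = ns @ zs" "set zs \<subseteq> {x}" "\<exists>m\<in>set ns'. label_of m = label_of x"
     "distinct (map label_of ns) \<longrightarrow> distinct (map label_of ns')"
  proof (cases "\<exists>m\<in>set ns. same_label m x")
    case True
    then show ?thesis using that[of "[]"] by (auto simp: ns'_def add_new_def same_label_iff)
  next
    case False
    then show ?thesis using that[of "[x]"] by (fastforce simp: ns'_def add_new_def same_label_iff)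
  qed
  obtain ys where ys: "foldl add_new ns' xs = ns' @ ys" "set ys \<subseteq> set xs"
     "\<forall>x\<in>set xs. \<exists>m\<in>set (ns' @ ys). label_of m = label_of x" "distinct (map label_of ns') \<longrightarrow> distinct (map label_of (ns' @ ys))"
    using Cons[of ns'] by blast
  have "foldl add_new ns (x # xs) = ns @ (zs @ ys)" using ys(1) zs(1) by (simp add: ns'_def)
  moreover have "set (zs @ ys) \<subseteq> set (x # xs)" using zs(2) ys(2) by auto
  moreover have "\<forall>x'\<in>set (x # xs). \<exists>m\<in>set (ns @ (zs @ ys)). label_of m = label_of x'" using ys(3) zs(1,3) by auto
  moreover have "distinct (map label_of ns) \<longrightarrow> distinct (map label_of (ns @ (zs @ ys)))" using ys(4) zs(1,4) by auto
  ultimately show ?case by blast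
qed auto

text \<open>\<open>Q\<close> limits the size of the node list, so the cut-off never happens. A round
  that changes the list lengthens it, and the length is at most the size, hence at most
  \<open>length pad\<close>; so the iteration is stationary before \<open>pad\<close> is used
  up.\<close>

lemma explore_fixpoint:
  assumes Q: "Q [l]" "\<And>ns. Q ns \<Longrightarrow> Q (grow T ns)" "\<And>ns. Q ns \<Longrightarrow> sz ns \<le> length pad"
  shows "Q (explore T pad l) \<and> grow T (explore T pad l) = explore T pad l"
proof -
  have g: "\<exists>ys. grow T ns = ns @ ys" for ns unfolding grow_def using foldl_add_new by blast
  define s where "s i = ((grow T) ^^ i) [l]" for i
  have Qs: "Q (s i)" for i by (induction i) (auto simp: s_def Q)
  have "foldl (\<lambda>s _. let s' = grow T s in if sz s' \<le> length pad then s' else s) (s i) us = s (i + length us)"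
    for i and us :: "unit list"
  proof (induction us arbitrary: i)
    case (Cons u us)
    have "s (Suc i) = grow T (s i)" by (simp add: s_def)
    then show ?case using Cons[of "Suc i"] Q(3)[OF Qs[of "Suc i"]] by (simp add: Let_def)
  qed simp
  from this[of 0 pad] have e: "explore T pad l = s (length pad)" by (simp add: explore_def s_def)
  have "grow T (s i) = s i \<or> i < length (s i)" for i
  proof (induction i)
    case (Suc i)
    have S: "s (Suc i) = grow T (s i)" by (simp add: s_def)
    show ?case
    proof (cases "grow T (s i) = s i")
      case False
      then obtain ys where "grow T (s i) = s i @ ys" "ys \<noteq> []" using g[of "s i"] by auto
      then have "Suc i < length (s (Suc i))" using Suc False S by (cases ys) auto
      then show ?thesis by simp
    qed (simp add: S)
  qed (simp add: s_def)
  moreover have "\<not> length pad < length (s (length pad))"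
    using Q(3)[OF Qs] length_le_sz[of "s (length pad)"] by (meson le_trans not_less)
  ultimately show ?thesis unfolding e using Qs by blast
qed

definition label_list_ok :: "gci list \<Rightarrow> assertion list \<Rightarrow> assertion list option \<Rightarrow> bool" where
  "label_list_ok ts gs l = (case l of None \<Rightarrow> True | Some L \<Rightarrow> distinct L \<and> root_label_inv ts gs (set L))"

lemma expand_distinct: "Some L' \<in> set (expand L) \<Longrightarrow> distinct L'"
proof -
  assume "Some L' \<in> set (expand L)"
  then obtain A where "Some L' \<in> set (expand1 L A)" using expand_nonempty[of L] by force
  then show ?thesis by (auto simp: expand1_def Let_def split: concept.splits if_splits)
qed

lemma ex_succ_distinct: "Some L' \<in> set (ex_succ T L) \<Longrightarrow> distinct L'"
  by (auto simp: ex_succ_def split: concept.splits if_splits)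

lemma label_list_ok_succs:
  assumes "label_list_ok ts gs l" "m \<in> set (succs (assoc_concept ts (set gs)) l)"
  shows "label_list_ok ts gs m"
proof (cases m)
  case (Some M)
  obtain L where L: "l = Some L" using assms(2) by (cases l) (auto simp: succs_def)
  then have inv: "root_label_inv ts gs (set L)" using assms(1) by (simp add: label_list_ok_def)
  show ?thesis
  proof (cases "expand L = []")
    case True
    then have m: "m \<in> set (ex_succ (assoc_concept ts (set gs)) L)" using assms(2) L by (simp add: succs_def)
    then have "ex_rule (assoc_concept ts (set gs)) (set L) (Seq (set M))" using label_of_ex_succ Some by force
    then show ?thesis using ex_succ_distinct m Some inv
      by (auto simp: label_list_ok_def ex_rule_iff lower_def intro!: root_label_inv_ex_label)
  next
    case False
    then have m: "m \<in> set (expand L)" using assms(2) L by (simp add: succs_def)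
    then have "Seq (set M) \<in> label_of ` set (expand L)" using Some by (metis image_eqI label_of_simps(2))
    then show ?thesis using root_label_inv_prop_rule[OF inv expand_rule[OF False]] expand_distinct m Some
      by (simp add: label_list_ok_def)
  qed
qed (simp add: label_list_ok_def)

text \<open>Reachability inside the current list is part of the invariant, because a tableau has no
  unreachable nodes. The relation is restricted to listed nodes, hence it only grows with the
  list.\<close>

definition nodes_ok :: "gci list \<Rightarrow> assertion list \<Rightarrow> assertion list option \<Rightarrow> assertion list option list \<Rightarrow> bool" where
  "nodes_ok ts gs l ns \<longleftrightarrow> distinct (map label_of ns) \<and> (\<forall>m\<in>set ns. label_list_ok ts gs m) \<and> (\<exists>ms. ns = l # ms) \<and>
     (\<forall>m\<in>set ns. (l, m) \<in> {(a, b). a \<in> set ns \<and> b \<in> set ns \<and> b \<in> set (succs (assoc_concept ts (set gs)) a)}\<^sup>*)"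

lemma nodes_ok_grow:
  assumes "nodes_ok ts gs l ns" shows "nodes_ok ts gs l (grow (assoc_concept ts (set gs)) ns)"
proof -
  let ?T = "assoc_concept ts (set gs)"
  let ?R = "\<lambda>ns. {(a, b). a \<in> set ns \<and> b \<in> set ns \<and> b \<in> set (succs ?T a)}"
  obtain ys where ys: "grow ?T ns = ns @ ys" "set ys \<subseteq> set (concat (map (succs ?T) ns))"
    "distinct (map label_of ns) \<longrightarrow> distinct (map label_of (ns @ ys))"
    using foldl_add_new[of ns "concat (map (succs ?T) ns)"] unfolding grow_def by blast
  have "?R ns \<subseteq> ?R (ns @ ys)" by auto
  then have mono: "(?R ns)\<^sup>* \<subseteq> (?R (ns @ ys))\<^sup>*" by (rule rtrancl_mono)
  have "label_list_ok ts gs m \<and> (l, m) \<in> (?R (ns @ ys))\<^sup>*" if "m \<in> set (ns @ ys)" for m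
  proof (cases "m \<in> set ns")
    case True
    then show ?thesis using assms mono by (auto simp: nodes_ok_def)
  next
    case False
    then have "m \<in> set ys" using that by simp
    then obtain a where a: "a \<in> set ns" "m \<in> set (succs ?T a)" using ys(2) by auto
    have "(l, a) \<in> (?R (ns @ ys))\<^sup>*" using assms mono a(1) by (auto simp: nodes_ok_def)
    moreover have "(a, m) \<in> ?R (ns @ ys)" using a that by simp
    ultimately have "(l, m) \<in> (?R (ns @ ys))\<^sup>*" by (rule rtrancl_into_rtrancl)
    moreover have "label_list_ok ts gs m" using label_list_ok_succs[of ts gs a m] a assms by (auto simp: nodes_ok_def)
    ultimately show ?thesis by blast
  qed
  then show ?thesis using assms ys(1,3) unfolding nodes_ok_def by auto
qed

lemma set_enum: "set (enum xs) = {(i, xs ! i) |i. i < length xs}"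
  by (force simp: enum_def set_zip)

text \<open>A stationary \<open>grow\<close> means that every successor label already occurs in the
  list. Distinct labels then make positions and labels interchangeable.\<close>

lemma tableau_graph:
  assumes ok: "nodes_ok ts gs l ns" and fx: "grow (assoc_concept ts (set gs)) ns = ns"
    and l: "label_of l = Seq (set gs \<union> {Assert (assoc_concept ts (set gs)) Ge 1})"
  shows "tableau (assoc_concept ts (set gs)) (set gs) (graph_of (graph (assoc_concept ts (set gs)) ns))"
proof -
  let ?T = "assoc_concept ts (set gs)"
  let ?G = "graph_of (graph ?T ns)"
  have len: "length (graph ?T ns) = length ns" by (simp add: graph_def)
  have V: "verts ?G = {..<length ns}" by (simp add: graph_of_def len)
  have lab: "lab ?G v = label_of (ns ! v)" if "v < length ns" for v
    using that by (simp add: graph_of_def graph_def label_of_def)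
  have E: "edges ?G = {(v, w). v < length ns \<and> w < length ns \<and> (\<exists>m\<in>set (succs ?T (ns ! v)). label_of m = label_of (ns ! w))}"
  proof -
    have "w \<in> set (snd (graph ?T ns ! v)) \<longleftrightarrow> w < length ns \<and> (\<exists>m\<in>set (succs ?T (ns ! v)). label_of m = label_of (ns ! w))"
      if "v < length ns" for v w
      using that by (auto simp: graph_def set_enum same_label_iff image_iff)
    then show ?thesis by (auto simp: graph_of_def len)
  qed
  obtain ys where ys: "grow ?T ns = ns @ ys" "\<forall>x\<in>set (concat (map (succs ?T) ns)). \<exists>m\<in>set (ns @ ys). label_of m = label_of x"
    using foldl_add_new[of ns "concat (map (succs ?T) ns)"] unfolding grow_def by blast
  then have closed: "\<exists>w<length ns. label_of (ns ! w) = label_of m" if "v < length ns" "m \<in> set (succs ?T (ns ! v))" for v m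
    using fx that by (fastforce simp: in_set_conv_nth)
  have labs: "lab ?G ` children ?G v = label_of ` set (succs ?T (ns ! v))" if v: "v < length ns" for v
  proof (intro equalityI subsetI)
    fix a assume "a \<in> lab ?G ` children ?G v"
    then obtain w where "w \<in> children ?G v" "a = lab ?G w" by blast
    moreover from this obtain m where "m \<in> set (succs ?T (ns ! v))" "label_of m = label_of (ns ! w)" "w < length ns"
      by (auto simp: E)
    ultimately show "a \<in> label_of ` set (succs ?T (ns ! v))" using lab[of w] by (metis image_eqI)
  next
    fix a assume "a \<in> label_of ` set (succs ?T (ns ! v))"
    then obtain m where m: "m \<in> set (succs ?T (ns ! v))" "a = label_of m" by blast
    obtain w where w: "w < length ns" "label_of (ns ! w) = label_of m" using closed[OF v m(1)] by blast
    then have "w \<in> children ?G v" using v m by (auto simp: E)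
    then show "a \<in> lab ?G ` children ?G v" using lab[OF w(1)] w(2) m(2) by (metis image_eqI)
  qed
  obtain ms where ms: "ns = l # ms" using ok by (auto simp: nodes_ok_def)
  have pos: "0 < length ns" "ns ! 0 = l" using ms by auto
  have root: "root ?G = 0" by (simp add: graph_of_def)
  have reach: "\<exists>v<length ns. ns ! v = m \<and> (0, v) \<in> (edges ?G)\<^sup>*"
    if "(l, m) \<in> {(a, b). a \<in> set ns \<and> b \<in> set ns \<and> b \<in> set (succs ?T a)}\<^sup>*" for m
    using that
  proof (induction rule: rtrancl_induct)
    case base
    then show ?case using ms by (intro exI[of _ 0]) auto
  next
    case (step a b)
    then obtain v where v: "v < length ns" "ns ! v = a" "(0, v) \<in> (edges ?G)\<^sup>*" by blast
    obtain w where w: "w < length ns" "ns ! w = b" using step by (auto simp: in_set_conv_nth)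
    have "(v, w) \<in> edges ?G" using v w step by (auto simp: E)
    with v(3) have "(0, w) \<in> (edges ?G)\<^sup>*" by (rule rtrancl_into_rtrancl)
    then show ?case using w by blast
  qed
  show ?thesis unfolding tableau_def
  proof (intro conjI ballI)
    show "root ?G \<in> verts ?G" unfolding root V using pos by simp
    show "edges ?G \<subseteq> verts ?G \<times> verts ?G" by (auto simp: V E)
    show "inj_on (lab ?G) (verts ?G)"
      using ok by (auto simp: inj_on_def V lab nodes_ok_def distinct_conv_nth)
    show "verts ?G \<subseteq> (edges ?G)\<^sup>* `` {root ?G}"
    proof
      fix v assume "v \<in> verts ?G"
      then have v: "v < length ns" by (simp add: V)
      then obtain w where w: "w < length ns" "ns ! w = ns ! v" "(0, w) \<in> (edges ?G)\<^sup>*"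
        using reach[of "ns ! v"] ok by (auto simp: nodes_ok_def)
      \<comment> \<open>Equal entries have the same position because the labels are
        distinct.\<close>
      then have "w = v" using ok v by (metis distinct_conv_nth distinct_map nodes_ok_def)
      then show "v \<in> (edges ?G)\<^sup>* `` {root ?G}" using w by (simp add: root)
    qed
    show "lab ?G (root ?G) = Seq (set gs \<union> {Assert ?T Ge 1})" unfolding root lab[OF pos(1)] pos(2) by (rule l)
    fix v assume "v \<in> verts ?G"
    then have v: "v < length ns" by (simp add: V)
    show "case lab ?G v of Bot \<Rightarrow> children ?G v = {}
      | Seq L \<Rightarrow> if saturated L then lab ?G ` children ?G v = {l. ex_rule ?T L l}
          else prop_rule L (lab ?G ` children ?G v)"
    proof (cases "ns ! v")
      case None
      then have "lab ?G ` children ?G v = {}" using labs[OF v] by (simp add: succs_def)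
      then show ?thesis using lab[OF v] None by simp
    next
      case (Some L)
      then show ?thesis using labs[OF v] lab[OF v] saturated_iff_expand[of L] expand_rule[of L] label_of_ex_succ[of ?T L]
        by (simp add: succs_def)
    qed
  qed
qed

lemma set_unsat_pass: "set us \<subseteq> {..<length g} \<Longrightarrow> set (unsat_pass g us) = unsat_step (graph_of g) (set us)"
proof -
  assume us: "set us \<subseteq> {..<length g}"
  have lab: "lab (graph_of g) v = label_of (fst (g ! v))" for v by (simp add: graph_of_def label_of_def)
  have V: "verts (graph_of g) = {..<length g}" by (simp add: graph_of_def)
  have ch: "children (graph_of g) v = set (snd (g ! v))" if "v < length g" for v
    using that by (auto simp: graph_of_def)
  have "v \<in> set (unsat_pass g us) \<longleftrightarrow> v \<in> unsat_step (graph_of g) (set us)" for v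
  proof (cases "v < length g")
    case True
    show ?thesis
    proof (cases "fst (g ! v)")
      case None
      then show ?thesis using True
        by (auto simp: unsat_pass_def set_enum image_iff unsat_step_def and_node_def or_node_def lab)
    next
      case (Some L)
      then show ?thesis using True saturated_iff_expand[of L] ch[OF True]
        by (auto simp: unsat_pass_def set_enum image_iff unsat_step_def and_node_def or_node_def lab V)
    qed
  next
    case False
    then show ?thesis using us
      by (auto simp: unsat_pass_def set_enum image_iff unsat_step_def and_node_def or_node_def V)
  qed
  then show ?thesis by blast
qed

text \<open>As long as the stages change, stage i has at least i elements. A change after
  \<open>length g\<close> rounds would need a proper subset of the vertices with as many elements as
  there are vertices.\<close>

lemma set_unsat_list: "set (unsat_list g) = Unsat (graph_of g)"
proof -
  let ?G = "graph_of g"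
  have V: "verts ?G = {..<length g}" by (simp add: graph_of_def)
  have fin: "finite (verts ?G)" by (simp add: V)
  note U = Unsat_lfp[OF fin]
  define u where "u i = ((unsat_pass g) ^^ i) (map fst (filter (\<lambda>q. fst (snd q) = None) (enum g)))" for i
  have u0: "set (u 0) = {v \<in> verts ?G. lab ?G v = Bot}"
    by (auto simp: u_def set_enum image_iff graph_of_def split: option.splits)
  have inc: "X \<subseteq> unsat_step ?G X" for X by (auto simp: unsat_step_def)
  have mono: "X \<subseteq> Y \<Longrightarrow> unsat_step ?G X \<subseteq> unsat_step ?G Y" for X Y by (auto simp: unsat_step_def)
  have sub: "X \<subseteq> verts ?G \<Longrightarrow> unsat_step ?G X \<subseteq> verts ?G" for X
    by (auto simp: unsat_step_def and_node_def or_node_def)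
  have uV: "set (u i) \<subseteq> verts ?G" and uS: "set (u (Suc i)) = unsat_step ?G (set (u i))" for i
  proof (induction i)
    case 0
    { case 1 show ?case using u0 by auto }
    { case 2 show ?case using set_unsat_pass[of "u 0" g] u0 V by (auto simp: u_def) }
  next
    case (Suc i)
    { case 1 show ?case using Suc sub by simp }
    { case 2
      have "set (u (Suc i)) \<subseteq> {..<length g}" using Suc sub V by simp
      from set_unsat_pass[OF this] show ?case by (simp add: u_def) }
  qed
  have le: "set (u i) \<subseteq> Unsat ?G" for i
  proof (induction i)
    case 0 show ?case using u0 U(2) by simp
  next
    case (Suc i) then show ?case using uS mono[OF Suc] U(1) by simp
  qed
  have grow: "unsat_step ?G (set (u i)) = set (u i) \<or> i \<le> card (set (u i))" for i
  proof (induction i)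
    case (Suc i)
    show ?case
    proof (cases "unsat_step ?G (set (u i)) = set (u i)")
      case True then show ?thesis by (simp add: uS)
    next
      case False
      then have "set (u i) \<subset> set (u (Suc i))" using inc uS by blast
      then have "card (set (u i)) < card (set (u (Suc i)))" by (intro psubset_card_mono) auto
      then show ?thesis using Suc False by auto
    qed
  qed simp
  have "unsat_step ?G (set (u (length g))) = set (u (length g))"
  proof (rule ccontr)
    assume a: "\<not> ?thesis"
    then have "length g \<le> card (set (u (length g)))" using grow by blast
    moreover have "set (u (length g)) \<subset> verts ?G" using a uV[of "Suc (length g)"] uS inc by blast
    then have "card (set (u (length g))) < length g" using psubset_card_mono[OF fin] V by (metis card_lessThan)
    ultimately show False by simp
  qed
  then have fixp: "X \<subseteq> set (u (length g)) \<Longrightarrow> unsat_step ?G X \<subseteq> set (u (length g))" for X using mono by blast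
  have "set (u 0) \<subseteq> set (u i)" for i by (induction i) (use inc uS in auto)
  then have "Unsat ?G \<subseteq> set (u (length g))" using U(4)[OF _ fixp] u0 by simp
  moreover have "unsat_list g = u (length g)"
  proof -
    have "foldl (\<lambda>us _. unsat_pass g us) vs ys = ((unsat_pass g) ^^ length ys) vs" for vs and ys :: graph_rep
      by (induction ys arbitrary: vs) (auto simp: funpow_swap1)
    then show ?thesis by (simp add: unsat_list_def u_def)
  qed
  ultimately show ?thesis using le by auto
qed

section \<open>Sizes\<close>

lemma size_rat_eq: "size_rat q = size_nat (nat \<bar>fst (quotient_of q)\<bar>) + size_nat (denom q)"
  by (simp add: size_rat_def denom_def split: prod.splits)

lemma sz_rat_eq: "sz q = sz (fst (quotient_of q) < 0) + sz (nat \<bar>fst (quotient_of q)\<bar>) + sz (denom q) + 2"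
  unfolding sz_def[of q] cd_rat denom_def by (simp add: sz_def)

lemma size_rat_le_sz: "size_rat q \<le> sz q"
  using size_nat_le_sz[of "nat \<bar>fst (quotient_of q)\<bar>"] size_nat_le_sz[of "denom q"]
  by (simp add: size_rat_eq sz_rat_eq)

lemma sz_rat_le: "sz q \<le> 11 * size_rat q"
  using sz_nat_le[of "nat \<bar>fst (quotient_of q)\<bar>"] sz_nat_le[of "denom q"]
    sz_bool_le[of "fst (quotient_of q) < 0"] size_rat_pos[of q]
  by (simp add: size_rat_eq sz_rat_eq)

lemma size_concept_le_sz: "size_concept C \<le> sz C"
proof (induction C)
  case (Atom p) then show ?case using size_nat_le_sz[of p] by (simp add: sz_concept_simps)
next
  case (Const c) then show ?case using size_rat_le_sz[of c] by (simp add: sz_concept_simps)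
next
  case (Ominus C c) then show ?case using size_rat_le_sz[of c] by (simp add: sz_concept_simps)
next
  case (Ex R C) then show ?case using size_nat_le_sz[of R] by (simp add: sz_concept_simps)
qed (auto simp: sz_concept_simps)

lemma sz_concept_le: "sz C \<le> 20 * size_concept C"
proof (induction C)
  case (Atom p) then show ?case using sz_nat_le[of p] by (simp add: sz_concept_simps)
next
  case (Const c) then show ?case using sz_rat_le[of c] by (simp add: sz_concept_simps)
next
  case (Ominus C c) then show ?case using sz_rat_le[of c] by (simp add: sz_concept_simps)
next
  case (Ex R C) then show ?case using sz_nat_le[of R] by (simp add: sz_concept_simps)
qed (auto simp: sz_concept_simps)

lemma sz_cmp_le: "sz (r :: cmp) \<le> 7"
  by (cases r) (auto simp: sz_def cd_cmp_simps)

lemma sz_Assert: "sz (Assert C r c) = sz r + sz C + sz c + 2"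
  by (simp add: sz_def cd_assertion_simps)

lemma size_assertion_le_sz: "size_assertion A \<le> sz A"
proof (cases A)
  case (Assert C r c)
  then show ?thesis using size_concept_le_sz[of C] size_rat_le_sz[of c] by (simp add: sz_Assert)
qed

lemma sz_assertion_le: "sz A \<le> 20 * size_assertion A"
proof (cases A)
  case (Assert C r c)
  then show ?thesis using sz_cmp_le[of r] sz_concept_le[of C] sz_rat_le[of c] by (simp add: sz_Assert)
qed

lemma size_gci_le_sz: "size_gci g \<le> sz g"
  using size_concept_le_sz[of "fst g"] size_concept_le_sz[of "snd g"]
  by (cases g) (simp add: size_gci_def)

lemma sz_gci_le: "sz g \<le> 20 * size_gci g" for g :: gci
  using sz_concept_le[of "fst g"] sz_concept_le[of "snd g"] by (cases g) (simp add: size_gci_def)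

lemma input_size_le_sz: "input_size ts gs \<le> sz (ts, gs)"
proof -
  have "sum_list (map size_gci ts) \<le> sz ts"
  proof (induction ts)
    case (Cons g ts) then show ?case using size_gci_le_sz[of g] unfolding sz_simps(3) by simp
  qed simp
  moreover have "sum_list (map size_assertion gs) \<le> sz gs"
  proof (induction gs)
    case (Cons A gs) then show ?case using size_assertion_le_sz[of A] unfolding sz_simps(3) by simp
  qed simp
  ultimately show ?thesis by (simp add: input_size_def)
qed

lemma sz_input_le: "sz (ts, gs) \<le> 21 * input_size ts gs + 3"
proof -
  have "sz ts \<le> 21 * sum_list (map size_gci ts) + 1"
  proof (induction ts)
    case (Cons g ts)
    have "1 \<le> size_gci g" by (simp add: size_gci_def)
    then show ?case using Cons sz_gci_le[of g] unfolding sz_simps(3) by simp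
  qed simp
  moreover have "sz gs \<le> 21 * sum_list (map size_assertion gs) + 1"
  proof (induction gs)
    case (Cons A gs)
    have "1 \<le> size_assertion A" by (cases A) simp
    then show ?case using Cons sz_assertion_le[of A] unfolding sz_simps(3) by simp
  qed simp
  ultimately show ?thesis by (simp add: input_size_def)
qed

text \<open>The denominator divides M and the numerator is at most X * M in absolute value. Binary
  lengths are estimated by the numbers themselves, which is good enough where only an exponential
  bound is wanted.\<close>

lemma sz_multiples_le:
  assumes "0 < M" "q \<in> multiples M" "\<bar>q\<bar> \<le> of_nat X"
  shows "sz q \<le> 8 * (M * (X + 1)) + 10"
proof -
  define a b where "a = fst (quotient_of q)" and "b = denom q"
  have b0: "0 < b" by (simp add: b_def denom_pos)
  have q: "q = of_int a / of_nat b" unfolding a_def b_def denom_def by (rule rat_eq_quotient)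
  obtain k where "q = of_int k / of_nat M" using assms(2) by (auto simp: multiples_def)
  then have "of_int a * of_nat M = (of_int k * of_nat b :: rat)" using q b0 assms(1) by (simp add: field_simps)
  then have "(of_int (a * int M) :: rat) = of_int (k * int b)" by simp
  then have "a * int M = k * int b" by (simp only: of_int_eq_iff)
  then have "int b dvd a * int M" by simp
  moreover have "coprime (int b) a"
    using quotient_of_coprime[of q a "snd (quotient_of q)"] quotient_of_denom_pos'[of q]
    by (simp add: a_def b_def denom_def coprime_commute)
  ultimately have "int b dvd int M" by (simp add: coprime_dvd_mult_right_iff)
  then have bM: "b \<le> M" using assms(1) by (auto dest: dvd_imp_le)
  have "\<bar>of_int a\<bar> = \<bar>q\<bar> * of_nat b" using b0 by (simp add: q abs_mult)
  also have "\<dots> \<le> of_nat X * of_nat b" using assms(3) by (intro mult_right_mono) auto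
  finally have "of_int \<bar>a\<bar> \<le> (of_int (int (X * b)) :: rat)" by simp
  then have "\<bar>a\<bar> \<le> int (X * b)" by (simp only: of_int_le_iff)
  then have "nat \<bar>a\<bar> \<le> X * b" by (simp only: nat_le_iff)
  also have "\<dots> \<le> X * M" using bM by simp
  finally have aM: "nat \<bar>a\<bar> \<le> X * M" .
  have "sz q \<le> 3 + (4 * nat \<bar>a\<bar> + 1) + (4 * b + 1) + 2"
    unfolding sz_rat_eq a_def[symmetric] b_def[symmetric]
    using sz_bool_le[of "a < 0"] sz_nat_le[of "nat \<bar>a\<bar>"] sz_nat_le[of b] size_nat_le_self[of "nat \<bar>a\<bar>"] size_nat_le_self[of b]
    by linarith
  then show ?thesis using aM bM by (simp add: algebra_simps)
qed

text \<open>Keeps apart the two factors of a size estimate: the number of constructors, which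
  \<open>csize\<close> controls, and the largest name or constant, which \<open>K\<close>
  controls.\<close>

primrec payload_le :: "nat \<Rightarrow> concept \<Rightarrow> bool" where
  "payload_le K (Atom p) = (sz p \<le> K)"
| "payload_le K (Const c) = (sz c \<le> K)"
| "payload_le K (Neg C) = payload_le K C"
| "payload_le K (Ominus C c) = (payload_le K C \<and> sz c \<le> K)"
| "payload_le K (And C D) = (payload_le K C \<and> payload_le K D)"
| "payload_le K (Ex R C) = (sz R \<le> K \<and> payload_le K C)"

lemma payload_le_sz: "payload_le K C \<Longrightarrow> sz C \<le> csize C * (K + 15)"
  by (induction C) (auto simp: sz_concept_simps add_mult_distrib)

lemma payload_leI: "sz C \<le> K \<Longrightarrow> payload_le K C"
  by (induction C) (auto simp: sz_concept_simps)

text \<open>Passing to a part of a concept changes the bound by at most 1 while \<open>csize\<close>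
  drops by at least 1, so the sum of |bound| and \<open>csize\<close> does not grow. Constants are
  exempt: \<open>Ominus_upper\<close> turns a bound, possibly outside the unit interval, into
  one.\<close>

definition small_assertion :: "nat \<Rightarrow> nat \<Rightarrow> nat \<Rightarrow> assertion \<Rightarrow> bool" where
  "small_assertion M X K A \<longleftrightarrow> payload_le K (concept_of A) \<and> concept_consts (concept_of A) \<subseteq> multiples M \<and>
     bound_of A \<in> multiples M \<and> \<bar>bound_of A\<bar> \<le> of_nat X \<and>
     ((\<exists>d. concept_of A = Const d) \<or>
      \<bar>bound_of A\<bar> + of_nat (csize (concept_of A)) \<le> of_nat X \<and> (\<forall>q\<in>concept_consts (concept_of A). \<bar>q\<bar> \<le> 1))"

lemma small_assertion_cl:
  assumes M: "0 < M" and K: "8 * (M * (X + 1)) + 10 \<le> K"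
    and A: "small_assertion M X K (Assert C r c)" "A \<in> subassertions C r c"
  shows "small_assertion M X K A"
proof (rule subassertions_invariant[where P = "small_assertion M X K", OF _ _ _ _ A])
  have one: "1 \<in> multiples M" using multiples_of_int[OF M, of 1] by simp
  fix C D :: concept and r c q R
  show "small_assertion M X K (Assert (Neg C) r c) \<Longrightarrow> small_assertion M X K (Assert C (flip r) (1 - c))"
    using multiples_diff[OF one, of c] csize_pos[of C] by (auto simp: small_assertion_def)
  show "small_assertion M X K (Assert (Ominus C q) r c) \<Longrightarrow>
      small_assertion M X K (Assert C r (c + q)) \<and> small_assertion M X K (Assert (Const c) (flip r) 0)"
    using sz_multiples_le[OF M, of c X] K multiples_0[of M] csize_pos[of C] multiples_add[of c M q] by (auto simp: small_assertion_def)
  show "small_assertion M X K (Assert (And C D) r c) \<Longrightarrow>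
      small_assertion M X K (Assert C r c) \<and> small_assertion M X K (Assert D r c)"
    by (auto simp: small_assertion_def)
  show "small_assertion M X K (Assert (Ex R C) r c) \<Longrightarrow> small_assertion M X K (Assert C r c)"
    by (auto simp: small_assertion_def)
qed

lemma sz_small_assertion:
  assumes "0 < M" "8 * (M * (X + 1)) + 10 \<le> K" "small_assertion M X K A"
  shows "sz A \<le> (X + 1) * (K + 15) + K + 9"
proof -
  obtain C r c where A: "A = Assert C r c" by (cases A)
  have "csize C \<le> X + 1"
  proof (cases "\<exists>d. C = Const d")
    case False
    then have "\<bar>c\<bar> + of_nat (csize C) \<le> of_nat X" using assms(3) by (auto simp: small_assertion_def A)
    then have "(of_nat (csize C) :: rat) \<le> of_nat X" using abs_ge_zero[of c] by linarith
    then show ?thesis by simp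
  qed auto
  then have "csize C * (K + 15) \<le> (X + 1) * (K + 15)" by (rule mult_le_mono1)
  then have "sz C \<le> (X + 1) * (K + 15)"
    using payload_le_sz[of K C] assms(3) by (simp add: small_assertion_def A)
  moreover have "sz c \<le> K" using sz_multiples_le[OF assms(1), of c X] assms(2,3) by (auto simp: small_assertion_def A)
  ultimately show ?thesis using sz_cmp_le[of r] by (simp add: A sz_Assert)
qed

lemma abs_rat_le: "\<bar>q\<bar> \<le> of_nat (2 ^ size_rat q)"
proof -
  let ?a = "fst (quotient_of q)"
  have "\<bar>q\<bar> = of_int \<bar>?a\<bar> / of_nat (denom q)"
    by (subst rat_eq_quotient[of q]) (simp add: denom_def abs_divide)
  also have "\<dots> \<le> of_int \<bar>?a\<bar>" using denom_pos[of q] by (simp add: divide_le_eq mult_le_cancel_left1 Suc_leI)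
  also have "\<dots> = of_nat (nat \<bar>?a\<bar>)" by simp
  also have "\<dots> \<le> of_nat (2 ^ size_rat q)"
  proof (rule of_nat_mono)
    have "nat \<bar>?a\<bar> \<le> 2 ^ size_nat (nat \<bar>?a\<bar>)" using less_size_nat by (rule less_imp_le)
    also have "\<dots> \<le> 2 ^ size_rat q" by (intro power_increasing) (auto simp: size_rat_eq)
    finally show "nat \<bar>?a\<bar> \<le> 2 ^ size_rat q" .
  qed
  finally show ?thesis .
qed

text \<open>\<open>2 ^ m + m\<close> covers a bound of the input plus the weight of its concept; the
  rest covers the weight of the associated concept plus its bound 1.\<close>

definition csize_bound :: "nat \<Rightarrow> nat" where "csize_bound m = 2 ^ m + 2 + m + (2 * 2 ^ m + 1) * 16 * m"
definition payload_bound :: "nat \<Rightarrow> nat" where "payload_bound m = m + 8 * (2 * 2 ^ m * (csize_bound m + 1)) + 10"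
definition assertion_bound :: "nat \<Rightarrow> nat" where "assertion_bound m = (csize_bound m + 1) * (payload_bound m + 15) + payload_bound m + 9"
text \<open>The first part makes \<open>pad\<close> longer than the numerators of the half grid, the
  second leaves room for the complete list of nodes.\<close>

definition required :: "nat \<Rightarrow> nat" where
  "required m = 2 * 2 ^ m + 1 + (node_bound m * ((2 * m + 1) * (assertion_bound m + 1) + 4) + 1)"

lemma label_universe_bound_mono: "n \<le> m \<Longrightarrow> label_universe_bound n \<le> label_universe_bound m"
  unfolding label_universe_bound_def by (intro add_mono mult_mono power_increasing) auto

lemma node_bound_mono: "n \<le> m \<Longrightarrow> node_bound n \<le> node_bound m"
proof -
  assume a: "n \<le> m"
  have "(label_universe_bound n + 1) ^ (2 * n + 1) \<le> (label_universe_bound m + 1) ^ (2 * n + 1)"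
    using label_universe_bound_mono[OF a] by (intro power_mono) auto
  also have "\<dots> \<le> (label_universe_bound m + 1) ^ (2 * m + 1)" using a by (intro power_increasing) auto
  finally show ?thesis by (simp add: node_bound_def)
qed

lemma csize_assoc_concept_le:
  assumes "input_size ts gs \<le> m" shows "csize (assoc_concept ts (set gs)) + 1 \<le> csize_bound m"
proof -
  have "(2 * 2 ^ input_size ts gs + 1) * 16 * input_size ts gs \<le> (2 * 2 ^ m + 1) * 16 * m"
    using assms by (intro mult_mono add_mono power_increasing) auto
  then show ?thesis using csize_assoc_concept[of ts gs] unfolding csize_bound_def by linarith
qed

lemma multiples_double: "multiples N \<subseteq> multiples (2 * N)"
proof
  fix q assume "q \<in> multiples N"
  then obtain k where "q = of_int k / of_nat N" by (auto simp: multiples_def)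
  then have "q = of_int (2 * k) / of_nat (2 * N)" by simp
  then show "q \<in> multiples (2 * N)" unfolding multiples_def by blast
qed

text \<open>The assertions of the root are small by inspection, and smallness passes to
  subassertions. The denominator is 2N, not N, because midpoints occur among the constants of
  T.\<close>

lemma label_universe_sz:
  assumes wf: "\<forall>g\<in>set ts. wf_gci g" "\<forall>A\<in>set gs. wf_assertion A" and A: "A \<in> label_universe ts gs"
  defines "m \<equiv> sz (ts, gs)"
  shows "sz A \<le> assertion_bound m"
proof -
  let ?T = "assoc_concept ts (set gs)"
  let ?N = "common_denom (set ts) (set gs)"
  let ?Z = "Z'_set (set ts) (set gs)"
  let ?small = "small_assertion (2 * ?N) (csize_bound m) (payload_bound m)"
  have nm: "input_size ts gs \<le> m" unfolding m_def by (rule input_size_le_sz)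
  have N: "0 < 2 * ?N" using common_denom_pos[OF finite_set finite_set, of ts gs] by simp
  have "(2::nat) ^ input_size ts gs \<le> 2 ^ m" using nm by (intro power_increasing) auto
  then have "2 * ?N \<le> 2 * 2 ^ m" using common_denom_le[of ts gs] by linarith
  then have "2 * ?N * (csize_bound m + 1) \<le> 2 * 2 ^ m * (csize_bound m + 1)" by (rule mult_right_mono) simp
  then have K: "8 * (2 * ?N * (csize_bound m + 1)) + 10 + m \<le> payload_bound m" unfolding payload_bound_def by linarith
  have allc: "all_consts (set ts) (set gs) \<subseteq> multiples (2 * ?N)"
    using all_consts_multiples[OF finite_set finite_set, of ts gs] multiples_double by blast
  have unit: "wf_concept C \<Longrightarrow> q \<in> concept_consts C \<Longrightarrow> 0 \<le> q \<and> q \<le> 1" for C q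
    by (induction C) auto
  have "?small B" if B: "B \<in> set gs" for B
  proof (cases B)
    case (Assert C r c)
    have "assertion_consts B \<subseteq> multiples (2 * ?N)" using allc B by (force simp: all_consts_def)
    then have 1: "concept_consts C \<subseteq> multiples (2 * ?N)" "c \<in> multiples (2 * ?N)" using Assert by auto
    have "sz B \<le> m" using sz_mem_le[OF B] by (simp add: m_def)
    then have 2: "payload_le (payload_bound m) C" using K by (intro payload_leI) (simp add: Assert sz_Assert)
    have 3: "\<bar>q\<bar> \<le> 1" if "q \<in> concept_consts C" for q
      using unit[OF _ that] wf(2) B Assert by force
    have "size_assertion B \<le> sum_list (map size_assertion gs)" using B by (induction gs) auto
    then have s: "1 + size_concept C + size_rat c \<le> input_size ts gs" by (simp add: Assert input_size_def)
    then have "\<bar>c\<bar> \<le> of_nat (2 ^ m)"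
      using nm by (intro order_trans[OF abs_rat_le] of_nat_mono power_increasing) auto
    moreover have "csize C \<le> m" using s nm csize_le_size[of C] by linarith
    then have "(of_nat (csize C) :: rat) \<le> of_nat m" by (rule of_nat_mono)
    moreover have "(of_nat (2 ^ m) + of_nat m :: rat) \<le> of_nat (csize_bound m)"
      unfolding of_nat_add[symmetric] by (rule of_nat_mono) (simp add: csize_bound_def)
    ultimately have 4: "\<bar>c\<bar> + of_nat (csize C) \<le> of_nat (csize_bound m)" by linarith
    then have 5: "\<bar>c\<bar> \<le> of_nat (csize_bound m)" using of_nat_0_le_iff[of "csize C", where 'a = rat] by linarith
    show ?thesis using 1 2 3 4 5 by (simp add: small_assertion_def Assert)
  qed
  moreover have "?small (Assert ?T Ge 1)"
  proof -
    have z: "z \<in> multiples (2 * ?N) \<and> 0 \<le> z \<and> z \<le> 1" if "z \<in> ?Z" for z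
    proof -
      obtain k where k: "k \<le> 2 * ?N" "z = of_nat k / of_nat (2 * ?N)"
        using \<open>z \<in> ?Z\<close> unfolding Z'_set_eq[OF finite_set finite_set] by auto
      then have "0 \<le> z \<and> z \<le> 1" using N by (simp add: divide_le_eq del: of_nat_mult)
      moreover have "z = of_int (int k) / of_nat (2 * ?N)" using k(2) by simp
      then have "z \<in> multiples (2 * ?N)" unfolding multiples_def by blast
      ultimately show ?thesis by blast
    qed
    have one: "1 \<in> multiples (2 * ?N)" using multiples_of_int[OF N, of 1] by simp
    have mag1: "1 \<le> csize_bound m" by (simp add: csize_bound_def)
    have small_rat: "sz q \<le> payload_bound m" if "q \<in> multiples (2 * ?N)" "\<bar>q\<bar> \<le> 1" for q
    proof -
      have "\<bar>q\<bar> \<le> of_nat (csize_bound m)" using that(2) of_nat_mono[OF mag1, where 'a = rat] by simp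
      then show ?thesis using sz_multiples_le[OF N that(1), of "csize_bound m"] K by linarith
    qed
    have gci: "payload_le (payload_bound m) (fst g) \<and> payload_le (payload_bound m) (snd g) \<and>
        concept_consts (fst g) \<union> concept_consts (snd g) \<subseteq> multiples (2 * ?N) \<inter> {q. \<bar>q\<bar> \<le> 1}" if g: "g \<in> set ts" for g
    proof -
      have "sz g \<le> m" using sz_mem_le[OF g] by (simp add: m_def)
      then have "sz (fst g) \<le> payload_bound m" "sz (snd g) \<le> payload_bound m" using K by (cases g; simp)+
      moreover have "concept_consts (fst g) \<union> concept_consts (snd g) \<subseteq> all_consts (set ts) (set gs)"
        using g by (force simp: all_consts_def)
      moreover have "\<bar>q\<bar> \<le> 1" if "q \<in> concept_consts (fst g) \<union> concept_consts (snd g)" for q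
        using that unit[of "fst g" q] unit[of "snd g" q] wf(1) g by (force simp: wf_gci_def)
      ultimately show ?thesis using allc by (auto intro: payload_leI)
    qed
    have pa: "payload_le k (big_and Cs) \<longleftrightarrow> (\<forall>C\<in>set Cs. payload_le k C)" if "sz (1::rat) \<le> k" for k Cs
      using that by (induction Cs rule: big_and.induct) auto
    have po: "payload_le k (big_or Cs) \<longleftrightarrow> (\<forall>C\<in>set Cs. payload_le k C)" if "sz (0::rat) \<le> k" for k Cs
      using that by (induction Cs rule: big_or.induct) (auto simp: Or_def)
    have ca: "concept_consts (big_and Cs) \<subseteq> {1} \<union> (\<Union>C\<in>set Cs. concept_consts C)" for Cs
      by (induction Cs rule: big_and.induct) auto
    have co: "concept_consts (big_or Cs) \<subseteq> {0} \<union> (\<Union>C\<in>set Cs. concept_consts C)" for Cs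
      by (induction Cs rule: big_or.induct) (auto simp: Or_def)
    have Zl: "set (sorted_list_of_set ?Z) = ?Z" by (simp add: finite_Z'_set)
    have z': "sz z \<le> payload_bound m \<and> sz (1 - z) \<le> payload_bound m" if "z \<in> ?Z" for z
      using z[OF that] multiples_diff[OF one, of z] by (auto intro!: small_rat)
    have "payload_le (payload_bound m) ?T"
      unfolding assoc_concept_def assoc_gci_def
      using gci z' small_rat[OF one] small_rat[OF multiples_0] by (auto simp: pa po Zl Oplus_def)
    moreover have "concept_consts ?T \<subseteq> multiples (2 * ?N) \<inter> {q. \<bar>q\<bar> \<le> 1}"
    proof -
      have "concept_consts (assoc_gci ?Z g) \<subseteq> multiples (2 * ?N) \<inter> {q. \<bar>q\<bar> \<le> 1}" if "g \<in> set ts" for g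
      proof -
        have "{0} \<union> (\<Union>C\<in>set (map (\<lambda>z. And (Oplus (Neg (fst g)) z) (Oplus (snd g) (1 - z))) (sorted_list_of_set ?Z)). concept_consts C)
           \<subseteq> multiples (2 * ?N) \<inter> {q. \<bar>q\<bar> \<le> 1}"
          using gci[OF that] z multiples_diff[OF one] multiples_0[of "2 * ?N"] by (auto simp: Zl Oplus_def)
        then show ?thesis unfolding assoc_gci_def using co by (meson order_trans)
      qed
      then have "{1} \<union> (\<Union>C\<in>set (map (assoc_gci ?Z) ts). concept_consts C) \<subseteq> multiples (2 * ?N) \<inter> {q. \<bar>q\<bar> \<le> 1}"
        using one by auto
      then show ?thesis unfolding assoc_concept_def using ca by (meson order_trans)
    qed
    moreover have "(1 :: rat) + of_nat (csize ?T) \<le> of_nat (csize_bound m)"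
      using of_nat_mono[OF csize_assoc_concept_le[OF nm], where 'a = rat] by simp
    moreover have "(1 :: rat) \<le> of_nat (csize_bound m)" using mag1 by (metis of_nat_1 of_nat_le_iff)
    ultimately show ?thesis using one by (auto simp: small_assertion_def)
  qed
  ultimately have root: "?small B" if "B \<in> set gs \<union> {Assert ?T Ge 1}" for B using that by blast
  obtain B where B: "B \<in> set gs \<union> {Assert ?T Ge 1}" "A \<in> (case B of Assert C r c \<Rightarrow> subassertions C r c)"
    using A unfolding label_universe_def closure_of_def by blast
  obtain C r c where C: "B = Assert C r c" by (cases B)
  have "?small A" using small_assertion_cl[OF N, of "csize_bound m" "payload_bound m" C r c A] K root[OF B(1)] B(2) by (simp add: C)
  then show ?thesis unfolding assertion_bound_def using sz_small_assertion[OF N, of "csize_bound m" "payload_bound m" A] K by simp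
qed

lemma nodes_ok_sz:
  assumes wf: "\<forall>g\<in>set ts. wf_gci g" "\<forall>A\<in>set gs. wf_assertion A" and ns: "nodes_ok ts gs l ns"
  defines "m \<equiv> sz (ts, gs)"
  shows "sz ns \<le> node_bound m * ((2 * m + 1) * (assertion_bound m + 1) + 4) + 1"
proof -
  have nm: "input_size ts gs \<le> m" unfolding m_def by (rule input_size_le_sz)
  have lab: "sz l \<le> (2 * m + 1) * (assertion_bound m + 1) + 3" if "l \<in> set ns" for l
  proof (cases l)
    case (Some L)
    then have L: "distinct L" "root_label_inv ts gs (set L)" using ns that by (auto simp: nodes_ok_def label_list_ok_def)
    have "length L \<le> 2 * m + 1" using root_label_inv_card[OF L(2)] distinct_card[OF L(1)] nm by simp
    moreover have "sz L \<le> length L * (assertion_bound m + 1) + 1"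
      using root_label_inv_subset[OF L(2)] label_universe_sz[OF wf] by (intro sz_list_le) (auto simp: m_def)
    ultimately have "sz L \<le> (2 * m + 1) * (assertion_bound m + 1) + 1"
      by (meson add_le_mono1 le_trans mult_le_mono1)
    then show ?thesis using Some by simp
  qed simp
  have "length ns = card (label_of ` set ns)" using ns by (metis distinct_card length_map nodes_ok_def set_map)
  also have "\<dots> \<le> node_bound (input_size ts gs)"
  proof (rule label_count(2))
    fix a assume "a \<in> label_of ` set ns"
    then obtain k where "k \<in> set ns" "a = label_of k" by blast
    then have "label_list_ok ts gs k" "a = label_of k" using ns by (simp_all add: nodes_ok_def)
    then show "a = Bot \<or> (\<exists>L. a = Seq L \<and> root_label_inv ts gs L)"
      by (auto simp: label_list_ok_def label_of_def split: option.splits)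
  qed
  also have "\<dots> \<le> node_bound m" by (rule node_bound_mono[OF nm])
  finally have "length ns \<le> node_bound m" .
  then have "length ns * ((2 * m + 1) * (assertion_bound m + 1) + 3 + 1) + 1 \<le> node_bound m * ((2 * m + 1) * (assertion_bound m + 1) + 4) + 1"
    by (intro add_right_mono mult_le_mono) auto
  then show ?thesis using sz_list_le[OF lab] by (rule le_trans[rotated])
qed

text \<open>For a sufficiently long \<open>pad\<close> neither the grid nor the exploration is
  truncated, and the polynomial-time function computes the genuine tableau.\<close>

lemma construct_correct:
  assumes wf: "\<forall>g\<in>set ts. wf_gci g" "\<forall>A\<in>set gs. wf_assertion A"
    and pad: "required (sz (ts, gs)) \<le> length pad"
  obtains ns us where "construct (pad, ts, gs) = (ns, us, answer (graph_of ns))"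
    "tableau (assoc_concept ts (set gs)) (set gs) (graph_of ns)" "set us = Unsat (graph_of ns)"
proof -
  let ?T = "assoc_concept ts (set gs)" and ?m = "sz (ts, gs)"
  have "(2::nat) ^ input_size ts gs \<le> 2 ^ ?m" using input_size_le_sz by (intro power_increasing) auto
  then have "2 * common_denom (set ts) (set gs) < length pad"
    using common_denom_le[of ts gs] pad unfolding required_def by linarith
  then have T: "tbox_concept pad ts gs = ?T" by (rule tbox_concept_eq)
  define l where "l = Some (uniq (Assert ?T Ge 1 # gs))"
  have l: "label_of l = Seq (set gs \<union> {Assert ?T Ge 1})" by (simp add: l_def)
  define ns where "ns = explore ?T pad l"
  have "nodes_ok ts gs l ns \<and> grow ?T ns = ns" unfolding ns_def
  proof (rule explore_fixpoint)
    show "nodes_ok ts gs l [l]"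
      using root_label_inv_root[of ts gs] by (simp add: nodes_ok_def label_list_ok_def l_def)
    show "sz ns \<le> length pad" if "nodes_ok ts gs l ns" for ns
      using nodes_ok_sz[OF wf that] pad unfolding required_def by linarith
  qed (rule nodes_ok_grow)
  then have tab: "tableau ?T (set gs) (graph_of (graph ?T ns))" using tableau_graph[OF _ _ l] by blast
  show ?thesis
  proof (rule that[OF _ tab set_unsat_list])
    show "construct (pad, ts, gs) = (graph ?T ns, unsat_list (graph ?T ns), answer (graph_of (graph ?T ns)))"
      using set_unsat_list[of "graph ?T ns"]
      by (simp add: construct_def T Let_def l_def[symmetric] ns_def[symmetric] answer_def graph_of_def)
  qed
qed

section \<open>Exponential time\<close>

definition exp_bounded :: "(nat \<Rightarrow> nat) \<Rightarrow> bool" where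
  "exp_bounded B \<longleftrightarrow> (\<exists>C. poly_bounded C \<and> (\<forall>n. B n \<le> 2 ^ C n))"

named_theorems exp_bounded_intros

lemma exp_bounded_if_poly_bounded: "poly_bounded B \<Longrightarrow> exp_bounded B"
  unfolding exp_bounded_def by (auto intro!: exI[of _ B] less_imp_le)

lemma exp_bounded_const [exp_bounded_intros]: "exp_bounded (\<lambda>n. c)" and exp_bounded_id [exp_bounded_intros]: "exp_bounded (\<lambda>n. n)"
  and exp_bounded_pow [exp_bounded_intros]: "exp_bounded (\<lambda>n. (n + 2) ^ k)"
  by (intro exp_bounded_if_poly_bounded poly_bounded_intros)+

lemma exp_bounded_add [exp_bounded_intros]: assumes "exp_bounded B" "exp_bounded C" shows "exp_bounded (\<lambda>n. B n + C n)"
proof -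
  obtain b c where b: "poly_bounded b" "\<And>n. B n \<le> 2 ^ b n" and c: "poly_bounded c" "\<And>n. C n \<le> 2 ^ c n"
    using assms unfolding exp_bounded_def by blast
  have "B n + C n \<le> 2 ^ (b n + c n + 1)" for n
  proof -
    have "(2::nat) ^ b n \<le> 2 ^ (b n + c n)" "(2::nat) ^ c n \<le> 2 ^ (b n + c n)" by (intro power_increasing; simp)+
    moreover have "(2::nat) ^ (b n + c n + 1) = 2 * 2 ^ (b n + c n)" by simp
    ultimately show ?thesis using b(2)[of n] c(2)[of n] by linarith
  qed
  moreover have "poly_bounded (\<lambda>n. b n + c n + 1)" by (intro poly_bounded_intros b c)
  ultimately show ?thesis unfolding exp_bounded_def by blast
qed

lemma exp_bounded_mult [exp_bounded_intros]: assumes "exp_bounded B" "exp_bounded C" shows "exp_bounded (\<lambda>n. B n * C n)"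
proof -
  obtain b c where b: "poly_bounded b" "\<And>n. B n \<le> 2 ^ b n" and c: "poly_bounded c" "\<And>n. C n \<le> 2 ^ c n"
    using assms unfolding exp_bounded_def by blast
  have "B n * C n \<le> 2 ^ (b n + c n)" for n
    unfolding power_add by (intro mult_le_mono b c)
  moreover have "poly_bounded (\<lambda>n. b n + c n)" by (intro poly_bounded_intros b c)
  ultimately show ?thesis unfolding exp_bounded_def by blast
qed

text \<open>The exponent may depend on n, as in the number of subsets of bounded size: a power of
  2^b with exponent q is 2^(b*q), and b*q stays polynomial.\<close>

lemma exp_bounded_power: assumes "exp_bounded B" "poly_bounded q" shows "exp_bounded (\<lambda>n. B n ^ q n)"
proof -
  obtain b where b: "poly_bounded b" "\<And>n. B n \<le> 2 ^ b n" using assms unfolding exp_bounded_def by blast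
  have "B n ^ q n \<le> 2 ^ (b n * q n)" for n
    unfolding power_mult by (intro power_mono b) simp
  moreover have "poly_bounded (\<lambda>n. b n * q n)" by (intro poly_bounded_intros b assms)
  ultimately show ?thesis unfolding exp_bounded_def by blast
qed

lemma exp_bounded_power_const [exp_bounded_intros]: "exp_bounded B \<Longrightarrow> exp_bounded (\<lambda>n. B n ^ k)"
  by (intro exp_bounded_power poly_bounded_intros)

lemma exp_bounded_two_power [exp_bounded_intros]: "poly_bounded q \<Longrightarrow> exp_bounded (\<lambda>n. 2 ^ q n)"
  unfolding exp_bounded_def by blast

lemma exp_boundedE:
  assumes "exp_bounded B" obtains k where "\<And>n. B n \<le> 2 ^ ((n + 2) ^ k)"
proof -
  obtain b where b: "poly_bounded b" "\<And>n. B n \<le> 2 ^ b n" using assms unfolding exp_bounded_def by blast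
  obtain k where "\<And>n. b n \<le> (n + 2) ^ k" using b(1) unfolding poly_bounded_def by blast
  then have "B n \<le> 2 ^ ((n + 2) ^ k)" for n
    using b(2)[of n] by (meson le_trans one_le_numeral power_increasing)
  then show ?thesis by (rule that)
qed

lemma exp_bounded_node_bound: "exp_bounded node_bound"
proof -
  have "exp_bounded (\<lambda>n. (label_universe_bound n + 1) ^ (2 * n + 1))"
    unfolding label_universe_bound_def by (intro exp_bounded_power exp_bounded_intros poly_bounded_intros)
  then show ?thesis unfolding node_bound_def by (intro exp_bounded_intros)
qed

lemma exp_bounded_required: "exp_bounded required"
proof -
  have "exp_bounded csize_bound" unfolding csize_bound_def by (intro exp_bounded_intros poly_bounded_intros)
  then have "exp_bounded payload_bound" unfolding payload_bound_def by (intro exp_bounded_intros poly_bounded_intros)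
  with \<open>exp_bounded csize_bound\<close> have "exp_bounded assertion_bound" unfolding assertion_bound_def by (intro exp_bounded_intros)
  then show ?thesis unfolding required_def by (intro exp_bounded_intros poly_bounded_intros exp_bounded_node_bound)
qed

section \<open>An exponentially long unary string\<close>

primrec ticks :: "nat \<Rightarrow> 'a::coded \<Rightarrow> unit list" where
  "ticks 0 x = [()]"
| "ticks (Suc k) x = concat (map (\<lambda>_. ticks k x) (() # () # replicate (sz x) ()))"

lemma length_ticks: "length (ticks k x) = (sz x + 2) ^ k"
proof (induction k)
  case (Suc k)
  then show ?case by (simp add: length_concat sum_list_replicate)
qed simp

lemma polytime_ticks_power: "polytime (ticks k :: 'a::coded \<Rightarrow> unit list)"
proof (induction k)
  case (Suc k)
  have "polytime (\<lambda>x :: 'a. concat (map (\<lambda>_::unit. ticks k x) (() # () # replicate (sz x) ())))"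
    by (intro polytime_intros polytime_ticks polytime_comp[OF Suc])
  then show ?case by simp
qed (simp add: polytime_const)

text \<open>Doubling a one-element list polynomially often. The number of rounds is itself available
  in unary, from \<open>ticks\<close>.\<close>

definition padding :: "nat \<Rightarrow> 'a::coded \<Rightarrow> unit list" where
  "padding k x = foldl (\<lambda>p _. p @ p) [()] (ticks k x)"

lemma length_doubling: "length (foldl (\<lambda>p _. p @ p) p us) = 2 ^ length us * length p"
  by (induction us arbitrary: p) auto

lemma length_padding: "length (padding k x) = 2 ^ ((sz x + 2) ^ k)"
  by (simp add: padding_def length_doubling length_ticks)

lemma sz_units: "sz (us :: unit list) = 2 * length us + 1"
  by (induction us) auto

text \<open>The general estimate for folds is used with an exponential bound on the states:
  polynomially many rounds, each polynomial in the current state, stay exponential.\<close>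

lemma time_bounded_padding: "\<exists>B. exp_bounded B \<and> time_bounded B (padding k :: 'a::coded \<Rightarrow> unit list)"
proof -
  have "polytime (\<lambda>p :: 'a \<times> unit list \<times> unit. fst (snd p) @ fst (snd p))" by (intro polytime_intros)
  then obtain a where a: "time_bounded (\<lambda>n. (n + 2) ^ a) (\<lambda>p :: 'a \<times> unit list \<times> unit. fst (snd p) @ fst (snd p))"
    unfolding polytime_def by blast
  have "polytime (\<lambda>x :: 'a. [()])" by (rule polytime_const)
  then obtain b where b: "time_bounded (\<lambda>n. (n + 2) ^ b) (\<lambda>x :: 'a. [()])" unfolding polytime_def by blast
  obtain c where c: "time_bounded (\<lambda>n. (n + 2) ^ c) (ticks k :: 'a \<Rightarrow> unit list)" using polytime_ticks_power unfolding polytime_def by blast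
  let ?S = "\<lambda>n. 2 * 2 ^ ((n + 2) ^ k) + 1 :: nat"
  have S: "sz (foldl (\<lambda>p _. p @ p) [()] (take i (ticks k x))) \<le> ?S (sz x)" for x :: 'a and i
  proof -
    have "(2::nat) ^ length (take i (ticks k x)) \<le> 2 ^ ((sz x + 2) ^ k)"
      by (intro power_increasing) (auto simp: length_ticks)
    then show ?thesis by (simp add: sz_units length_doubling)
  qed
  show ?thesis unfolding padding_def
  proof (intro exI conjI)
    show "time_bounded (\<lambda>n. (n + 2) ^ b + (n + 2) ^ c + ?S n + ((n + 2) ^ c + 1) * ((n + ?S n + (n + 2) ^ c + 2 + 2) ^ a + 20) + 20)
      (\<lambda>x :: 'a. foldl (\<lambda>p _. p @ p) [()] (ticks k x))"
      using time_bounded_foldl[where g = "\<lambda>x p _. p @ p", OF a mono_pow b c S] by simp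
  qed (intro exp_bounded_intros poly_bounded_intros)
qed

text \<open>Execution starts at function 0, whereas an implementation may have any entry point; a
  wrapper in front calls the relocated one, and the 4 pays for the wrapper and its call.\<close>

lemma computes_withinI:
  assumes "implements R i B f"
  shows "computes_within (Call (Suc i) [V 0] # map (shift_calls 1) R) (cd x) (cd (f x)) (B (sz x) + 4)"
proof -
  let ?P = "[Call (Suc i) [V 0]] @ map (shift_calls (length [Call (Suc i) [V 0]])) R"
  have "implements ?P (length [Call (Suc i) [V 0]] + i) B f" by (rule implements_shift[OF assms])
  then have h: "implements ?P (Suc i) B f" by simp
  have "eval_le ?P [cd x] (Call (Suc i) [V 0]) (cd (f x)) (1 + B (sz x) + 1)"
    by (intro implements_call[OF h] eval_le_V) auto
  then have "eval_le ?P [cd x] (Call 0 [V 0]) (cd (f x)) ((1 + 0) + (1 + B (sz x) + 1) + 1)"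
    by (intro eval_le_Call[where xs = "[cd x]"] evals_le_Cons evals_le_Nil eval_le_V) auto
  then have "eval_le ?P [cd x] (Call 0 [V 0]) (cd (f x)) (B (sz x) + 4)" by (rule eval_le_mono) simp
  then show ?thesis unfolding computes_within_def eval_le_def by auto
qed

lemma cd_input: "cd (ts :: gci list, gs :: assertion list) = enc_input ts gs"
proof -
  have "(cd :: gci \<Rightarrow> tree) = enc_gci" by (rule ext) (simp add: cd_prod_def enc_gci_def cd_concept_def)
  moreover have "(cd :: assertion \<Rightarrow> tree) = enc_assertion" by (rule ext) (simp add: cd_assertion_def)
  ultimately show ?thesis by (simp add: enc_input_def cd_list_def)
qed

lemma cd_output: "cd (ns :: graph_rep, us :: nat list, b :: bool) = enc_output ns us b"
proof -
  have a: "(cd :: assertion \<Rightarrow> tree) = enc_assertion" by (rule ext) (simp add: cd_assertion_def)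
  have n: "(cd :: nat \<Rightarrow> tree) = enc_nat" by (rule ext) (simp add: cd_nat_def)
  have "(cd :: assertion list option \<times> nat list \<Rightarrow> tree) = enc_node"
    by (rule ext) (simp add: cd_prod_def enc_node_def cd_list_def cd_option_def a n split: option.split)
  then show ?thesis by (simp add: enc_output_def cd_list_def cd_bool_def n)
qed

theorem theorem3:
  shows "\<exists>(P :: program) (p :: nat poly).
    \<forall>(ts :: gci list) (gs :: assertion list).
      (\<forall>g \<in> set ts. wf_gci g) \<and> (\<forall>A \<in> set gs. wf_assertion A) \<longrightarrow>
      (let T = assoc_concept ts (set gs);
           bound = 2 ^ poly p (input_size ts gs)
       in (\<forall>G :: 'v tgraph. tableau T (set gs) G \<longrightarrow>
             finite (verts G) \<and> card (verts G) \<le> bound \<and>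
             (satisfiable TYPE('a) (set ts) (set gs) \<longrightarrow> answer G) \<and>
             (answer G \<longrightarrow> satisfiable TYPE(nat) (set ts) (set gs))) \<and>
          (\<exists>ns us. tableau T (set gs) (graph_of ns) \<and> set us = Unsat (graph_of ns) \<and>
             computes_within P (enc_input ts gs) (enc_output ns us (answer (graph_of ns))) bound))"
proof -
  obtain k where k: "\<And>n. required n \<le> 2 ^ ((n + 2) ^ k)" using exp_boundedE[OF exp_bounded_required] by blast
  obtain B where B: "exp_bounded B" "time_bounded B (padding k :: gci list \<times> assertion list \<Rightarrow> unit list)" using time_bounded_padding by blast
  have "polytime (\<lambda>x :: gci list \<times> assertion list. x)" by (rule polytime_id)
  then obtain a where a: "time_bounded (\<lambda>n. (n + 2) ^ a) (\<lambda>x :: gci list \<times> assertion list. x)" unfolding polytime_def by blast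
  obtain c where c: "time_bounded (\<lambda>n. (n + 2) ^ c) construct" using polytime_construct unfolding polytime_def by blast
  let ?C = "\<lambda>n. B n + (n + 2) ^ a + 5"
  \<comment> \<open>The cost of a polynomial-time function behind an exponential-time one: a
    polynomial in an exponentially bounded quantity is again exponentially bounded.\<close>
  let ?D = "\<lambda>n. ?C n + (?C n + 2) ^ c + 3"
  have "time_bounded ?D (\<lambda>x. construct (padding k x, x))" using time_bounded_comp[OF c time_bounded_pair[OF B(2) a] mono_pow] .
  then obtain R i where R: "implements R i ?D (\<lambda>x. construct (padding k x, x))" unfolding time_bounded_def by blast
  have "exp_bounded (\<lambda>n. ?D n + 4)" by (intro exp_bounded_intros B(1))
  then obtain d where d: "\<And>n. ?D n + 4 \<le> 2 ^ ((n + 2) ^ d)" using exp_boundedE by blast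
  obtain e where e: "\<And>n. node_bound n \<le> 2 ^ ((n + 2) ^ e)" using exp_boundedE[OF exp_bounded_node_bound] by blast
  let ?P = "Call (Suc i) [V 0] # map (shift_calls 1) R"
  \<comment> \<open>The first summand bounds the running time, since the code of an input of size n
    has at most 21n + 3 nodes and \<open>d\<close> belongs to the base \<open>sz + 2\<close>; the
    second bounds the number of vertices.\<close>
  let ?p = "[:5, 21:] ^ d + [:2, 1:] ^ e :: nat poly"
  show ?thesis
  proof (rule exI[of _ ?P], rule exI[of _ ?p], intro allI impI, elim conjE)
    fix ts :: "gci list" and gs :: "assertion list"
    assume wf: "\<forall>g\<in>set ts. wf_gci g" "\<forall>A\<in>set gs. wf_assertion A"
    let ?T = "assoc_concept ts (set gs)" and ?n = "input_size ts gs"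
    let ?b = "2 ^ poly ?p ?n :: nat"
    have p: "poly ?p ?n = (21 * ?n + 5) ^ d + (?n + 2) ^ e" by (simp add: poly_power mult.commute add.commute)
    have bound1: "node_bound ?n \<le> ?b"
      using e[of ?n] unfolding p by (meson le_add2 le_trans one_le_numeral power_increasing)
    have "(sz (ts, gs) + 2) ^ d \<le> (21 * ?n + 5) ^ d" using sz_input_le[of ts gs] by (intro power_mono) auto
    then have bound2: "?D (sz (ts, gs)) + 4 \<le> ?b"
      using d[of "sz (ts, gs)"] unfolding p by (meson le_add1 le_trans one_le_numeral power_increasing)
    have "finite (verts G) \<and> card (verts G) \<le> ?b \<and>
        (satisfiable TYPE('a) (set ts) (set gs) \<longrightarrow> answer G) \<and>
        (answer G \<longrightarrow> satisfiable TYPE(nat) (set ts) (set gs))"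
      if G: "tableau ?T (set gs) G" for G :: "'v tgraph"
    proof -
      have f: "finite (verts G)" "card (verts G) \<le> ?b" using tableau_finite[OF G] bound1 by auto
      then show ?thesis
        using answer_if_satisfiable[OF wf finite_set G f(1)] satisfiable_if_answer[OF wf finite_set G f(1)] by blast
    qed
    moreover have "\<exists>ns us. tableau ?T (set gs) (graph_of ns) \<and> set us = Unsat (graph_of ns) \<and>
        computes_within ?P (enc_input ts gs) (enc_output ns us (answer (graph_of ns))) ?b"
    proof -
      have "required (sz (ts, gs)) \<le> length (padding k (ts, gs))" using k by (simp add: length_padding)
      then obtain ns us where c: "construct (padding k (ts, gs), ts, gs) = (ns, us, answer (graph_of ns))"
        and t: "tableau ?T (set gs) (graph_of ns)" "set us = Unsat (graph_of ns)"
        by (rule construct_correct[OF wf])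
      have "computes_within ?P (cd (ts, gs)) (cd (construct (padding k (ts, gs), ts, gs))) (?D (sz (ts, gs)) + 4)"
        using computes_withinI[OF R, of "(ts, gs)"] .
      then have "computes_within ?P (enc_input ts gs) (enc_output ns us (answer (graph_of ns))) ?b"
        unfolding c cd_input cd_output computes_within_def using bound2 by (meson le_trans)
      then show ?thesis using t by blast
    qed
    ultimately show "let T = ?T; bound = ?b in (\<forall>G :: 'v tgraph. tableau T (set gs) G \<longrightarrow>
             finite (verts G) \<and> card (verts G) \<le> bound \<and>
             (satisfiable TYPE('a) (set ts) (set gs) \<longrightarrow> answer G) \<and>
             (answer G \<longrightarrow> satisfiable TYPE(nat) (set ts) (set gs))) \<and>
          (\<exists>ns us. tableau T (set gs) (graph_of ns) \<and> set us = Unsat (graph_of ns) \<and>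
             computes_within ?P (enc_input ts gs) (enc_output ns us (answer (graph_of ns))) bound)"
      unfolding Let_def by blast
  qed
qed

unused_thms

end
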